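(* Let $k$ be a field, let $\mathcal{C}\to\mathcal{B}=\mathcal{C}/G$ be a Galois covering of $k$-categories with finite group $G$, and assume that the characteristic of $k$ is zero or does not divide the order of $G$. Let $\mathcal{M}$ be a $\mathcal{B}$-bimodule. Then for every $n\ge0$ $$H_n(\mathcal{B},\mathcal{M})=H_n(\mathcal{C},L\mathcal{M})/G .$$ Moreover, if $\mathcal{M}$ is locally finite, then for every $n\ge 0$ $$H^n(\mathcal{B},\mathcal{M})=H^n(\mathcal{C},L\mathcal{M})^G .$$ (Equalities denote isomorphisms of vector spaces.)
   Context: $k$-categories and bimodules. A $k$-category is a small category whose morphism sets are $k$-vector spaces and whose composition is $k$-bilinear. $\mathcal{C}_0$ is the set of objects and ${}_y\mathcal{C}_x$ is the space of morphisms from $x$ to $y$, so composition is ${}_z\mathcal{C}_y\otimes_k{}_y\mathcal{C}_x\to{}_z\mathcal{C}_x$. A $\mathcal{C}$-bimodule $\mathcal{M}$ is a family of vector spaces $\{{}_y\mathcal{M}_x\}_{x,y\in\mathcal{C}_0}$ with $k$-bilinear left and right actions ${}_z\mathcal{C}_y\otimes{}_y\mathcal{M}_x\to{}_z\mathcal{M}_x$ and ${}_y\mathcal{M}_x\otimes{}_x\mathcal{C}_u\to{}_y\mathcal{M}_u$ that are associative, unital and commute with each other. A bimodule is locally finite if every ${}_y\mathcal{M}_x$ is finite dimensional over $k$. Hochschild-Mitchell homology. $H_*(\mathcal{C},\mathcal{M})$ is the homology of the chain complex with $C_0(\mathcal{C},\mathcal{M})=\bigoplus_x{}_x\mathcal{M}_x$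 and, for $n\ge1$, $C_n(\mathcal{C},\mathcal{M})=\bigoplus_{(x_{n+1},\dots,x_1)}{}_{x_1}\mathcal{M}_{x_{n+1}}\otimes_k{}_{x_{n+1}}\mathcal{C}_{x_n}\otimes_k\cdots\otimes_k{}_{x_2}\mathcal{C}_{x_1}$, with boundary $d(m,c_n,\dots,c_1)=(mc_n,c_{n-1},\dots,c_1)+\sum_{i=1}^{n-1}(-1)^i(m,c_n,\dots,c_{n-i+1}c_{n-i},\dots,c_1)+(-1)^n(c_1m,c_n,\dots,c_2)$. Hochschild-Mitchell cohomology. $H^*(\mathcal{C},\mathcal{M})$ is the cohomology of the cochain complex with $C^0(\mathcal{C},\mathcal{M})=\prod_x{}_x\mathcal{M}_x$ and, for $n\ge1$, $C^n(\mathcal{C},\mathcal{M})=\prod_{(x_{n+1},\dots,x_1)}\operatorname{Hom}_k({}_{x_{n+1}}\mathcal{C}_{x_n}\otimes\cdots\otimes{}_{x_2}\mathcal{C}_{x_1},\ {}_{x_{n+1}}\mathcal{M}_{x_1})$, with coboundary $df(c_{n+1}\otimes\cdots\otimes c_1)=(-1)^{n+1}c_{n+1}f(c_n\otimes\cdots\otimes c_1)+\sum_{i=1}^n(-1)^if(c_{n+1}\otimes\cdots\otimes c_{i+1}c_i\otimes\cdots\otimes c_1)+f(c_{n+1}\otimes\cdots\otimes c_2)c_1$ (in degree $0$: $(d(m_x)_x)(c)=-c\,m_x+m_y\,c$ for $c\in{}_y\mathcal{C}_x$). Galois coverings. A group $G$ acts freely on $\mathcal{C}$ if $G$ acts on $\mathcal{C}_0$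 with $sx=x$ for some $x$ only when $s=1$, and acts on morphisms by $k$-linear maps $s:{}_y\mathcal{C}_x\to{}_{sy}\mathcal{C}_{sx}$ with $s(dc)=(sd)(sc)$ and $s(tc)=(st)c$. For a $kG$-module $X$, $X/G$ denotes the coinvariants $X/(\operatorname{Ker}\epsilon)X$, where $\epsilon:kG\to k$ is the augmentation, and $X^G$ the invariants. The quotient category $\mathcal{C}/G$ has as objects the $G$-orbits of objects of $\mathcal{C}$, and for orbits $u,v$, ${}_v(\mathcal{C}/G)_u=\bigl(\bigoplus_{x\in u,\,y\in v}{}_y\mathcal{C}_x\bigr)/G$. The composition of the class of $d\in{}_z\mathcal{C}_{y'}$ with the class of $c\in{}_y\mathcal{C}_x$ ($y,y'$ in the same orbit) is the class of $(sd)c$, where $s$ is the unique element of $G$ with $sy'=y$. A Galois covering with group $G$ is the projection functor $\mathcal{C}\to\mathcal{B}=\mathcal{C}/G$ for a free action of $G$ on $\mathcal{C}$. Write $\overline{x}$ for the orbit of $x$ and $\overline{c}$ for the class of $c$. Lifted bimodule. For a $\mathcal{B}$-bimodule $\mathcal{M}$, the $\mathcal{C}$-bimodule $L\mathcal{M}$ is ${}_y(L\mathcal{M})_x={}_{\overline{y}}\mathcal{M}_{\overline{x}}$ with actions $c\cdot m=\overline{c}\,m$, $m\cdot c=m\,\overline{c}$. Actions of $G$. Using ${}_{sy}(L\mathcal{M})_{sx}={}_y(L\mathcal{M})_x$, $G$ acts on $C_*(\mathcal{C},L\mathcal{M})$ and $H_*(\mathcal{C},L\mathcal{M})$ by $s(m,c_n,\dots,c_1)=(m,sc_n,\dots,sc_1)$,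 and on $C^*(\mathcal{C},L\mathcal{M})$ and $H^*(\mathcal{C},L\mathcal{M})$ by $(sf)(c_n\otimes\cdots\otimes c_1)=f(s^{-1}c_n\otimes\cdots\otimes s^{-1}c_1)$ (in degree $0$, $(sm)_x=m_{s^{-1}x}$). *)

theory Defs
  imports "Jordan_Normal_Form.Missing_VectorSpace" "HOL-Algebra.AbelCoset"
    "HOL-Algebra.Group_Action"
begin

section \<open>Vector spaces\<close>

text \<open>
  Vector spaces are modules of HOL-Algebra over a field, in the sense of the locale
  \<^locale>\<open>vectorspace\<close>. The fields \<open>mult\<close> and \<open>one\<close> of the record type
  \<open>module\<close> play no role for a module and are left \<^const>\<open>undefined\<close> in the constructions below.
\<close>

definition field_char :: "('k, 'r) ring_scheme \<Rightarrow> nat" where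
  "field_char K =
    (if \<exists>n::nat. n > 0 \<and> [n] \<cdot>\<^bsub>K\<^esub> \<one>\<^bsub>K\<^esub> = \<zero>\<^bsub>K\<^esub>
     then LEAST n::nat. n > 0 \<and> [n] \<cdot>\<^bsub>K\<^esub> \<one>\<^bsub>K\<^esub> = \<zero>\<^bsub>K\<^esub> else 0)"

definition vs_iso ::
  "('k, 'r) ring_scheme \<Rightarrow> ('k, 'a) module \<Rightarrow> ('k, 'b) module \<Rightarrow> bool" where
  "vs_iso K A B \<longleftrightarrow> (\<exists>f \<in> module_hom K A B. bij_betw f (carrier A) (carrier B))"

definition bilinear ::
  "('k, 'r) ring_scheme \<Rightarrow> ('k, 'a) module \<Rightarrow> ('k, 'b) module \<Rightarrow> ('k, 'c) module
    \<Rightarrow> ('a \<Rightarrow> 'b \<Rightarrow> 'c) \<Rightarrow> bool" where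
  "bilinear K A B D f \<longleftrightarrow>
    (\<forall>a \<in> carrier A. f a \<in> module_hom K B D) \<and>
    (\<forall>b \<in> carrier B. (\<lambda>a. f a b) \<in> module_hom K A D)"

definition prod_space :: "'i set \<Rightarrow> ('i \<Rightarrow> ('k, 'a) module) \<Rightarrow> ('k, 'i \<Rightarrow> 'a) module" where
  "prod_space I A =
    \<lparr>carrier = (\<Pi>\<^sub>E i\<in>I. carrier (A i)), mult = undefined, one = undefined,
     zero = (\<lambda>i\<in>I. \<zero>\<^bsub>A i\<^esub>),
     add = (\<lambda>f g. \<lambda>i\<in>I. f i \<oplus>\<^bsub>A i\<^esub> g i),
     smult = (\<lambda>a f. \<lambda>i\<in>I. a \<odot>\<^bsub>A i\<^esub> f i)\<rparr>"

definition dsum_supp :: "'i set \<Rightarrow> ('i \<Rightarrow> ('k, 'a) module) \<Rightarrow> ('i \<Rightarrow> 'a) \<Rightarrow> 'i set" where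
  "dsum_supp I A f = {i \<in> I. f i \<noteq> \<zero>\<^bsub>A i\<^esub>}"

definition dsum_space :: "'i set \<Rightarrow> ('i \<Rightarrow> ('k, 'a) module) \<Rightarrow> ('k, 'i \<Rightarrow> 'a) module" where
  "dsum_space I A =
    (prod_space I A)\<lparr>carrier := {f \<in> carrier (prod_space I A). finite (dsum_supp I A f)}\<rparr>"

definition dsum_inj :: "'i set \<Rightarrow> ('i \<Rightarrow> ('k, 'a) module) \<Rightarrow> 'i \<Rightarrow> 'a \<Rightarrow> ('i \<Rightarrow> 'a)" where
  "dsum_inj I A i a = (\<lambda>j\<in>I. if j = i then a else \<zero>\<^bsub>A j\<^esub>)"

text \<open>Elements of a quotient are cosets; operations are those of \<open>ring\<close> quotients in HOL-Algebra.\<close>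

definition quot_space :: "('k, 'a) module \<Rightarrow> 'a set \<Rightarrow> ('k, 'a set) module" where
  "quot_space V W =
    \<lparr>carrier = a_rcosets\<^bsub>V\<^esub> W, mult = undefined, one = undefined,
     zero = W,
     add = (\<lambda>S T. S <+>\<^bsub>V\<^esub> T),
     smult = (\<lambda>a S. \<Union>x\<in>S. W +>\<^bsub>V\<^esub> (a \<odot>\<^bsub>V\<^esub> x))\<rparr>"

definition hom_space ::
  "('k, 'r) ring_scheme \<Rightarrow> ('k, 'a) module \<Rightarrow> ('k, 'b) module \<Rightarrow> ('k, 'a \<Rightarrow> 'b) module" where
  "hom_space K A B =
    \<lparr>carrier = module_hom K A B \<inter> extensional (carrier A), mult = undefined, one = undefined,
     zero = (\<lambda>x\<in>carrier A. \<zero>\<^bsub>B\<^esub>),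
     add = (\<lambda>f g. \<lambda>x\<in>carrier A. f x \<oplus>\<^bsub>B\<^esub> g x),
     smult = (\<lambda>a f. \<lambda>x\<in>carrier A. a \<odot>\<^bsub>B\<^esub> f x)\<rparr>"

definition self_space :: "('k, 'r) ring_scheme \<Rightarrow> ('k, 'k) module" where
  "self_space K =
    \<lparr>carrier = carrier K, mult = mult K, one = one K, zero = zero K, add = add K, smult = mult K\<rparr>"

definition free_space :: "('k, 'r) ring_scheme \<Rightarrow> 'b set \<Rightarrow> ('k, 'b \<Rightarrow> 'k) module" where
  "free_space K S = dsum_space S (\<lambda>_. self_space K)"

definition free_gen :: "('k, 'r) ring_scheme \<Rightarrow> 'b set \<Rightarrow> 'b \<Rightarrow> ('b \<Rightarrow> 'k)" where
  "free_gen K S b = dsum_inj S (\<lambda>_. self_space K) b \<one>\<^bsub>K\<^esub>"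

text \<open>The linear extension to \<open>free_space K S\<close> of a map \<open>\<phi>\<close> from \<open>S\<close> to \<open>V\<close>.\<close>

definition free_lift ::
  "('k, 'r) ring_scheme \<Rightarrow> 'b set \<Rightarrow> ('k, 'a) module \<Rightarrow> ('b \<Rightarrow> 'a) \<Rightarrow> ('b \<Rightarrow> 'k) \<Rightarrow> 'a" where
  "free_lift K S V \<phi> p =
    (\<Oplus>\<^bsub>V\<^esub> b \<in> dsum_supp S (\<lambda>_. self_space K) p. p b \<odot>\<^bsub>V\<^esub> \<phi> b)"


section \<open>Tensor products\<close>

text \<open>
  Tensor products are quotients of the free vector space on the set of all tuples by the
  multilinearity relations. There are two versions: \<open>N\<^sub>1 \<otimes> \<dots> \<otimes> N\<^sub>n\<close> for a list of
  spaces of the same type, with tuples \<open>[c\<^sub>1, \<dots>, c\<^sub>n]\<close>, and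
  \<open>A \<otimes> N\<^sub>1 \<otimes> \<dots> \<otimes> N\<^sub>n\<close>, with tuples \<open>(m, [c\<^sub>1, \<dots>, c\<^sub>n])\<close>, where \<open>A\<close> may have another type.
  For the empty list these are (up to the canonical isomorphisms) the ground field and \<open>A\<close>.

  \<open>lin_rels K S A h\<close> are the relations that make
  \<open>x \<mapsto> [h x]\<close> linear on \<open>A\<close>, where \<open>h\<close> puts \<open>x\<close> at some place of a fixed tuple.
\<close>

definition lin_rels ::
  "('k, 'r) ring_scheme \<Rightarrow> 't set \<Rightarrow> ('k, 'a) module \<Rightarrow> ('a \<Rightarrow> 't) \<Rightarrow> ('t \<Rightarrow> 'k) set" where
  "lin_rels K S A h =
    (let F = free_space K S; e = free_gen K S in
      {e (h (x \<oplus>\<^bsub>A\<^esub> y)) \<ominus>\<^bsub>F\<^esub> (e (h x) \<oplus>\<^bsub>F\<^esub> e (h y)) | x y. x \<in> carrier A \<and> y \<in> carrier A} \<union>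
      {e (h (a \<odot>\<^bsub>A\<^esub> x)) \<ominus>\<^bsub>F\<^esub> (a \<odot>\<^bsub>F\<^esub> e (h x)) | a x. a \<in> carrier K \<and> x \<in> carrier A})"

definition tuples :: "('k, 'c) module list \<Rightarrow> 'c list set" where
  "tuples Ns = {cs. list_all2 (\<lambda>c N. c \<in> carrier N) cs Ns}"

definition tensor_null :: "('k, 'r) ring_scheme \<Rightarrow> ('k, 'c) module list \<Rightarrow> ('c list \<Rightarrow> 'k) set" where
  "tensor_null K Ns =
    module.span K (free_space K (tuples Ns))
      (\<Union>cs \<in> tuples Ns. \<Union>i \<in> {..<length Ns}.
        lin_rels K (tuples Ns) (Ns ! i) (\<lambda>x. cs[i := x]))"

definition tensor ::
  "('k, 'r) ring_scheme \<Rightarrow> ('k, 'c) module list \<Rightarrow> ('k, ('c list \<Rightarrow> 'k) set) module" where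
  "tensor K Ns = quot_space (free_space K (tuples Ns)) (tensor_null K Ns)"

definition pure_tensor ::
  "('k, 'r) ring_scheme \<Rightarrow> ('k, 'c) module list \<Rightarrow> 'c list \<Rightarrow> ('c list \<Rightarrow> 'k) set" where
  "pure_tensor K Ns cs =
    tensor_null K Ns +>\<^bsub>free_space K (tuples Ns)\<^esub> free_gen K (tuples Ns) cs"

definition tuples1 :: "('k, 'm) module \<Rightarrow> ('k, 'c) module list \<Rightarrow> ('m \<times> 'c list) set" where
  "tuples1 A Ns = carrier A \<times> tuples Ns"

definition tensor1_null ::
  "('k, 'r) ring_scheme \<Rightarrow> ('k, 'm) module \<Rightarrow> ('k, 'c) module list \<Rightarrow> ('m \<times> 'c list \<Rightarrow> 'k) set"
  where
  "tensor1_null K A Ns =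
    module.span K (free_space K (tuples1 A Ns))
      ((\<Union>cs \<in> tuples Ns. lin_rels K (tuples1 A Ns) A (\<lambda>x. (x, cs))) \<union>
       (\<Union>m \<in> carrier A. \<Union>cs \<in> tuples Ns. \<Union>i \<in> {..<length Ns}.
          lin_rels K (tuples1 A Ns) (Ns ! i) (\<lambda>x. (m, cs[i := x]))))"

definition tensor1 ::
  "('k, 'r) ring_scheme \<Rightarrow> ('k, 'm) module \<Rightarrow> ('k, 'c) module list
    \<Rightarrow> ('k, ('m \<times> 'c list \<Rightarrow> 'k) set) module" where
  "tensor1 K A Ns = quot_space (free_space K (tuples1 A Ns)) (tensor1_null K A Ns)"

definition pure_tensor1 ::
  "('k, 'r) ring_scheme \<Rightarrow> ('k, 'm) module \<Rightarrow> ('k, 'c) module list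
    \<Rightarrow> 'm \<times> 'c list \<Rightarrow> ('m \<times> 'c list \<Rightarrow> 'k) set" where
  "pure_tensor1 K A Ns t =
    tensor1_null K A Ns +>\<^bsub>free_space K (tuples1 A Ns)\<^esub> free_gen K (tuples1 A Ns) t"

text \<open>
  The linear map to \<open>V\<close> on a tensor product (with set of tuples \<open>S\<close>) induced by a
  multilinear map \<open>\<phi>\<close> on tuples: the linear extension of \<open>\<phi>\<close> to the free vector space
  is constant on each coset \<open>T\<close>, and its value there is the value of the induced map.
\<close>

definition tensor_lift ::
  "('k, 'r) ring_scheme \<Rightarrow> 't set \<Rightarrow> ('k, 'a) module \<Rightarrow> ('t \<Rightarrow> 'a) \<Rightarrow> ('t \<Rightarrow> 'k) set \<Rightarrow> 'a" where
  "tensor_lift K S V \<phi> T = the_elem (free_lift K S V \<phi> ` T)"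


section \<open>Linear categories and bimodules\<close>

text \<open>
  \<open>Hom C y x\<close> is the space of morphisms from \<open>x\<close> to \<open>y\<close>, and
  \<open>comp C z y x d c\<close> is the composite \<open>d c\<close> of \<open>c \<in> Hom C y x\<close> and \<open>d \<in> Hom C z y\<close>. Morphism
  spaces for different pairs of objects need not be disjoint, hence the object arguments.
\<close>

record ('o, 'c, 'k) kcat =
  Obj :: "'o set"
  Hom :: "'o \<Rightarrow> 'o \<Rightarrow> ('k, 'c) module"
  comp :: "'o \<Rightarrow> 'o \<Rightarrow> 'o \<Rightarrow> 'c \<Rightarrow> 'c \<Rightarrow> 'c"
  ident :: "'o \<Rightarrow> 'c"

locale kcategory = field K for K :: "('k, 'r) ring_scheme" (structure) +
  fixes C :: "('o, 'c, 'k) kcat"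
  assumes hom_vectorspace:
      "\<lbrakk>x \<in> Obj C; y \<in> Obj C\<rbrakk> \<Longrightarrow> vectorspace K (Hom C y x)"
    and comp_bilinear:
      "\<lbrakk>x \<in> Obj C; y \<in> Obj C; z \<in> Obj C\<rbrakk>
        \<Longrightarrow> bilinear K (Hom C z y) (Hom C y x) (Hom C z x) (comp C z y x)"
    and comp_assoc:
      "\<lbrakk>x \<in> Obj C; y \<in> Obj C; z \<in> Obj C; w \<in> Obj C;
        c \<in> carrier (Hom C y x); d \<in> carrier (Hom C z y); e \<in> carrier (Hom C w z)\<rbrakk>
        \<Longrightarrow> comp C w z x e (comp C z y x d c) = comp C w y x (comp C w z y e d) c"
    and ident_closed: "x \<in> Obj C \<Longrightarrow> ident C x \<in> carrier (Hom C x x)"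
    and ident_left:
      "\<lbrakk>x \<in> Obj C; y \<in> Obj C; c \<in> carrier (Hom C y x)\<rbrakk> \<Longrightarrow> comp C y y x (ident C y) c = c"
    and ident_right:
      "\<lbrakk>x \<in> Obj C; y \<in> Obj C; c \<in> carrier (Hom C y x)\<rbrakk> \<Longrightarrow> comp C y x x c (ident C x) = c"

text \<open>
  \<open>lact M z y x c m\<close> is \<open>c m\<close> for \<open>c \<in> Hom C z y\<close>, \<open>m \<in> Bim M y x\<close>, and
  \<open>ract M y x u m c\<close> is \<open>m c\<close> for \<open>m \<in> Bim M y x\<close>, \<open>c \<in> Hom C x u\<close>.
\<close>

record ('o, 'c, 'm, 'k) bimod =
  Bim :: "'o \<Rightarrow> 'o \<Rightarrow> ('k, 'm) module"
  lact :: "'o \<Rightarrow> 'o \<Rightarrow> 'o \<Rightarrow> 'c \<Rightarrow> 'm \<Rightarrow> 'm"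
  ract :: "'o \<Rightarrow> 'o \<Rightarrow> 'o \<Rightarrow> 'm \<Rightarrow> 'c \<Rightarrow> 'm"

locale bimodule =
  fixes K :: "('k, 'r) ring_scheme" and C :: "('o, 'c, 'k) kcat" and M :: "('o, 'c, 'm, 'k) bimod"
  assumes bim_vectorspace:
      "\<lbrakk>x \<in> Obj C; y \<in> Obj C\<rbrakk> \<Longrightarrow> vectorspace K (Bim M y x)"
    and lact_bilinear:
      "\<lbrakk>x \<in> Obj C; y \<in> Obj C; z \<in> Obj C\<rbrakk>
        \<Longrightarrow> bilinear K (Hom C z y) (Bim M y x) (Bim M z x) (lact M z y x)"
    and ract_bilinear:
      "\<lbrakk>u \<in> Obj C; x \<in> Obj C; y \<in> Obj C\<rbrakk>
        \<Longrightarrow> bilinear K (Bim M y x) (Hom C x u) (Bim M y u) (ract M y x u)"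
    and lact_assoc:
      "\<lbrakk>x \<in> Obj C; y \<in> Obj C; z \<in> Obj C; w \<in> Obj C;
        m \<in> carrier (Bim M y x); c \<in> carrier (Hom C z y); d \<in> carrier (Hom C w z)\<rbrakk>
        \<Longrightarrow> lact M w z x d (lact M z y x c m) = lact M w y x (comp C w z y d c) m"
    and ract_assoc:
      "\<lbrakk>y \<in> Obj C; x \<in> Obj C; u \<in> Obj C; v \<in> Obj C;
        m \<in> carrier (Bim M y x); c \<in> carrier (Hom C x u); d \<in> carrier (Hom C u v)\<rbrakk>
        \<Longrightarrow> ract M y u v (ract M y x u m c) d = ract M y x v m (comp C x u v c d)"
    and lact_ident:
      "\<lbrakk>x \<in> Obj C; y \<in> Obj C; m \<in> carrier (Bim M y x)\<rbrakk> \<Longrightarrow> lact M y y x (ident C y) m = m"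
    and ract_ident:
      "\<lbrakk>x \<in> Obj C; y \<in> Obj C; m \<in> carrier (Bim M y x)\<rbrakk> \<Longrightarrow> ract M y x x m (ident C x) = m"
    and lact_ract:
      "\<lbrakk>z \<in> Obj C; y \<in> Obj C; x \<in> Obj C; u \<in> Obj C;
        c \<in> carrier (Hom C z y); m \<in> carrier (Bim M y x); d \<in> carrier (Hom C x u)\<rbrakk>
        \<Longrightarrow> ract M z x u (lact M z y x c m) d = lact M z y u c (ract M y x u m d)"

definition locally_finite ::
  "('k, 'r) ring_scheme \<Rightarrow> ('o, 'c, 'k) kcat \<Rightarrow> ('o, 'c, 'm, 'k) bimod \<Rightarrow> bool" where
  "locally_finite K C M \<longleftrightarrow>
    (\<forall>x \<in> Obj C. \<forall>y \<in> Obj C. vectorspace.fin_dim K (Bim M y x))"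


section \<open>Hochschild-Mitchell homology and cohomology\<close>

text \<open>
  A tuple \<open>(x\<^sub>n\<^sub>+\<^sub>1, \<dots>, x\<^sub>1)\<close> of objects and a tuple \<open>(c\<^sub>n, \<dots>, c\<^sub>1)\<close> of morphisms are lists
  \<open>xs\<close>, \<open>cs\<close> in the same order. So \<open>cs ! i = c\<^sub>n\<^sub>-\<^sub>i\<close> is a morphism
  from \<open>xs ! Suc i\<close> to \<open>xs ! i\<close>.

  Degree 0 needs no separate definitions: there a summand of the chains is the tensor product of
  \<open>Bim M x x\<close> with an empty list of morphism spaces, and a factor of the cochains is the space of
  linear maps from the empty tensor product, that is the ground field, to \<open>Bim M x x\<close>.
\<close>

definition obj_tuples :: "('o, 'c, 'k) kcat \<Rightarrow> nat \<Rightarrow> 'o list set" where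
  "obj_tuples C n = {xs. length xs = Suc n \<and> set xs \<subseteq> Obj C}"

definition homs :: "('o, 'c, 'k) kcat \<Rightarrow> 'o list \<Rightarrow> ('k, 'c) module list" where
  "homs C xs = map2 (Hom C) xs (tl xs)"

definition remove_nth :: "nat \<Rightarrow> 'a list \<Rightarrow> 'a list" where
  "remove_nth i xs = take i xs @ drop (Suc i) xs"

text \<open>
  For \<open>i \<ge> 1\<close> the morphisms \<open>cs ! (i - 1)\<close> and \<open>cs ! i\<close>, which meet at the object \<open>xs ! i\<close>,
  are replaced by their composite; the matching tuple of objects is \<open>remove_nth i xs\<close>.
\<close>

definition merge_at :: "('o, 'c, 'k) kcat \<Rightarrow> 'o list \<Rightarrow> nat \<Rightarrow> 'c list \<Rightarrow> 'c list" where
  "merge_at C xs i cs =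
    take (i - 1) cs @
    comp C (xs ! (i - 1)) (xs ! i) (xs ! Suc i) (cs ! (i - 1)) (cs ! i) # drop (Suc i) cs"

definition chain_summand where
  "chain_summand K C M xs = tensor1 K (Bim M (last xs) (hd xs)) (homs C xs)"

definition chains where
  "chains K C M n = dsum_space (obj_tuples C n) (chain_summand K C M)"

text \<open>The element \<open>m \<otimes> c\<^sub>n \<otimes> \<dots> \<otimes> c\<^sub>1\<close> of the summand at \<open>xs\<close>, as a chain.\<close>

definition chain_gen where
  "chain_gen K C M n xs t =
    dsum_inj (obj_tuples C n) (chain_summand K C M) xs
      (pure_tensor1 K (Bim M (last xs) (hd xs)) (homs C xs) t)"

text \<open>
  The linear map on \<open>chains K C M n\<close> with value \<open>\<phi> xs (m, cs)\<close> at
  \<open>chain_gen K C M n xs (m, cs)\<close>, for \<open>\<phi> xs\<close> multilinear.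
\<close>

definition chain_lift where
  "chain_lift K C M n V \<phi> t =
    (\<Oplus>\<^bsub>V\<^esub> xs \<in> dsum_supp (obj_tuples C n) (chain_summand K C M) t.
      tensor_lift K (tuples1 (Bim M (last xs) (hd xs)) (homs C xs)) V (\<phi> xs) (t xs))"

text \<open>The boundary map from degree \<open>Suc n\<close> to degree \<open>n\<close>.\<close>

definition chain_bd where
  "chain_bd K C M n =
    (let D = chains K C M n; sg = (\<lambda>i::nat. (\<ominus>\<^bsub>K\<^esub> \<one>\<^bsub>K\<^esub>) [^]\<^bsub>K\<^esub> i) in
     chain_lift K C M (Suc n) D
      (\<lambda>xs (m, cs).
        chain_gen K C M n (tl xs) (ract M (last xs) (hd xs) (xs ! 1) m (hd cs), tl cs)
        \<oplus>\<^bsub>D\<^esub> (\<Oplus>\<^bsub>D\<^esub> i \<in> {1..n}.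
              sg i \<odot>\<^bsub>D\<^esub> chain_gen K C M n (remove_nth i xs) (m, merge_at C xs i cs))
        \<oplus>\<^bsub>D\<^esub> sg (Suc n) \<odot>\<^bsub>D\<^esub>
              chain_gen K C M n (butlast xs)
                (lact M (xs ! n) (last xs) (hd xs) (last cs) m, butlast cs)))"

definition cycles where
  "cycles K C M n =
    (case n of
      0 \<Rightarrow> carrier (chains K C M 0)
    | Suc k \<Rightarrow> {t \<in> carrier (chains K C M (Suc k)). chain_bd K C M k t = \<zero>\<^bsub>chains K C M k\<^esub>})"

definition boundaries where
  "boundaries K C M n = chain_bd K C M n ` carrier (chains K C M (Suc n))"

definition HM_homology where
  "HM_homology K C M n =
    quot_space ((chains K C M n)\<lparr>carrier := cycles K C M n\<rparr>) (boundaries K C M n)"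

definition cochains where
  "cochains K C M n =
    prod_space (obj_tuples C n)
      (\<lambda>xs. hom_space K (tensor K (homs C xs)) (Bim M (hd xs) (last xs)))"

text \<open>
  The coboundary map from degree \<open>n\<close> to degree \<open>Suc n\<close>. As \<open>cs = [c\<^sub>n\<^sub>+\<^sub>1, \<dots>, c\<^sub>1]\<close> here,
  the composite \<open>c\<^sub>i\<^sub>+\<^sub>1 c\<^sub>i\<close> is formed at position \<open>Suc n - i\<close>.
\<close>

definition cochain_bd where
  "cochain_bd K C M n f =
    (\<lambda>xs \<in> obj_tuples C (Suc n). \<lambda>T \<in> carrier (tensor K (homs C xs)).
      let V = Bim M (hd xs) (last xs); sg = (\<lambda>i::nat. (\<ominus>\<^bsub>K\<^esub> \<one>\<^bsub>K\<^esub>) [^]\<^bsub>K\<^esub> i);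
          ev = (\<lambda>ys ds. f ys (pure_tensor K (homs C ys) ds)) in
      tensor_lift K (tuples (homs C xs)) V
        (\<lambda>cs.
          sg (Suc n) \<odot>\<^bsub>V\<^esub> lact M (hd xs) (xs ! 1) (last xs) (hd cs) (ev (tl xs) (tl cs))
          \<oplus>\<^bsub>V\<^esub> (\<Oplus>\<^bsub>V\<^esub> i \<in> {1..n}.
                sg i \<odot>\<^bsub>V\<^esub> ev (remove_nth (Suc n - i) xs) (merge_at C xs (Suc n - i) cs))
          \<oplus>\<^bsub>V\<^esub> ract M (hd xs) (xs ! n) (last xs) (ev (butlast xs) (butlast cs)) (last cs))
        T)"

definition cocycles where
  "cocycles K C M n =
    {f \<in> carrier (cochains K C M n). cochain_bd K C M n f = \<zero>\<^bsub>cochains K C M (Suc n)\<^esub>}"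

definition coboundaries where
  "coboundaries K C M n =
    (case n of
      0 \<Rightarrow> {\<zero>\<^bsub>cochains K C M 0\<^esub>}
    | Suc k \<Rightarrow> cochain_bd K C M k ` carrier (cochains K C M k))"

definition HM_cohomology where
  "HM_cohomology K C M n =
    quot_space ((cochains K C M n)\<lparr>carrier := cocycles K C M n\<rparr>) (coboundaries K C M n)"


section \<open>Invariants and coinvariants\<close>

text \<open>
  A \<open>kG\<close>-module is given by a space \<open>X\<close> and a map \<open>act\<close> describing the action of the elements
  of \<open>G\<close>. The group algebra \<open>kG\<close> is \<open>free_space K (carrier G)\<close>.
\<close>

definition invariants_space where
  "invariants_space G X act = X\<lparr>carrier := {x \<in> carrier X. \<forall>s \<in> carrier G. act s x = x}\<rparr>"

definition augmentation where
  "augmentation K G r = (\<Oplus>\<^bsub>K\<^esub> s \<in> dsum_supp (carrier G) (\<lambda>_. self_space K) r. r s)"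

definition augmentation_span where
  "augmentation_span K G X act =
    module.span K X
      {free_lift K (carrier G) X (\<lambda>s. act s x) r | r x.
        r \<in> carrier (free_space K (carrier G)) \<and> augmentation K G r = \<zero>\<^bsub>K\<^esub> \<and> x \<in> carrier X}"

definition coinvariants where
  "coinvariants K G X act = quot_space X (augmentation_span K G X act)"


section \<open>Galois coverings\<close>

text \<open>
  \<open>\<phi> s x\<close> is \<open>s x\<close> for an object \<open>x\<close> and \<open>\<psi> s y x c\<close> is \<open>s c\<close> for \<open>c \<in> Hom C y x\<close>.
\<close>

locale free_kcat_action =
  kcategory K C + group_action G "Obj C" \<phi>
  for K :: "('k, 'r) ring_scheme" and C :: "('o, 'c, 'k) kcat"
    and G :: "('g, 'h) monoid_scheme" and \<phi> :: "'g \<Rightarrow> 'o \<Rightarrow> 'o" +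
  fixes \<psi> :: "'g \<Rightarrow> 'o \<Rightarrow> 'o \<Rightarrow> 'c \<Rightarrow> 'c"
  assumes free: "\<lbrakk>s \<in> carrier G; x \<in> Obj C; \<phi> s x = x\<rbrakk> \<Longrightarrow> s = \<one>\<^bsub>G\<^esub>"
    and act_linear:
      "\<lbrakk>s \<in> carrier G; x \<in> Obj C; y \<in> Obj C\<rbrakk>
        \<Longrightarrow> \<psi> s y x \<in> module_hom K (Hom C y x) (Hom C (\<phi> s y) (\<phi> s x))"
    and act_comp:
      "\<lbrakk>s \<in> carrier G; x \<in> Obj C; y \<in> Obj C; z \<in> Obj C;
        c \<in> carrier (Hom C y x); d \<in> carrier (Hom C z y)\<rbrakk>
        \<Longrightarrow> \<psi> s z x (comp C z y x d c) =
            comp C (\<phi> s z) (\<phi> s y) (\<phi> s x) (\<psi> s z y d) (\<psi> s y x c)"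
    and act_one:
      "\<lbrakk>x \<in> Obj C; y \<in> Obj C; c \<in> carrier (Hom C y x)\<rbrakk> \<Longrightarrow> \<psi> \<one>\<^bsub>G\<^esub> y x c = c"
    and act_mult:
      "\<lbrakk>s \<in> carrier G; t \<in> carrier G; x \<in> Obj C; y \<in> Obj C; c \<in> carrier (Hom C y x)\<rbrakk>
        \<Longrightarrow> \<psi> t (\<phi> s y) (\<phi> s x) (\<psi> s y x c) = \<psi> (t \<otimes>\<^bsub>G\<^esub> s) y x c"

definition orbit_sum ::
  "('o, 'c, 'k) kcat \<Rightarrow> 'o set \<Rightarrow> 'o set \<Rightarrow> ('k, 'o \<times> 'o \<Rightarrow> 'c) module" where
  "orbit_sum C v u = dsum_space (v \<times> u) (\<lambda>(y, x). Hom C y x)"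

definition orbit_inj where
  "orbit_inj C v u = dsum_inj (v \<times> u) (\<lambda>(y, x). Hom C y x)"

definition orbit_supp where
  "orbit_supp C v u = dsum_supp (v \<times> u) (\<lambda>(y, x). Hom C y x)"

definition orbit_act where
  "orbit_act G \<phi> \<psi> v u s f =
    (\<lambda>(y, x) \<in> v \<times> u.
      let y' = \<phi> (inv\<^bsub>G\<^esub> s) y; x' = \<phi> (inv\<^bsub>G\<^esub> s) x in \<psi> s y' x' (f (y', x')))"

definition quot_hom where
  "quot_hom K C G \<phi> \<psi> v u = coinvariants K G (orbit_sum C v u) (orbit_act G \<phi> \<psi> v u)"

text \<open>The class modulo \<open>G\<close> of an element of \<open>orbit_sum C v u\<close>.\<close>

definition quot_class where
  "quot_class K C G \<phi> \<psi> v u f =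
    augmentation_span K G (orbit_sum C v u) (orbit_act G \<phi> \<psi> v u) +>\<^bsub>orbit_sum C v u\<^esub> f"

text \<open>
  Composition in the quotient category: the bilinear extension of
  \<open>([d], [c]) \<mapsto> [(s d) c]\<close> for \<open>d \<in> Hom C z y'\<close>, \<open>c \<in> Hom C y x\<close> and \<open>s y' = y\<close>,
  computed on representatives.
\<close>

definition quot_comp where
  "quot_comp K C G \<phi> \<psi> w v u Dc Ec =
    (\<Union>d \<in> Dc. \<Union>e \<in> Ec. quot_class K C G \<phi> \<psi> w u
      (finsum (orbit_sum C w u)
        (\<lambda>((z, y'), (y, x)).
          let s = (THE s. s \<in> carrier G \<and> \<phi> s y' = y) in
          orbit_inj C w u (\<phi> s z, x) (comp C (\<phi> s z) y x (\<psi> s z y' (d (z, y'))) (e (y, x))))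
        (orbit_supp C w v d \<times> orbit_supp C v u e)))"

text \<open>The union defining an identity is over equal cosets: all \<open>ident C x\<close> with \<open>x \<in> u\<close> have the same class.\<close>

definition quot_cat where
  "quot_cat K C G \<phi> \<psi> =
    \<lparr>Obj = orbits G (Obj C) \<phi>,
     Hom = quot_hom K C G \<phi> \<psi>,
     comp = quot_comp K C G \<phi> \<psi>,
     ident = (\<lambda>u. \<Union>x \<in> u. quot_class K C G \<phi> \<psi> u u (orbit_inj C u u (x, x) (ident C x)))\<rparr>"

text \<open>The covering functor on morphisms, \<open>c \<in> Hom C y x\<close>; on objects it is \<^term>\<open>orbit G \<phi>\<close>.\<close>

definition covering where
  "covering K C G \<phi> \<psi> y x c =
    quot_class K C G \<phi> \<psi> (orbit G \<phi> y) (orbit G \<phi> x)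
      (orbit_inj C (orbit G \<phi> y) (orbit G \<phi> x) (y, x) c)"

definition lift_bimod where
  "lift_bimod K C G \<phi> \<psi> M =
    \<lparr>Bim = (\<lambda>y x. Bim M (orbit G \<phi> y) (orbit G \<phi> x)),
     lact = (\<lambda>z y x c m.
       lact M (orbit G \<phi> z) (orbit G \<phi> y) (orbit G \<phi> x) (covering K C G \<phi> \<psi> z y c) m),
     ract = (\<lambda>y x u m c.
       ract M (orbit G \<phi> y) (orbit G \<phi> x) (orbit G \<phi> u) m (covering K C G \<phi> \<psi> x u c))\<rparr>"


section \<open>The action on homology and cohomology\<close>

text \<open>
  In this section \<open>L\<close> is a lifted bimodule, so \<open>Bim L (\<phi> s y) (\<phi> s x) = Bim L y x\<close>.
  On homology and cohomology \<open>s\<close> sends a coset to its image under \<open>s\<close>.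
\<close>

definition act_tuple where
  "act_tuple \<psi> s xs cs = map (\<lambda>i. \<psi> s (xs ! i) (xs ! Suc i) (cs ! i)) [0..<length cs]"

definition chain_act where
  "chain_act K C \<phi> \<psi> L n s =
    chain_lift K C L n (chains K C L n)
      (\<lambda>xs (m, cs). chain_gen K C L n (map (\<phi> s) xs) (m, act_tuple \<psi> s xs cs))"

definition homology_act where
  "homology_act K C \<phi> \<psi> L n s T = chain_act K C \<phi> \<psi> L n s ` T"

definition cochain_act where
  "cochain_act K C G \<phi> \<psi> L n s f =
    (\<lambda>xs \<in> obj_tuples C n. \<lambda>T \<in> carrier (tensor K (homs C xs)).
      let s' = inv\<^bsub>G\<^esub> s; ys = map (\<phi> s') xs in
      tensor_lift K (tuples (homs C xs)) (Bim L (hd xs) (last xs))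
        (\<lambda>cs. f ys (pure_tensor K (homs C ys) (act_tuple \<psi> s' xs cs))) T)"

definition cohomology_act where
  "cohomology_act K C G \<phi> \<psi> L n s T = cochain_act K C G \<phi> \<psi> L n s ` T"

end

theory Submission
  imports Defs
begin

text \<open>
  The proof is a transfer argument. The covering functor sends a tuple of morphisms of \<open>\<C>\<close> to a
  tuple of morphisms of \<open>\<B> = \<C>/G\<close> and so induces a chain map \<open>p\<close> from the chains of \<open>\<C>\<close> with
  values in \<open>L\<M>\<close> to the chains of \<open>\<B>\<close> with values in \<open>\<M>\<close>. As \<open>G\<close> is finite, there is also a map
  \<open>t\<close> in the other direction. Every morphism \<open>\<gamma>\<close> from \<open>u\<close> to \<open>v\<close> in \<open>\<B>\<close> has, for
  all \<open>y \<in> v\<close> and \<open>x \<in> u\<close>, a component from \<open>x\<close> to \<open>y\<close> in \<open>\<C>\<close> (\<open>lift_at\<close>): the class of \<open>c\<close> has the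
  component \<open>s c\<close> between the end points of \<open>s c\<close>, for \<open>s \<in> G\<close>, and all its other components vanish.
  The transfer \<open>t\<close> sends \<open>(m, \<gamma>\<^sub>n, \<dots>, \<gamma>\<^sub>1)\<close> to the sum, over all tuples of objects of \<open>\<C>\<close> above the
  given tuple of orbits, of \<open>m\<close> followed by the components between the chosen objects.

  Two counting facts carry everything. First, \<open>p t\<close> is multiplication by the order of \<open>G\<close>
  (\<open>sum_lifts\<close>): a morphism is the sum of the classes of its components with a fixed source, so the
  sum over the tuples of lifts collapses one object at a time, and the choice of the last object
  contributes the factor. Second, \<open>t p\<close> is the sum of all elements of \<open>G\<close> acting on chains
  (\<open>sum_lifts_of_cover\<close>): by freeness the only tuples of objects between which all components of
  the classes of \<open>c\<^sub>n, \<dots>, c\<^sub>1\<close> can be non-zero are the translates of the original tuple.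

  The order of \<open>G\<close> is invertible in the field. Hence \<open>p\<close> is onto, and because \<open>p\<close> and the action
  commute with the boundary maps, so does \<open>t\<close>. Thus \<open>p\<close> and \<open>t\<close> pass to homology with the same
  two identities, and pure algebra (\<open>transfer_iso\<close>) shows that then \<open>t\<close> followed by the projection is
  an isomorphism onto the coinvariants, with inverse induced by \<open>p\<close> up to the factor. In the same way the pullback of
  cochains along the covering functor and the sum over lifts satisfy both identities, and the pullback is an
  isomorphism onto the invariants of the cohomology of \<open>\<C>\<close>.

  Apart from this, work goes into the quotient category: its composition is defined by representatives and has to be
  shown bilinear and compatible with the covering functor (\<open>quot_comp_eq\<close>, \<open>cov_comp\<close>).
\<close>

section \<open>Linear maps, spans and quotients\<close>

lemma module_homI:
  assumes "\<And>x. x \<in> carrier A \<Longrightarrow> f x \<in> carrier B"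
    and "\<And>x y. x \<in> carrier A \<Longrightarrow> y \<in> carrier A \<Longrightarrow> f (x \<oplus>\<^bsub>A\<^esub> y) = f x \<oplus>\<^bsub>B\<^esub> f y"
    and "\<And>a x. a \<in> carrier R \<Longrightarrow> x \<in> carrier A \<Longrightarrow> f (a \<odot>\<^bsub>A\<^esub> x) = a \<odot>\<^bsub>B\<^esub> f x"
  shows "f \<in> module_hom R A B"
  using assms by (auto simp: module_hom_def)

lemma hom_in: "f \<in> module_hom R A B \<Longrightarrow> x \<in> carrier A \<Longrightarrow> f x \<in> carrier B"
  by (auto simp: module_hom_def)

lemma hom_comp:
  "f \<in> module_hom R A B \<Longrightarrow> g \<in> module_hom R B D \<Longrightarrow> (\<lambda>x. g (f x)) \<in> module_hom R A D"
  by (auto simp: module_hom_def Pi_def)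

lemma hom_cong:
  assumes "f \<in> module_hom R A B" "module R A" "\<And>x. x \<in> carrier A \<Longrightarrow> g x = f x"
  shows "g \<in> module_hom R A B"
proof -
  interpret A: module R A by fact
  show ?thesis using assms(1,3) by (auto simp: module_hom_def Pi_def)
qed

lemma finsum_mono_neutral:
  assumes "abelian_monoid V" "finite J" "I \<subseteq> J" "\<And>i. i \<in> J - I \<Longrightarrow> f i = \<zero>\<^bsub>V\<^esub>"
    "f \<in> J \<rightarrow> carrier V"
  shows "finsum V f I = finsum V f J"
proof -
  interpret abelian_monoid V by fact
  show ?thesis using assms by (intro add.finprod_mono_neutral_cong_left) auto
qed

context cring
begin

lemma hom_zero:
  assumes "f \<in> module_hom R A B" "module R A" "module R B"
  shows "f \<zero>\<^bsub>A\<^esub> = \<zero>\<^bsub>B\<^esub>"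
proof -
  interpret mod_hom R A B f using assms by (simp add: mod_hom_def mod_hom_axioms_def)
  show ?thesis by simp
qed

lemma hom_minus:
  assumes "f \<in> module_hom R A B" "module R A" "module R B" "x \<in> carrier A" "y \<in> carrier A"
  shows "f (x \<ominus>\<^bsub>A\<^esub> y) = f x \<ominus>\<^bsub>B\<^esub> f y"
proof -
  interpret mod_hom R A B f using assms by (simp add: mod_hom_def mod_hom_axioms_def)
  show ?thesis using assms by simp
qed

lemma hom_finsum:
  assumes "f \<in> module_hom R A B" "module R A" "module R B" "g \<in> I \<rightarrow> carrier A"
  shows "f (finsum A g I) = (\<Oplus>\<^bsub>B\<^esub>i\<in>I. f (g i))"
proof -
  interpret A: module R A by fact
  interpret B: module R B by fact
  show ?thesis using assms(4)
  proof (induction I rule: infinite_finite_induct)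
    case (infinite I) then show ?case
      by (simp add: hom_zero[OF assms(1-3)])
  next
    case empty then show ?case by (simp add: hom_zero[OF assms(1-3)])
  next
    case (insert i I)
    then show ?case
      using hom_in[OF assms(1)]
      by (simp add: module_hom_add[OF assms(1)] Pi_def)
  qed
qed

lemma hom_id: "(\<lambda>x. x) \<in> module_hom R A A"
  by (auto simp: module_hom_def)

lemma hom_const_zero:
  assumes "module R B" shows "(\<lambda>x. \<zero>\<^bsub>B\<^esub>) \<in> module_hom R A B"
proof -
  interpret B: module R B by fact
  show ?thesis by (auto intro!: module_homI)
qed

lemma hom_add:
  assumes "module R A" "module R B" "f \<in> module_hom R A B" "g \<in> module_hom R A B"
  shows "(\<lambda>x. f x \<oplus>\<^bsub>B\<^esub> g x) \<in> module_hom R A B"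
proof -
  interpret A: module R A by fact
  interpret B: module R B by fact
  show ?thesis
    using hom_in[OF assms(3)] hom_in[OF assms(4)]
    by (auto intro!: module_homI simp: module_hom_add[OF assms(3)] module_hom_add[OF assms(4)]
      module_hom_smult[OF assms(3)] module_hom_smult[OF assms(4)] B.a_ac B.smult_r_distr)
qed

lemma hom_smult:
  assumes "module R A" "module R B" "f \<in> module_hom R A B" "a \<in> carrier R"
  shows "(\<lambda>x. a \<odot>\<^bsub>B\<^esub> f x) \<in> module_hom R A B"
proof -
  interpret A: module R A by fact
  interpret B: module R B by fact
  show ?thesis
    using hom_in[OF assms(3)] assms(4)
    by (auto intro!: module_homI simp: module_hom_add[OF assms(3)]
      module_hom_smult[OF assms(3)] B.smult_r_distr B.smult_assoc1[symmetric] m_comm)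
qed

lemma hom_sum:
  assumes "module R A" "module R B" "\<And>i. i \<in> I \<Longrightarrow> f i \<in> module_hom R A B"
  shows "(\<lambda>x. \<Oplus>\<^bsub>B\<^esub>i\<in>I. f i x) \<in> module_hom R A B"
  using assms(3)
proof (induction I rule: infinite_finite_induct)
  interpret A: module R A by fact
  interpret B: module R B by fact
  { case (infinite I) then show ?case using hom_const_zero[OF assms(2)] by simp }
  { case empty then show ?case using hom_const_zero[OF assms(2)] by simp }
  { case (insert i I)
    then have "(\<lambda>x. f i x \<oplus>\<^bsub>B\<^esub> (\<Oplus>\<^bsub>B\<^esub>i\<in>I. f i x)) \<in> module_hom R A B"
      by (intro hom_add assms(1,2) insert.IH) simp_all
    moreover have "f j x \<in> carrier B" if "j \<in> insert i I" "x \<in> carrier A" for j x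
      using hom_in[OF insert.prems that(2)] that by blast
    ultimately show ?case
      by (elim hom_cong[OF _ assms(1)]) (use insert in \<open>simp add: Pi_def\<close>) }
qed

lemma submoduleI:
  assumes "module R V" "W \<subseteq> carrier V" "\<zero>\<^bsub>V\<^esub> \<in> W"
    "\<And>x y. x \<in> W \<Longrightarrow> y \<in> W \<Longrightarrow> x \<oplus>\<^bsub>V\<^esub> y \<in> W"
    "\<And>a x. a \<in> carrier R \<Longrightarrow> x \<in> W \<Longrightarrow> a \<odot>\<^bsub>V\<^esub> x \<in> W"
  shows "LinearCombinations.submodule R W V"
  using assms by (auto simp: LinearCombinations.submodule_def)

lemma carrier_submodule: "module R V \<Longrightarrow> LinearCombinations.submodule R (carrier V) V"
  by (rule submoduleI)
    (auto simp: module_def abelian_group_def abelian_monoid.a_closed abelian_monoid.zero_closed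
      module_axioms_def)

lemma hom_ker_submodule:
  assumes "f \<in> module_hom R A B" "module R A" "module R B" 
  shows "LinearCombinations.submodule R {x \<in> carrier A. f x = \<zero>\<^bsub>B\<^esub>} A"
proof -
  interpret mod_hom R A B f using assms by (simp add: mod_hom_def mod_hom_axioms_def)
  show ?thesis using ker_is_submodule by (simp add: ker_def)
qed

lemma hom_im_submodule:
  assumes "f \<in> module_hom R A B" "module R A" "module R B" 
  shows "LinearCombinations.submodule R (f ` carrier A) B"
proof -
  interpret mod_hom R A B f using assms by (simp add: mod_hom_def mod_hom_axioms_def)
  show ?thesis using im_is_submodule by (simp add: im_def)
qed

lemma span_submodule:
  "module R A \<Longrightarrow> S \<subseteq> carrier A \<Longrightarrow> LinearCombinations.submodule R (module.span R A S) A"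
  by (rule module.span_is_submodule)

lemma span_incl: "module R A \<Longrightarrow> S \<subseteq> carrier A \<Longrightarrow> s \<in> S \<Longrightarrow> s \<in> module.span R A S"
  using module.in_own_span by blast

lemma hom_kills_span:
  assumes "f \<in> module_hom R A B" "module R A" "module R B" "S \<subseteq> carrier A"
    "\<And>s. s \<in> S \<Longrightarrow> f s = \<zero>\<^bsub>B\<^esub>" "x \<in> module.span R A S"
  shows "f x = \<zero>\<^bsub>B\<^esub>"
  using module.span_is_subset[OF assms(2) _ hom_ker_submodule[OF assms(1-3)], of S] assms(4-6)
  by blast

text \<open>The coset calculus below is stated for \<open>V\<close> with its carrier cut down to a subspace \<open>Z\<close> that
  need not contain \<open>W\<close>. Only sums and multiples of representatives enter, so the cosets of \<open>W\<close>
  through \<open>Z\<close> always form a vector space, a copy of \<open>Z/(Z \<inter> W)\<close>. Homology is the case of cycles \<open>Z\<close> and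
  boundaries \<open>W\<close>.\<close>

lemma coset_def: "W +>\<^bsub>V\<^esub> x = (\<lambda>w. w \<oplus>\<^bsub>V\<^esub> x) ` W"
  by (auto simp: a_r_coset_def')

lemma coset_eq_iff:
  assumes "LinearCombinations.submodule R W V" "x \<in> carrier V" "y \<in> carrier V"
  shows "W +>\<^bsub>V\<^esub> x = W +>\<^bsub>V\<^esub> y \<longleftrightarrow> x \<ominus>\<^bsub>V\<^esub> y \<in> W"
proof -
  interpret W: LinearCombinations.submodule R W V by fact
  interpret V: module R V by (rule W.module)
  have W: "w \<in> carrier V" if "w \<in> W" for w using that W.subset by auto
  show ?thesis
  proof
    assume "W +>\<^bsub>V\<^esub> x = W +>\<^bsub>V\<^esub> y"
    then have "\<zero>\<^bsub>V\<^esub> \<oplus>\<^bsub>V\<^esub> x \<in> W +>\<^bsub>V\<^esub> y" by (force simp: coset_def)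
    then obtain w where "w \<in> W" "x = w \<oplus>\<^bsub>V\<^esub> y" using assms by (auto simp: coset_def)
    then show "x \<ominus>\<^bsub>V\<^esub> y \<in> W" using assms W
      by (simp add: V.minus_eq V.a_assoc V.r_neg)
  next
    assume d: "x \<ominus>\<^bsub>V\<^esub> y \<in> W"
    have d': "y \<ominus>\<^bsub>V\<^esub> x \<in> W"
      using W.smult_closed[OF _ d, of "\<ominus> \<one>"] assms V.smult_minus_1[of "x \<ominus>\<^bsub>V\<^esub> y"]
      by (simp add: V.minus_eq V.minus_add V.a_comm)
    have "w \<oplus>\<^bsub>V\<^esub> x = (w \<oplus>\<^bsub>V\<^esub> (x \<ominus>\<^bsub>V\<^esub> y)) \<oplus>\<^bsub>V\<^esub> y" if "w \<in> W" for w
      using W[OF that] assms by (simp add: V.minus_eq V.a_assoc V.l_neg)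
    then have "W +>\<^bsub>V\<^esub> x \<subseteq> W +>\<^bsub>V\<^esub> y"
      unfolding coset_def by (intro image_subsetI) (rule image_eqI, assumption, rule W.m_closed[OF _ d])
    moreover have "w \<oplus>\<^bsub>V\<^esub> y = (w \<oplus>\<^bsub>V\<^esub> (y \<ominus>\<^bsub>V\<^esub> x)) \<oplus>\<^bsub>V\<^esub> x" if "w \<in> W" for w
      using W[OF that] assms by (simp add: V.minus_eq V.a_assoc V.l_neg)
    then have "W +>\<^bsub>V\<^esub> y \<subseteq> W +>\<^bsub>V\<^esub> x"
      unfolding coset_def by (intro image_subsetI) (rule image_eqI, assumption, rule W.m_closed[OF _ d'])
    ultimately show "W +>\<^bsub>V\<^esub> x = W +>\<^bsub>V\<^esub> y" by (rule equalityI)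
  qed
qed

lemma coset_self:
  assumes "LinearCombinations.submodule R W V" "x \<in> carrier V"
  shows "x \<in> W +>\<^bsub>V\<^esub> x"
proof -
  interpret W: LinearCombinations.submodule R W V by fact
  interpret V: module R V by (rule W.module)
  show ?thesis unfolding coset_def
    by (rule image_eqI[OF _ W.zero_closed]) (simp add: assms(2))
qed

lemma coset_memD:
  assumes "LinearCombinations.submodule R W V" "x \<in> carrier V" "y \<in> W +>\<^bsub>V\<^esub> x"
  shows "y \<in> carrier V" "W +>\<^bsub>V\<^esub> y = W +>\<^bsub>V\<^esub> x"
proof -
  interpret W: LinearCombinations.submodule R W V by fact
  interpret V: module R V by (rule W.module)
  obtain w where w: "w \<in> W" "w \<in> carrier V" "y = w \<oplus>\<^bsub>V\<^esub> x" using assms(3) W.subset by (auto simp: coset_def)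
  show y: "y \<in> carrier V" using w assms by simp
  have "y \<ominus>\<^bsub>V\<^esub> x = w" using w assms by (simp add: V.minus_eq V.a_assoc V.r_neg)
  then show "W +>\<^bsub>V\<^esub> y = W +>\<^bsub>V\<^esub> x" using w by (subst coset_eq_iff[OF assms(1) y assms(2)]) simp
qed

lemma coset_add:
  assumes "LinearCombinations.submodule R W V" "x \<in> carrier V" "y \<in> carrier V"
  shows "(W +>\<^bsub>V\<^esub> x) <+>\<^bsub>V\<^esub> (W +>\<^bsub>V\<^esub> y) = W +>\<^bsub>V\<^esub> (x \<oplus>\<^bsub>V\<^esub> y)"
proof -
  interpret W: LinearCombinations.submodule R W V by fact
  interpret V: module R V by (rule W.module)
  have W: "w \<in> carrier V" if "w \<in> W" for w using that W.subset by auto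
  have "(v \<oplus>\<^bsub>V\<^esub> x) \<oplus>\<^bsub>V\<^esub> (w \<oplus>\<^bsub>V\<^esub> y) = (v \<oplus>\<^bsub>V\<^esub> w) \<oplus>\<^bsub>V\<^esub> (x \<oplus>\<^bsub>V\<^esub> y)" if "v \<in> W" "w \<in> W" for v w
    using W[OF that(1)] W[OF that(2)] assms by (simp add: V.a_ac)
  then have "(W +>\<^bsub>V\<^esub> x) <+>\<^bsub>V\<^esub> (W +>\<^bsub>V\<^esub> y) \<subseteq> W +>\<^bsub>V\<^esub> (x \<oplus>\<^bsub>V\<^esub> y)"
    using W.m_closed by (force simp: set_add_def' coset_def)
  moreover have "w \<oplus>\<^bsub>V\<^esub> (x \<oplus>\<^bsub>V\<^esub> y) = (w \<oplus>\<^bsub>V\<^esub> x) \<oplus>\<^bsub>V\<^esub> (\<zero>\<^bsub>V\<^esub> \<oplus>\<^bsub>V\<^esub> y)" if "w \<in> W" for w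
    using W[OF that(1)] assms by (simp add: V.a_ac)
  then have "W +>\<^bsub>V\<^esub> (x \<oplus>\<^bsub>V\<^esub> y) \<subseteq> (W +>\<^bsub>V\<^esub> x) <+>\<^bsub>V\<^esub> (W +>\<^bsub>V\<^esub> y)"
    using W.zero_closed by (fastforce simp: set_add_def' coset_def)
  ultimately show ?thesis by blast
qed

lemma coset_smult:
  assumes "LinearCombinations.submodule R W V" "x \<in> carrier V" "a \<in> carrier R"
  shows "(\<Union>y \<in> W +>\<^bsub>V\<^esub> x. W +>\<^bsub>V\<^esub> (a \<odot>\<^bsub>V\<^esub> y)) = W +>\<^bsub>V\<^esub> (a \<odot>\<^bsub>V\<^esub> x)"
proof -
  interpret W: LinearCombinations.submodule R W V by fact
  interpret V: module R V by (rule W.module)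
  have "W +>\<^bsub>V\<^esub> (a \<odot>\<^bsub>V\<^esub> y) = W +>\<^bsub>V\<^esub> (a \<odot>\<^bsub>V\<^esub> x)" if y: "y \<in> W +>\<^bsub>V\<^esub> x" for y
  proof -
    obtain w where w: "w \<in> W" "w \<in> carrier V" "y = w \<oplus>\<^bsub>V\<^esub> x" using y W.subset by (auto simp: coset_def)
    then have "a \<odot>\<^bsub>V\<^esub> y \<ominus>\<^bsub>V\<^esub> a \<odot>\<^bsub>V\<^esub> x = a \<odot>\<^bsub>V\<^esub> w"
      using assms by (simp add: V.smult_r_distr V.minus_eq V.a_assoc V.r_neg)
    then show ?thesis using w assms by (subst coset_eq_iff[OF assms(1)]) auto
  qed
  from SUP_cong[OF refl this] have "(\<Union>y \<in> W +>\<^bsub>V\<^esub> x. W +>\<^bsub>V\<^esub> (a \<odot>\<^bsub>V\<^esub> y)) = (\<Union>y \<in> W +>\<^bsub>V\<^esub> x. W +>\<^bsub>V\<^esub> (a \<odot>\<^bsub>V\<^esub> x))"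
    .
  also have "\<dots> = W +>\<^bsub>V\<^esub> (a \<odot>\<^bsub>V\<^esub> x)"
    using coset_self[OF assms(1,2)] by (subst UN_constant) (simp split: if_splits, blast)
  finally show ?thesis .
qed

lemma quot_space_simps:
  "zero (quot_space (V\<lparr>carrier := Z\<rparr>) W) = W"
  "add (quot_space (V\<lparr>carrier := Z\<rparr>) W) S T = S <+>\<^bsub>V\<^esub> T"
  "smult (quot_space (V\<lparr>carrier := Z\<rparr>) W) a S = (\<Union>x\<in>S. W +>\<^bsub>V\<^esub> (a \<odot>\<^bsub>V\<^esub> x))"
  "carrier (quot_space (V\<lparr>carrier := Z\<rparr>) W) = (\<lambda>x. W +>\<^bsub>V\<^esub> x) ` Z"
proof -
  have c: "a_r_coset (V\<lparr>carrier := Z\<rparr>) = a_r_coset V" for Z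
    by (intro ext) (simp add: a_r_coset_def r_coset_def)
  show "zero (quot_space (V\<lparr>carrier := Z\<rparr>) W) = W" by (simp add: quot_space_def)
  show "add (quot_space (V\<lparr>carrier := Z\<rparr>) W) S T = S <+>\<^bsub>V\<^esub> T"
    by (simp add: quot_space_def set_add_def set_mult_def)
  show "smult (quot_space (V\<lparr>carrier := Z\<rparr>) W) a S = (\<Union>x\<in>S. W +>\<^bsub>V\<^esub> (a \<odot>\<^bsub>V\<^esub> x))"
    by (simp add: quot_space_def c)
  show "carrier (quot_space (V\<lparr>carrier := Z\<rparr>) W) = (\<lambda>x. W +>\<^bsub>V\<^esub> x) ` Z"
    by (simp add: quot_space_def A_RCOSETS_def' c UNION_singleton_eq_range)
qed

lemma quot_space_ops:
  assumes "LinearCombinations.submodule R W V"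
  shows "x \<in> carrier V \<Longrightarrow> y \<in> carrier V \<Longrightarrow>
      add (quot_space (V\<lparr>carrier := Z\<rparr>) W) (W +>\<^bsub>V\<^esub> x) (W +>\<^bsub>V\<^esub> y) = W +>\<^bsub>V\<^esub> (x \<oplus>\<^bsub>V\<^esub> y)"
    and "x \<in> carrier V \<Longrightarrow> a \<in> carrier R \<Longrightarrow>
      smult (quot_space (V\<lparr>carrier := Z\<rparr>) W) a (W +>\<^bsub>V\<^esub> x) = W +>\<^bsub>V\<^esub> (a \<odot>\<^bsub>V\<^esub> x)"
    and "zero (quot_space (V\<lparr>carrier := Z\<rparr>) W) = W +>\<^bsub>V\<^esub> \<zero>\<^bsub>V\<^esub>"
proof -
  interpret W: LinearCombinations.submodule R W V by fact
  interpret V: module R V by (rule W.module)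
  have "(\<lambda>w. w \<oplus>\<^bsub>V\<^esub> \<zero>\<^bsub>V\<^esub>) ` W = (\<lambda>w. w) ` W"
    using W.subset by (intro image_cong) auto
  then show "zero (quot_space (V\<lparr>carrier := Z\<rparr>) W) = W +>\<^bsub>V\<^esub> \<zero>\<^bsub>V\<^esub>"
    by (simp add: quot_space_simps(1) coset_def)
qed (simp_all only: quot_space_simps coset_add[OF assms] coset_smult[OF assms])

lemma quot_space_sub_module:
  assumes W: "LinearCombinations.submodule R W V" and Z: "LinearCombinations.submodule R Z V"
  shows "module R (quot_space (V\<lparr>carrier := Z\<rparr>) W)"
proof -
  interpret W: LinearCombinations.submodule R W V by fact
  interpret Z: LinearCombinations.submodule R Z V by fact
  interpret V: module R V by (rule W.module)
  have ZV: "z \<in> carrier V" if "z \<in> Z" for z using that Z.subset by auto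
  let ?Q = "quot_space (V\<lparr>carrier := Z\<rparr>) W"
  note c = quot_space_ops[OF W, where Z = Z] quot_space_simps(4)
  have neg: "\<ominus>\<^bsub>V\<^esub> x \<in> Z" if "x \<in> Z" for x
    using that Z.smult_closed[of "\<ominus> \<one>" x] V.smult_minus_1[of x] ZV by simp
  show ?thesis
  proof (rule moduleI)
    show "cring R" ..
    show "abelian_group ?Q"
    proof (rule abelian_groupI)
      show "\<exists>y\<in>carrier ?Q. y \<oplus>\<^bsub>?Q\<^esub> x = \<zero>\<^bsub>?Q\<^esub>" if x: "x \<in> carrier ?Q" for x
      proof -
        obtain v where v: "v \<in> Z" "x = W +>\<^bsub>V\<^esub> v" using x by (auto simp: c)
        then have "(W +>\<^bsub>V\<^esub> (\<ominus>\<^bsub>V\<^esub> v)) \<oplus>\<^bsub>?Q\<^esub> x = \<zero>\<^bsub>?Q\<^esub>"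
          by (simp add: c ZV V.l_neg)
        then show ?thesis using neg[OF v(1)] by (auto simp: c(4))
      qed
    qed (auto simp: c ZV V.a_ac intro!: imageI)
  qed (auto simp: c ZV V.smult_l_distr V.smult_r_distr V.smult_assoc1 intro!: imageI)
qed

lemma quot_space_module:
  assumes W: "LinearCombinations.submodule R W V"
  shows "module R (quot_space V W)"
  using quot_space_sub_module[OF W carrier_submodule] W by (simp add: LinearCombinations.submodule_def)

lemma quot_space_carrier: "carrier (quot_space V W) = (\<lambda>x. W +>\<^bsub>V\<^esub> x) ` carrier V"
  using quot_space_simps(4)[where V=V and Z="carrier V" and W=W] by simp

lemma quot_class_hom:
  assumes W: "LinearCombinations.submodule R W V"
  shows "(\<lambda>x. W +>\<^bsub>V\<^esub> x) \<in> module_hom R V (quot_space V W)"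
  using quot_space_ops[OF W, where Z = "carrier V"]
  by (auto intro!: module_homI simp: quot_space_carrier)

text \<open>This evaluates maps on cosets that are defined as the only element of an image, like \<^const>\<open>tensor_lift\<close>.\<close>

lemma coset_image:
  assumes W: "LinearCombinations.submodule R W V" and "module R U"
    and f: "f \<in> module_hom R V U" and k: "\<And>w. w \<in> W \<Longrightarrow> f w = \<zero>\<^bsub>U\<^esub>" and x: "x \<in> carrier V"
  shows "f ` (W +>\<^bsub>V\<^esub> x) = {f x}"
proof -
  interpret W: LinearCombinations.submodule R W V by fact
  interpret V: module R V by (rule W.module)
  interpret U: module R U by fact
  have "f (w \<oplus>\<^bsub>V\<^esub> x) = f x" if "w \<in> W" for w
  proof -
    have "w \<in> carrier V" using that W.subset by auto
    then show ?thesis using that x hom_in[OF f x] by (simp add: module_hom_add[OF f] k)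
  qed
  then have "(\<lambda>w. f (w \<oplus>\<^bsub>V\<^esub> x)) ` W = (\<lambda>w. f x) ` W" by (intro image_cong) auto
  moreover have "W \<noteq> {}" by (metis W.zero_closed empty_iff)
  ultimately show ?thesis by (simp add: coset_def image_image image_constant_conv)
qed

lemma quot_lift_hom:
  assumes W: "LinearCombinations.submodule R W V" and "module R U"
    and f: "f \<in> module_hom R V U" and k: "\<And>w. w \<in> W \<Longrightarrow> f w = \<zero>\<^bsub>U\<^esub>"
  shows "(\<lambda>T. the_elem (f ` T)) \<in> module_hom R (quot_space V W) U"
proof -
  interpret W: LinearCombinations.submodule R W V by fact
  interpret V: module R V by (rule W.module)
  note i = coset_image[OF W assms(2) f k]
  note s = quot_space_ops[OF W, where Z = "carrier V", simplified] quot_space_carrier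
  show ?thesis
    by (rule module_homI)
      (auto simp: s i hom_in[OF f] module_hom_add[OF f] module_hom_smult[OF f])
qed


end

section \<open>Products, direct sums and spaces given by generators and relations\<close>

context cring
begin

lemma module_facts:
  assumes "module R V"
  shows "\<zero>\<^bsub>V\<^esub> \<in> carrier V"
    and "x \<in> carrier V \<Longrightarrow> y \<in> carrier V \<Longrightarrow> x \<oplus>\<^bsub>V\<^esub> y \<in> carrier V"
    and "a \<in> carrier R \<Longrightarrow> x \<in> carrier V \<Longrightarrow> a \<odot>\<^bsub>V\<^esub> x \<in> carrier V"
    and "x \<in> carrier V \<Longrightarrow> \<ominus>\<^bsub>V\<^esub> x \<in> carrier V"
    and "x \<in> carrier V \<Longrightarrow> \<zero>\<^bsub>V\<^esub> \<oplus>\<^bsub>V\<^esub> x = x"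
    and "x \<in> carrier V \<Longrightarrow> x \<oplus>\<^bsub>V\<^esub> \<zero>\<^bsub>V\<^esub> = x"
    and "x \<in> carrier V \<Longrightarrow> \<ominus>\<^bsub>V\<^esub> x \<oplus>\<^bsub>V\<^esub> x = \<zero>\<^bsub>V\<^esub>"
    and "x \<in> carrier V \<Longrightarrow> \<one> \<odot>\<^bsub>V\<^esub> x = x"
    and "a \<in> carrier R \<Longrightarrow> a \<odot>\<^bsub>V\<^esub> \<zero>\<^bsub>V\<^esub> = \<zero>\<^bsub>V\<^esub>"
    and "x \<in> carrier V \<Longrightarrow> y \<in> carrier V \<Longrightarrow> x \<oplus>\<^bsub>V\<^esub> y = y \<oplus>\<^bsub>V\<^esub> x"
    and "x \<in> carrier V \<Longrightarrow> y \<in> carrier V \<Longrightarrow> z \<in> carrier V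
      \<Longrightarrow> (x \<oplus>\<^bsub>V\<^esub> y) \<oplus>\<^bsub>V\<^esub> z = x \<oplus>\<^bsub>V\<^esub> (y \<oplus>\<^bsub>V\<^esub> z)"
    and "a \<in> carrier R \<Longrightarrow> b \<in> carrier R \<Longrightarrow> x \<in> carrier V
      \<Longrightarrow> (a \<oplus> b) \<odot>\<^bsub>V\<^esub> x = a \<odot>\<^bsub>V\<^esub> x \<oplus>\<^bsub>V\<^esub> b \<odot>\<^bsub>V\<^esub> x"
    and "a \<in> carrier R \<Longrightarrow> x \<in> carrier V \<Longrightarrow> y \<in> carrier V
      \<Longrightarrow> a \<odot>\<^bsub>V\<^esub> (x \<oplus>\<^bsub>V\<^esub> y) = a \<odot>\<^bsub>V\<^esub> x \<oplus>\<^bsub>V\<^esub> a \<odot>\<^bsub>V\<^esub> y"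
    and "a \<in> carrier R \<Longrightarrow> b \<in> carrier R \<Longrightarrow> x \<in> carrier V
      \<Longrightarrow> (a \<otimes> b) \<odot>\<^bsub>V\<^esub> x = a \<odot>\<^bsub>V\<^esub> (b \<odot>\<^bsub>V\<^esub> x)"
proof -
  interpret V: module R V by fact
  show "\<zero>\<^bsub>V\<^esub> \<in> carrier V"
    and "x \<in> carrier V \<Longrightarrow> y \<in> carrier V \<Longrightarrow> x \<oplus>\<^bsub>V\<^esub> y \<in> carrier V"
    and "a \<in> carrier R \<Longrightarrow> x \<in> carrier V \<Longrightarrow> a \<odot>\<^bsub>V\<^esub> x \<in> carrier V"
    and "x \<in> carrier V \<Longrightarrow> \<ominus>\<^bsub>V\<^esub> x \<in> carrier V"
    and "x \<in> carrier V \<Longrightarrow> \<zero>\<^bsub>V\<^esub> \<oplus>\<^bsub>V\<^esub> x = x"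
    and "x \<in> carrier V \<Longrightarrow> x \<oplus>\<^bsub>V\<^esub> \<zero>\<^bsub>V\<^esub> = x"
    and "x \<in> carrier V \<Longrightarrow> \<ominus>\<^bsub>V\<^esub> x \<oplus>\<^bsub>V\<^esub> x = \<zero>\<^bsub>V\<^esub>"
    and "x \<in> carrier V \<Longrightarrow> \<one> \<odot>\<^bsub>V\<^esub> x = x"
    and "a \<in> carrier R \<Longrightarrow> a \<odot>\<^bsub>V\<^esub> \<zero>\<^bsub>V\<^esub> = \<zero>\<^bsub>V\<^esub>"
    and "x \<in> carrier V \<Longrightarrow> y \<in> carrier V \<Longrightarrow> x \<oplus>\<^bsub>V\<^esub> y = y \<oplus>\<^bsub>V\<^esub> x"
    by (simp_all add: V.l_neg) (simp add: V.a_comm)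
  show "x \<in> carrier V \<Longrightarrow> y \<in> carrier V \<Longrightarrow> z \<in> carrier V
      \<Longrightarrow> (x \<oplus>\<^bsub>V\<^esub> y) \<oplus>\<^bsub>V\<^esub> z = x \<oplus>\<^bsub>V\<^esub> (y \<oplus>\<^bsub>V\<^esub> z)" by (rule V.a_assoc)
  show "a \<in> carrier R \<Longrightarrow> b \<in> carrier R \<Longrightarrow> x \<in> carrier V
      \<Longrightarrow> (a \<oplus> b) \<odot>\<^bsub>V\<^esub> x = a \<odot>\<^bsub>V\<^esub> x \<oplus>\<^bsub>V\<^esub> b \<odot>\<^bsub>V\<^esub> x" by (rule V.smult_l_distr)
  show "a \<in> carrier R \<Longrightarrow> x \<in> carrier V \<Longrightarrow> y \<in> carrier V
      \<Longrightarrow> a \<odot>\<^bsub>V\<^esub> (x \<oplus>\<^bsub>V\<^esub> y) = a \<odot>\<^bsub>V\<^esub> x \<oplus>\<^bsub>V\<^esub> a \<odot>\<^bsub>V\<^esub> y" by (rule V.smult_r_distr)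
  show "a \<in> carrier R \<Longrightarrow> b \<in> carrier R \<Longrightarrow> x \<in> carrier V
      \<Longrightarrow> (a \<otimes> b) \<odot>\<^bsub>V\<^esub> x = a \<odot>\<^bsub>V\<^esub> (b \<odot>\<^bsub>V\<^esub> x)" by (rule V.smult_assoc1)
qed

lemma prod_space_simps:
  "carrier (prod_space I A) = (\<Pi>\<^sub>E i\<in>I. carrier (A i))"
  "zero (prod_space I A) = (\<lambda>i\<in>I. \<zero>\<^bsub>A i\<^esub>)"
  "add (prod_space I A) f g = (\<lambda>i\<in>I. f i \<oplus>\<^bsub>A i\<^esub> g i)"
  "smult (prod_space I A) a f = (\<lambda>i\<in>I. a \<odot>\<^bsub>A i\<^esub> f i)"
  by (simp_all add: prod_space_def)

lemma prod_space_module: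
  assumes A: "\<And>i. i \<in> I \<Longrightarrow> module R (A i)"
  shows "module R (prod_space I A)"
proof -
  note F = module_facts[OF A]
  have c: "f i \<in> carrier (A i)" if "f \<in> carrier (prod_space I A)" "i \<in> I" for f i
    using that by (auto simp: prod_space_simps)
  have e: "f \<in> extensional I" if "f \<in> carrier (prod_space I A)" for f
    using that by (auto simp: prod_space_simps PiE_def)
  have m: "restrict f I \<in> carrier (prod_space I A)" if "\<And>i. i \<in> I \<Longrightarrow> f i \<in> carrier (A i)" for f
    using that by (simp add: prod_space_simps)
  note ps = prod_space_simps(2-)
  note eq = extensionalityI[where A = I]
  show ?thesis
  proof (rule moduleI)
    show "cring R" ..
    show "abelian_group (prod_space I A)"
    proof (rule abelian_groupI)
      show "\<exists>g\<in>carrier (prod_space I A). g \<oplus>\<^bsub>prod_space I A\<^esub> f = \<zero>\<^bsub>prod_space I A\<^esub>"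
        if "f \<in> carrier (prod_space I A)" for f
        by (rule bexI[of _ "\<lambda>i\<in>I. \<ominus>\<^bsub>A i\<^esub> f i"])
          (simp add: ps F(4,7) c[OF that] cong: restrict_cong, rule m, simp add: F c[OF that])
    qed ((unfold ps; rule m; simp add: F c) | (unfold ps; rule restrict_ext; rule F(10); simp add: c)
      | (rule eq; simp add: e ps F(1-9,11-) c))+
  qed ((unfold ps; rule m; simp add: F c) | (unfold ps; rule restrict_ext; rule F(10); simp add: c)
      | (rule eq; simp add: e ps F(1-9,11-) c))+
qed

lemma dsum_space_simps:
  "carrier (dsum_space I A) = {f \<in> (\<Pi>\<^sub>E i\<in>I. carrier (A i)). finite (dsum_supp I A f)}"
  "zero (dsum_space I A) = (\<lambda>i\<in>I. \<zero>\<^bsub>A i\<^esub>)"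
  "add (dsum_space I A) f g = (\<lambda>i\<in>I. f i \<oplus>\<^bsub>A i\<^esub> g i)"
  "smult (dsum_space I A) a f = (\<lambda>i\<in>I. a \<odot>\<^bsub>A i\<^esub> f i)"
  by (simp_all add: dsum_space_def prod_space_def)

lemma dsum_space_module:
  assumes A: "\<And>i. i \<in> I \<Longrightarrow> module R (A i)"
  shows "module R (dsum_space I A)"
proof -
  note F = module_facts[OF A]
  interpret P: module R "prod_space I A" by (rule prod_space_module[OF A])
  let ?D = "{f \<in> carrier (prod_space I A). finite (dsum_supp I A f)}"
  have "LinearCombinations.submodule R ?D (prod_space I A)"
  proof (rule submoduleI)
    have "dsum_supp I A \<zero>\<^bsub>prod_space I A\<^esub> = {}"
      by (auto simp: dsum_supp_def prod_space_simps)
    then show "\<zero>\<^bsub>prod_space I A\<^esub> \<in> ?D" by simp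
    show "f \<oplus>\<^bsub>prod_space I A\<^esub> g \<in> ?D" if "f \<in> ?D" "g \<in> ?D" for f g
    proof -
      have "dsum_supp I A (f \<oplus>\<^bsub>prod_space I A\<^esub> g) \<subseteq> dsum_supp I A f \<union> dsum_supp I A g"
        by (auto simp: dsum_supp_def prod_space_simps F)
      then show ?thesis using that by (auto intro: finite_subset)
    qed
    show "a \<odot>\<^bsub>prod_space I A\<^esub> f \<in> ?D" if "a \<in> carrier R" "f \<in> ?D" for f a
    proof -
      have "dsum_supp I A (a \<odot>\<^bsub>prod_space I A\<^esub> f) \<subseteq> dsum_supp I A f"
        using that by (auto simp: dsum_supp_def prod_space_simps F)
      then show ?thesis using that by (auto intro: finite_subset)
    qed
  qed (auto intro: P.module_axioms)
  then show ?thesis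
    unfolding dsum_space_def by (rule P.submodule_is_module)
qed

lemma dsum_proj_hom: "i \<in> I \<Longrightarrow> (\<lambda>f. f i) \<in> module_hom R (dsum_space I A) (A i)"
  by (auto intro!: module_homI simp: dsum_space_simps)

lemma dsum_inj_hom:
  assumes A: "\<And>i. i \<in> I \<Longrightarrow> module R (A i)" and i: "i \<in> I"
  shows "dsum_inj I A i \<in> module_hom R (A i) (dsum_space I A)"
proof (rule module_homI)
  note F = module_facts[OF A]
  show "dsum_inj I A i x \<in> carrier (dsum_space I A)" if "x \<in> carrier (A i)" for x
  proof -
    have "dsum_supp I A (dsum_inj I A i x) \<subseteq> {i}"
      by (auto simp: dsum_supp_def dsum_inj_def)
    then show ?thesis using that finite_subset
      by (auto simp: dsum_space_simps dsum_inj_def F)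
  qed
qed (use module_facts[OF A] i in \<open>auto simp: dsum_inj_def dsum_space_simps intro!: restrict_ext\<close>)

lemma dsum_expand:
  assumes A: "\<And>i. i \<in> I \<Longrightarrow> module R (A i)" and x: "x \<in> carrier (dsum_space I A)"
    and J: "finite J" "dsum_supp I A x \<subseteq> J" "J \<subseteq> I"
  shows "x = (\<Oplus>\<^bsub>dsum_space I A\<^esub>i\<in>J. dsum_inj I A i (x i))" (is "x = ?s")
proof -
  interpret D: module R "dsum_space I A" by (rule dsum_space_module[OF A])
  have xi: "x i \<in> carrier (A i)" if "i \<in> I" for i
    using x that by (auto simp: dsum_space_simps)
  have inD: "(\<lambda>i. dsum_inj I A i (x i)) \<in> J \<rightarrow> carrier (dsum_space I A)"
    by (rule Pi_I, rule hom_in[OF dsum_inj_hom[OF A]]) (use J xi in auto)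
  then have s: "?s \<in> carrier (dsum_space I A)" by (rule D.finsum_closed)
  show ?thesis
  proof (rule extensionalityI[where A = I])
    fix j assume j: "j \<in> I"
    interpret Aj: module R "A j" by (rule A[OF j])
    have "?s j = (\<Oplus>\<^bsub>A j\<^esub>i\<in>J. dsum_inj I A i (x i) j)"
      using hom_finsum[OF dsum_proj_hom[OF j] D.module_axioms Aj.module_axioms inD] .
    also have "\<dots> = (\<Oplus>\<^bsub>A j\<^esub>i\<in>J. if j = i then x j else \<zero>\<^bsub>A j\<^esub>)"
      using xi[OF j] j by (intro Aj.finsum_cong') (auto simp: dsum_inj_def)
    also have "\<dots> = x j"
    proof (cases "j \<in> J")
      case True then show ?thesis
        using Aj.finsum_singleton[OF True J(1), of "\<lambda>_. x j"] xi[OF j] by auto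
    next
      case False
      then have "x j = \<zero>\<^bsub>A j\<^esub>" using J(2) j by (auto simp: dsum_supp_def)
      moreover have "(\<Oplus>\<^bsub>A j\<^esub>i\<in>J. if j = i then x j else \<zero>\<^bsub>A j\<^esub>) = (\<Oplus>\<^bsub>A j\<^esub>i\<in>J. \<zero>\<^bsub>A j\<^esub>)"
        using False by (intro Aj.finsum_cong') auto
      ultimately show ?thesis by simp
    qed
    finally show "x j = ?s j" by simp
  qed (use x s in \<open>auto simp: dsum_space_simps PiE_def\<close>)
qed

lemma dsum_ext:
  assumes A: "\<And>i. i \<in> I \<Longrightarrow> module R (A i)" and V: "module R V"
    and f: "f \<in> module_hom R (dsum_space I A) V" and g: "g \<in> module_hom R (dsum_space I A) V"
    and eq: "\<And>i a. i \<in> I \<Longrightarrow> a \<in> carrier (A i) \<Longrightarrow> f (dsum_inj I A i a) = g (dsum_inj I A i a)"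
    and x: "x \<in> carrier (dsum_space I A)"
  shows "f x = g x"
proof -
  interpret V: module R V by fact
  note D = dsum_space_module[OF A]
  let ?J = "dsum_supp I A x"
  have J: "finite ?J" "?J \<subseteq> ?J" "?J \<subseteq> I" using x by (auto simp: dsum_space_simps dsum_supp_def)
  have xi: "x i \<in> carrier (A i)" if "i \<in> I" for i
    using x that by (auto simp: dsum_space_simps)
  have inD: "(\<lambda>i. dsum_inj I A i (x i)) \<in> ?J \<rightarrow> carrier (dsum_space I A)"
    by (rule Pi_I, rule hom_in[OF dsum_inj_hom[OF A]]) (use J xi in auto)
  have "f x = (\<Oplus>\<^bsub>V\<^esub>i\<in>?J. f (dsum_inj I A i (x i)))"
    by (subst dsum_expand[OF A x J]) (auto intro: hom_finsum[OF f D V inD])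
  also have "\<dots> = (\<Oplus>\<^bsub>V\<^esub>i\<in>?J. g (dsum_inj I A i (x i)))"
    using J(3) xi inD hom_in[OF g] by (intro V.finsum_cong') (auto simp: eq)
  also have "\<dots> = g x"
    by (subst (2) dsum_expand[OF A x J]) (auto intro: hom_finsum[OF g D V inD, symmetric])
  finally show ?thesis .
qed

text \<open>The universal property of the direct sum. Its sums run over the support of the argument,
  which varies; on a finite set of indices that contains the supports involved they are additive.\<close>

lemma dsum_lift:
  assumes A: "\<And>i. i \<in> I \<Longrightarrow> module R (A i)" and V: "module R V"
    and g: "\<And>i. i \<in> I \<Longrightarrow> g i \<in> module_hom R (A i) V"
  shows dsum_lift_hom:
      "(\<lambda>x. \<Oplus>\<^bsub>V\<^esub>i\<in>dsum_supp I A x. g i (x i)) \<in> module_hom R (dsum_space I A) V" (is "?h \<in> _")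
    and dsum_lift_inj:
      "i \<in> I \<Longrightarrow> a \<in> carrier (A i) \<Longrightarrow>
        (\<Oplus>\<^bsub>V\<^esub>j\<in>dsum_supp I A (dsum_inj I A i a). g j (dsum_inj I A i a j)) = g i a"
proof -
  interpret V: module R V by fact
  interpret D: module R "dsum_space I A" by (rule dsum_space_module[OF A])
  have xi: "x i \<in> carrier (A i)" if "x \<in> carrier (dsum_space I A)" "i \<in> I" for x i
    using that by (auto simp: dsum_space_simps)
  have *: "?h x = (\<Oplus>\<^bsub>V\<^esub>i\<in>J. g i (x i))"
    if "x \<in> carrier (dsum_space I A)" "finite J" "dsum_supp I A x \<subseteq> J" "J \<subseteq> I" for x J
  proof (rule finsum_mono_neutral)
    show "g i (x i) = \<zero>\<^bsub>V\<^esub>" if i: "i \<in> J - dsum_supp I A x" for i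
    proof -
      have "i \<in> I" "x i = \<zero>\<^bsub>A i\<^esub>" using i that \<open>J \<subseteq> I\<close> by (auto simp: dsum_supp_def)
      then show ?thesis using hom_zero[OF g A V] by simp
    qed
  qed (use that xi hom_in[OF g] in \<open>auto intro: V.abelian_monoid_axioms\<close>)
  have fin: "finite (dsum_supp I A x)" "dsum_supp I A x \<subseteq> I" if "x \<in> carrier (dsum_space I A)" for x
    using that by (auto simp: dsum_space_simps dsum_supp_def)
  show "?h \<in> module_hom R (dsum_space I A) V"
  proof (rule module_homI)
    show "?h x \<in> carrier V" if "x \<in> carrier (dsum_space I A)" for x
      using fin[OF that] xi[OF that] hom_in[OF g] by (intro V.finsum_closed) auto
    show "?h (x \<oplus>\<^bsub>dsum_space I A\<^esub> y) = ?h x \<oplus>\<^bsub>V\<^esub> ?h y"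
      if x: "x \<in> carrier (dsum_space I A)" and y: "y \<in> carrier (dsum_space I A)" for x y
    proof -
      let ?s = "x \<oplus>\<^bsub>dsum_space I A\<^esub> y"
      have s: "?s \<in> carrier (dsum_space I A)" using x y by simp
      let ?J = "dsum_supp I A ?s \<union> dsum_supp I A x \<union> dsum_supp I A y"
      have J: "finite ?J" "?J \<subseteq> I" using fin[OF s] fin[OF x] fin[OF y] by auto
      have "?h ?s = (\<Oplus>\<^bsub>V\<^esub>i\<in>?J. g i (?s i))" using J by (intro *[OF s]) auto
      also have "\<dots> = (\<Oplus>\<^bsub>V\<^esub>i\<in>?J. g i (x i) \<oplus>\<^bsub>V\<^esub> g i (y i))"
        using J(2) xi[OF x] xi[OF y] hom_in[OF g]
        by (intro V.finsum_cong') (auto simp: dsum_space_simps module_hom_add[OF g] subset_iff)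
      also have "\<dots> = (\<Oplus>\<^bsub>V\<^esub>i\<in>?J. g i (x i)) \<oplus>\<^bsub>V\<^esub> (\<Oplus>\<^bsub>V\<^esub>i\<in>?J. g i (y i))"
        using J(2) xi[OF x] xi[OF y] hom_in[OF g] by (intro V.finsum_addf) auto
      also have "(\<Oplus>\<^bsub>V\<^esub>i\<in>?J. g i (x i)) = ?h x" using J by (intro *[OF x, symmetric]) auto
      also have "(\<Oplus>\<^bsub>V\<^esub>i\<in>?J. g i (y i)) = ?h y" using J by (intro *[OF y, symmetric]) auto
      finally show ?thesis .
    qed
    show "?h (a \<odot>\<^bsub>dsum_space I A\<^esub> x) = a \<odot>\<^bsub>V\<^esub> ?h x"
      if a: "a \<in> carrier R" and x: "x \<in> carrier (dsum_space I A)" for a x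
    proof -
      let ?s = "a \<odot>\<^bsub>dsum_space I A\<^esub> x"
      have s: "?s \<in> carrier (dsum_space I A)" using x a by simp
      let ?J = "dsum_supp I A ?s \<union> dsum_supp I A x"
      have J: "finite ?J" "?J \<subseteq> I" using fin[OF s] fin[OF x] by auto
      have "?h ?s = (\<Oplus>\<^bsub>V\<^esub>i\<in>?J. g i (?s i))" using J by (intro *[OF s]) auto
      also have "\<dots> = (\<Oplus>\<^bsub>V\<^esub>i\<in>?J. a \<odot>\<^bsub>V\<^esub> g i (x i))"
        using J(2) xi[OF x] hom_in[OF g] a
        by (intro V.finsum_cong') (auto simp: dsum_space_simps module_hom_smult[OF g] subset_iff)
      also have "\<dots> = a \<odot>\<^bsub>V\<^esub> (\<Oplus>\<^bsub>V\<^esub>i\<in>?J. g i (x i))"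
        using J xi[OF x] hom_in[OF g] a by (intro V.finsum_smult_ldistr[symmetric]) auto
      also have "(\<Oplus>\<^bsub>V\<^esub>i\<in>?J. g i (x i)) = ?h x" using J by (intro *[OF x, symmetric]) auto
      finally show ?thesis .
    qed
  qed
  show "?h (dsum_inj I A i a) = g i a" if i: "i \<in> I" "a \<in> carrier (A i)"
  proof -
    have "dsum_inj I A i a \<in> carrier (dsum_space I A)"
      by (rule hom_in[OF dsum_inj_hom[where A = A and I = I, OF A i(1)] i(2)])
    then have "?h (dsum_inj I A i a) = (\<Oplus>\<^bsub>V\<^esub>j\<in>{i}. g j (dsum_inj I A i a j))"
      by (rule *) (use i in \<open>auto simp: dsum_supp_def dsum_inj_def\<close>)
    also have "\<dots> = g i a"
      using i hom_in[OF g[OF i(1)]] by (simp add: dsum_inj_def)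
    finally show ?thesis .
  qed
qed

lemma hom_space_simps:
  "carrier (hom_space R A B) = module_hom R A B \<inter> extensional (carrier A)"
  "zero (hom_space R A B) = (\<lambda>x\<in>carrier A. \<zero>\<^bsub>B\<^esub>)"
  "add (hom_space R A B) f g = (\<lambda>x\<in>carrier A. f x \<oplus>\<^bsub>B\<^esub> g x)"
  "smult (hom_space R A B) a f = (\<lambda>x\<in>carrier A. a \<odot>\<^bsub>B\<^esub> f x)"
  by (simp_all add: hom_space_def)

lemma hom_space_module:
  assumes A: "module R A" and B: "module R B"
  shows "module R (hom_space R A B)"
proof -
  interpret A: module R A by fact
  interpret B: module R B by fact
  have h: "f \<in> module_hom R A B" and e: "f \<in> extensional (carrier A)"
    if "f \<in> carrier (hom_space R A B)" for f
    using that by (auto simp: hom_space_simps)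
  have m: "restrict f (carrier A) \<in> carrier (hom_space R A B)" if "f \<in> module_hom R A B" for f
    using hom_cong[OF that A] by (simp add: hom_space_simps)
  note c = hom_in[OF h] and ps = hom_space_simps(2-) and eq = extensionalityI[where A = "carrier A"]
  note F = module_facts[OF B]
  show ?thesis
  proof (rule moduleI)
    show "cring R" ..
    show "abelian_group (hom_space R A B)"
    proof (rule abelian_groupI)
      show "\<exists>g\<in>carrier (hom_space R A B). g \<oplus>\<^bsub>hom_space R A B\<^esub> f = \<zero>\<^bsub>hom_space R A B\<^esub>"
        if "f \<in> carrier (hom_space R A B)" for f
        by (rule bexI[of _ "\<lambda>x\<in>carrier A. (\<ominus> \<one>) \<odot>\<^bsub>B\<^esub> f x"])
          (simp add: ps B.smult_minus_1 B.l_neg c[OF that] cong: restrict_cong,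
           rule m, rule hom_smult[OF A B], simp_all add: h[OF that])
    qed ((unfold ps; rule m; intro hom_add hom_smult hom_const_zero A B h; assumption)
      | (unfold ps; rule restrict_ext; rule F(10); simp add: c)
      | (rule eq; simp add: e ps F(1-9,11-) c))+
  qed ((unfold ps; rule m; intro hom_add hom_smult hom_const_zero A B h; assumption)
      | (rule eq; simp add: e ps F(1-9,11-) c))+
qed

lemma self_space_module: "module R (self_space R)"
proof (rule moduleI)
  show "abelian_group (self_space R)"
    by (rule abelian_groupI) (auto simp: self_space_def a_ac intro: bexI[of _ "\<ominus> x" for x] l_neg)
qed (auto simp: self_space_def l_distr r_distr m_assoc intro: is_cring)

lemma free_space_module: "module R (free_space R S)"
  unfolding free_space_def by (rule dsum_space_module[OF self_space_module])

lemma free_gen_closed: "b \<in> S \<Longrightarrow> free_gen R S b \<in> carrier (free_space R S)"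
  unfolding free_gen_def free_space_def
  by (rule hom_in[OF dsum_inj_hom[OF self_space_module]]) (auto simp: self_space_def)

lemma scale_hom:
  assumes "module R V" "v \<in> carrier V"
  shows "(\<lambda>a. a \<odot>\<^bsub>V\<^esub> v) \<in> module_hom R (self_space R) V"
proof -
  interpret V: module R V by fact
  show ?thesis using assms(2)
    by (auto intro!: module_homI simp: self_space_def V.smult_l_distr V.smult_assoc1)
qed

lemma free_lift:
  assumes V: "module R V" and \<phi>: "\<And>b. b \<in> S \<Longrightarrow> \<phi> b \<in> carrier V"
  shows free_lift_hom: "free_lift R S V \<phi> \<in> module_hom R (free_space R S) V"
    and free_lift_gen: "b \<in> S \<Longrightarrow> free_lift R S V \<phi> (free_gen R S b) = \<phi> b"
proof -
  interpret V: module R V by fact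
  note l = dsum_lift[OF self_space_module V scale_hom[OF V \<phi>], of S "\<lambda>b. b"]
  show "free_lift R S V \<phi> \<in> module_hom R (free_space R S) V"
    using l(1) unfolding free_lift_def[abs_def] free_space_def by simp
  show "free_lift R S V \<phi> (free_gen R S b) = \<phi> b" if "b \<in> S"
    using l(2)[of b \<one>] \<phi>[OF that] that
    unfolding free_lift_def free_gen_def by (simp add: self_space_def)
qed

lemma free_ext:
  assumes V: "module R V" and f: "f \<in> module_hom R (free_space R S) V"
    and g: "g \<in> module_hom R (free_space R S) V"
    and eq: "\<And>b. b \<in> S \<Longrightarrow> f (free_gen R S b) = g (free_gen R S b)"
    and x: "x \<in> carrier (free_space R S)"
  shows "f x = g x"
proof (rule dsum_ext[OF self_space_module V f[unfolded free_space_def] g[unfolded free_space_def] _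
      x[unfolded free_space_def]])
  fix b a assume b: "b \<in> S" and a: "a \<in> carrier (self_space R)"
  then have "dsum_inj S (\<lambda>_. self_space R) b a = a \<odot>\<^bsub>free_space R S\<^esub> free_gen R S b"
    using module_hom_smult[OF dsum_inj_hom[OF self_space_module b], of a \<one>]
    by (simp add: free_space_def free_gen_def self_space_def)
  then show "f (dsum_inj S (\<lambda>_. self_space R) b a) = g (dsum_inj S (\<lambda>_. self_space R) b a)"
    using a free_gen_closed[OF b] eq[OF b]
    by (simp add: module_hom_smult[OF f] module_hom_smult[OF g] self_space_def)
qed

lemma lin_rels_closed:
  assumes A: "module R A" and h: "\<And>x. x \<in> carrier A \<Longrightarrow> h x \<in> S"
  shows "lin_rels R S A h \<subseteq> carrier (free_space R S)"
proof -
  interpret F: module R "free_space R S" by (rule free_space_module)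
  interpret A: module R A by fact
  show ?thesis using h by (auto simp: lin_rels_def Let_def free_gen_closed)
qed

text \<open>This lemma and the next one say that the relations for \<open>h\<close> are exactly what it takes to make \<open>h\<close> linear: a linear
  map that is linear along \<open>h\<close> kills them, and modulo them \<open>h\<close> is linear.\<close>

lemma lin_rels_killed:
  assumes A: "module R A" and V: "module R V" and h: "\<And>x. x \<in> carrier A \<Longrightarrow> h x \<in> S"
    and f: "f \<in> module_hom R (free_space R S) V"
    and l: "(\<lambda>x. f (free_gen R S (h x))) \<in> module_hom R A V" and r: "r \<in> lin_rels R S A h"
  shows "f r = \<zero>\<^bsub>V\<^esub>"
proof -
  interpret F: module R "free_space R S" by (rule free_space_module)
  interpret A: module R A by fact
  interpret V: module R V by fact
  have gen: "free_gen R S (h x) \<in> carrier (free_space R S)" if "x \<in> carrier A" for x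
    by (rule free_gen_closed[OF h[OF that]])
  have z: "v \<ominus>\<^bsub>V\<^esub> v = \<zero>\<^bsub>V\<^esub>" if "v \<in> carrier V" for v
    using that by (simp add: V.minus_eq V.r_neg)
  from r consider
    (add) x y where "x \<in> carrier A" "y \<in> carrier A"
      "r = free_gen R S (h (x \<oplus>\<^bsub>A\<^esub> y)) \<ominus>\<^bsub>free_space R S\<^esub>
        (free_gen R S (h x) \<oplus>\<^bsub>free_space R S\<^esub> free_gen R S (h y))"
    | (smult) a x where "a \<in> carrier R" "x \<in> carrier A"
      "r = free_gen R S (h (a \<odot>\<^bsub>A\<^esub> x)) \<ominus>\<^bsub>free_space R S\<^esub>
        (a \<odot>\<^bsub>free_space R S\<^esub> free_gen R S (h x))"
    unfolding lin_rels_def Let_def by blast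
  then show ?thesis
  proof cases
    case add
    then show ?thesis
      using hom_in[OF l] module_hom_add[OF l add(1,2)]
      by (simp add: z hom_minus[OF f F.module_axioms V] module_hom_add[OF f] gen)
  next
    case smult
    then show ?thesis
      using hom_in[OF l] module_hom_smult[OF l smult(1,2)]
      by (simp add: z hom_minus[OF f F.module_axioms V] module_hom_smult[OF f] gen)
  qed
qed

lemma lin_rels_linear:
  assumes A: "module R A" and h: "\<And>x. x \<in> carrier A \<Longrightarrow> h x \<in> S"
    and W: "LinearCombinations.submodule R W (free_space R S)" and r: "lin_rels R S A h \<subseteq> W"
  shows "(\<lambda>x. W +>\<^bsub>free_space R S\<^esub> free_gen R S (h x)) \<in> module_hom R A (quot_space (free_space R S) W)"
proof -
  interpret F: module R "free_space R S" by (rule free_space_module)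
  interpret A: module R A by fact
  note ops = quot_space_ops[OF W, where Z = "carrier (free_space R S)", simplified]
  have gen: "free_gen R S (h x) \<in> carrier (free_space R S)" if "x \<in> carrier A" for x
    by (rule free_gen_closed[OF h[OF that]])
  show ?thesis
  proof (rule module_homI)
    show "W +>\<^bsub>free_space R S\<^esub> free_gen R S (h x) \<in> carrier (quot_space (free_space R S) W)"
      if "x \<in> carrier A" for x using gen[OF that] by (auto simp: quot_space_carrier)
    show "W +>\<^bsub>free_space R S\<^esub> free_gen R S (h (x \<oplus>\<^bsub>A\<^esub> y)) =
        (W +>\<^bsub>free_space R S\<^esub> free_gen R S (h x)) \<oplus>\<^bsub>quot_space (free_space R S) W\<^esub>
        (W +>\<^bsub>free_space R S\<^esub> free_gen R S (h y))" if "x \<in> carrier A" "y \<in> carrier A" for x y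
    proof -
      have "free_gen R S (h (x \<oplus>\<^bsub>A\<^esub> y)) \<ominus>\<^bsub>free_space R S\<^esub>
          (free_gen R S (h x) \<oplus>\<^bsub>free_space R S\<^esub> free_gen R S (h y)) \<in> W"
        using that by (intro subsetD[OF r]) (simp add: lin_rels_def Let_def, blast)
      then show ?thesis using that gen by (simp add: ops coset_eq_iff[OF W])
    qed
    show "W +>\<^bsub>free_space R S\<^esub> free_gen R S (h (a \<odot>\<^bsub>A\<^esub> x)) =
        a \<odot>\<^bsub>quot_space (free_space R S) W\<^esub> (W +>\<^bsub>free_space R S\<^esub> free_gen R S (h x))"
      if "a \<in> carrier R" "x \<in> carrier A" for a x
    proof -
      have "free_gen R S (h (a \<odot>\<^bsub>A\<^esub> x)) \<ominus>\<^bsub>free_space R S\<^esub>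
          (a \<odot>\<^bsub>free_space R S\<^esub> free_gen R S (h x)) \<in> W"
        using that by (intro subsetD[OF r]) (simp add: lin_rels_def Let_def, blast)
      then show ?thesis using that gen by (simp add: ops coset_eq_iff[OF W])
    qed
  qed
qed

text \<open>The universal property of a space with generators \<open>S\<close> and relations \<open>Q\<close>.\<close>

lemma presented_lift:
  assumes V: "module R V" and \<phi>: "\<And>b. b \<in> S \<Longrightarrow> \<phi> b \<in> carrier V"
    and Q: "Q \<subseteq> carrier (free_space R S)"
    and k: "\<And>q. q \<in> Q \<Longrightarrow> free_lift R S V \<phi> q = \<zero>\<^bsub>V\<^esub>"
  defines "W \<equiv> module.span R (free_space R S) Q"
  shows presented_lift_hom:
      "tensor_lift R S V \<phi> \<in> module_hom R (quot_space (free_space R S) W) V"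
    and presented_lift_gen:
      "b \<in> S \<Longrightarrow> tensor_lift R S V \<phi> (W +>\<^bsub>free_space R S\<^esub> free_gen R S b) = \<phi> b"
proof -
  note F = free_space_module[of S] and l = free_lift_hom[OF V \<phi>]
  note W = span_submodule[OF F Q, folded W_def]
  have k': "free_lift R S V \<phi> w = \<zero>\<^bsub>V\<^esub>" if "w \<in> W" for w
    using hom_kills_span[OF l F V Q k] that by (simp add: W_def)
  show "tensor_lift R S V \<phi> \<in> module_hom R (quot_space (free_space R S) W) V"
    unfolding tensor_lift_def[abs_def] by (rule quot_lift_hom[OF W V l k'])
  show "tensor_lift R S V \<phi> (W +>\<^bsub>free_space R S\<^esub> free_gen R S b) = \<phi> b" if "b \<in> S"
    using coset_image[OF W V l k' free_gen_closed[OF that]] free_lift_gen[OF V \<phi> that]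
    by (simp add: tensor_lift_def)
qed

lemma presented_ext:
  assumes V: "module R V" and W: "LinearCombinations.submodule R W (free_space R S)"
    and f: "f \<in> module_hom R (quot_space (free_space R S) W) V"
    and g: "g \<in> module_hom R (quot_space (free_space R S) W) V"
    and eq: "\<And>b. b \<in> S \<Longrightarrow> f (W +>\<^bsub>free_space R S\<^esub> free_gen R S b) = g (W +>\<^bsub>free_space R S\<^esub> free_gen R S b)"
    and T: "T \<in> carrier (quot_space (free_space R S) W)"
  shows "f T = g T"
proof -
  obtain x where x: "x \<in> carrier (free_space R S)" "T = W +>\<^bsub>free_space R S\<^esub> x"
    using T by (auto simp: quot_space_carrier)
  show ?thesis unfolding x(2)
    by (rule free_ext[OF V hom_comp[OF quot_class_hom[OF W] f] hom_comp[OF quot_class_hom[OF W] g] eq x(1)])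
qed

end

section \<open>Multilinear maps and tensor products\<close>

definition mlin :: "('k, 'r) ring_scheme \<Rightarrow> ('k, 'c) module list \<Rightarrow> ('k, 'a) module \<Rightarrow> ('c list \<Rightarrow> 'a) \<Rightarrow> bool" where
  "mlin K Ns V f \<longleftrightarrow> (\<forall>cs\<in>tuples Ns. f cs \<in> carrier V \<and>
    (\<forall>i<length Ns. (\<lambda>x. f (cs[i := x])) \<in> module_hom K (Ns ! i) V))"

definition mlin1 :: "('k, 'r) ring_scheme \<Rightarrow> ('k, 'm) module \<Rightarrow> ('k, 'c) module list
    \<Rightarrow> ('k, 'a) module \<Rightarrow> ('m \<times> 'c list \<Rightarrow> 'a) \<Rightarrow> bool" where
  "mlin1 K A Ns V f \<longleftrightarrow> (\<forall>cs\<in>tuples Ns. (\<lambda>m. f (m, cs)) \<in> module_hom K A V) \<and>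
    (\<forall>m\<in>carrier A. mlin K Ns V (\<lambda>cs. f (m, cs)))"

text \<open>Such a map of tuples sends the line through a tuple in one coordinate direction to a line in one coordinate
  direction, linearly. This is what is needed for the composite with a multilinear map to be
  multilinear, and it holds for functors applied to tuples and for the merging of two adjacent morphisms.\<close>

definition slotwise :: "('k, 'r) ring_scheme \<Rightarrow> ('k, 'c) module list \<Rightarrow> ('k, 'd) module list
    \<Rightarrow> ('c list \<Rightarrow> 'd list) \<Rightarrow> bool" where
  "slotwise K Ns Ns' F \<longleftrightarrow> (\<forall>cs\<in>tuples Ns. F cs \<in> tuples Ns' \<and>
    (\<forall>i<length Ns. \<exists>j<length Ns'. \<exists>l\<in>module_hom K (Ns ! i) (Ns' ! j).
      \<forall>x\<in>carrier (Ns ! i). F (cs[i := x]) = (F cs)[j := l x]))"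

lemma tuples_iff:
  "cs \<in> tuples Ns \<longleftrightarrow> length cs = length Ns \<and> (\<forall>i<length Ns. cs ! i \<in> carrier (Ns ! i))"
  by (auto simp: tuples_def list_all2_conv_all_nth)

lemma tuples_update:
  "cs \<in> tuples Ns \<Longrightarrow> i < length Ns \<Longrightarrow> x \<in> carrier (Ns ! i) \<Longrightarrow> cs[i := x] \<in> tuples Ns"
  by (auto simp: tuples_iff nth_list_update)

lemma mlinD:
  assumes "mlin K Ns V f" "cs \<in> tuples Ns"
  shows "f cs \<in> carrier V"
    and "i < length Ns \<Longrightarrow> (\<lambda>x. f (cs[i := x])) \<in> module_hom K (Ns ! i) V"
  using assms by (auto simp: mlin_def)

lemma mlin1D:
  assumes "mlin1 K A Ns V f"
  shows "cs \<in> tuples Ns \<Longrightarrow> (\<lambda>m. f (m, cs)) \<in> module_hom K A V"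
    and "m \<in> carrier A \<Longrightarrow> mlin K Ns V (\<lambda>cs. f (m, cs))"
    and "m \<in> carrier A \<Longrightarrow> cs \<in> tuples Ns \<Longrightarrow> f (m, cs) \<in> carrier V"
proof -
  show l: "cs \<in> tuples Ns \<Longrightarrow> (\<lambda>m. f (m, cs)) \<in> module_hom K A V"
    using assms by (simp add: mlin1_def)
  show "m \<in> carrier A \<Longrightarrow> mlin K Ns V (\<lambda>cs. f (m, cs))"
    using assms by (simp add: mlin1_def)
  show "m \<in> carrier A \<Longrightarrow> cs \<in> tuples Ns \<Longrightarrow> f (m, cs) \<in> carrier V"
    using hom_in[OF l] by blast
qed

lemma mlin_slotwise:
  assumes "mlin K Ns' V f" "slotwise K Ns Ns' F" "\<And>N. N \<in> set Ns \<Longrightarrow> module K N"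
  shows "mlin K Ns V (\<lambda>cs. f (F cs))"
  unfolding mlin_def
proof (intro ballI conjI allI impI)
  fix cs assume cs: "cs \<in> tuples Ns"
  then have F: "F cs \<in> tuples Ns'" using assms(2) by (simp add: slotwise_def)
  show "f (F cs) \<in> carrier V" by (rule mlinD(1)[OF assms(1) F])
  fix i assume i: "i < length Ns"
  then obtain j l where j: "j < length Ns'" "l \<in> module_hom K (Ns ! i) (Ns' ! j)"
      "\<forall>x\<in>carrier (Ns ! i). F (cs[i := x]) = (F cs)[j := l x]"
    using assms(2) cs unfolding slotwise_def by blast
  show "(\<lambda>x. f (F (cs[i := x]))) \<in> module_hom K (Ns ! i) V"
    by (rule hom_cong[OF hom_comp[OF j(2) mlinD(2)[OF assms(1) F j(1)]]])
      (use assms(3) i j(3) in simp_all)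
qed

text \<open>The function \<^const>\<open>act_tuple\<close> without the group, so that it covers the covering functor and the
  components of a morphism of the quotient as well.\<close>

definition map_tuple :: "('o \<Rightarrow> 'o \<Rightarrow> 'c \<Rightarrow> 'd) \<Rightarrow> 'o list \<Rightarrow> 'c list \<Rightarrow> 'd list" where
  "map_tuple f xs cs = map (\<lambda>i. f (xs ! i) (xs ! Suc i) (cs ! i)) [0..<length cs]"

lemma act_tuple_eq: "act_tuple \<psi> s = map_tuple (\<psi> s)"
  by (intro ext) (simp add: act_tuple_def map_tuple_def)

lemma map_tuple_simps [simp]:
  "length (map_tuple f xs cs) = length cs"
  "i < length cs \<Longrightarrow> map_tuple f xs cs ! i = f (xs ! i) (xs ! Suc i) (cs ! i)"
  by (simp_all add: map_tuple_def)

lemma slotwise_map_tuple: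
  assumes "length Ns' = length Ns"
    and "\<And>i. i < length Ns \<Longrightarrow> f (xs ! i) (xs ! Suc i) \<in> module_hom K (Ns ! i) (Ns' ! i)"
  shows "slotwise K Ns Ns' (map_tuple f xs)"
  unfolding slotwise_def
proof (intro ballI conjI allI impI)
  fix cs assume cs: "cs \<in> tuples Ns"
  then show "map_tuple f xs cs \<in> tuples Ns'"
    using hom_in[OF assms(2)] assms(1) by (simp add: tuples_iff)
  fix i assume i: "i < length Ns"
  have "map_tuple f xs (cs[i := x]) = (map_tuple f xs cs)[i := f (xs ! i) (xs ! Suc i) x]" for x
    using cs i by (intro nth_equalityI) (auto simp: nth_list_update tuples_iff)
  then show "\<exists>j<length Ns'. \<exists>l\<in>module_hom K (Ns ! i) (Ns' ! j).
      \<forall>x\<in>carrier (Ns ! i). map_tuple f xs (cs[i := x]) = (map_tuple f xs cs)[j := l x]"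
    using i assms by (intro exI[of _ i] conjI bexI[of _ "f (xs ! i) (xs ! Suc i)"]) auto
qed

text \<open>The analogue of \<open>slotwise\<close> for tuples with a coefficient: a morphism may also be absorbed by
  the coefficient.\<close>

definition slotwise1 :: "('k, 'r) ring_scheme \<Rightarrow> ('k, 'm) module \<Rightarrow> ('k, 'c) module list
    \<Rightarrow> ('k, 'n) module \<Rightarrow> ('k, 'd) module list \<Rightarrow> ('m \<times> 'c list \<Rightarrow> 'n \<times> 'd list) \<Rightarrow> bool" where
  "slotwise1 K A Ns A' Ns' F \<longleftrightarrow>
    (\<forall>m\<in>carrier A. \<forall>cs\<in>tuples Ns. F (m, cs) \<in> tuples1 A' Ns') \<and>
    (\<forall>cs\<in>tuples Ns. \<exists>l\<in>module_hom K A A'. \<exists>ds\<in>tuples Ns'. \<forall>m\<in>carrier A. F (m, cs) = (l m, ds)) \<and>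
    (\<forall>m\<in>carrier A. \<forall>cs\<in>tuples Ns. \<forall>i<length Ns.
      (\<exists>l\<in>module_hom K (Ns ! i) A'. \<exists>ds\<in>tuples Ns'. \<forall>x\<in>carrier (Ns ! i). F (m, cs[i := x]) = (l x, ds)) \<or>
      (\<exists>j<length Ns'. \<exists>l\<in>module_hom K (Ns ! i) (Ns' ! j). \<exists>m'\<in>carrier A'. \<exists>ds\<in>tuples Ns'.
        \<forall>x\<in>carrier (Ns ! i). F (m, cs[i := x]) = (m', ds[j := l x])))"

lemma mlin1_slotwise1:
  assumes f: "mlin1 K A' Ns' V f" and F: "slotwise1 K A Ns A' Ns' F"
    and A: "module K A" and Ns: "\<And>N. N \<in> set Ns \<Longrightarrow> module K N"
  shows "mlin1 K A Ns V (\<lambda>t. f (F t))"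
  unfolding mlin1_def mlin_def
proof (intro ballI conjI allI impI)
  fix cs assume cs: "cs \<in> tuples Ns"
  then obtain l ds where l: "l \<in> module_hom K A A'" "ds \<in> tuples Ns'" "\<forall>m\<in>carrier A. F (m, cs) = (l m, ds)"
    using F unfolding slotwise1_def by blast
  show "(\<lambda>m. f (F (m, cs))) \<in> module_hom K A V"
    by (rule hom_cong[OF hom_comp[OF l(1) mlin1D(1)[OF f l(2)]] A]) (use l(3) in simp)
next
  fix m cs assume m: "m \<in> carrier A" and cs: "cs \<in> tuples Ns"
  have "F (m, cs) \<in> tuples1 A' Ns'" using F m cs unfolding slotwise1_def by blast
  then show "f (F (m, cs)) \<in> carrier V" using mlin1D(3)[OF f] by (auto simp: tuples1_def)
  fix i assume i: "i < length Ns"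
  have N: "module K (Ns ! i)" using Ns i by simp
  from F m cs i consider
    (coeff) l ds where "l \<in> module_hom K (Ns ! i) A'" "ds \<in> tuples Ns'"
      "\<forall>x\<in>carrier (Ns ! i). F (m, cs[i := x]) = (l x, ds)"
  | (slot) j l m' ds where "j < length Ns'" "l \<in> module_hom K (Ns ! i) (Ns' ! j)" "m' \<in> carrier A'"
      "ds \<in> tuples Ns'" "\<forall>x\<in>carrier (Ns ! i). F (m, cs[i := x]) = (m', ds[j := l x])"
    unfolding slotwise1_def by blast
  then show "(\<lambda>x. f (F (m, cs[i := x]))) \<in> module_hom K (Ns ! i) V"
  proof cases
    case coeff
    show ?thesis
      by (rule hom_cong[OF hom_comp[OF coeff(1) mlin1D(1)[OF f coeff(2)]] N]) (use coeff(3) in simp)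
  next
    case slot
    show ?thesis
      by (rule hom_cong[OF hom_comp[OF slot(2) mlinD(2)[OF mlin1D(2)[OF f slot(3)] slot(4,1)]] N])
        (use slot(5) in simp)
  qed
qed

lemma slotwise1_right:
  assumes "slotwise K Ns Ns' F"
  shows "slotwise1 K A Ns A Ns' (\<lambda>(m, cs). (m, F cs))"
  unfolding slotwise1_def
proof (intro conjI ballI allI impI)
  show "(case (m, cs) of (m, cs) \<Rightarrow> (m, F cs)) \<in> tuples1 A Ns'" if "m \<in> carrier A" "cs \<in> tuples Ns" for m cs
    using that assms by (simp add: slotwise_def tuples1_def)
  show "\<exists>l\<in>module_hom K A A. \<exists>ds\<in>tuples Ns'. \<forall>m\<in>carrier A. (case (m, cs) of (m, cs) \<Rightarrow> (m, F cs)) = (l m, ds)"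
    if "cs \<in> tuples Ns" for cs
    using that assms by (intro bexI[of _ "\<lambda>x. x"] bexI[of _ "F cs"]) (auto simp: slotwise_def module_hom_def)
  fix m cs i assume "m \<in> carrier A" "cs \<in> tuples Ns" "i < length Ns"
  then have "\<exists>j<length Ns'. \<exists>l\<in>module_hom K (Ns ! i) (Ns' ! j). \<exists>m'\<in>carrier A. \<exists>ds\<in>tuples Ns'.
        \<forall>x\<in>carrier (Ns ! i). (m, F (cs[i := x])) = (m', ds[j := l x])"
    using assms unfolding slotwise_def by fast
  then show "(\<exists>l\<in>module_hom K (Ns ! i) A. \<exists>ds\<in>tuples Ns'.
      \<forall>x\<in>carrier (Ns ! i). (case (m, cs[i := x]) of (m, cs) \<Rightarrow> (m, F cs)) = (l x, ds)) \<or>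
    (\<exists>j<length Ns'. \<exists>l\<in>module_hom K (Ns ! i) (Ns' ! j). \<exists>m'\<in>carrier A. \<exists>ds\<in>tuples Ns'.
      \<forall>x\<in>carrier (Ns ! i). (case (m, cs[i := x]) of (m, cs) \<Rightarrow> (m, F cs)) = (m', ds[j := l x]))"
    by simp
qed

context cring
begin

lemma mlin_hom:
  assumes f: "mlin R Ns V f" and g: "g \<in> module_hom R V U"
  shows "mlin R Ns U (\<lambda>cs. g (f cs))"
  using mlinD[OF f] unfolding mlin_def
  by (intro ballI conjI allI impI hom_comp[OF _ g] hom_in[OF g]) simp_all

lemma mlin_add:
  assumes f: "mlin R Ns V f" and g: "mlin R Ns V g" and V: "module R V"
    and N: "\<And>N. N \<in> set Ns \<Longrightarrow> module R N"
  shows "mlin R Ns V (\<lambda>cs. f cs \<oplus>\<^bsub>V\<^esub> g cs)"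
  using mlinD[OF f] mlinD[OF g] unfolding mlin_def
  by (intro ballI conjI allI impI hom_add[OF N V] module_facts(2)[OF V]) simp_all

lemma mlin_smult:
  assumes f: "mlin R Ns V f" and a: "a \<in> carrier R" and V: "module R V"
    and N: "\<And>N. N \<in> set Ns \<Longrightarrow> module R N"
  shows "mlin R Ns V (\<lambda>cs. a \<odot>\<^bsub>V\<^esub> f cs)"
  using mlinD[OF f] a unfolding mlin_def
  by (intro ballI conjI allI impI hom_smult[OF N V] module_facts(3)[OF V]) simp_all

lemma mlin_sum:
  assumes "\<And>i. i \<in> I \<Longrightarrow> mlin R Ns V (f i)" "module R V" "\<And>N. N \<in> set Ns \<Longrightarrow> module R N"
  shows "mlin R Ns V (\<lambda>cs. \<Oplus>\<^bsub>V\<^esub>i\<in>I. f i cs)"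
proof -
  interpret V: module R V by fact
  show ?thesis unfolding mlin_def
  proof (intro ballI conjI allI impI)
    fix cs assume cs: "cs \<in> tuples Ns"
    show "(\<Oplus>\<^bsub>V\<^esub>i\<in>I. f i cs) \<in> carrier V"
      using mlinD(1)[OF assms(1) cs] by (intro V.finsum_closed) auto
    fix k assume k: "k < length Ns"
    show "(\<lambda>x. \<Oplus>\<^bsub>V\<^esub>i\<in>I. f i (cs[k := x])) \<in> module_hom R (Ns ! k) V"
      using assms k by (intro hom_sum mlinD(2)[OF assms(1) cs]) auto
  qed
qed

lemma mlin1_add:
  assumes f: "mlin1 R A Ns V f" and g: "mlin1 R A Ns V g" and V: "module R V" and A: "module R A"
    and N: "\<And>N. N \<in> set Ns \<Longrightarrow> module R N"
  shows "mlin1 R A Ns V (\<lambda>t. f t \<oplus>\<^bsub>V\<^esub> g t)"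
  using mlin1D(1,2)[OF f] mlin1D(1,2)[OF g] unfolding mlin1_def
  by (intro ballI conjI hom_add[OF A V] mlin_add[OF _ _ V N]) simp_all

lemma mlin1_smult:
  assumes f: "mlin1 R A Ns V f" and a: "a \<in> carrier R" and V: "module R V" and A: "module R A"
    and N: "\<And>N. N \<in> set Ns \<Longrightarrow> module R N"
  shows "mlin1 R A Ns V (\<lambda>t. a \<odot>\<^bsub>V\<^esub> f t)"
  using mlin1D(1,2)[OF f] a unfolding mlin1_def
  by (intro ballI conjI hom_smult[OF A V] mlin_smult[OF _ _ V N]) simp_all

lemma mlin1_sum:
  assumes f: "\<And>i. i \<in> I \<Longrightarrow> mlin1 R A Ns V (f i)" and V: "module R V" and A: "module R A"
    and N: "\<And>N. N \<in> set Ns \<Longrightarrow> module R N"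
  shows "mlin1 R A Ns V (\<lambda>t. \<Oplus>\<^bsub>V\<^esub>i\<in>I. f i t)"
  using mlin1D(1,2)[OF f] unfolding mlin1_def
  by (intro ballI conjI hom_sum[OF A V] mlin_sum[OF _ V N]) simp_all

lemma mlin_zero:
  assumes f: "mlin R Ns V f" and V: "module R V" and N: "module R (Ns ! i)" and cs: "cs \<in> tuples Ns"
    and i: "i < length Ns" "cs ! i = \<zero>\<^bsub>Ns ! i\<^esub>"
  shows "f cs = \<zero>\<^bsub>V\<^esub>"
  using hom_zero[OF mlinD(2)[OF f cs i(1)] N V] i by (metis list_update_id)

lemma tensor_rels:
  assumes "\<And>N. N \<in> set Ns \<Longrightarrow> module R N" "cs \<in> tuples Ns" "i < length Ns"
  shows "lin_rels R (tuples Ns) (Ns ! i) (\<lambda>x. cs[i := x]) \<subseteq> carrier (free_space R (tuples Ns))"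
  using assms by (intro lin_rels_closed tuples_update) auto

lemma tensor_null_submodule:
  assumes "\<And>N. N \<in> set Ns \<Longrightarrow> module R N"
  shows "LinearCombinations.submodule R (tensor_null R Ns) (free_space R (tuples Ns))"
  unfolding tensor_null_def using tensor_rels[OF assms]
  by (intro span_submodule free_space_module UN_least) auto

lemma tensor_module:
  assumes "\<And>N. N \<in> set Ns \<Longrightarrow> module R N"
  shows "module R (tensor R Ns)"
  unfolding tensor_def by (intro quot_space_module tensor_null_submodule assms)

lemma mlin_pure_tensor:
  assumes "\<And>N. N \<in> set Ns \<Longrightarrow> module R N"
  shows "mlin R Ns (tensor R Ns) (pure_tensor R Ns)"
  unfolding mlin_def
proof (intro ballI conjI allI impI)
  note W = tensor_null_submodule[OF assms]
  fix cs assume cs: "cs \<in> tuples Ns"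
  show "pure_tensor R Ns cs \<in> carrier (tensor R Ns)"
    unfolding pure_tensor_def tensor_def using free_gen_closed[OF cs] by (auto simp: quot_space_carrier)
  fix i assume i: "i < length Ns"
  show "(\<lambda>x. pure_tensor R Ns (cs[i := x])) \<in> module_hom R (Ns ! i) (tensor R Ns)"
    unfolding pure_tensor_def tensor_def
  proof (rule lin_rels_linear[OF _ tuples_update[OF cs i] W])
    show "module R (Ns ! i)" using assms i by simp
    show "lin_rels R (tuples Ns) (Ns ! i) (\<lambda>x. cs[i := x]) \<subseteq> tensor_null R Ns"
    proof
      fix r assume "r \<in> lin_rels R (tuples Ns) (Ns ! i) (\<lambda>x. cs[i := x])"
      with cs i show "r \<in> tensor_null R Ns"
        unfolding tensor_null_def using tensor_rels[OF assms]
        by (intro span_incl free_space_module UN_least UN_I) auto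
    qed
  qed
qed

lemma tensor_lift:
  assumes N: "\<And>N. N \<in> set Ns \<Longrightarrow> module R N" and V: "module R V" and f: "mlin R Ns V f"
  shows tensor_lift_hom: "tensor_lift R (tuples Ns) V f \<in> module_hom R (tensor R Ns) V"
    and tensor_lift_pure: "cs \<in> tuples Ns \<Longrightarrow> tensor_lift R (tuples Ns) V f (pure_tensor R Ns cs) = f cs"
proof -
  let ?Q = "\<Union>cs\<in>tuples Ns. \<Union>i\<in>{..<length Ns}. lin_rels R (tuples Ns) (Ns ! i) (\<lambda>x. cs[i := x])"
  have fV: "f b \<in> carrier V" if "b \<in> tuples Ns" for b by (rule mlinD(1)[OF f that])
  have l: "free_lift R (tuples Ns) V f \<in> module_hom R (free_space R (tuples Ns)) V"
    by (rule free_lift_hom[OF V fV])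
  have lg: "free_lift R (tuples Ns) V f (free_gen R (tuples Ns) b) = f b" if "b \<in> tuples Ns" for b
    by (rule free_lift_gen[OF V fV that])
  have Q: "?Q \<subseteq> carrier (free_space R (tuples Ns))" using tensor_rels[OF N] by (intro UN_least) auto
  have k: "free_lift R (tuples Ns) V f q = \<zero>\<^bsub>V\<^esub>" if q: "q \<in> ?Q" for q
  proof -
    obtain cs i where *: "cs \<in> tuples Ns" "i < length Ns"
      "q \<in> lin_rels R (tuples Ns) (Ns ! i) (\<lambda>x. cs[i := x])" using q by blast
    show ?thesis
    proof (rule lin_rels_killed[OF _ V tuples_update[OF *(1,2)] l _ *(3)])
      show M: "module R (Ns ! i)" using N *(2) by simp
      show "(\<lambda>x. free_lift R (tuples Ns) V f (free_gen R (tuples Ns) (cs[i := x]))) \<in> module_hom R (Ns ! i) V"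
        by (rule hom_cong[OF mlinD(2)[OF f *(1,2)] M]) (rule lg[OF tuples_update[OF *(1,2)]])
    qed
  qed
  show "tensor_lift R (tuples Ns) V f \<in> module_hom R (tensor R Ns) V"
    unfolding tensor_def tensor_null_def by (rule presented_lift_hom[OF V fV Q k])
  show "cs \<in> tuples Ns \<Longrightarrow> tensor_lift R (tuples Ns) V f (pure_tensor R Ns cs) = f cs"
    unfolding pure_tensor_def tensor_null_def by (rule presented_lift_gen[OF V fV Q k])
qed

lemma tensor_ext:
  assumes "\<And>N. N \<in> set Ns \<Longrightarrow> module R N" "module R V"
    "f \<in> module_hom R (tensor R Ns) V" "g \<in> module_hom R (tensor R Ns) V"
    "\<And>cs. cs \<in> tuples Ns \<Longrightarrow> f (pure_tensor R Ns cs) = g (pure_tensor R Ns cs)"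
    "T \<in> carrier (tensor R Ns)"
  shows "f T = g T"
  using presented_ext[OF assms(2) tensor_null_submodule[OF assms(1)], where f = f and g = g and T = T] assms(3-)
  by (simp add: tensor_def pure_tensor_def)

lemma tensor1_rels:
  assumes "module R A" "\<And>N. N \<in> set Ns \<Longrightarrow> module R N" "cs \<in> tuples Ns"
  shows "lin_rels R (tuples1 A Ns) A (\<lambda>m. (m, cs)) \<subseteq> carrier (free_space R (tuples1 A Ns))"
    and "m \<in> carrier A \<Longrightarrow> i < length Ns \<Longrightarrow>
      lin_rels R (tuples1 A Ns) (Ns ! i) (\<lambda>x. (m, cs[i := x])) \<subseteq> carrier (free_space R (tuples1 A Ns))"
  using assms by (rule_tac [!] lin_rels_closed) (auto simp: tuples1_def tuples_update)

lemma tensor1_null_submodule: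
  assumes "module R A" "\<And>N. N \<in> set Ns \<Longrightarrow> module R N"
  shows "LinearCombinations.submodule R (tensor1_null R A Ns) (free_space R (tuples1 A Ns))"
  unfolding tensor1_null_def using tensor1_rels[OF assms]
  by (intro span_submodule free_space_module Un_least UN_least) auto

lemma tensor1_module:
  assumes "module R A" "\<And>N. N \<in> set Ns \<Longrightarrow> module R N"
  shows "module R (tensor1 R A Ns)"
  unfolding tensor1_def by (intro quot_space_module tensor1_null_submodule assms)

lemma tensor1_null_incl:
  assumes A: "module R A" and N: "\<And>N. N \<in> set Ns \<Longrightarrow> module R N" and cs: "cs \<in> tuples Ns"
  shows "lin_rels R (tuples1 A Ns) A (\<lambda>m. (m, cs)) \<subseteq> tensor1_null R A Ns"
    and "m \<in> carrier A \<Longrightarrow> i < length Ns \<Longrightarrow>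
      lin_rels R (tuples1 A Ns) (Ns ! i) (\<lambda>x. (m, cs[i := x])) \<subseteq> tensor1_null R A Ns"
proof -
  let ?Q = "(\<Union>cs \<in> tuples Ns. lin_rels R (tuples1 A Ns) A (\<lambda>x. (x, cs))) \<union>
       (\<Union>m \<in> carrier A. \<Union>cs \<in> tuples Ns. \<Union>i \<in> {..<length Ns}.
          lin_rels R (tuples1 A Ns) (Ns ! i) (\<lambda>x. (m, cs[i := x])))"
  have c: "?Q \<subseteq> carrier (free_space R (tuples1 A Ns))"
    using tensor1_rels[OF A N] by (intro Un_least UN_least) auto
  have Q: "?Q \<subseteq> tensor1_null R A Ns"
    unfolding tensor1_null_def by (rule subsetI, rule span_incl[OF free_space_module c])
  show "lin_rels R (tuples1 A Ns) A (\<lambda>m. (m, cs)) \<subseteq> tensor1_null R A Ns"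
    by (rule subset_trans[OF _ Q]) (use cs in blast)
  show "lin_rels R (tuples1 A Ns) (Ns ! i) (\<lambda>x. (m, cs[i := x])) \<subseteq> tensor1_null R A Ns"
    if "m \<in> carrier A" "i < length Ns"
    by (rule subset_trans[OF _ Q]) (use cs that in blast)
qed

lemma mlin1_pure_tensor1:
  assumes A: "module R A" and N: "\<And>N. N \<in> set Ns \<Longrightarrow> module R N"
  shows "mlin1 R A Ns (tensor1 R A Ns) (pure_tensor1 R A Ns)"
  unfolding mlin1_def mlin_def
proof (intro ballI conjI allI impI)
  have W: "LinearCombinations.submodule R (tensor1_null R A Ns) (free_space R (tuples1 A Ns))"
    by (rule tensor1_null_submodule[OF A N])
  fix cs assume cs: "cs \<in> tuples Ns"
  show "(\<lambda>m. pure_tensor1 R A Ns (m, cs)) \<in> module_hom R A (tensor1 R A Ns)"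
    unfolding pure_tensor1_def tensor1_def
    by (rule lin_rels_linear[OF A _ W])
      (simp add: tuples1_def cs, rule tensor1_null_incl(1)[OF A N cs])
  fix m assume m: "m \<in> carrier A"
  show "pure_tensor1 R A Ns (m, cs) \<in> carrier (tensor1 R A Ns)"
    unfolding pure_tensor1_def tensor1_def using free_gen_closed[of "(m, cs)" "tuples1 A Ns"] m cs
    by (auto simp: quot_space_carrier tuples1_def)
  fix i assume i: "i < length Ns"
  show "(\<lambda>x. pure_tensor1 R A Ns (m, cs[i := x])) \<in> module_hom R (Ns ! i) (tensor1 R A Ns)"
    unfolding pure_tensor1_def tensor1_def
    by (rule lin_rels_linear[OF _ _ W])
      (simp add: N i, simp add: tuples1_def m tuples_update[OF cs i],
        rule tensor1_null_incl(2)[OF A N cs m i])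
qed

lemma tensor1_lift:
  assumes A: "module R A" and N: "\<And>N. N \<in> set Ns \<Longrightarrow> module R N" and V: "module R V"
    and f: "mlin1 R A Ns V f"
  shows tensor1_lift_hom: "tensor_lift R (tuples1 A Ns) V f \<in> module_hom R (tensor1 R A Ns) V"
    and tensor1_lift_pure: "t \<in> tuples1 A Ns \<Longrightarrow>
      tensor_lift R (tuples1 A Ns) V f (pure_tensor1 R A Ns t) = f t"
proof -
  let ?S = "tuples1 A Ns"
  let ?Q = "(\<Union>cs \<in> tuples Ns. lin_rels R ?S A (\<lambda>x. (x, cs))) \<union>
       (\<Union>m \<in> carrier A. \<Union>cs \<in> tuples Ns. \<Union>i \<in> {..<length Ns}. lin_rels R ?S (Ns ! i) (\<lambda>x. (m, cs[i := x])))"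
  have fV: "f t \<in> carrier V" if "t \<in> ?S" for t
    using that mlin1D(3)[OF f] by (auto simp: tuples1_def)
  have l: "free_lift R (?S) V f \<in> module_hom R (free_space R (?S)) V"
    by (rule free_lift_hom[OF V fV])
  have lg: "free_lift R (?S) V f (free_gen R (?S) b) = f b" if "b \<in> ?S" for b
    by (rule free_lift_gen[OF V fV that])
  have Q: "?Q \<subseteq> carrier (free_space R ?S)"
    using tensor1_rels[OF A N] by (intro Un_least UN_least) auto
  have k: "free_lift R ?S V f q = \<zero>\<^bsub>V\<^esub>" if q: "q \<in> ?Q" for q
  proof -
    from q consider (coeff) cs where "cs \<in> tuples Ns" "q \<in> lin_rels R ?S A (\<lambda>x. (x, cs))"
      | (slot) m cs i where "m \<in> carrier A" "cs \<in> tuples Ns" "i < length Ns"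
        "q \<in> lin_rels R ?S (Ns ! i) (\<lambda>x. (m, cs[i := x]))" by blast
    then show ?thesis
    proof cases
      case coeff
      have h: "(m, cs) \<in> ?S" if "m \<in> carrier A" for m using that coeff by (simp add: tuples1_def)
      show ?thesis
        by (rule lin_rels_killed[OF A V h l hom_cong[OF mlin1D(1)[OF f coeff(1)] A lg[OF h]] coeff(2)])
    next
      case slot
      have M: "module R (Ns ! i)" using N slot by simp
      have h: "(m, cs[i := x]) \<in> ?S" if "x \<in> carrier (Ns ! i)" for x
        using that slot tuples_update by (auto simp: tuples1_def)
      show ?thesis
        by (rule lin_rels_killed[OF M V h l
              hom_cong[OF mlinD(2)[OF mlin1D(2)[OF f slot(1)] slot(2,3)] M lg[OF h]] slot(4)])
    qed
  qed
  show "tensor_lift R ?S V f \<in> module_hom R (tensor1 R A Ns) V"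
    unfolding tensor1_def tensor1_null_def by (rule presented_lift_hom[OF V fV Q k])
  show "t \<in> ?S \<Longrightarrow> tensor_lift R ?S V f (pure_tensor1 R A Ns t) = f t"
    unfolding pure_tensor1_def tensor1_null_def by (rule presented_lift_gen[OF V fV Q k])
qed

lemma tensor1_ext:
  assumes "module R A" "\<And>N. N \<in> set Ns \<Longrightarrow> module R N" "module R V"
    "f \<in> module_hom R (tensor1 R A Ns) V" "g \<in> module_hom R (tensor1 R A Ns) V"
    "\<And>t. t \<in> tuples1 A Ns \<Longrightarrow> f (pure_tensor1 R A Ns t) = g (pure_tensor1 R A Ns t)"
    "T \<in> carrier (tensor1 R A Ns)"
  shows "f T = g T"
  using presented_ext[OF assms(3) tensor1_null_submodule[OF assms(1,2)], where f = f and g = g and T = T] assms(4-)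
  by (simp add: tensor1_def pure_tensor1_def)

end

section \<open>Chains and cochains\<close>

lemma (in cring) mlin1_hom:
  assumes f: "mlin1 R A Ns V f" and g: "g \<in> module_hom R V U"
  shows "mlin1 R A Ns U (\<lambda>t. g (f t))"
  using mlin1D(1,2)[OF f] unfolding mlin1_def
  by (intro ballI conjI hom_comp[OF _ g] mlin_hom[OF _ g]) simp_all

lemma bilinearD:
  assumes "bilinear K A B D f"
  shows "a \<in> carrier A \<Longrightarrow> f a \<in> module_hom K B D"
    and "b \<in> carrier B \<Longrightarrow> (\<lambda>a. f a b) \<in> module_hom K A D"
    and "a \<in> carrier A \<Longrightarrow> b \<in> carrier B \<Longrightarrow> f a b \<in> carrier D"
  using assms hom_in[of "f a" K B D b] by (auto simp: bilinear_def)

lemma obj_tuplesD: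
  assumes "xs \<in> obj_tuples C n"
  shows "length xs = Suc n" "xs \<noteq> []" "hd xs = xs ! 0" "last xs = xs ! n"
    "i \<le> n \<Longrightarrow> xs ! i \<in> Obj C" "hd xs \<in> Obj C" "last xs \<in> Obj C"
    "length (homs C xs) = n" "i < n \<Longrightarrow> homs C xs ! i = Hom C (xs ! i) (xs ! Suc i)"
proof -
  show l: "length xs = Suc n" and n: "xs \<noteq> []" using assms by (auto simp: obj_tuples_def)
  show h: "hd xs = xs ! 0" and la: "last xs = xs ! n" using l n by (simp_all add: hd_conv_nth last_conv_nth)
  show o: "xs ! i \<in> Obj C" if "i \<le> n" for i using assms that by (auto simp: obj_tuples_def)
  show "hd xs \<in> Obj C" "last xs \<in> Obj C" using o by (simp_all add: h la)
  show "length (homs C xs) = n" "i < n \<Longrightarrow> homs C xs ! i = Hom C (xs ! i) (xs ! Suc i)"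
    using l by (simp_all add: homs_def nth_tl)
qed

lemma obj_tuples_faces:
  assumes "xs \<in> obj_tuples C (Suc n)"
  shows "tl xs \<in> obj_tuples C n" "butlast xs \<in> obj_tuples C n"
    "hd (tl xs) = xs ! 1" "last (tl xs) = last xs" "hd (butlast xs) = hd xs" "last (butlast xs) = xs ! n"
    "1 \<le> i \<Longrightarrow> i \<le> n \<Longrightarrow> remove_nth i xs \<in> obj_tuples C n"
    "1 \<le> i \<Longrightarrow> i \<le> n \<Longrightarrow> hd (remove_nth i xs) = hd xs"
    "1 \<le> i \<Longrightarrow> i \<le> n \<Longrightarrow> last (remove_nth i xs) = last xs"
proof -
  note d = obj_tuplesD[OF assms]
  show "tl xs \<in> obj_tuples C n" "butlast xs \<in> obj_tuples C n"
    using assms d(2) by (auto simp: obj_tuples_def dest: in_set_butlastD list.set_sel(2))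
  have "tl xs \<noteq> []" "butlast xs \<noteq> []" using d(1) by (auto simp flip: length_0_conv)
  then show "hd (tl xs) = xs ! 1" "last (tl xs) = last xs" "hd (butlast xs) = hd xs" "last (butlast xs) = xs ! n"
    using d(1) by (auto simp: hd_conv_nth nth_tl last_tl nth_butlast last_conv_nth d)
  assume i: "1 \<le> i" "i \<le> n"
  show "remove_nth i xs \<in> obj_tuples C n"
    using assms i by (auto simp: obj_tuples_def remove_nth_def dest: in_set_takeD in_set_dropD)
  show "hd (remove_nth i xs) = hd xs" using i d(1) by (auto simp: remove_nth_def hd_append)
  show "last (remove_nth i xs) = last xs" using i d(1) by (auto simp: remove_nth_def)
qed

lemma remove_nth_nth:
  "i < length xs \<Longrightarrow> j < length xs - 1 \<Longrightarrow> remove_nth i xs ! j = (if j < i then xs ! j else xs ! Suc j)"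
  by (auto simp: remove_nth_def nth_append)

lemma merge_at_nth:
  assumes "length cs = Suc n" "1 \<le> i" "i \<le> n"
  shows "length (merge_at C xs i cs) = n"
    "j < n \<Longrightarrow> merge_at C xs i cs ! j = (if Suc j < i then cs ! j
      else if Suc j = i then comp C (xs ! (i - 1)) (xs ! i) (xs ! Suc i) (cs ! (i - 1)) (cs ! i)
      else cs ! Suc j)"
proof -
  show "length (merge_at C xs i cs) = n" using assms by (simp add: merge_at_def)
  assume j: "j < n"
  have "j - (i - 1) = Suc (j - i)" "i + (j - i) = j" if "i \<le> j" using that assms(2) by auto
  then show "merge_at C xs i cs ! j = (if Suc j < i then cs ! j
      else if Suc j = i then comp C (xs ! (i - 1)) (xs ! i) (xs ! Suc i) (cs ! (i - 1)) (cs ! i)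
      else cs ! Suc j)"
    using assms j by (cases "i \<le> j") (auto simp: merge_at_def nth_append)
qed

text \<open>The values of the coboundary map, of pullbacks, of the group action and of the transfer are cochains given
  by a multilinear formula on tuples; this is their common form.\<close>

definition cochain_of where
  "cochain_of K C M n \<phi> = (\<lambda>xs \<in> obj_tuples C n. \<lambda>T \<in> carrier (tensor K (homs C xs)).
      tensor_lift K (tuples (homs C xs)) (Bim M (hd xs) (last xs)) (\<phi> xs) T)"

text \<open>The differentials are sums of bilinear operations, composition and the two actions, and it is their
  bilinearity that makes the differentials well defined on tensor products. This locale collects
  just that, for a category and a bimodule.\<close>

locale lin_data = cring K for K :: "('k, 'r) ring_scheme" (structure) +
  fixes C :: "('o, 'c, 'k) kcat" and M :: "('o, 'c, 'm, 'k) bimod"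
  assumes hom_module: "\<lbrakk>x \<in> Obj C; y \<in> Obj C\<rbrakk> \<Longrightarrow> module K (Hom C y x)"
    and bim_module: "\<lbrakk>x \<in> Obj C; y \<in> Obj C\<rbrakk> \<Longrightarrow> module K (Bim M y x)"
    and comp_bil: "\<lbrakk>x \<in> Obj C; y \<in> Obj C; z \<in> Obj C\<rbrakk>
        \<Longrightarrow> bilinear K (Hom C z y) (Hom C y x) (Hom C z x) (comp C z y x)"
    and lact_bil: "\<lbrakk>x \<in> Obj C; y \<in> Obj C; z \<in> Obj C\<rbrakk>
        \<Longrightarrow> bilinear K (Hom C z y) (Bim M y x) (Bim M z x) (lact M z y x)"
    and ract_bil: "\<lbrakk>u \<in> Obj C; x \<in> Obj C; y \<in> Obj C\<rbrakk>
        \<Longrightarrow> bilinear K (Bim M y x) (Hom C x u) (Bim M y u) (ract M y x u)"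
begin

abbreviation "coeff_space xs \<equiv> Bim M (last xs) (hd xs)"
abbreviation "value_space xs \<equiv> Bim M (hd xs) (last xs)"

definition sg :: "nat \<Rightarrow> 'k" where "sg i = (\<ominus> \<one>) [^] i"

lemma sg_closed [simp]: "sg i \<in> carrier K" by (simp add: sg_def)

lemma homs_module:
  assumes "xs \<in> obj_tuples C n" "N \<in> set (homs C xs)"
  shows "module K N"
  using assms obj_tuplesD[OF assms(1)] by (auto simp: in_set_conv_nth intro!: hom_module)

lemma coeffs_module: "xs \<in> obj_tuples C n \<Longrightarrow> module K (coeff_space xs)"
  and values_module: "xs \<in> obj_tuples C n \<Longrightarrow> module K (value_space xs)"
  using obj_tuplesD[of xs C n] by (auto intro: bim_module)

lemma chain_summand_module: "xs \<in> obj_tuples C n \<Longrightarrow> module K (chain_summand K C M xs)"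
  unfolding chain_summand_def by (rule tensor1_module[OF coeffs_module homs_module])

lemma chains_module: "module K (chains K C M n)"
  unfolding chains_def by (rule dsum_space_module[OF chain_summand_module])

lemma mlin1_chain_gen:
  assumes xs: "xs \<in> obj_tuples C n"
  shows "mlin1 K (coeff_space xs) (homs C xs) (chains K C M n) (chain_gen K C M n xs)"
proof -
  have "mlin1 K (coeff_space xs) (homs C xs) (chain_summand K C M xs) (pure_tensor1 K (coeff_space xs) (homs C xs))"
    unfolding chain_summand_def by (rule mlin1_pure_tensor1[OF coeffs_module[OF xs] homs_module[OF xs]])
  moreover have "dsum_inj (obj_tuples C n) (chain_summand K C M) xs
      \<in> module_hom K (chain_summand K C M xs) (chains K C M n)"
    unfolding chains_def by (rule dsum_inj_hom[OF chain_summand_module xs])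
  ultimately show ?thesis unfolding chain_gen_def[abs_def] by (rule mlin1_hom)
qed

text \<open>The universal property of the chains, and with the next lemma the way to prove all identities between
  maps on chains: it suffices to compare them on the generators \<open>m \<otimes> c\<^sub>n \<otimes> \<dots> \<otimes> c\<^sub>1\<close>.\<close>

lemma chain_lift:
  assumes V: "module K V"
    and f: "\<And>xs. xs \<in> obj_tuples C n \<Longrightarrow> mlin1 K (coeff_space xs) (homs C xs) V (f xs)"
  shows chain_lift_hom: "chain_lift K C M n V f \<in> module_hom K (chains K C M n) V"
    and chain_lift_gen: "xs \<in> obj_tuples C n \<Longrightarrow> t \<in> tuples1 (coeff_space xs) (homs C xs) \<Longrightarrow>
      chain_lift K C M n V f (chain_gen K C M n xs t) = f xs t"
proof -
  let ?g = "\<lambda>xs. tensor_lift K (tuples1 (coeff_space xs) (homs C xs)) V (f xs)"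
  have g: "?g xs \<in> module_hom K (chain_summand K C M xs) V" if "xs \<in> obj_tuples C n" for xs
    unfolding chain_summand_def
    by (rule tensor1_lift_hom[OF coeffs_module[OF that] homs_module[OF that] V f[OF that]])
  show "chain_lift K C M n V f \<in> module_hom K (chains K C M n) V"
    unfolding chain_lift_def[abs_def] chains_def
    by (rule dsum_lift_hom[where g = ?g, OF chain_summand_module V g])
  assume xs: "xs \<in> obj_tuples C n" and t: "t \<in> tuples1 (coeff_space xs) (homs C xs)"
  have "pure_tensor1 K (coeff_space xs) (homs C xs) t \<in> carrier (chain_summand K C M xs)"
    using mlin1D(3)[OF mlin1_pure_tensor1[OF coeffs_module[OF xs] homs_module[OF xs]]] t
    by (auto simp: chain_summand_def tuples1_def)
  then have "chain_lift K C M n V f (chain_gen K C M n xs t) = ?g xs (pure_tensor1 K (coeff_space xs) (homs C xs) t)"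
    unfolding chain_lift_def chain_gen_def
    by (intro dsum_lift_inj[where g = ?g, OF chain_summand_module V g] xs)
  also have "\<dots> = f xs t"
    by (rule tensor1_lift_pure[OF coeffs_module[OF xs] homs_module[OF xs] V f[OF xs] t])
  finally show "chain_lift K C M n V f (chain_gen K C M n xs t) = f xs t" .
qed

lemma chains_ext:
  assumes V: "module K V" and f: "f \<in> module_hom K (chains K C M n) V"
    and g: "g \<in> module_hom K (chains K C M n) V"
    and eq: "\<And>xs m cs. xs \<in> obj_tuples C n \<Longrightarrow> m \<in> carrier (coeff_space xs) \<Longrightarrow> cs \<in> tuples (homs C xs) \<Longrightarrow>
      f (chain_gen K C M n xs (m, cs)) = g (chain_gen K C M n xs (m, cs))"
    and c: "c \<in> carrier (chains K C M n)"
  shows "f c = g c"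
proof (rule dsum_ext[OF chain_summand_module V f[unfolded chains_def] g[unfolded chains_def] _
      c[unfolded chains_def]])
  fix xs T assume xs: "xs \<in> obj_tuples C n" and T: "T \<in> carrier (chain_summand K C M xs)"
  let ?i = "dsum_inj (obj_tuples C n) (chain_summand K C M) xs"
  have i: "?i \<in> module_hom K (tensor1 K (coeff_space xs) (homs C xs)) (chains K C M n)"
    using dsum_inj_hom[where A = "chain_summand K C M", OF chain_summand_module xs]
    by (simp add: chains_def chain_summand_def)
  show "f (?i T) = g (?i T)"
    by (rule tensor1_ext[OF coeffs_module[OF xs] homs_module[OF xs] V hom_comp[OF i f] hom_comp[OF i g] _
          T[unfolded chain_summand_def]])
      (use eq[OF xs] in \<open>auto simp: chain_gen_def tuples1_def\<close>)
qed

text \<open>Position \<open>k\<close> of the tuple moves to position \<open>k\<close> or \<open>k - 1\<close>, by the identity if it is not involved in the merge, and by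
  composition with the other factor if it is.\<close>

lemma slotwise_merge_at:
  assumes xs: "xs \<in> obj_tuples C (Suc n)" and i: "1 \<le> i" "i \<le> n"
  shows "slotwise K (homs C xs) (homs C (remove_nth i xs)) (merge_at C xs i)"
  unfolding slotwise_def
proof (intro ballI conjI allI impI)
  note d = obj_tuplesD[OF xs] and e = obj_tuplesD[OF obj_tuples_faces(7)[OF xs i]]
  have b: "bilinear K (Hom C (xs ! (i - 1)) (xs ! i)) (Hom C (xs ! i) (xs ! Suc i))
      (Hom C (xs ! (i - 1)) (xs ! Suc i)) (comp C (xs ! (i - 1)) (xs ! i) (xs ! Suc i))"
    using i by (intro comp_bil d(5)) auto
  fix cs assume cs: "cs \<in> tuples (homs C xs)"
  have len: "length cs = Suc n" using cs d by (simp add: tuples_iff)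
  have csi: "cs ! j \<in> carrier (Hom C (xs ! j) (xs ! Suc j))" if "j \<le> n" for j
    using cs d that by (simp add: tuples_iff)
  have c1: "cs ! (i - 1) \<in> carrier (Hom C (xs ! (i - 1)) (xs ! i))" using csi[of "i - 1"] i by simp
  have hm: "homs C (remove_nth i xs) ! j = (if Suc j < i then Hom C (xs ! j) (xs ! Suc j)
      else if Suc j = i then Hom C (xs ! (i - 1)) (xs ! Suc i) else Hom C (xs ! Suc j) (xs ! Suc (Suc j)))"
    if "j < n" for j
    using that i d(1) by (auto simp: e remove_nth_nth)
  note m = merge_at_nth[OF _ i, where C = C and xs = xs]
  show "merge_at C xs i cs \<in> tuples (homs C (remove_nth i xs))"
    using bilinearD(3)[OF b] i csi c1
    by (auto simp: tuples_iff e(8) m[OF len] hm)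
  fix k assume k: "k < length (homs C xs)"
  have up: "length (cs[q := x]) = Suc n" for q x using len by simp
  have eqI: "merge_at C xs i (cs[k := x]) = (merge_at C xs i cs)[j := y]"
    if "j < n" "\<And>l. l < n \<Longrightarrow> merge_at C xs i (cs[k := x]) ! l = (if l = j then y else merge_at C xs i cs ! l)"
    for x y j
    using that by (intro nth_equalityI) (simp_all add: m(1)[OF len] m(1)[OF up] nth_list_update)
  have ex: "\<exists>j<length (homs C (remove_nth i xs)). \<exists>l\<in>module_hom K (homs C xs ! k) (homs C (remove_nth i xs) ! j).
      \<forall>x\<in>carrier (homs C xs ! k). merge_at C xs i (cs[k := x]) = (merge_at C xs i cs)[j := l x]"
    if "j < n" "l \<in> module_hom K (homs C xs ! k) (homs C (remove_nth i xs) ! j)"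
      "\<And>x p. p < n \<Longrightarrow> merge_at C xs i (cs[k := x]) ! p = (if p = j then l x else merge_at C xs i cs ! p)" for j l
    using that e(8) by (intro exI[of _ j] conjI bexI[of _ l] ballI eqI) auto
  have k': "k \<le> n" using k d(8) by simp
  consider "Suc k < i" | "Suc k = i" | "k = i" | "i < k" by linarith
  then show "\<exists>j<length (homs C (remove_nth i xs)). \<exists>l\<in>module_hom K (homs C xs ! k) (homs C (remove_nth i xs) ! j).
      \<forall>x\<in>carrier (homs C xs ! k). merge_at C xs i (cs[k := x]) = (merge_at C xs i cs)[j := l x]"
  proof cases
    case 1
    show ?thesis
      by (rule ex[of k "\<lambda>x. x"]) (use 1 i len d in \<open>auto simp: hm m[OF len] m[OF up] nth_list_update hom_id\<close>)
  next
    case 2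
    show ?thesis
      by (rule ex[of k "\<lambda>x. comp C (xs ! k) (xs ! i) (xs ! Suc i) x (cs ! i)"])
        (use 2 i len d bilinearD(2)[OF b csi[OF i(2)]] in
          \<open>auto simp: hm m[OF len] m[OF up] nth_list_update\<close>)
  next
    case 3
    show ?thesis
      by (rule ex[of "i - 1" "comp C (xs ! (i - 1)) (xs ! i) (xs ! Suc i) (cs ! (i - 1))"])
        (use 3 i len d bilinearD(1)[OF b c1] in
          \<open>auto simp: hm m[OF len] m[OF up] nth_list_update\<close>)
  next
    case 4
    show ?thesis
      by (rule ex[of "k - 1" "\<lambda>x. x"])
        (use 4 i len d k' in \<open>auto simp: hm m[OF len] m[OF up] nth_list_update hom_id\<close>)
  qed
qed

lemma outer_slots:
  assumes xs: "xs \<in> obj_tuples C (Suc n)" and cs: "cs \<in> tuples (homs C xs)"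
  shows "tl cs \<in> tuples (homs C (tl xs))" "butlast cs \<in> tuples (homs C (butlast xs))"
    "hd cs \<in> carrier (Hom C (hd xs) (xs ! 1))" "last cs \<in> carrier (Hom C (xs ! n) (last xs))"
    "hd (cs[0 := x]) = x" "tl (cs[0 := x]) = tl cs"
    "hd (cs[Suc j := x]) = hd cs" "tl (cs[Suc j := x]) = (tl cs)[j := x]"
    "last (cs[n := x]) = x" "butlast (cs[n := x]) = butlast cs"
    "j < n \<Longrightarrow> last (cs[j := x]) = last cs" "j < n \<Longrightarrow> butlast (cs[j := x]) = (butlast cs)[j := x]"
    "j < n \<Longrightarrow> homs C xs ! Suc j = homs C (tl xs) ! j"
    "j < n \<Longrightarrow> homs C xs ! j = homs C (butlast xs) ! j"
    "homs C xs ! 0 = Hom C (hd xs) (xs ! 1)" "homs C xs ! n = Hom C (xs ! n) (last xs)"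
proof -
  note d = obj_tuplesD[OF xs] and t = obj_tuplesD[OF obj_tuples_faces(1)[OF xs]]
    and b = obj_tuplesD[OF obj_tuples_faces(2)[OF xs]]
  have len: "length cs = Suc n" using cs d by (simp add: tuples_iff)
  then obtain c cs' where c: "cs = c # cs'" by (cases cs) auto
  have ne: "ds \<noteq> []" if "length ds = Suc n" for ds :: "'c list" using that by auto
  have lh: "hd cs = cs ! 0" "last ds = ds ! n" if "length ds = Suc n" for ds :: "'c list"
    using that by (simp_all add: c last_conv_nth[OF ne])
  note lh = lh(1)[OF len] lh(2)
  show ht: "homs C xs ! Suc j = homs C (tl xs) ! j" and hb: "homs C xs ! j = homs C (butlast xs) ! j" if "j < n" for j
    using that d(1) by (simp_all add: d(9) t(9) b(9) nth_tl nth_butlast)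
  show h0: "homs C xs ! 0 = Hom C (hd xs) (xs ! 1)" and hn: "homs C xs ! n = Hom C (xs ! n) (last xs)"
    using d by simp_all
  show "tl cs \<in> tuples (homs C (tl xs))" "butlast cs \<in> tuples (homs C (butlast xs))"
    using cs len by (simp_all add: tuples_iff d(8) t(8) b(8) nth_tl nth_butlast ht[symmetric] hb[symmetric])
  show "hd cs \<in> carrier (Hom C (hd xs) (xs ! 1))" "last cs \<in> carrier (Hom C (xs ! n) (last xs))"
  proof -
    have "cs ! 0 \<in> carrier (homs C xs ! 0)" "cs ! n \<in> carrier (homs C xs ! n)"
      using cs by (simp_all add: tuples_iff d(8))
    then show "hd cs \<in> carrier (Hom C (hd xs) (xs ! 1))" "last cs \<in> carrier (Hom C (xs ! n) (last xs))"
      unfolding h0 hn lh(1) lh(2)[OF len] .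
  qed
  show "hd (cs[0 := x]) = x" "tl (cs[0 := x]) = tl cs"
    "hd (cs[Suc j := x]) = hd cs" "tl (cs[Suc j := x]) = (tl cs)[j := x]" by (simp_all add: c)
  show "last (cs[n := x]) = x" using len by (simp add: lh(2))
  show "butlast (cs[n := x]) = butlast cs" using len by (intro nth_equalityI) (auto simp: nth_butlast)
  show "last (cs[j := x]) = last cs" if "j < n" using len that
    by (simp add: lh(2))
  show "butlast (cs[j := x]) = (butlast cs)[j := x]" if "j < n"
    using len that by (intro nth_equalityI) (auto simp: nth_butlast nth_list_update)
qed

lemma slotwise1_first_face:
  assumes xs: "xs \<in> obj_tuples C (Suc n)"
  shows "slotwise1 K (coeff_space xs) (homs C xs) (coeff_space (tl xs)) (homs C (tl xs))
    (\<lambda>(m, cs). (ract M (last xs) (hd xs) (xs ! 1) m (hd cs), tl cs))"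
  unfolding slotwise1_def
proof (intro conjI ballI allI impI)
  note d = obj_tuplesD[OF xs] and fc = obj_tuples_faces[OF xs] and s = outer_slots[OF xs]
  have o1: "xs ! 1 \<in> Obj C" by (rule d(5)) simp
  note b = ract_bil[OF o1 d(6,7)]
  fix cs assume cs: "cs \<in> tuples (homs C xs)"
  show "\<exists>l\<in>module_hom K (coeff_space xs) (coeff_space (tl xs)). \<exists>ds\<in>tuples (homs C (tl xs)). \<forall>m\<in>carrier (coeff_space xs).
      (case (m, cs) of (m, cs) \<Rightarrow> (ract M (last xs) (hd xs) (xs ! 1) m (hd cs), tl cs)) = (l m, ds)"
    using bilinearD(2)[OF b s(3)[OF cs]] s(1)[OF cs] fc(3,4)
    by (intro bexI[of _ "\<lambda>m. ract M (last xs) (hd xs) (xs ! 1) m (hd cs)"] bexI[of _ "tl cs"]) auto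
  fix m assume m: "m \<in> carrier (coeff_space xs)"
  show "(case (m, cs) of (m, cs) \<Rightarrow> (ract M (last xs) (hd xs) (xs ! 1) m (hd cs), tl cs))
      \<in> tuples1 (coeff_space (tl xs)) (homs C (tl xs))"
    using bilinearD(3)[OF b m s(3)[OF cs]] s(1)[OF cs] fc(3,4) by (simp add: tuples1_def)
  fix i assume i: "i < length (homs C xs)"
  show "(\<exists>l\<in>module_hom K (homs C xs ! i) (coeff_space (tl xs)). \<exists>ds\<in>tuples (homs C (tl xs)). \<forall>x\<in>carrier (homs C xs ! i).
        (case (m, cs[i := x]) of (m, cs) \<Rightarrow> (ract M (last xs) (hd xs) (xs ! 1) m (hd cs), tl cs)) = (l x, ds)) \<or>
      (\<exists>j<length (homs C (tl xs)). \<exists>l\<in>module_hom K (homs C xs ! i) (homs C (tl xs) ! j).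
        \<exists>m'\<in>carrier (coeff_space (tl xs)). \<exists>ds\<in>tuples (homs C (tl xs)). \<forall>x\<in>carrier (homs C xs ! i).
        (case (m, cs[i := x]) of (m, cs) \<Rightarrow> (ract M (last xs) (hd xs) (xs ! 1) m (hd cs), tl cs)) = (m', ds[j := l x]))"
  proof (cases i)
    case 0
    show ?thesis
      using bilinearD(1)[OF b m] s(1)[OF cs] fc(3,4) s(15)[OF cs]
      by (intro disjI1 bexI[of _ "ract M (last xs) (hd xs) (xs ! 1) m"] bexI[of _ "tl cs"])
        (auto simp: 0 s(5,6)[OF cs])
  next
    case (Suc j)
    then have j: "j < n" using i d(8) by simp
    show ?thesis
      using bilinearD(3)[OF b m s(3)[OF cs]] s(1)[OF cs] fc(3,4) s(13)[OF cs j] j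
        obj_tuplesD(8)[OF fc(1)]
      by (intro disjI2 exI[of _ j] conjI bexI[of _ "\<lambda>x. x"]
          bexI[of _ "ract M (last xs) (hd xs) (xs ! 1) m (hd cs)"] bexI[of _ "tl cs"])
        (auto simp: Suc s(7,8)[OF cs] hom_id)
  qed
qed

lemma slotwise1_last_face:
  assumes xs: "xs \<in> obj_tuples C (Suc n)"
  shows "slotwise1 K (coeff_space xs) (homs C xs) (coeff_space (butlast xs)) (homs C (butlast xs))
    (\<lambda>(m, cs). (lact M (xs ! n) (last xs) (hd xs) (last cs) m, butlast cs))"
  unfolding slotwise1_def
proof (intro conjI ballI allI impI)
  note d = obj_tuplesD[OF xs] and fc = obj_tuples_faces[OF xs] and s = outer_slots[OF xs]
  have on: "xs ! n \<in> Obj C" by (rule d(5)) simp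
  note b = lact_bil[OF d(6,7) on]
  fix cs assume cs: "cs \<in> tuples (homs C xs)"
  show "\<exists>l\<in>module_hom K (coeff_space xs) (coeff_space (butlast xs)). \<exists>ds\<in>tuples (homs C (butlast xs)). \<forall>m\<in>carrier (coeff_space xs).
      (case (m, cs) of (m, cs) \<Rightarrow> (lact M (xs ! n) (last xs) (hd xs) (last cs) m, butlast cs)) = (l m, ds)"
    using bilinearD(1)[OF b s(4)[OF cs]] s(2)[OF cs] fc(5,6)
    by (intro bexI[of _ "lact M (xs ! n) (last xs) (hd xs) (last cs)"] bexI[of _ "butlast cs"]) auto
  fix m assume m: "m \<in> carrier (coeff_space xs)"
  show "(case (m, cs) of (m, cs) \<Rightarrow> (lact M (xs ! n) (last xs) (hd xs) (last cs) m, butlast cs))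
      \<in> tuples1 (coeff_space (butlast xs)) (homs C (butlast xs))"
    using bilinearD(3)[OF b s(4)[OF cs] m] s(2)[OF cs] fc(5,6) by (simp add: tuples1_def)
  fix i assume i: "i < length (homs C xs)"
  show "(\<exists>l\<in>module_hom K (homs C xs ! i) (coeff_space (butlast xs)). \<exists>ds\<in>tuples (homs C (butlast xs)). \<forall>x\<in>carrier (homs C xs ! i).
        (case (m, cs[i := x]) of (m, cs) \<Rightarrow> (lact M (xs ! n) (last xs) (hd xs) (last cs) m, butlast cs)) = (l x, ds)) \<or>
      (\<exists>j<length (homs C (butlast xs)). \<exists>l\<in>module_hom K (homs C xs ! i) (homs C (butlast xs) ! j).
        \<exists>m'\<in>carrier (coeff_space (butlast xs)). \<exists>ds\<in>tuples (homs C (butlast xs)). \<forall>x\<in>carrier (homs C xs ! i).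
        (case (m, cs[i := x]) of (m, cs) \<Rightarrow> (lact M (xs ! n) (last xs) (hd xs) (last cs) m, butlast cs)) = (m', ds[j := l x]))"
  proof (cases "i = n")
    case True
    show ?thesis
      using bilinearD(2)[OF b m] s(2)[OF cs] fc(5,6) s(16)[OF cs]
      by (intro disjI1 bexI[of _ "\<lambda>c. lact M (xs ! n) (last xs) (hd xs) c m"] bexI[of _ "butlast cs"])
        (auto simp: True s(9,10)[OF cs])
  next
    case False
    then have j: "i < n" using i d(8) by simp
    show ?thesis
      using bilinearD(3)[OF b s(4)[OF cs] m] s(2)[OF cs] fc(5,6) s(14)[OF cs j] j
        obj_tuplesD(8)[OF fc(2)]
      by (intro disjI2 exI[of _ i] conjI bexI[of _ "\<lambda>x. x"]
          bexI[of _ "lact M (xs ! n) (last xs) (hd xs) (last cs) m"] bexI[of _ "butlast cs"])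
        (auto simp: s(11,12)[OF cs j] hom_id)
  qed
qed

definition bd_tuple where
  "bd_tuple n xs t = (case t of (m, cs) \<Rightarrow>
    chain_gen K C M n (tl xs) (ract M (last xs) (hd xs) (xs ! 1) m (hd cs), tl cs)
    \<oplus>\<^bsub>chains K C M n\<^esub> (\<Oplus>\<^bsub>chains K C M n\<^esub> i \<in> {1..n}.
      sg i \<odot>\<^bsub>chains K C M n\<^esub> chain_gen K C M n (remove_nth i xs) (m, merge_at C xs i cs))
    \<oplus>\<^bsub>chains K C M n\<^esub> sg (Suc n) \<odot>\<^bsub>chains K C M n\<^esub>
      chain_gen K C M n (butlast xs) (lact M (xs ! n) (last xs) (hd xs) (last cs) m, butlast cs))"

lemma chain_bd_eq: "chain_bd K C M n = chain_lift K C M (Suc n) (chains K C M n) (bd_tuple n)"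
  unfolding chain_bd_def Let_def bd_tuple_def[abs_def] sg_def ..

lemma mlin1_bd_tuple:
  assumes xs: "xs \<in> obj_tuples C (Suc n)"
  shows "mlin1 K (coeff_space xs) (homs C xs) (chains K C M n) (bd_tuple n xs)"
proof -
  let ?D = "chains K C M n"
  note fc = obj_tuples_faces[OF xs]
  note A = coeffs_module[OF xs] and N = homs_module[OF xs]
  have 1: "mlin1 K (coeff_space xs) (homs C xs) ?D
      (\<lambda>t. chain_gen K C M n (tl xs) ((\<lambda>(m, cs). (ract M (last xs) (hd xs) (xs ! 1) m (hd cs), tl cs)) t))"
    by (rule mlin1_slotwise1[OF mlin1_chain_gen[OF fc(1)] slotwise1_first_face[OF xs] A N])
  have 2: "mlin1 K (coeff_space xs) (homs C xs) ?D
      (\<lambda>t. chain_gen K C M n (remove_nth i xs) ((\<lambda>(m, cs). (m, merge_at C xs i cs)) t))"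
    if i: "i \<in> {1..n}" for i
  proof -
    from i have i': "1 \<le> i" "i \<le> n" by auto
    have "slotwise1 K (coeff_space xs) (homs C xs) (coeff_space (remove_nth i xs)) (homs C (remove_nth i xs))
        (\<lambda>(m, cs). (m, merge_at C xs i cs))"
      using slotwise1_right[OF slotwise_merge_at[OF xs i']] fc(8,9)[OF i'] by simp
    then show ?thesis by (rule mlin1_slotwise1[OF mlin1_chain_gen[OF fc(7)[OF i']] _ A N])
  qed
  have 3: "mlin1 K (coeff_space xs) (homs C xs) ?D
      (\<lambda>t. chain_gen K C M n (butlast xs) ((\<lambda>(m, cs). (lact M (xs ! n) (last xs) (hd xs) (last cs) m, butlast cs)) t))"
    by (rule mlin1_slotwise1[OF mlin1_chain_gen[OF fc(2)] slotwise1_last_face[OF xs] A N])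
  note D = chains_module[of n]
  have "mlin1 K (coeff_space xs) (homs C xs) ?D (\<lambda>t.
      chain_gen K C M n (tl xs) ((\<lambda>(m, cs). (ract M (last xs) (hd xs) (xs ! 1) m (hd cs), tl cs)) t)
      \<oplus>\<^bsub>?D\<^esub> (\<Oplus>\<^bsub>?D\<^esub> i \<in> {1..n}. sg i \<odot>\<^bsub>?D\<^esub>
        chain_gen K C M n (remove_nth i xs) ((\<lambda>(m, cs). (m, merge_at C xs i cs)) t))
      \<oplus>\<^bsub>?D\<^esub> sg (Suc n) \<odot>\<^bsub>?D\<^esub>
        chain_gen K C M n (butlast xs) ((\<lambda>(m, cs). (lact M (xs ! n) (last xs) (hd xs) (last cs) m, butlast cs)) t))"
    by (intro mlin1_add[OF _ _ D A N] mlin1_sum[OF _ D A N] mlin1_smult[OF _ _ D A N] 1 2 3 sg_closed)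
  then show ?thesis
    by (simp add: bd_tuple_def[abs_def] case_prod_unfold)
qed

lemma chain_bd_hom: "chain_bd K C M n \<in> module_hom K (chains K C M (Suc n)) (chains K C M n)"
  unfolding chain_bd_eq by (rule chain_lift_hom[OF chains_module mlin1_bd_tuple])

lemma chain_bd_gen:
  "xs \<in> obj_tuples C (Suc n) \<Longrightarrow> t \<in> tuples1 (coeff_space xs) (homs C xs) \<Longrightarrow>
    chain_bd K C M n (chain_gen K C M (Suc n) xs t) = bd_tuple n xs t"
  unfolding chain_bd_eq by (rule chain_lift_gen[OF chains_module mlin1_bd_tuple])

lemma cochains_module: "module K (cochains K C M n)"
  unfolding cochains_def
  by (rule prod_space_module, rule hom_space_module, rule tensor_module, erule (1) homs_module, erule values_module)

lemma cochain_hom: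
  assumes "f \<in> carrier (cochains K C M n)" "xs \<in> obj_tuples C n"
  shows "f xs \<in> module_hom K (tensor K (homs C xs)) (value_space xs)"
    and "f xs \<in> extensional (carrier (tensor K (homs C xs)))"
  using assms by (auto simp: cochains_def prod_space_simps hom_space_simps dest: PiE_mem)

lemma cochain_mlin:
  assumes "f \<in> carrier (cochains K C M n)" "xs \<in> obj_tuples C n"
  shows "mlin K (homs C xs) (value_space xs) (\<lambda>cs. f xs (pure_tensor K (homs C xs) cs))"
  by (rule mlin_hom[OF mlin_pure_tensor cochain_hom(1)[OF assms]], rule homs_module[OF assms(2)])

lemma cochain_ext:
  assumes f: "f \<in> carrier (cochains K C M n)" and g: "g \<in> carrier (cochains K C M n)"
    and eq: "\<And>xs cs. xs \<in> obj_tuples C n \<Longrightarrow> cs \<in> tuples (homs C xs) \<Longrightarrow>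
      f xs (pure_tensor K (homs C xs) cs) = g xs (pure_tensor K (homs C xs) cs)"
  shows "f = g"
proof (rule extensionalityI[where A = "obj_tuples C n"])
  show "f \<in> extensional (obj_tuples C n)" "g \<in> extensional (obj_tuples C n)"
    using f g by (auto simp: cochains_def prod_space_simps PiE_def)
  fix xs assume xs: "xs \<in> obj_tuples C n"
  show "f xs = g xs"
  proof (rule extensionalityI[OF cochain_hom(2)[OF f xs] cochain_hom(2)[OF g xs]])
    fix T assume "T \<in> carrier (tensor K (homs C xs))"
    then show "f xs T = g xs T"
      by (intro tensor_ext[OF homs_module[OF xs] values_module[OF xs] cochain_hom(1)[OF f xs]
          cochain_hom(1)[OF g xs] eq[OF xs]])
  qed
qed

lemma eval_hom:
  assumes xs: "xs \<in> obj_tuples C n" and cs: "cs \<in> tuples (homs C xs)"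
  shows "(\<lambda>f. f xs (pure_tensor K (homs C xs) cs)) \<in> module_hom K (cochains K C M n) (value_space xs)"
proof -
  have p: "pure_tensor K (homs C xs) cs \<in> carrier (tensor K (homs C xs))"
    by (rule mlinD(1)[OF mlin_pure_tensor cs], rule homs_module[OF xs])
  show ?thesis
  proof (rule module_homI)
    show "f xs (pure_tensor K (homs C xs) cs) \<in> carrier (value_space xs)" if "f \<in> carrier (cochains K C M n)" for f
      by (rule hom_in[OF cochain_hom(1)[OF that xs] p])
  qed (use xs p in \<open>simp_all add: cochains_def prod_space_simps hom_space_simps\<close>)
qed

lemma cochain_of:
  assumes m: "\<And>xs. xs \<in> obj_tuples C n \<Longrightarrow> mlin K (homs C xs) (value_space xs) (\<phi> xs)"
  shows cochain_of_closed: "cochain_of K C M n \<phi> \<in> carrier (cochains K C M n)"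
    and cochain_of_pure: "xs \<in> obj_tuples C n \<Longrightarrow> cs \<in> tuples (homs C xs) \<Longrightarrow>
      cochain_of K C M n \<phi> xs (pure_tensor K (homs C xs) cs) = \<phi> xs cs"
proof -
  have l: "tensor_lift K (tuples (homs C xs)) (value_space xs) (\<phi> xs)
      \<in> module_hom K (tensor K (homs C xs)) (value_space xs)" if "xs \<in> obj_tuples C n" for xs
    by (rule tensor_lift_hom[OF homs_module[OF that] values_module[OF that] m[OF that]])
  have r: "restrict (tensor_lift K (tuples (homs C xs)) (value_space xs) (\<phi> xs)) (carrier (tensor K (homs C xs)))
      \<in> module_hom K (tensor K (homs C xs)) (value_space xs)" if "xs \<in> obj_tuples C n" for xs
    by (rule hom_cong[OF l[OF that] tensor_module], rule homs_module[OF that]) simp_all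
  show "cochain_of K C M n \<phi> \<in> carrier (cochains K C M n)"
    using r by (simp add: cochain_of_def cochains_def prod_space_simps hom_space_simps)
  assume xs: "xs \<in> obj_tuples C n" and cs: "cs \<in> tuples (homs C xs)"
  have p: "pure_tensor K (homs C xs) cs \<in> carrier (tensor K (homs C xs))"
    by (rule mlinD(1)[OF mlin_pure_tensor cs], rule homs_module[OF xs])
  show "cochain_of K C M n \<phi> xs (pure_tensor K (homs C xs) cs) = \<phi> xs cs"
    using xs p tensor_lift_pure[OF homs_module[OF xs] values_module[OF xs] m[OF xs] cs]
    by (simp add: cochain_of_def)
qed

lemma cochain_of_hom:
  assumes A: "module K A"
    and m: "\<And>f xs. f \<in> carrier A \<Longrightarrow> xs \<in> obj_tuples C n \<Longrightarrow> mlin K (homs C xs) (value_space xs) (\<Phi> f xs)"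
    and l: "\<And>xs cs. xs \<in> obj_tuples C n \<Longrightarrow> cs \<in> tuples (homs C xs) \<Longrightarrow>
      (\<lambda>f. \<Phi> f xs cs) \<in> module_hom K A (value_space xs)"
  shows "(\<lambda>f. cochain_of K C M n (\<Phi> f)) \<in> module_hom K A (cochains K C M n)"
proof -
  interpret A: module K A by fact
  interpret D: module K "cochains K C M n" by (rule cochains_module)
  have c: "cochain_of K C M n (\<Phi> f) \<in> carrier (cochains K C M n)" if "f \<in> carrier A" for f
    by (rule cochain_of_closed[OF m[OF that]])
  have p: "cochain_of K C M n (\<Phi> f) xs (pure_tensor K (homs C xs) cs) = \<Phi> f xs cs"
    if "f \<in> carrier A" "xs \<in> obj_tuples C n" "cs \<in> tuples (homs C xs)" for f xs cs
    by (rule cochain_of_pure[OF m[OF that(1)] that(2,3)])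
  show ?thesis
  proof (rule module_homI)
    show "cochain_of K C M n (\<Phi> f) \<in> carrier (cochains K C M n)" if "f \<in> carrier A" for f by (rule c[OF that])
    show "cochain_of K C M n (\<Phi> (f \<oplus>\<^bsub>A\<^esub> g)) =
        cochain_of K C M n (\<Phi> f) \<oplus>\<^bsub>cochains K C M n\<^esub> cochain_of K C M n (\<Phi> g)"
      if f: "f \<in> carrier A" and g: "g \<in> carrier A" for f g
      by (rule cochain_ext[where n = n])
        (simp_all add: c f g p module_hom_add[OF eval_hom] module_hom_add[OF l])
    show "cochain_of K C M n (\<Phi> (a \<odot>\<^bsub>A\<^esub> f)) = a \<odot>\<^bsub>cochains K C M n\<^esub> cochain_of K C M n (\<Phi> f)"
      if f: "f \<in> carrier A" and a: "a \<in> carrier K" for f a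
      by (rule cochain_ext[where n = n])
        (simp_all add: c f a p module_hom_smult[OF eval_hom] module_hom_smult[OF l])
  qed
qed

definition cobd_tuple where
  "cobd_tuple n f xs cs =
    sg (Suc n) \<odot>\<^bsub>value_space xs\<^esub> lact M (hd xs) (xs ! 1) (last xs) (hd cs)
      (f (tl xs) (pure_tensor K (homs C (tl xs)) (tl cs)))
    \<oplus>\<^bsub>value_space xs\<^esub> (\<Oplus>\<^bsub>value_space xs\<^esub> i \<in> {1..n}. sg i \<odot>\<^bsub>value_space xs\<^esub>
      f (remove_nth (Suc n - i) xs) (pure_tensor K (homs C (remove_nth (Suc n - i) xs)) (merge_at C xs (Suc n - i) cs)))
    \<oplus>\<^bsub>value_space xs\<^esub> ract M (hd xs) (xs ! n) (last xs)
      (f (butlast xs) (pure_tensor K (homs C (butlast xs)) (butlast cs))) (last cs)"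

lemma cochain_bd_eq: "cochain_bd K C M n f = cochain_of K C M (Suc n) (cobd_tuple n f)"
  unfolding cochain_bd_def Let_def cochain_of_def cobd_tuple_def[abs_def] sg_def ..

lemma mlin_cobd_tuple:
  assumes f: "f \<in> carrier (cochains K C M n)" and xs: "xs \<in> obj_tuples C (Suc n)"
  shows "mlin K (homs C xs) (value_space xs) (cobd_tuple n f xs)"
proof -
  note d = obj_tuplesD[OF xs] and fc = obj_tuples_faces[OF xs]
  note N = homs_module[OF xs] and V = values_module[OF xs]
  have o1: "xs ! 1 \<in> Obj C" and on: "xs ! n \<in> Obj C" by (rule d(5), simp)+
  note bl = lact_bil[OF d(7) o1 d(6)] and br = ract_bil[OF d(7) on d(6)]
  note ft = cochain_mlin[OF f fc(1)] and fb = cochain_mlin[OF f fc(2)]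
  have vt: "value_space (tl xs) = Bim M (xs ! 1) (last xs)" and vb: "value_space (butlast xs) = Bim M (hd xs) (xs ! n)"
    using fc by simp_all
  have 1: "mlin K (homs C xs) (value_space xs)
      (\<lambda>cs. lact M (hd xs) (xs ! 1) (last xs) (hd cs) (f (tl xs) (pure_tensor K (homs C (tl xs)) (tl cs))))"
    unfolding mlin_def
  proof (intro ballI conjI allI impI)
    fix cs assume cs: "cs \<in> tuples (homs C xs)"
    note s = outer_slots[OF xs cs]
    show "lact M (hd xs) (xs ! 1) (last xs) (hd cs) (f (tl xs) (pure_tensor K (homs C (tl xs)) (tl cs)))
        \<in> carrier (value_space xs)"
      using mlinD(1)[OF ft s(1)] vt by (intro bilinearD(3)[OF bl s(3)]) simp
    fix i assume i: "i < length (homs C xs)"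
    show "(\<lambda>x. lact M (hd xs) (xs ! 1) (last xs) (hd (cs[i := x]))
        (f (tl xs) (pure_tensor K (homs C (tl xs)) (tl (cs[i := x]))))) \<in> module_hom K (homs C xs ! i) (value_space xs)"
    proof (cases i)
      case 0
      show ?thesis unfolding 0 s(5,6,15)
        using mlinD(1)[OF ft s(1)] vt by (intro bilinearD(2)[OF bl]) simp
    next
      case (Suc j)
      then have j: "j < n" using i d(8) by simp
      have "(\<lambda>x. f (tl xs) (pure_tensor K (homs C (tl xs)) ((tl cs)[j := x])))
          \<in> module_hom K (homs C (tl xs) ! j) (Bim M (xs ! 1) (last xs))"
        using mlinD(2)[OF ft s(1), of j] j vt obj_tuplesD(8)[OF fc(1)] by simp
      then show ?thesis unfolding Suc s(7,8) s(13)[OF j]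
        by (rule hom_comp[OF _ bilinearD(1)[OF bl s(3)]])
    qed
  qed
  have 2: "mlin K (homs C xs) (value_space xs)
      (\<lambda>cs. f (remove_nth (Suc n - i) xs) (pure_tensor K (homs C (remove_nth (Suc n - i) xs)) (merge_at C xs (Suc n - i) cs)))"
    if "i \<in> {1..n}" for i
  proof -
    have i: "1 \<le> Suc n - i" "Suc n - i \<le> n" using that by auto
    show ?thesis
      using mlin_slotwise[OF cochain_mlin[OF f fc(7)[OF i]] slotwise_merge_at[OF xs i] N] fc(8,9)[OF i]
      by simp
  qed
  have 3: "mlin K (homs C xs) (value_space xs)
      (\<lambda>cs. ract M (hd xs) (xs ! n) (last xs) (f (butlast xs) (pure_tensor K (homs C (butlast xs)) (butlast cs))) (last cs))"
    unfolding mlin_def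
  proof (intro ballI conjI allI impI)
    fix cs assume cs: "cs \<in> tuples (homs C xs)"
    note s = outer_slots[OF xs cs]
    have v: "f (butlast xs) (pure_tensor K (homs C (butlast xs)) (butlast cs)) \<in> carrier (Bim M (hd xs) (xs ! n))"
      using mlinD(1)[OF fb s(2)] vb by simp
    show "ract M (hd xs) (xs ! n) (last xs) (f (butlast xs) (pure_tensor K (homs C (butlast xs)) (butlast cs))) (last cs)
        \<in> carrier (value_space xs)"
      by (rule bilinearD(3)[OF br v s(4)])
    fix i assume i: "i < length (homs C xs)"
    show "(\<lambda>x. ract M (hd xs) (xs ! n) (last xs)
        (f (butlast xs) (pure_tensor K (homs C (butlast xs)) (butlast (cs[i := x])))) (last (cs[i := x])))
        \<in> module_hom K (homs C xs ! i) (value_space xs)"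
    proof (cases "i = n")
      case True
      show ?thesis unfolding True s(9,10,16) by (rule bilinearD(1)[OF br v])
    next
      case False
      then have j: "i < n" using i d(8) by simp
      have "(\<lambda>x. f (butlast xs) (pure_tensor K (homs C (butlast xs)) ((butlast cs)[i := x])))
          \<in> module_hom K (homs C (butlast xs) ! i) (Bim M (hd xs) (xs ! n))"
        using mlinD(2)[OF fb s(2), of i] j vb obj_tuplesD(8)[OF fc(2)] by simp
      then show ?thesis unfolding s(11,12,14)[OF j]
        by (rule hom_comp[OF _ bilinearD(2)[OF br s(4)]])
    qed
  qed
  show ?thesis unfolding cobd_tuple_def[abs_def]
    by (intro mlin_add[OF _ _ V N] mlin_sum[OF _ V N] mlin_smult[OF _ _ V N] 1 2 3 sg_closed)
qed

lemma cobd_tuple_hom: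
  assumes xs: "xs \<in> obj_tuples C (Suc n)" and cs: "cs \<in> tuples (homs C xs)"
  shows "(\<lambda>f. cobd_tuple n f xs cs) \<in> module_hom K (cochains K C M n) (value_space xs)"
proof -
  note d = obj_tuplesD[OF xs] and fc = obj_tuples_faces[OF xs] and s = outer_slots[OF xs cs]
  note V = values_module[OF xs] and D = cochains_module[of n]
  have o1: "xs ! 1 \<in> Obj C" and on: "xs ! n \<in> Obj C" by (rule d(5), simp)+
  note bl = lact_bil[OF d(7) o1 d(6)] and br = ract_bil[OF d(7) on d(6)]
  have 1: "(\<lambda>f. lact M (hd xs) (xs ! 1) (last xs) (hd cs) (f (tl xs) (pure_tensor K (homs C (tl xs)) (tl cs))))
      \<in> module_hom K (cochains K C M n) (value_space xs)"
    using eval_hom[OF fc(1) s(1)] fc(3,4) by (intro hom_comp[OF _ bilinearD(1)[OF bl s(3)]]) simp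
  have 3: "(\<lambda>f. ract M (hd xs) (xs ! n) (last xs) (f (butlast xs) (pure_tensor K (homs C (butlast xs)) (butlast cs))) (last cs))
      \<in> module_hom K (cochains K C M n) (value_space xs)"
    using eval_hom[OF fc(2) s(2)] fc(5,6) by (intro hom_comp[OF _ bilinearD(2)[OF br s(4)]]) simp
  have 2: "(\<lambda>f. f (remove_nth (Suc n - i) xs)
        (pure_tensor K (homs C (remove_nth (Suc n - i) xs)) (merge_at C xs (Suc n - i) cs)))
      \<in> module_hom K (cochains K C M n) (value_space xs)" if "i \<in> {1..n}" for i
  proof -
    have i: "1 \<le> Suc n - i" "Suc n - i \<le> n" using that by auto
    have "merge_at C xs (Suc n - i) cs \<in> tuples (homs C (remove_nth (Suc n - i) xs))"
      using slotwise_merge_at[OF xs i] cs by (simp add: slotwise_def)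
    from eval_hom[OF fc(7)[OF i] this] show ?thesis using fc(8,9)[OF i] by simp
  qed
  show ?thesis unfolding cobd_tuple_def
    by (intro hom_add[OF D V] hom_sum[OF D V] hom_smult[OF D V] 1 2 3 sg_closed)
qed

lemma cochain_bd_hom: "cochain_bd K C M n \<in> module_hom K (cochains K C M n) (cochains K C M (Suc n))"
  unfolding cochain_bd_eq[abs_def]
  by (rule cochain_of_hom[OF cochains_module mlin_cobd_tuple cobd_tuple_hom])

lemma cochain_bd_pure:
  "f \<in> carrier (cochains K C M n) \<Longrightarrow> xs \<in> obj_tuples C (Suc n) \<Longrightarrow> cs \<in> tuples (homs C xs) \<Longrightarrow>
    cochain_bd K C M n f xs (pure_tensor K (homs C xs) cs) = cobd_tuple n f xs cs"
  unfolding cochain_bd_eq by (rule cochain_of_pure[OF mlin_cobd_tuple])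

end

section \<open>Maps induced by functors\<close>

text \<open>A linear functor \<open>F\<close> from \<open>\<C>\<close> to \<open>\<C>'\<close> such that \<open>\<M>\<close> is the restriction of \<open>\<M>'\<close> along \<open>F\<close>. The covering functor is
  one, by definition of the lifted bimodule, and so is every element of the group, as a functor from \<open>\<C>\<close> to
  itself that does not change the classes of morphisms. Hence the chain map property is proved once for both.\<close>

locale lin_functor = S: lin_data K C M + T: lin_data K C' M'
  for K :: "('k, 'r) ring_scheme" and C :: "('o, 'c, 'k) kcat" and M :: "('o, 'c, 'm, 'k) bimod"
    and C' :: "('p, 'd, 'k) kcat" and M' :: "('p, 'd, 'm, 'k) bimod" +
  fixes fo :: "'o \<Rightarrow> 'p" and fh :: "'o \<Rightarrow> 'o \<Rightarrow> 'c \<Rightarrow> 'd"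
  assumes fo_obj: "x \<in> Obj C \<Longrightarrow> fo x \<in> Obj C'"
    and fh_hom: "\<lbrakk>x \<in> Obj C; y \<in> Obj C\<rbrakk> \<Longrightarrow> fh y x \<in> module_hom K (Hom C y x) (Hom C' (fo y) (fo x))"
    and fh_comp: "\<lbrakk>x \<in> Obj C; y \<in> Obj C; z \<in> Obj C; c \<in> carrier (Hom C y x); d \<in> carrier (Hom C z y)\<rbrakk>
        \<Longrightarrow> fh z x (comp C z y x d c) = comp C' (fo z) (fo y) (fo x) (fh z y d) (fh y x c)"
    and fo_bim: "\<lbrakk>x \<in> Obj C; y \<in> Obj C\<rbrakk> \<Longrightarrow> Bim M' (fo y) (fo x) = Bim M y x"
    and fh_lact: "\<lbrakk>x \<in> Obj C; y \<in> Obj C; z \<in> Obj C; c \<in> carrier (Hom C z y); m \<in> carrier (Bim M y x)\<rbrakk>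
        \<Longrightarrow> lact M' (fo z) (fo y) (fo x) (fh z y c) m = lact M z y x c m"
    and fh_ract: "\<lbrakk>x \<in> Obj C; y \<in> Obj C; u \<in> Obj C; c \<in> carrier (Hom C x u); m \<in> carrier (Bim M y x)\<rbrakk>
        \<Longrightarrow> ract M' (fo y) (fo x) (fo u) m (fh x u c) = ract M y x u m c"
begin

lemma map_obj_tuples: "xs \<in> obj_tuples C n \<Longrightarrow> map fo xs \<in> obj_tuples C' n"
  using fo_obj by (auto simp: obj_tuples_def)

lemma map_ends:
  assumes "xs \<in> obj_tuples C n"
  shows "Bim M' (last (map fo xs)) (hd (map fo xs)) = Bim M (last xs) (hd xs)"
    and "Bim M' (hd (map fo xs)) (last (map fo xs)) = Bim M (hd xs) (last xs)"
  using obj_tuplesD[OF assms] by (auto simp: hd_map last_map intro!: fo_bim)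

lemma slotwise_functor:
  assumes xs: "xs \<in> obj_tuples C n"
  shows "slotwise K (homs C xs) (homs C' (map fo xs)) (map_tuple fh xs)"
proof (rule slotwise_map_tuple)
  note d = obj_tuplesD[OF xs] and e = obj_tuplesD[OF map_obj_tuples[OF xs]]
  show "length (homs C' (map fo xs)) = length (homs C xs)" using d(8) e(8) by simp
  fix i assume "i < length (homs C xs)"
  then have "i < n" by (simp add: d(8))
  then show "fh (xs ! i) (xs ! Suc i) \<in> module_hom K (homs C xs ! i) (homs C' (map fo xs) ! i)"
    using d e by (auto intro!: fh_hom)
qed

lemma map_tuple_closed:
  "xs \<in> obj_tuples C n \<Longrightarrow> cs \<in> tuples (homs C xs) \<Longrightarrow> map_tuple fh xs cs \<in> tuples (homs C' (map fo xs))"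
  using slotwise_functor by (simp add: slotwise_def)

lemma map_tuple_faces:
  assumes xs: "xs \<in> obj_tuples C (Suc n)" and cs: "cs \<in> tuples (homs C xs)"
  shows "map_tuple fh (tl xs) (tl cs) = tl (map_tuple fh xs cs)"
    and "map_tuple fh (butlast xs) (butlast cs) = butlast (map_tuple fh xs cs)"
    and "hd (map_tuple fh xs cs) = fh (hd xs) (xs ! 1) (hd cs)"
    and "last (map_tuple fh xs cs) = fh (xs ! n) (last xs) (last cs)"
    and "1 \<le> i \<Longrightarrow> i \<le> n \<Longrightarrow>
      map_tuple fh (remove_nth i xs) (merge_at C xs i cs) = merge_at C' (map fo xs) i (map_tuple fh xs cs)"
    and "map fo (remove_nth i xs) = remove_nth i (map fo xs)"
proof -
  note d = obj_tuplesD[OF xs]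
  have len: "length cs = Suc n" using cs d by (simp add: tuples_iff)
  have lenm: "length (map_tuple fh xs cs) = Suc n" using len by simp
  have ne: "cs \<noteq> []" "map_tuple fh xs cs \<noteq> []" using len lenm by (auto simp del: map_tuple_simps(1))
  show "map_tuple fh (tl xs) (tl cs) = tl (map_tuple fh xs cs)"
    using len d(1) by (intro nth_equalityI) (auto simp: nth_tl)
  show "map_tuple fh (butlast xs) (butlast cs) = butlast (map_tuple fh xs cs)"
    using len d(1) by (intro nth_equalityI) (auto simp: nth_butlast)
  show "hd (map_tuple fh xs cs) = fh (hd xs) (xs ! 1) (hd cs)"
    using len d(3) ne by (simp add: hd_conv_nth)
  show "last (map_tuple fh xs cs) = fh (xs ! n) (last xs) (last cs)"
    using len d(4) ne by (simp add: last_conv_nth)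
  show "map fo (remove_nth i xs) = remove_nth i (map fo xs)"
    by (simp add: remove_nth_def take_map drop_map)
  assume i: "1 \<le> i" "i \<le> n"
  note m = merge_at_nth[OF len i] and m' = merge_at_nth[OF lenm i]
  have csj: "cs ! j \<in> carrier (Hom C (xs ! j) (xs ! Suc j))" if "j \<le> n" for j
    using cs d that by (simp add: tuples_iff)
  have c: "fh (xs ! (i - 1)) (xs ! Suc i) (comp C (xs ! (i - 1)) (xs ! i) (xs ! Suc i) (cs ! (i - 1)) (cs ! i)) =
      comp C' (fo (xs ! (i - 1))) (fo (xs ! i)) (fo (xs ! Suc i)) (fh (xs ! (i - 1)) (xs ! i) (cs ! (i - 1)))
        (fh (xs ! i) (xs ! Suc i) (cs ! i))"
    using csj[of i] csj[of "i - 1"] i by (intro fh_comp d(5)) auto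
  show "map_tuple fh (remove_nth i xs) (merge_at C xs i cs) = merge_at C' (map fo xs) i (map_tuple fh xs cs)"
  proof (rule nth_equalityI)
    show "length (map_tuple fh (remove_nth i xs) (merge_at C xs i cs)) =
        length (merge_at C' (map fo xs) i (map_tuple fh xs cs))" by (simp add: m(1) m'(1))
    fix j assume "j < length (map_tuple fh (remove_nth i xs) (merge_at C xs i cs))"
    then have j: "j < n" by (simp add: m(1))
    then show "map_tuple fh (remove_nth i xs) (merge_at C xs i cs) ! j =
        merge_at C' (map fo xs) i (map_tuple fh xs cs) ! j"
      using i d(1) len c by (auto simp: m m' remove_nth_nth)
  qed
qed

definition push where
  "push n = chain_lift K C M n (chains K C' M' n)
    (\<lambda>xs (m, cs). chain_gen K C' M' n (map fo xs) (m, map_tuple fh xs cs))"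

lemma mlin1_push:
  assumes xs: "xs \<in> obj_tuples C n"
  shows "mlin1 K (Bim M (last xs) (hd xs)) (homs C xs) (chains K C' M' n)
    (\<lambda>(m, cs). chain_gen K C' M' n (map fo xs) (m, map_tuple fh xs cs))"
proof -
  have "mlin1 K (Bim M (last xs) (hd xs)) (homs C xs) (chains K C' M' n)
    (\<lambda>t. chain_gen K C' M' n (map fo xs) ((\<lambda>(m, cs). (m, map_tuple fh xs cs)) t))"
    by (rule mlin1_slotwise1[OF T.mlin1_chain_gen[OF map_obj_tuples[OF xs], unfolded map_ends(1)[OF xs]]
          slotwise1_right[OF slotwise_functor[OF xs]] S.coeffs_module[OF xs] S.homs_module[OF xs]])
  then show ?thesis by (simp add: case_prod_unfold)
qed

lemma push_hom: "push n \<in> module_hom K (chains K C M n) (chains K C' M' n)"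
  unfolding push_def by (rule S.chain_lift_hom[OF T.chains_module mlin1_push])

lemma push_gen:
  assumes "xs \<in> obj_tuples C n" "m \<in> carrier (Bim M (last xs) (hd xs))" "cs \<in> tuples (homs C xs)"
  shows "push n (chain_gen K C M n xs (m, cs)) = chain_gen K C' M' n (map fo xs) (m, map_tuple fh xs cs)"
  unfolding push_def
  by (subst S.chain_lift_gen[OF T.chains_module mlin1_push assms(1)]) (use assms in \<open>auto simp: tuples1_def\<close>)

text \<open>The functor commutes with each face: with the inner ones because it preserves composition, with the
  outer ones because morphisms act on \<open>\<M>\<close> through their images.\<close>

lemma push_bd:
  assumes c: "c \<in> carrier (chains K C M (Suc n))"
  shows "push n (chain_bd K C M n c) = chain_bd K C' M' n (push (Suc n) c)"
proof (rule S.chains_ext[OF T.chains_module hom_comp[OF S.chain_bd_hom push_hom]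
      hom_comp[OF push_hom T.chain_bd_hom] _ c])
  fix xs m cs assume xs: "xs \<in> obj_tuples C (Suc n)" and m: "m \<in> carrier (Bim M (last xs) (hd xs))"
    and cs: "cs \<in> tuples (homs C xs)"
  note d = obj_tuplesD[OF xs] and fc = obj_tuples_faces[OF xs] and s = S.outer_slots[OF xs cs]
  note xs' = map_obj_tuples[OF xs] and cs' = map_tuple_closed[OF xs cs] and mt = map_tuple_faces[OF xs cs]
  have o1: "xs ! 1 \<in> Obj C" and on: "xs ! n \<in> Obj C" by (rule d(5), simp)+
  have mr: "ract M (last xs) (hd xs) (xs ! 1) m (hd cs) \<in> carrier (Bim M (last xs) (xs ! 1))"
    by (rule bilinearD(3)[OF S.ract_bil[OF o1 d(6,7)] m s(3)])
  have ml: "lact M (xs ! n) (last xs) (hd xs) (last cs) m \<in> carrier (Bim M (xs ! n) (hd xs))"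
    by (rule bilinearD(3)[OF S.lact_bil[OF d(6,7) on] s(4) m])
  interpret D: module K "chains K C M n" by (rule S.chains_module)
  interpret D': module K "chains K C' M' n" by (rule T.chains_module)
  let ?g = "chain_gen K C M n" and ?g' = "chain_gen K C' M' n"
  have g1: "?g (tl xs) (ract M (last xs) (hd xs) (xs ! 1) m (hd cs), tl cs) \<in> carrier (chains K C M n)"
    by (rule mlin1D(3)[OF S.mlin1_chain_gen[OF fc(1)]]) (use mr s(1) fc in simp_all)
  have g3: "?g (butlast xs) (lact M (xs ! n) (last xs) (hd xs) (last cs) m, butlast cs) \<in> carrier (chains K C M n)"
    by (rule mlin1D(3)[OF S.mlin1_chain_gen[OF fc(2)]]) (use ml s(2) fc in simp_all)
  have mc: "merge_at C xs i cs \<in> tuples (homs C (remove_nth i xs))" if "i \<in> {1..n}" for i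
    using S.slotwise_merge_at[OF xs, of i] cs that by (simp add: slotwise_def)
  have g2: "?g (remove_nth i xs) (m, merge_at C xs i cs) \<in> carrier (chains K C M n)" if "i \<in> {1..n}" for i
    by (rule mlin1D(3)[OF S.mlin1_chain_gen[OF fc(7)]]) (use m mc[OF that] fc(8,9)[of i] that in simp_all)
  have h1: "push n (?g (tl xs) (ract M (last xs) (hd xs) (xs ! 1) m (hd cs), tl cs)) =
      ?g' (tl (map fo xs)) (ract M' (last (map fo xs)) (hd (map fo xs)) (map fo xs ! 1) m (hd (map_tuple fh xs cs)),
        tl (map_tuple fh xs cs))"
    using fh_ract[OF d(6,7) o1 s(3) m] d(1,2)
    by (subst push_gen[OF fc(1)]) (use mr s(1) fc in \<open>simp_all add: mt map_tl hd_map last_map\<close>)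
  have h3: "push n (?g (butlast xs) (lact M (xs ! n) (last xs) (hd xs) (last cs) m, butlast cs)) =
      ?g' (butlast (map fo xs)) (lact M' (map fo xs ! n) (last (map fo xs)) (hd (map fo xs)) (last (map_tuple fh xs cs)) m,
        butlast (map_tuple fh xs cs))"
    using fh_lact[OF d(6,7) on s(4) m] d(1,2)
    by (subst push_gen[OF fc(2)]) (use ml s(2) fc in \<open>simp_all add: mt map_butlast hd_map last_map\<close>)
  have h2: "push n (S.sg i \<odot>\<^bsub>chains K C M n\<^esub> ?g (remove_nth i xs) (m, merge_at C xs i cs)) =
      S.sg i \<odot>\<^bsub>chains K C' M' n\<^esub> ?g' (remove_nth i (map fo xs)) (m, merge_at C' (map fo xs) i (map_tuple fh xs cs))"
    if i: "i \<in> {1..n}" for i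
  proof -
    have i': "1 \<le> i" "i \<le> n" using i by auto
    have "push n (?g (remove_nth i xs) (m, merge_at C xs i cs)) =
        ?g' (remove_nth i (map fo xs)) (m, merge_at C' (map fo xs) i (map_tuple fh xs cs))"
      using m mc[OF i] fc(8,9)[OF i'] by (subst push_gen[OF fc(7)[OF i']]) (simp_all add: mt(5)[OF i'] mt(6))
    then show ?thesis using module_hom_smult[OF push_hom S.sg_closed g2[OF i]] by simp
  qed
  have "push n (chain_bd K C M n (chain_gen K C M (Suc n) xs (m, cs))) =
      push n (S.bd_tuple n xs (m, cs))"
    using m cs by (subst S.chain_bd_gen[OF xs]) (simp_all add: tuples1_def)
  also have "\<dots> = T.bd_tuple n (map fo xs) (m, map_tuple fh xs cs)"
  proof -
    have su: "(\<lambda>i. S.sg i \<odot>\<^bsub>chains K C M n\<^esub> ?g (remove_nth i xs) (m, merge_at C xs i cs))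
        \<in> {1..n} \<rightarrow> carrier (chains K C M n)" using g2 by auto
    have "push n (\<Oplus>\<^bsub>chains K C M n\<^esub>i\<in>{1..n}. S.sg i \<odot>\<^bsub>chains K C M n\<^esub> ?g (remove_nth i xs) (m, merge_at C xs i cs)) =
      (\<Oplus>\<^bsub>chains K C' M' n\<^esub>i\<in>{1..n}. push n (S.sg i \<odot>\<^bsub>chains K C M n\<^esub> ?g (remove_nth i xs) (m, merge_at C xs i cs)))"
      by (rule S.hom_finsum[OF push_hom D.module_axioms D'.module_axioms su])
    also have "\<dots> = (\<Oplus>\<^bsub>chains K C' M' n\<^esub>i\<in>{1..n}. S.sg i \<odot>\<^bsub>chains K C' M' n\<^esub>
        ?g' (remove_nth i (map fo xs)) (m, merge_at C' (map fo xs) i (map_tuple fh xs cs)))"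
      using hom_in[OF push_hom funcset_mem[OF su]] h2 by (intro D'.finsum_cong') auto
    finally show ?thesis
      using g1 g3 D.finsum_closed[OF su]
      by (simp add: S.bd_tuple_def T.bd_tuple_def module_hom_add[OF push_hom] module_hom_smult[OF push_hom] h1 h3
          del: One_nat_def)
  qed
  also have "\<dots> = chain_bd K C' M' n (push (Suc n) (chain_gen K C M (Suc n) xs (m, cs)))"
    using m cs' map_ends(1)[OF xs]
    by (subst push_gen[OF xs m cs], subst T.chain_bd_gen[OF xs']) (simp_all add: tuples1_def)
  finally show "push n (chain_bd K C M n (chain_gen K C M (Suc n) xs (m, cs))) =
      chain_bd K C' M' n (push (Suc n) (chain_gen K C M (Suc n) xs (m, cs)))" .
qed

definition pull where
  "pull n f = cochain_of K C M n
    (\<lambda>xs cs. f (map fo xs) (pure_tensor K (homs C' (map fo xs)) (map_tuple fh xs cs)))"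

lemma mlin_pull:
  assumes f: "f \<in> carrier (cochains K C' M' n)" and xs: "xs \<in> obj_tuples C n"
  shows "mlin K (homs C xs) (Bim M (hd xs) (last xs))
    (\<lambda>cs. f (map fo xs) (pure_tensor K (homs C' (map fo xs)) (map_tuple fh xs cs)))"
  by (rule mlin_slotwise[OF T.cochain_mlin[OF f map_obj_tuples[OF xs], unfolded map_ends(2)[OF xs]]
        slotwise_functor[OF xs] S.homs_module[OF xs]])

lemma pull_hom: "pull n \<in> module_hom K (cochains K C' M' n) (cochains K C M n)"
  unfolding pull_def[abs_def]
proof (rule S.cochain_of_hom[OF T.cochains_module mlin_pull])
  fix xs cs assume xs: "xs \<in> obj_tuples C n" and cs: "cs \<in> tuples (homs C xs)"
  show "(\<lambda>f. f (map fo xs) (pure_tensor K (homs C' (map fo xs)) (map_tuple fh xs cs)))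
      \<in> module_hom K (cochains K C' M' n) (Bim M (hd xs) (last xs))"
    using T.eval_hom[OF map_obj_tuples[OF xs] map_tuple_closed[OF xs cs]] map_ends(2)[OF xs] by simp
qed

lemma pull_pure:
  "f \<in> carrier (cochains K C' M' n) \<Longrightarrow> xs \<in> obj_tuples C n \<Longrightarrow> cs \<in> tuples (homs C xs) \<Longrightarrow>
    pull n f xs (pure_tensor K (homs C xs) cs) =
      f (map fo xs) (pure_tensor K (homs C' (map fo xs)) (map_tuple fh xs cs))"
  unfolding pull_def by (rule S.cochain_of_pure[OF mlin_pull])

lemma pull_bd:
  assumes f: "f \<in> carrier (cochains K C' M' n)"
  shows "pull (Suc n) (cochain_bd K C' M' n f) = cochain_bd K C M n (pull n f)"
proof (rule S.cochain_ext)
  note bf = hom_in[OF T.cochain_bd_hom f] and pf = hom_in[OF pull_hom f]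
  show "pull (Suc n) (cochain_bd K C' M' n f) \<in> carrier (cochains K C M (Suc n))"
    by (rule hom_in[OF pull_hom bf])
  show "cochain_bd K C M n (pull n f) \<in> carrier (cochains K C M (Suc n))"
    by (rule hom_in[OF S.cochain_bd_hom pf])
  fix xs cs assume xs: "xs \<in> obj_tuples C (Suc n)" and cs: "cs \<in> tuples (homs C xs)"
  note d = obj_tuplesD[OF xs] and fc = obj_tuples_faces[OF xs] and s = S.outer_slots[OF xs cs]
  note xs' = map_obj_tuples[OF xs] and cs' = map_tuple_closed[OF xs cs] and mt = map_tuple_faces[OF xs cs]
  have o1: "xs ! 1 \<in> Obj C" and on: "xs ! n \<in> Obj C" by (rule d(5), simp)+
  let ?V = "Bim M (hd xs) (last xs)"
  interpret V: module K ?V by (rule S.values_module[OF xs])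
  have t: "pull n f (tl xs) (pure_tensor K (homs C (tl xs)) (tl cs)) =
      f (tl (map fo xs)) (pure_tensor K (homs C' (tl (map fo xs))) (tl (map_tuple fh xs cs)))"
    by (subst pull_pure[OF f fc(1) s(1)]) (simp add: mt map_tl)
  have b: "pull n f (butlast xs) (pure_tensor K (homs C (butlast xs)) (butlast cs)) =
      f (butlast (map fo xs)) (pure_tensor K (homs C' (butlast (map fo xs))) (butlast (map_tuple fh xs cs)))"
    by (subst pull_pure[OF f fc(2) s(2)]) (simp add: mt map_butlast)
  have m: "pull n f (remove_nth i xs) (pure_tensor K (homs C (remove_nth i xs)) (merge_at C xs i cs)) =
      f (remove_nth i (map fo xs)) (pure_tensor K (homs C' (remove_nth i (map fo xs)))
        (merge_at C' (map fo xs) i (map_tuple fh xs cs)))" if i: "1 \<le> i" "i \<le> n" for i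
  proof -
    have "merge_at C xs i cs \<in> tuples (homs C (remove_nth i xs))"
      using S.slotwise_merge_at[OF xs i] cs by (simp add: slotwise_def)
    then show ?thesis by (subst pull_pure[OF f fc(7)[OF i]]) (simp_all add: mt(5)[OF i] mt(6))
  qed
  have vt: "pull n f (tl xs) (pure_tensor K (homs C (tl xs)) (tl cs)) \<in> carrier (Bim M (xs ! 1) (last xs))"
    using mlinD(1)[OF S.cochain_mlin[OF pf fc(1)] s(1)] fc by simp
  have vb: "pull n f (butlast xs) (pure_tensor K (homs C (butlast xs)) (butlast cs)) \<in> carrier (Bim M (hd xs) (xs ! n))"
    using mlinD(1)[OF S.cochain_mlin[OF pf fc(2)] s(2)] fc by simp
  have vm: "pull n f (remove_nth i xs) (pure_tensor K (homs C (remove_nth i xs)) (merge_at C xs i cs)) \<in> carrier ?V"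
    if i: "1 \<le> i" "i \<le> n" for i
  proof -
    have "merge_at C xs i cs \<in> tuples (homs C (remove_nth i xs))"
      using S.slotwise_merge_at[OF xs i] cs by (simp add: slotwise_def)
    then show ?thesis using mlinD(1)[OF S.cochain_mlin[OF pf fc(7)[OF i]]] fc(8,9)[OF i] by simp
  qed
  have "pull (Suc n) (cochain_bd K C' M' n f) xs (pure_tensor K (homs C xs) cs) =
      T.cobd_tuple n f (map fo xs) (map_tuple fh xs cs)"
    by (simp add: pull_pure[OF bf xs cs] T.cochain_bd_pure[OF f xs' cs'])
  also have "\<dots> = S.cobd_tuple n (pull n f) xs cs"
  proof -
    have 1: "lact M' (hd (map fo xs)) (map fo xs ! 1) (last (map fo xs)) (hd (map_tuple fh xs cs))
        (f (tl (map fo xs)) (pure_tensor K (homs C' (tl (map fo xs))) (tl (map_tuple fh xs cs)))) =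
      lact M (hd xs) (xs ! 1) (last xs) (hd cs) (pull n f (tl xs) (pure_tensor K (homs C (tl xs)) (tl cs)))"
      using fh_lact[OF d(7) o1 d(6) s(3) vt] d(1,2) by (simp add: mt hd_map last_map flip: t)
    have 3: "ract M' (hd (map fo xs)) (map fo xs ! n) (last (map fo xs))
        (f (butlast (map fo xs)) (pure_tensor K (homs C' (butlast (map fo xs))) (butlast (map_tuple fh xs cs))))
        (last (map_tuple fh xs cs)) =
      ract M (hd xs) (xs ! n) (last xs) (pull n f (butlast xs) (pure_tensor K (homs C (butlast xs)) (butlast cs))) (last cs)"
      using fh_ract[OF on d(6) d(7) s(4) vb] d(1,2) by (simp add: mt hd_map last_map flip: b)
    have 2: "(\<Oplus>\<^bsub>?V\<^esub> i \<in> {1..n}. S.sg i \<odot>\<^bsub>?V\<^esub>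
        f (remove_nth (Suc n - i) (map fo xs)) (pure_tensor K (homs C' (remove_nth (Suc n - i) (map fo xs)))
          (merge_at C' (map fo xs) (Suc n - i) (map_tuple fh xs cs)))) =
      (\<Oplus>\<^bsub>?V\<^esub> i \<in> {1..n}. S.sg i \<odot>\<^bsub>?V\<^esub>
        pull n f (remove_nth (Suc n - i) xs) (pure_tensor K (homs C (remove_nth (Suc n - i) xs)) (merge_at C xs (Suc n - i) cs)))"
      using vm by (intro V.finsum_cong') (auto simp: m)
    show ?thesis
      unfolding S.cobd_tuple_def T.cobd_tuple_def map_ends(2)[OF xs] 1 2 3 ..
  qed
  also have "\<dots> = cochain_bd K C M n (pull n f) xs (pure_tensor K (homs C xs) cs)"
    by (simp add: S.cochain_bd_pure[OF pf xs cs])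
  finally show "pull (Suc n) (cochain_bd K C' M' n f) xs (pure_tensor K (homs C xs) cs) =
      cochain_bd K C M n (pull n f) xs (pure_tensor K (homs C xs) cs)" .
qed

end

section \<open>Coinvariants, invariants and transfer\<close>

lemma finsum_translate:
  assumes V: "abelian_monoid V" and G: "group G" and u: "u \<in> carrier G" and h: "h \<in> carrier G \<rightarrow> carrier V"
  shows "(\<Oplus>\<^bsub>V\<^esub>s\<in>carrier G. h (s \<otimes>\<^bsub>G\<^esub> u)) = (\<Oplus>\<^bsub>V\<^esub>s\<in>carrier G. h s)"
proof -
  interpret V: abelian_monoid V by fact
  interpret G: group G by fact
  have "(\<lambda>s. s \<otimes>\<^bsub>G\<^esub> u) ` carrier G = carrier G"
  proof (intro equalityI subsetI)
    fix s assume "s \<in> carrier G"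
    then show "s \<in> (\<lambda>s. s \<otimes>\<^bsub>G\<^esub> u) ` carrier G"
      using u by (intro image_eqI[where x = "s \<otimes>\<^bsub>G\<^esub> inv\<^bsub>G\<^esub> u"]) (simp_all add: G.m_assoc)
  qed (use u in auto)
  moreover have "inj_on (\<lambda>s. s \<otimes>\<^bsub>G\<^esub> u) (carrier G)" using u by (auto intro: inj_onI)
  ultimately show ?thesis using V.finsum_reindex[of h "\<lambda>s. s \<otimes>\<^bsub>G\<^esub> u" "carrier G"] h by auto
qed

lemma finsum_cartesian:
  assumes V: "abelian_monoid V" and "finite I" and J: "finite J"
    and h: "\<And>i j. i \<in> I \<Longrightarrow> j \<in> J \<Longrightarrow> h i j \<in> carrier V"
  shows "(\<Oplus>\<^bsub>V\<^esub>k\<in>I \<times> J. h (fst k) (snd k)) = (\<Oplus>\<^bsub>V\<^esub>i\<in>I. \<Oplus>\<^bsub>V\<^esub>j\<in>J. h i j)"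
  using assms(2) h
proof (induction I)
  case empty
  interpret V: abelian_monoid V by fact
  show ?case by simp
next
  case (insert i I)
  interpret V: abelian_monoid V by fact
  have hi: "h i j \<in> carrier V" if "j \<in> J" for j using insert.prems that by simp
  have hI: "h k j \<in> carrier V" if "k \<in> I" "j \<in> J" for k j using insert.prems that by simp
  have "insert i I \<times> J = (\<lambda>j. (i, j)) ` J \<union> I \<times> J" by auto
  then have "(\<Oplus>\<^bsub>V\<^esub>k\<in>insert i I \<times> J. h (fst k) (snd k)) =
      (\<Oplus>\<^bsub>V\<^esub>k\<in>(\<lambda>j. (i, j)) ` J. h (fst k) (snd k)) \<oplus>\<^bsub>V\<^esub> (\<Oplus>\<^bsub>V\<^esub>k\<in>I \<times> J. h (fst k) (snd k))"
    using insert.hyps J hi hI by (simp, intro V.finsum_Un_disjoint) auto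
  also have "(\<Oplus>\<^bsub>V\<^esub>k\<in>(\<lambda>j. (i, j)) ` J. h (fst k) (snd k)) = (\<Oplus>\<^bsub>V\<^esub>j\<in>J. h i j)"
    using hi by (subst V.finsum_reindex) (auto intro: inj_onI)
  also have "(\<Oplus>\<^bsub>V\<^esub>k\<in>I \<times> J. h (fst k) (snd k)) = (\<Oplus>\<^bsub>V\<^esub>i\<in>I. \<Oplus>\<^bsub>V\<^esub>j\<in>J. h i j)"
    by (rule insert.IH[OF hI])
  finally show ?case using insert.hyps hi hI by (simp add: Pi_def)
qed

context cring
begin

lemma augmentation_finite:
  assumes fin: "finite (carrier G)" and X: "module R X"
    and a: "a \<in> carrier G \<rightarrow> carrier X"
    and r: "r \<in> carrier (free_space R (carrier G))"
  shows "free_lift R (carrier G) X a r = (\<Oplus>\<^bsub>X\<^esub>s\<in>carrier G. r s \<odot>\<^bsub>X\<^esub> a s)"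
    and "augmentation R G r = (\<Oplus>s\<in>carrier G. r s)"
proof -
  interpret X: module R X by fact
  have rs: "r s \<in> carrier R" if "s \<in> carrier G" for s
    using r that by (auto simp: free_space_def dsum_space_simps self_space_def)
  show "free_lift R (carrier G) X a r = (\<Oplus>\<^bsub>X\<^esub>s\<in>carrier G. r s \<odot>\<^bsub>X\<^esub> a s)"
    unfolding free_lift_def
    by (rule finsum_mono_neutral) (use fin rs a in \<open>auto simp: funcset_mem[OF a] dsum_supp_def self_space_def X.abelian_monoid_axioms\<close>)
  show "augmentation R G r = (\<Oplus>s\<in>carrier G. r s)"
    unfolding augmentation_def
    by (rule finsum_mono_neutral) (use fin rs in \<open>auto simp: dsum_supp_def self_space_def abelian_monoid_axioms\<close>)
qed

lemma augmentation_gens_closed: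
  assumes X: "module R X" and act: "\<And>s x. s \<in> carrier G \<Longrightarrow> x \<in> carrier X \<Longrightarrow> act s x \<in> carrier X"
  shows "{free_lift R (carrier G) X (\<lambda>s. act s x) r | r x.
        r \<in> carrier (free_space R (carrier G)) \<and> augmentation R G r = \<zero> \<and> x \<in> carrier X} \<subseteq> carrier X"
proof clarify
  fix r x assume "r \<in> carrier (free_space R (carrier G))" and x: "x \<in> carrier X"
  then show "free_lift R (carrier G) X (\<lambda>s. act s x) r \<in> carrier X"
    by (intro hom_in[OF free_lift_hom[OF X]] act)
qed

lemma augmentation_span_submodule:
  assumes "module R X" "\<And>s x. s \<in> carrier G \<Longrightarrow> x \<in> carrier X \<Longrightarrow> act s x \<in> carrier X"
  shows "LinearCombinations.submodule R (augmentation_span R G X act) X"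
  unfolding augmentation_span_def by (rule span_submodule[OF assms(1) augmentation_gens_closed[OF assms]])

text \<open>Linear maps that are constant on orbits factor through the coinvariants, since such a map \<open>f\<close> sends
  \<open>\<Sum>\<^sub>s r\<^sub>s (s x)\<close> to \<open>(\<Sum>\<^sub>s r\<^sub>s) f x\<close>.\<close>

lemma augmentation_span_killed:
  assumes fin: "finite (carrier G)" and X: "module R X" and U: "module R U"
    and act: "\<And>s x. s \<in> carrier G \<Longrightarrow> x \<in> carrier X \<Longrightarrow> act s x \<in> carrier X"
    and f: "f \<in> module_hom R X U"
    and inv: "\<And>s x. s \<in> carrier G \<Longrightarrow> x \<in> carrier X \<Longrightarrow> f (act s x) = f x"
    and x: "x \<in> augmentation_span R G X act"
  shows "f x = \<zero>\<^bsub>U\<^esub>"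
proof (rule hom_kills_span[OF f X U augmentation_gens_closed[OF X act] _ x[unfolded augmentation_span_def]])
  interpret X: module R X by fact
  interpret U: module R U by fact
  fix g assume "g \<in> {free_lift R (carrier G) X (\<lambda>s. act s x) r | r x.
        r \<in> carrier (free_space R (carrier G)) \<and> augmentation R G r = \<zero> \<and> x \<in> carrier X}"
  then obtain r x where g: "g = free_lift R (carrier G) X (\<lambda>s. act s x) r"
    and r: "r \<in> carrier (free_space R (carrier G))" "augmentation R G r = \<zero>" and x: "x \<in> carrier X" by blast
  have rs: "r s \<in> carrier R" if "s \<in> carrier G" for s
    using r that by (auto simp: free_space_def dsum_space_simps self_space_def)
  have ax: "(\<lambda>s. act s x) \<in> carrier G \<rightarrow> carrier X" using act x by auto
  note e = augmentation_finite[OF fin X ax r(1)]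
  have a: "(\<lambda>s. r s \<odot>\<^bsub>X\<^esub> act s x) \<in> carrier G \<rightarrow> carrier X" using rs act x by auto
  have "f g = (\<Oplus>\<^bsub>U\<^esub>s\<in>carrier G. f (r s \<odot>\<^bsub>X\<^esub> act s x))"
    unfolding g e(1) by (rule hom_finsum[OF f X U a])
  also have "\<dots> = (\<Oplus>\<^bsub>U\<^esub>s\<in>carrier G. r s \<odot>\<^bsub>U\<^esub> f x)"
    using rs act x hom_in[OF f] by (intro U.finsum_cong') (auto simp: module_hom_smult[OF f] inv)
  also have "\<dots> = (\<Oplus>\<^bsub>self_space R\<^esub>s\<in>carrier G. r s) \<odot>\<^bsub>U\<^esub> f x"
    using rs by (intro hom_finsum[OF scale_hom[OF U hom_in[OF f x]] self_space_module U, symmetric])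
      (auto simp: self_space_def)
  also have "(\<Oplus>\<^bsub>self_space R\<^esub>s\<in>carrier G. r s) = (\<Oplus>s\<in>carrier G. r s)"
    by (simp add: finsum_def finprod_def self_space_def)
  finally show "f g = \<zero>\<^bsub>U\<^esub>" using r(2) e(2) hom_in[OF f x] by simp
qed

lemma augmentation_spanI:
  assumes fin: "finite (carrier G)" and X: "module R X"
    and act: "\<And>s x. s \<in> carrier G \<Longrightarrow> x \<in> carrier X \<Longrightarrow> act s x \<in> carrier X"
    and r: "\<And>s. s \<in> carrier G \<Longrightarrow> r s \<in> carrier R" "(\<Oplus>s\<in>carrier G. r s) = \<zero>" and x: "x \<in> carrier X"
  shows "(\<Oplus>\<^bsub>X\<^esub>s\<in>carrier G. r s \<odot>\<^bsub>X\<^esub> act s x) \<in> augmentation_span R G X act"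
proof -
  interpret X: module R X by fact
  let ?r = "restrict r (carrier G)"
  have r': "?r \<in> carrier (free_space R (carrier G))"
    using r(1) finite_subset[OF _ fin] by (auto simp: free_space_def dsum_space_simps self_space_def dsum_supp_def)
  have ax: "(\<lambda>s. act s x) \<in> carrier G \<rightarrow> carrier X" using act x by auto
  note e = augmentation_finite[OF fin X ax r']
  have "augmentation R G ?r = (\<Oplus>s\<in>carrier G. r s)"
    unfolding e(2) using r(1) by (intro finsum_cong') auto
  moreover have "free_lift R (carrier G) X (\<lambda>s. act s x) ?r = (\<Oplus>\<^bsub>X\<^esub>s\<in>carrier G. r s \<odot>\<^bsub>X\<^esub> act s x)"
    unfolding e(1) using r(1) act x by (intro X.finsum_cong') auto
  ultimately have "(\<Oplus>\<^bsub>X\<^esub>s\<in>carrier G. r s \<odot>\<^bsub>X\<^esub> act s x) \<in> {free_lift R (carrier G) X (\<lambda>s. act s x) r | r x.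
        r \<in> carrier (free_space R (carrier G)) \<and> augmentation R G r = \<zero> \<and> x \<in> carrier X}"
    using r' r(2) x by (intro CollectI exI[of _ ?r] exI[of _ x]) simp
  then show ?thesis
    unfolding augmentation_span_def by (rule span_incl[OF X augmentation_gens_closed[OF X], rotated]) (rule act)
qed

text \<open>The element \<open>s - 1\<close> of the group algebra has augmentation zero.\<close>

lemma augmentation_span_diff:
  assumes G: "group G" and fin: "finite (carrier G)" and X: "module R X"
    and act: "\<And>s x. s \<in> carrier G \<Longrightarrow> x \<in> carrier X \<Longrightarrow> act s x \<in> carrier X"
    and one: "act \<one>\<^bsub>G\<^esub> x = x" and s: "s \<in> carrier G" and x: "x \<in> carrier X"
  shows "act s x \<ominus>\<^bsub>X\<^esub> x \<in> augmentation_span R G X act"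
proof -
  interpret X: module R X by fact
  interpret G: group G by fact
  let ?d = "\<lambda>u s. if u = s then \<one> else \<zero>"
  let ?r = "\<lambda>g. ?d s g \<oplus> \<ominus> ?d \<one>\<^bsub>G\<^esub> g"
  have d: "(\<Oplus>g\<in>carrier G. ?d u g) = \<one>" if "u \<in> carrier G" for u
    using finsum_singleton[OF that fin, of "\<lambda>_. \<one>"] by simp
  have dm: "(\<Oplus>g\<in>carrier G. \<ominus> ?d \<one>\<^bsub>G\<^esub> g) = \<ominus> \<one>"
    using finsum_singleton[OF G.one_closed fin, of "\<lambda>_. \<ominus> \<one>"] by (simp add: if_distrib[of "a_inv R"] cong: if_cong)
  have "(\<Oplus>g\<in>carrier G. ?r g) = (\<Oplus>g\<in>carrier G. ?d s g) \<oplus> (\<Oplus>g\<in>carrier G. \<ominus> ?d \<one>\<^bsub>G\<^esub> g)"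
    by (intro finsum_addf) auto
  then have r0: "(\<Oplus>g\<in>carrier G. ?r g) = \<zero>" unfolding d[OF s] dm by (simp add: r_neg)
  have ax: "(\<lambda>g. act g x) \<in> carrier G \<rightarrow> carrier X" "(\<lambda>g. \<ominus>\<^bsub>X\<^esub> act g x) \<in> carrier G \<rightarrow> carrier X" using act x by auto
  have "(\<Oplus>\<^bsub>X\<^esub>g\<in>carrier G. ?r g \<odot>\<^bsub>X\<^esub> act g x) =
      (\<Oplus>\<^bsub>X\<^esub>g\<in>carrier G. (if s = g then act g x else \<zero>\<^bsub>X\<^esub>) \<oplus>\<^bsub>X\<^esub> (if \<one>\<^bsub>G\<^esub> = g then \<ominus>\<^bsub>X\<^esub> act g x else \<zero>\<^bsub>X\<^esub>))"
    using act x by (intro X.finsum_cong') (auto simp: X.smult_l_distr X.smult_l_minus X.smult_minus_1)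
  also have "\<dots> = (\<Oplus>\<^bsub>X\<^esub>g\<in>carrier G. if s = g then act g x else \<zero>\<^bsub>X\<^esub>) \<oplus>\<^bsub>X\<^esub>
      (\<Oplus>\<^bsub>X\<^esub>g\<in>carrier G. if \<one>\<^bsub>G\<^esub> = g then \<ominus>\<^bsub>X\<^esub> act g x else \<zero>\<^bsub>X\<^esub>)"
    using act x by (intro X.finsum_addf) auto
  also have "\<dots> = act s x \<ominus>\<^bsub>X\<^esub> x"
    unfolding X.finsum_singleton[OF s fin ax(1)] X.finsum_singleton[OF G.one_closed fin ax(2)] one
    by (simp add: X.minus_eq)
  finally have "(\<Oplus>\<^bsub>X\<^esub>g\<in>carrier G. ?r g \<odot>\<^bsub>X\<^esub> act g x) = act s x \<ominus>\<^bsub>X\<^esub> x" .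
  moreover have "(\<Oplus>\<^bsub>X\<^esub>g\<in>carrier G. ?r g \<odot>\<^bsub>X\<^esub> act g x) \<in> augmentation_span R G X act"
    by (rule augmentation_spanI[where act = act, OF fin X _ _ r0 x]) (simp_all add: act)
  ultimately show ?thesis by simp
qed

lemma smult_nat: "module R V \<Longrightarrow> x \<in> carrier V \<Longrightarrow> [n] \<cdot>\<^bsub>V\<^esub> x = ([n] \<cdot> \<one>) \<odot>\<^bsub>V\<^esub> x" for n :: nat
proof (induction n)
  case 0
  interpret V: module R V by fact
  show ?case using 0 by simp
next
  case (Suc n)
  interpret V: module R V by fact
  show ?case using Suc by (simp add: V.smult_l_distr)
qed

lemma finsum_sub:
  assumes Z: "LinearCombinations.submodule R Z V" and f: "f \<in> A \<rightarrow> Z"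
  shows "finsum (V\<lparr>carrier := Z\<rparr>) f A = finsum V f A"
proof -
  interpret Z: LinearCombinations.submodule R Z V by fact
  interpret V: module R V by (rule Z.module)
  interpret VZ: module R "V\<lparr>carrier := Z\<rparr>" by (rule V.submodule_is_module[OF Z])
  show ?thesis using f
  proof (induction A rule: infinite_finite_induct)
    case (insert a A)
    then have "f \<in> A \<rightarrow> Z" "f a \<in> Z" by auto
    moreover have "f \<in> A \<rightarrow> carrier V" "f a \<in> carrier V" using calculation Z.subset by auto
    ultimately show ?case using insert by simp
  qed simp_all
qed

text \<open>With \<open>n\<close> the order of \<open>G\<close>, the norm divided by \<open>n\<close> is a projection of \<open>X\<close> onto the invariants. It does not
  change classes in the coinvariants and vanishes on the augmentation span, so its image is also a copy of the
  coinvariants. The two identities say that \<open>Y\<close> is this image, embedded by \<open>t\<close>.\<close>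

lemma transfer_iso:
  assumes X: "module R X" and Y: "module R Y" and G: "group G" and fin: "finite (carrier G)"
    and act: "\<And>s. s \<in> carrier G \<Longrightarrow> act s \<in> module_hom R X X"
    and act_mult: "\<And>s u x. s \<in> carrier G \<Longrightarrow> u \<in> carrier G \<Longrightarrow> x \<in> carrier X \<Longrightarrow>
      act s (act u x) = act (s \<otimes>\<^bsub>G\<^esub> u) x"
    and act_one: "\<And>x. x \<in> carrier X \<Longrightarrow> act \<one>\<^bsub>G\<^esub> x = x"
    and p: "p \<in> module_hom R X Y" and t: "t \<in> module_hom R Y X"
    and pt: "\<And>y. y \<in> carrier Y \<Longrightarrow> p (t y) = ([order G] \<cdot> \<one>) \<odot>\<^bsub>Y\<^esub> y"
    and tp: "\<And>x. x \<in> carrier X \<Longrightarrow> t (p x) = (\<Oplus>\<^bsub>X\<^esub>s\<in>carrier G. act s x)"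
    and c: "c \<in> carrier R" "c \<otimes> ([order G] \<cdot> \<one>) = \<one>"
  shows "vs_iso R Y (coinvariants R G X act)" and "vs_iso R Y (invariants_space G X act)"
proof -
  interpret X: module R X by fact
  interpret Y: module R Y by fact
  interpret G: group G by fact
  let ?n = "[order G] \<cdot> \<one>" and ?N = "\<lambda>x. \<Oplus>\<^bsub>X\<^esub>s\<in>carrier G. act s x"
  have n: "?n \<in> carrier R" by simp
  note actc = hom_in[OF act]
  have act_fun: "(\<lambda>s. act s x) \<in> carrier G \<rightarrow> carrier X" if "x \<in> carrier X" for x using actc that by auto
  have cnX: "c \<odot>\<^bsub>X\<^esub> (?n \<odot>\<^bsub>X\<^esub> v) = v" if "v \<in> carrier X" for v
    using that c n by (simp add: X.smult_assoc1[symmetric])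
  have cnY: "c \<odot>\<^bsub>Y\<^esub> (?n \<odot>\<^bsub>Y\<^esub> v) = v" if "v \<in> carrier Y" for v
    using that c n by (simp add: Y.smult_assoc1[symmetric])
  have N_act: "?N (act u x) = ?N x" if "u \<in> carrier G" "x \<in> carrier X" for u x
  proof -
    have "?N (act u x) = (\<Oplus>\<^bsub>X\<^esub>s\<in>carrier G. act (s \<otimes>\<^bsub>G\<^esub> u) x)"
      using that actc by (intro X.finsum_cong') (auto simp: act_mult)
    also have "\<dots> = ?N x" by (rule finsum_translate[OF X.abelian_monoid_axioms G that(1) act_fun[OF that(2)]])
    finally show ?thesis .
  qed
  have act_N: "act u (?N x) = ?N x" if "u \<in> carrier G" "x \<in> carrier X" for u x
  proof -
    have "act u (?N x) = (\<Oplus>\<^bsub>X\<^esub>s\<in>carrier G. act (u \<otimes>\<^bsub>G\<^esub> s) x)"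
      using that actc by (subst hom_finsum[OF act[OF that(1)] X X act_fun[OF that(2)]], intro X.finsum_cong') (auto simp: act_mult)
    also have "\<dots> = (\<Oplus>\<^bsub>X\<^esub>s\<in>(\<lambda>s. u \<otimes>\<^bsub>G\<^esub> s) ` carrier G. act s x)"
      using that actc G.inj_on_cmult[OF that(1)] by (intro X.finsum_reindex[symmetric]) auto
    also have "(\<lambda>s. u \<otimes>\<^bsub>G\<^esub> s) ` carrier G = carrier G"
      using G.surj_const_mult that(1) by simp
    finally show ?thesis .
  qed
  have pin: "p x \<in> carrier Y" if "x \<in> carrier X" for x using hom_in[OF p that] .
  have tin: "t y \<in> carrier X" if "y \<in> carrier Y" for y using hom_in[OF t that] .
  \<comment> \<open>Up to the unit \<open>?n\<close>, the map \<open>p\<close> is \<open>p t p\<close>, which is \<open>p\<close> after the norm, and the norm is invariant.\<close>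
  have p_act: "p (act u x) = p x" if "u \<in> carrier G" "x \<in> carrier X" for u x
  proof -
    have "?n \<odot>\<^bsub>Y\<^esub> p (act u x) = ?n \<odot>\<^bsub>Y\<^esub> p x"
      using that actc by (simp add: pt[symmetric] pin tp N_act)
    then have "c \<odot>\<^bsub>Y\<^esub> (?n \<odot>\<^bsub>Y\<^esub> p (act u x)) = c \<odot>\<^bsub>Y\<^esub> (?n \<odot>\<^bsub>Y\<^esub> p x)" by simp
    then show ?thesis using that actc pin by (simp add: cnY)
  qed
  \<comment> \<open>Up to the unit \<open>?n\<close>, the map \<open>t\<close> is \<open>t p t\<close>, whose values are norms.\<close>
  have act_t: "act u (t y) = t y" if "u \<in> carrier G" "y \<in> carrier Y" for u y
  proof -
    have y: "t y = c \<odot>\<^bsub>X\<^esub> ?N (t y)"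
      using that n by (simp add: tp[symmetric] tin pt module_hom_smult[OF t] cnX)
    have "act u (c \<odot>\<^bsub>X\<^esub> ?N (t y)) = c \<odot>\<^bsub>X\<^esub> ?N (t y)"
      using that c act_fun tin by (subst module_hom_smult[OF act[OF that(1)]]) (auto simp: act_N)
    then show ?thesis using y by simp
  qed
  have inj_t: "y = z" if "y \<in> carrier Y" "z \<in> carrier Y" "p (t y) = p (t z)" for y z
  proof -
    have "y = c \<odot>\<^bsub>Y\<^esub> p (t y)" "z = c \<odot>\<^bsub>Y\<^esub> p (t z)" using that(1,2) by (simp_all only: pt cnY)
    with that(3) show ?thesis by (simp only:)
  qed
  have "t \<in> module_hom R Y (invariants_space G X act)"
    using act_t tin by (auto intro!: module_homI simp: invariants_space_def module_hom_add[OF t] module_hom_smult[OF t])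
  moreover have "bij_betw t (carrier Y) (carrier (invariants_space G X act))"
  proof (rule bij_betwI')
    show "(t y = t z) = (y = z)" if "y \<in> carrier Y" "z \<in> carrier Y" for y z using inj_t that by auto
    show "t y \<in> carrier (invariants_space G X act)" if "y \<in> carrier Y" for y
      using act_t that tin by (auto simp: invariants_space_def)
    show "\<exists>y\<in>carrier Y. x = t y" if "x \<in> carrier (invariants_space G X act)" for x
    proof (rule bexI)
      have x: "x \<in> carrier X" "\<And>s. s \<in> carrier G \<Longrightarrow> act s x = x" using that by (auto simp: invariants_space_def)
      have "?N x = (\<Oplus>\<^bsub>X\<^esub>s\<in>carrier G. x)" using x by (intro X.finsum_cong') auto
      also have "\<dots> = ?n \<odot>\<^bsub>X\<^esub> x" using x(1) by (simp add: X.add.finprod_const smult_nat[OF X] order_def)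
      finally show "x = t (c \<odot>\<^bsub>Y\<^esub> p x)"
        using x(1) c pin by (simp add: module_hom_smult[OF t] tp cnX)
      show "c \<odot>\<^bsub>Y\<^esub> p x \<in> carrier Y" using x(1) c pin by simp
    qed
  qed
  ultimately show "vs_iso R Y (invariants_space G X act)" unfolding vs_iso_def by blast
  let ?W = "augmentation_span R G X act"
  have W: "LinearCombinations.submodule R ?W X" by (rule augmentation_span_submodule[OF X actc])
  have pW: "p w = \<zero>\<^bsub>Y\<^esub>" if "w \<in> ?W" for w
    by (rule augmentation_span_killed[OF fin X Y actc p p_act that])
  \<comment> \<open>The coefficients \<open>1 - c\<close> of \<open>1 \<in> G\<close> and \<open>- c\<close> of the other elements add up to zero.\<close>
  have NW: "x \<ominus>\<^bsub>X\<^esub> c \<odot>\<^bsub>X\<^esub> ?N x \<in> ?W" if x: "x \<in> carrier X" for x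
  proof -
    let ?r = "\<lambda>s. (if \<one>\<^bsub>G\<^esub> = s then \<one> else \<zero>) \<oplus> \<ominus> c"
    have "(\<Oplus>s\<in>carrier G. ?r s) = (\<Oplus>s\<in>carrier G. if \<one>\<^bsub>G\<^esub> = s then \<one> else \<zero>) \<oplus> (\<Oplus>s\<in>carrier G. \<ominus> c)"
      using c by (intro finsum_addf) auto
    also have "(\<Oplus>s\<in>carrier G. if \<one>\<^bsub>G\<^esub> = s then \<one> else \<zero>) = \<one>"
      using finsum_singleton[OF G.one_closed fin, of "\<lambda>_. \<one>"] by simp
    also have "(\<Oplus>s\<in>carrier G. \<ominus> c) = \<ominus> \<one>"
    proof -
      have "(\<Oplus>s\<in>carrier G. \<ominus> c) = [order G] \<cdot> (\<ominus> c)" using c by (simp add: add.finprod_const order_def)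
      also have "\<dots> = ?n \<otimes> (\<ominus> c)" using c by (simp add: add_pow_ldistr)
      also have "\<dots> = \<ominus> \<one>" using c n by (simp add: r_minus m_comm[of "[order G] \<cdot> \<one>" c])
      finally show ?thesis .
    qed
    finally have r0: "(\<Oplus>s\<in>carrier G. ?r s) = \<zero>" by (simp add: r_neg)
    have rc: "?r s \<in> carrier R" for s using c by simp
    have "(\<Oplus>\<^bsub>X\<^esub>s\<in>carrier G. ?r s \<odot>\<^bsub>X\<^esub> act s x) =
        (\<Oplus>\<^bsub>X\<^esub>s\<in>carrier G. (if \<one>\<^bsub>G\<^esub> = s then act s x else \<zero>\<^bsub>X\<^esub>) \<oplus>\<^bsub>X\<^esub> (\<ominus> c) \<odot>\<^bsub>X\<^esub> act s x)"
      using c actc x by (intro X.finsum_cong') (auto simp: X.smult_l_distr)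
    also have "\<dots> = (\<Oplus>\<^bsub>X\<^esub>s\<in>carrier G. if \<one>\<^bsub>G\<^esub> = s then act s x else \<zero>\<^bsub>X\<^esub>) \<oplus>\<^bsub>X\<^esub>
        (\<Oplus>\<^bsub>X\<^esub>s\<in>carrier G. (\<ominus> c) \<odot>\<^bsub>X\<^esub> act s x)"
      using c actc x by (intro X.finsum_addf) auto
    also have "(\<Oplus>\<^bsub>X\<^esub>s\<in>carrier G. if \<one>\<^bsub>G\<^esub> = s then act s x else \<zero>\<^bsub>X\<^esub>) = x"
      using X.finsum_singleton[OF G.one_closed fin act_fun[OF x]] x by (simp add: act_one)
    also have "(\<Oplus>\<^bsub>X\<^esub>s\<in>carrier G. (\<ominus> c) \<odot>\<^bsub>X\<^esub> act s x) = (\<ominus> c) \<odot>\<^bsub>X\<^esub> ?N x"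
      using fin c act_fun[OF x] by (intro X.finsum_smult_ldistr[symmetric]) auto
    finally have "(\<Oplus>\<^bsub>X\<^esub>s\<in>carrier G. ?r s \<odot>\<^bsub>X\<^esub> act s x) = x \<ominus>\<^bsub>X\<^esub> c \<odot>\<^bsub>X\<^esub> ?N x"
      using c act_fun[OF x] by (simp add: X.minus_eq X.smult_l_minus)
    moreover have "(\<Oplus>\<^bsub>X\<^esub>s\<in>carrier G. ?r s \<odot>\<^bsub>X\<^esub> act s x) \<in> ?W"
      by (rule augmentation_spanI[where act = act, OF fin X _ rc r0 x]) (rule actc)
    ultimately show ?thesis by simp
  qed
  let ?q = "\<lambda>y. ?W +>\<^bsub>X\<^esub> t y"
  have "?q \<in> module_hom R Y (coinvariants R G X act)"
    unfolding coinvariants_def by (rule hom_comp[OF t quot_class_hom[OF W]])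
  moreover have "bij_betw ?q (carrier Y) (carrier (coinvariants R G X act))"
  proof (rule bij_betwI')
    show "(?q y = ?q z) = (y = z)" if "y \<in> carrier Y" "z \<in> carrier Y" for y z
    proof
      assume "?q y = ?q z"
      then have "t y \<ominus>\<^bsub>X\<^esub> t z \<in> ?W" using that tin by (simp add: coset_eq_iff[OF W])
      then have "p (t y) \<ominus>\<^bsub>Y\<^esub> p (t z) = \<zero>\<^bsub>Y\<^esub>"
        using pW hom_minus[OF p X Y] that tin by metis
      then have "p (t y) = p (t z)" using that tin pin by simp
      then show "y = z" using inj_t that by blast
    qed simp
    show "?q y \<in> carrier (coinvariants R G X act)" if "y \<in> carrier Y" for y
      unfolding coinvariants_def quot_space_carrier using tin[OF that] by (rule imageI)
    show "\<exists>y\<in>carrier Y. S = ?q y" if S: "S \<in> carrier (coinvariants R G X act)" for S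
    proof -
      obtain x where x: "x \<in> carrier X" "S = ?W +>\<^bsub>X\<^esub> x"
        using S by (auto simp: coinvariants_def quot_space_carrier)
      have "t (c \<odot>\<^bsub>Y\<^esub> p x) = c \<odot>\<^bsub>X\<^esub> ?N x" using x(1) c pin by (simp add: module_hom_smult[OF t] tp)
      then have "S = ?q (c \<odot>\<^bsub>Y\<^esub> p x)"
        unfolding x(2) using NW[OF x(1)] x(1) c act_fun by (simp add: coset_eq_iff[OF W])
      then show ?thesis using x(1) c pin by blast
    qed
  qed
  ultimately show "vs_iso R Y (coinvariants R G X act)" unfolding vs_iso_def by blast
qed

text \<open>The map between spaces of cosets induced by \<open>f\<close>; the cosets in the union coincide when \<open>f\<close> respects the
  subspaces that are divided out.\<close>

definition induced_map :: "'x set \<Rightarrow> ('a, 'x) module \<Rightarrow> ('y \<Rightarrow> 'x) \<Rightarrow> 'y set \<Rightarrow> 'x set" where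
  "induced_map W Y f T = (\<Union>x\<in>T. W +>\<^bsub>Y\<^esub> f x)"

lemma induced_map:
  assumes WX: "LinearCombinations.submodule R WX X" and ZX: "LinearCombinations.submodule R ZX X"
    and WY: "LinearCombinations.submodule R WY Y" and f: "f \<in> module_hom R X Y"
    and fZ: "\<And>x. x \<in> ZX \<Longrightarrow> f x \<in> ZY" and fW: "\<And>x. x \<in> WX \<Longrightarrow> f x \<in> WY"
  shows induced_map_coset: "x \<in> carrier X \<Longrightarrow> induced_map WY Y f (WX +>\<^bsub>X\<^esub> x) = WY +>\<^bsub>Y\<^esub> f x"
    and induced_map_hom: "induced_map WY Y f
      \<in> module_hom R (quot_space (X\<lparr>carrier := ZX\<rparr>) WX) (quot_space (Y\<lparr>carrier := ZY\<rparr>) WY)"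
proof -
  interpret WX: LinearCombinations.submodule R WX X by fact
  interpret WY: LinearCombinations.submodule R WY Y by fact
  interpret ZX: LinearCombinations.submodule R ZX X by fact
  interpret X: module R X by (rule WX.module)
  have ZXX: "x \<in> carrier X" if "x \<in> ZX" for x using that ZX.subset by auto
  show co: "induced_map WY Y f (WX +>\<^bsub>X\<^esub> x) = WY +>\<^bsub>Y\<^esub> f x" if x: "x \<in> carrier X" for x
  proof -
    have "WY +>\<^bsub>Y\<^esub> f y = WY +>\<^bsub>Y\<^esub> f x" if y: "y \<in> WX +>\<^bsub>X\<^esub> x" for y
    proof -
      note yx = coset_memD[OF WX x y]
      then have "f (y \<ominus>\<^bsub>X\<^esub> x) \<in> WY" using coset_eq_iff[OF WX yx(1) x] fW by simp
      then have "f y \<ominus>\<^bsub>Y\<^esub> f x \<in> WY" by (simp add: hom_minus[OF f WX.module WY.module yx(1) x])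
      then show ?thesis using coset_eq_iff[OF WY] hom_in[OF f] yx(1) x by simp
    qed
    from SUP_cong[OF refl this] have "induced_map WY Y f (WX +>\<^bsub>X\<^esub> x) = (\<Union>y\<in>WX +>\<^bsub>X\<^esub> x. WY +>\<^bsub>Y\<^esub> f x)"
      unfolding induced_map_def .
    moreover have "WX +>\<^bsub>X\<^esub> x \<noteq> {}" using coset_self[OF WX x] by (metis empty_iff)
    ultimately show ?thesis by simp
  qed
  show "induced_map WY Y f
      \<in> module_hom R (quot_space (X\<lparr>carrier := ZX\<rparr>) WX) (quot_space (Y\<lparr>carrier := ZY\<rparr>) WY)"
    by (rule module_homI)
      (auto simp: quot_space_simps(4) quot_space_ops[OF WX] quot_space_ops[OF WY] co ZXX fZ hom_in[OF f]
        module_hom_add[OF f] module_hom_smult[OF f])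
qed

text \<open>The same statement for subquotients, to be applied to homology: maps on \<open>X\<close> and \<open>Y\<close> that
  respect the subspaces satisfy the two identities on the subquotients as soon as they do so on \<open>X\<close> and \<open>Y\<close>.\<close>

lemma transfer_iso_subquotient:
  assumes G: "group G" and fin: "finite (carrier G)"
    and WX: "LinearCombinations.submodule R WX X" and ZX: "LinearCombinations.submodule R ZX X"
    and WY: "LinearCombinations.submodule R WY Y" and ZY: "LinearCombinations.submodule R ZY Y"
    and act: "\<And>s. s \<in> carrier G \<Longrightarrow> act s \<in> module_hom R X X"
    and act_mult: "\<And>s u x. s \<in> carrier G \<Longrightarrow> u \<in> carrier G \<Longrightarrow> x \<in> carrier X \<Longrightarrow>
      act s (act u x) = act (s \<otimes>\<^bsub>G\<^esub> u) x"
    and act_one: "\<And>x. x \<in> carrier X \<Longrightarrow> act \<one>\<^bsub>G\<^esub> x = x"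
    and actZ: "\<And>s x. s \<in> carrier G \<Longrightarrow> x \<in> ZX \<Longrightarrow> act s x \<in> ZX"
    and actW: "\<And>s x. s \<in> carrier G \<Longrightarrow> x \<in> WX \<Longrightarrow> act s x \<in> WX"
    and p: "p \<in> module_hom R X Y" and pZ: "\<And>x. x \<in> ZX \<Longrightarrow> p x \<in> ZY" and pW: "\<And>x. x \<in> WX \<Longrightarrow> p x \<in> WY"
    and t: "t \<in> module_hom R Y X" and tZ: "\<And>y. y \<in> ZY \<Longrightarrow> t y \<in> ZX" and tW: "\<And>y. y \<in> WY \<Longrightarrow> t y \<in> WX"
    and pt: "\<And>y. y \<in> carrier Y \<Longrightarrow> p (t y) = ([order G] \<cdot> \<one>) \<odot>\<^bsub>Y\<^esub> y"
    and tp: "\<And>x. x \<in> carrier X \<Longrightarrow> t (p x) = (\<Oplus>\<^bsub>X\<^esub>s\<in>carrier G. act s x)"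
    and c: "c \<in> carrier R" "c \<otimes> ([order G] \<cdot> \<one>) = \<one>"
  shows "vs_iso R (quot_space (Y\<lparr>carrier := ZY\<rparr>) WY)
      (coinvariants R G (quot_space (X\<lparr>carrier := ZX\<rparr>) WX) (\<lambda>s T. act s ` T))"
    and "vs_iso R (quot_space (Y\<lparr>carrier := ZY\<rparr>) WY)
      (invariants_space G (quot_space (X\<lparr>carrier := ZX\<rparr>) WX) (\<lambda>s T. act s ` T))"
proof -
  interpret G: group G by fact
  interpret WX: LinearCombinations.submodule R WX X by fact
  interpret WY: LinearCombinations.submodule R WY Y by fact
  interpret ZX: LinearCombinations.submodule R ZX X by fact
  interpret ZY: LinearCombinations.submodule R ZY Y by fact
  interpret X: module R X by (rule WX.module)
  interpret Y: module R Y by (rule WY.module)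
  let ?H = "quot_space (X\<lparr>carrier := ZX\<rparr>) WX" and ?H' = "quot_space (Y\<lparr>carrier := ZY\<rparr>) WY"
  note H = quot_space_sub_module[OF WX ZX] and H' = quot_space_sub_module[OF WY ZY]
  interpret H: module R ?H by (rule H)
  have ZXX: "x \<in> carrier X" if "x \<in> ZX" for x using that ZX.subset by auto
  have ZYY: "x \<in> carrier Y" if "x \<in> ZY" for x using that ZY.subset by auto
  have WXX: "x \<in> carrier X" if "x \<in> WX" for x using that WX.subset by auto
  have actco: "act s ` (WX +>\<^bsub>X\<^esub> x) = WX +>\<^bsub>X\<^esub> act s x" if s: "s \<in> carrier G" and x: "x \<in> carrier X" for s x
  proof -
    have "act s ` WX = WX"
    proof (intro equalityI subsetI)
      fix w assume w: "w \<in> WX"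
      have "act s (act (inv\<^bsub>G\<^esub> s) w) = w" using s w WXX by (simp add: act_mult act_one)
      then show "w \<in> act s ` WX" using actW[of "inv\<^bsub>G\<^esub> s" w] s w by (metis G.inv_closed imageI)
    qed (use actW s in auto)
    moreover have "act s ` (WX +>\<^bsub>X\<^esub> x) = (\<lambda>w. w \<oplus>\<^bsub>X\<^esub> act s x) ` act s ` WX"
      unfolding coset_def image_image using x WXX by (intro image_cong) (auto simp: module_hom_add[OF act[OF s]])
    ultimately show ?thesis by (simp add: coset_def)
  qed
  have actH: "(\<lambda>T. act s ` T) \<in> module_hom R ?H ?H" if s: "s \<in> carrier G" for s
  proof (rule module_homI)
    fix S assume S: "S \<in> carrier ?H"
    then obtain x where x: "x \<in> ZX" "S = WX +>\<^bsub>X\<^esub> x" by (auto simp: quot_space_simps(4))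
    note x' = ZXX[OF x(1)]
    show "act s ` S \<in> carrier ?H"
      unfolding x(2) actco[OF s x'] quot_space_simps(4) by (rule imageI, rule actZ[OF s x(1)])
    show "act s ` (a \<odot>\<^bsub>?H\<^esub> S) = a \<odot>\<^bsub>?H\<^esub> (act s ` S)" if a: "a \<in> carrier R" for a
      using a x' hom_in[OF act[OF s] x'] unfolding x(2)
      by (simp add: quot_space_ops(2)[OF WX] actco[OF s] module_hom_smult[OF act[OF s]])
    fix T assume "T \<in> carrier ?H"
    then obtain y where y: "y \<in> ZX" "T = WX +>\<^bsub>X\<^esub> y" by (auto simp: quot_space_simps(4))
    note y' = ZXX[OF y(1)]
    show "act s ` (S \<oplus>\<^bsub>?H\<^esub> T) = (act s ` S) \<oplus>\<^bsub>?H\<^esub> (act s ` T)"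
      using x' y' hom_in[OF act[OF s] x'] hom_in[OF act[OF s] y'] unfolding x(2) y(2)
      by (simp add: quot_space_ops(1)[OF WX] actco[OF s] module_hom_add[OF act[OF s]])
  qed
  note ip = induced_map[OF WX ZX WY p pZ pW] and it = induced_map[OF WY ZY WX t tZ tW]
  have cl: "(\<lambda>x. WX +>\<^bsub>X\<^esub> x) \<in> module_hom R (X\<lparr>carrier := ZX\<rparr>) ?H"
    by (rule module_homI) (auto simp: quot_space_simps(4) quot_space_ops[OF WX] ZXX)
  have mult: "act s ` act u ` T = act (s \<otimes>\<^bsub>G\<^esub> u) ` T"
    if su: "s \<in> carrier G" "u \<in> carrier G" and T: "T \<in> carrier ?H" for s u T
  proof -
    obtain x where x: "x \<in> ZX" "T = WX +>\<^bsub>X\<^esub> x" using T by (auto simp: quot_space_simps(4))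
    note x' = ZXX[OF x(1)]
    show ?thesis
      unfolding x(2) actco[OF su(2) x'] actco[OF su(1) hom_in[OF act[OF su(2)] x']]
        actco[OF G.m_closed[OF su] x'] act_mult[OF su x'] ..
  qed
  have one: "act \<one>\<^bsub>G\<^esub> ` T = T" if T: "T \<in> carrier ?H" for T
  proof -
    obtain x where x: "x \<in> ZX" "T = WX +>\<^bsub>X\<^esub> x" using T by (auto simp: quot_space_simps(4))
    note x' = ZXX[OF x(1)]
    show ?thesis unfolding x(2) actco[OF G.one_closed x'] act_one[OF x'] ..
  qed
  have ptH: "induced_map WY Y p (induced_map WX X t S) = ([order G] \<cdot> \<one>) \<odot>\<^bsub>?H'\<^esub> S" if "S \<in> carrier ?H'" for S
    using that hom_in[OF t] by (auto simp: quot_space_simps(4) ip(1) it(1) ZYY pt quot_space_ops[OF WY])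
  have tpH: "induced_map WX X t (induced_map WY Y p T) = (\<Oplus>\<^bsub>?H\<^esub>s\<in>carrier G. act s ` T)" if T: "T \<in> carrier ?H" for T
  proof -
    obtain x where x: "x \<in> ZX" "T = WX +>\<^bsub>X\<^esub> x" using T by (auto simp: quot_space_simps(4))
    have ax: "(\<lambda>s. act s x) \<in> carrier G \<rightarrow> ZX" using x actZ by auto
    have "induced_map WX X t (induced_map WY Y p T) = WX +>\<^bsub>X\<^esub> (\<Oplus>\<^bsub>X\<^esub>s\<in>carrier G. act s x)"
      using x hom_in[OF p] by (simp add: ip(1) it(1) ZXX tp)
    also have "\<dots> = WX +>\<^bsub>X\<^esub> (\<Oplus>\<^bsub>X\<lparr>carrier := ZX\<rparr>\<^esub>s\<in>carrier G. act s x)"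
      by (simp add: finsum_sub[OF ZX ax])
    also have "\<dots> = (\<Oplus>\<^bsub>?H\<^esub>s\<in>carrier G. WX +>\<^bsub>X\<^esub> act s x)"
      using ax by (intro hom_finsum[OF cl X.submodule_is_module[OF ZX] H]) simp
    also have "\<dots> = (\<Oplus>\<^bsub>?H\<^esub>s\<in>carrier G. act s ` T)"
      using x ZXX actZ by (intro H.finsum_cong') (auto simp: actco quot_space_simps(4))
    finally show ?thesis .
  qed
  note iso = transfer_iso[where act = "\<lambda>s T. act s ` T", OF H H' G fin actH mult one ip(2) it(2) ptH tpH c]
  show "vs_iso R ?H' (coinvariants R G ?H (\<lambda>s T. act s ` T))" by (rule iso(1))
  show "vs_iso R ?H' (invariants_space G ?H (\<lambda>s T. act s ` T))" by (rule iso(2))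
qed

end

section \<open>The quotient category of a finite Galois covering\<close>

locale finite_covering = free_kcat_action K C G \<phi> \<psi>
  for K :: "('k, 'r) ring_scheme" (structure) and C :: "('o, 'c, 'k) kcat"
    and G :: "('g, 'h) monoid_scheme" and \<phi> :: "'g \<Rightarrow> 'o \<Rightarrow> 'o"
    and \<psi> :: "'g \<Rightarrow> 'o \<Rightarrow> 'o \<Rightarrow> 'c \<Rightarrow> 'c" +
  assumes finite_group: "finite (carrier G)"
begin

lemma group_G: "group G"
  using group_hom group_hom.axioms(1) by blast

sublocale G: group G by (rule group_G)

abbreviation "\<B> \<equiv> quot_cat K C G \<phi> \<psi>"
abbreviation "qhom \<equiv> quot_hom K C G \<phi> \<psi>"
abbreviation "qclass \<equiv> quot_class K C G \<phi> \<psi>"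
abbreviation "orb \<equiv> orbit G \<phi>"
abbreviation "orbs \<equiv> orbits G (Obj C) \<phi>"
abbreviation "homp \<equiv> (\<lambda>(y, x). Hom C y x)"
abbreviation "cov \<equiv> covering K C G \<phi> \<psi>"
abbreviation "relators v u \<equiv> augmentation_span K G (orbit_sum C v u) (orbit_act G \<phi> \<psi> v u)"

lemma hom_mod: "x \<in> Obj C \<Longrightarrow> y \<in> Obj C \<Longrightarrow> module K (Hom C y x)"
  using hom_vectorspace by (auto simp: vectorspace_def)

lemma act_obj: "s \<in> carrier G \<Longrightarrow> x \<in> Obj C \<Longrightarrow> \<phi> s x \<in> Obj C"
  using element_image by blast

lemma act_obj_mult: "s \<in> carrier G \<Longrightarrow> u \<in> carrier G \<Longrightarrow> x \<in> Obj C \<Longrightarrow> \<phi> s (\<phi> u x) = \<phi> (s \<otimes>\<^bsub>G\<^esub> u) x"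
  by (simp add: composition_rule)

lemma act_obj_one: "x \<in> Obj C \<Longrightarrow> \<phi> \<one>\<^bsub>G\<^esub> x = x"
  using id_eq_one by (metis restrict_apply')

lemma act_obj_inv: "s \<in> carrier G \<Longrightarrow> x \<in> Obj C \<Longrightarrow> \<phi> s (\<phi> (inv\<^bsub>G\<^esub> s) x) = x"
    "s \<in> carrier G \<Longrightarrow> x \<in> Obj C \<Longrightarrow> \<phi> (inv\<^bsub>G\<^esub> s) (\<phi> s x) = x"
  by (simp_all add: act_obj_mult act_obj_one)

lemma act_obj_inv_eq: "s \<in> carrier G \<Longrightarrow> x \<in> Obj C \<Longrightarrow> y \<in> Obj C \<Longrightarrow> \<phi> (inv\<^bsub>G\<^esub> s) y = x \<longleftrightarrow> y = \<phi> s x"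
  using act_obj_inv by auto

lemma act_free:
  assumes "s \<in> carrier G" "u \<in> carrier G" "x \<in> Obj C" "\<phi> s x = \<phi> u x"
  shows "s = u"
proof -
  have "\<phi> (inv\<^bsub>G\<^esub> u \<otimes>\<^bsub>G\<^esub> s) x = \<phi> (inv\<^bsub>G\<^esub> u) (\<phi> s x)" using assms by (intro composition_rule) auto
  also have "\<dots> = x" unfolding assms(4) using assms by (simp add: act_obj_inv)
  finally have "inv\<^bsub>G\<^esub> u \<otimes>\<^bsub>G\<^esub> s = \<one>\<^bsub>G\<^esub>" using assms by (intro free) auto
  then show ?thesis using assms by (metis G.inv_closed G.inv_equality G.inv_inv)
qed

lemma orb_in: "x \<in> Obj C \<Longrightarrow> orb x \<in> orbs"
  by (auto simp: orbits_def)

lemma orb_self: "x \<in> Obj C \<Longrightarrow> x \<in> orb x"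
  by (rule orbit_refl)

lemma orbs_obj: "v \<in> orbs \<Longrightarrow> x \<in> v \<Longrightarrow> x \<in> Obj C"
  using orbits_coverture by blast

lemma orb_eq: "v \<in> orbs \<Longrightarrow> x \<in> v \<Longrightarrow> orb x = v"
  using disjoint_union[of v "orb x"] orb_in[OF orbs_obj] orb_self[OF orbs_obj] by blast

lemma orb_act: "s \<in> carrier G \<Longrightarrow> x \<in> Obj C \<Longrightarrow> orb (\<phi> s x) = orb x"
  by (rule orb_eq[OF orb_in]) (auto simp: orbit_def)

lemma orbs_act: "v \<in> orbs \<Longrightarrow> x \<in> v \<Longrightarrow> s \<in> carrier G \<Longrightarrow> \<phi> s x \<in> v"
  using orb_eq[of v x] by (auto simp: orbit_def)

lemma orb_bij: "x \<in> Obj C \<Longrightarrow> bij_betw (\<lambda>s. \<phi> s x) (carrier G) (orb x)"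
  using act_free by (auto simp: bij_betw_def inj_on_def orbit_def)

lemma orbs_finite: "v \<in> orbs \<Longrightarrow> finite v" and orbs_card: "v \<in> orbs \<Longrightarrow> card v = order G"
proof -
  assume "v \<in> orbs"
  then obtain x where "x \<in> Obj C" "v = orb x" by (auto simp: orbits_def)
  then show "finite v" "card v = order G"
    using bij_betw_finite[OF orb_bij[of x]] bij_betw_same_card[OF orb_bij[of x]] finite_group
    by (auto simp: order_def)
qed

lemma orbs_trans:
  assumes "v \<in> orbs" "x \<in> v" "y \<in> v"
  obtains s where "s \<in> carrier G" "y = \<phi> s x"
  using assms orb_eq[OF assms(1,2)] by (auto simp: orbit_def)

lemma homp_mod: "v \<in> orbs \<Longrightarrow> u \<in> orbs \<Longrightarrow> i \<in> v \<times> u \<Longrightarrow> module K (homp i)"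
  using orbs_obj by (auto intro!: hom_mod)

lemma orbit_sum_module: "v \<in> orbs \<Longrightarrow> u \<in> orbs \<Longrightarrow> module K (orbit_sum C v u)"
  unfolding orbit_sum_def by (rule dsum_space_module[OF homp_mod])

lemma orbit_sum_carrier:
  "v \<in> orbs \<Longrightarrow> u \<in> orbs \<Longrightarrow> carrier (orbit_sum C v u) = (\<Pi>\<^sub>E i\<in>v \<times> u. carrier (homp i))"
proof -
  assume "v \<in> orbs" "u \<in> orbs"
  then have "finite (v \<times> u)" by (intro finite_cartesian_product orbs_finite)
  then have "finite (dsum_supp (v \<times> u) homp f)" for f by (auto simp: dsum_supp_def)
  then show ?thesis by (simp add: orbit_sum_def dsum_space_simps)
qed

lemma orbit_sumD:
  "v \<in> orbs \<Longrightarrow> u \<in> orbs \<Longrightarrow> f \<in> carrier (orbit_sum C v u) \<Longrightarrow> y \<in> v \<Longrightarrow> x \<in> u \<Longrightarrow> f (y, x) \<in> carrier (Hom C y x)"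
  by (force simp: orbit_sum_carrier dest: PiE_mem)

lemma act_mor: "s \<in> carrier G \<Longrightarrow> x \<in> Obj C \<Longrightarrow> y \<in> Obj C \<Longrightarrow> c \<in> carrier (Hom C y x) \<Longrightarrow>
    \<psi> s y x c \<in> carrier (Hom C (\<phi> s y) (\<phi> s x))"
  by (rule hom_in[OF act_linear])

lemma act_mor_back:
  "s \<in> carrier G \<Longrightarrow> x \<in> Obj C \<Longrightarrow> y \<in> Obj C \<Longrightarrow>
    \<psi> s (\<phi> (inv\<^bsub>G\<^esub> s) y) (\<phi> (inv\<^bsub>G\<^esub> s) x)
      \<in> module_hom K (Hom C (\<phi> (inv\<^bsub>G\<^esub> s) y) (\<phi> (inv\<^bsub>G\<^esub> s) x)) (Hom C y x)"
  using act_linear[of s "\<phi> (inv\<^bsub>G\<^esub> s) x" "\<phi> (inv\<^bsub>G\<^esub> s) y"] by (simp add: act_obj act_obj_inv)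

lemma orbit_act_apply:
  "y \<in> v \<Longrightarrow> x \<in> u \<Longrightarrow> orbit_act G \<phi> \<psi> v u s f (y, x) =
    \<psi> s (\<phi> (inv\<^bsub>G\<^esub> s) y) (\<phi> (inv\<^bsub>G\<^esub> s) x) (f (\<phi> (inv\<^bsub>G\<^esub> s) y, \<phi> (inv\<^bsub>G\<^esub> s) x))"
  by (simp add: orbit_act_def Let_def)

lemma orbit_act_closed:
  assumes v: "v \<in> orbs" and u: "u \<in> orbs" and s: "s \<in> carrier G" and f: "f \<in> carrier (orbit_sum C v u)"
  shows "orbit_act G \<phi> \<psi> v u s f \<in> carrier (orbit_sum C v u)"
proof -
  have "orbit_act G \<phi> \<psi> v u s f (y, x) \<in> carrier (Hom C y x)" if "y \<in> v" "x \<in> u" for y x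
    unfolding orbit_act_apply[OF that]
    by (rule hom_in[OF act_mor_back orbit_sumD[OF v u f]])
      (use that s v u orbs_obj orbs_act in auto)
  moreover have "orbit_act G \<phi> \<psi> v u s f \<in> extensional (v \<times> u)" by (simp add: orbit_act_def)
  ultimately show ?thesis by (auto simp: orbit_sum_carrier v u PiE_def)
qed

lemma orbit_act_one:
  assumes v: "v \<in> orbs" and u: "u \<in> orbs" and f: "f \<in> carrier (orbit_sum C v u)"
  shows "orbit_act G \<phi> \<psi> v u \<one>\<^bsub>G\<^esub> f = f"
proof (rule extensionalityI[where A = "v \<times> u"])
  show "f \<in> extensional (v \<times> u)" using f by (simp add: orbit_sum_carrier v u PiE_def)
  show "orbit_act G \<phi> \<psi> v u \<one>\<^bsub>G\<^esub> f \<in> extensional (v \<times> u)" by (simp add: orbit_act_def)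
  fix i assume "i \<in> v \<times> u"
  then obtain y x where i: "i = (y, x)" "y \<in> v" "x \<in> u" by auto
  then show "orbit_act G \<phi> \<psi> v u \<one>\<^bsub>G\<^esub> f i = f i"
    using orbit_sumD[OF v u f i(2,3)] orbs_obj[OF v i(2)] orbs_obj[OF u i(3)]
    by (simp add: orbit_act_apply act_obj_one act_one)
qed

lemma orbit_act_mult:
  assumes v: "v \<in> orbs" and u: "u \<in> orbs" and s: "s \<in> carrier G" and r: "r \<in> carrier G"
    and f: "f \<in> carrier (orbit_sum C v u)" and y: "y \<in> v" and x: "x \<in> u"
  shows "orbit_act G \<phi> \<psi> v u s (orbit_act G \<phi> \<psi> v u r f) (y, x) = orbit_act G \<phi> \<psi> v u (s \<otimes>\<^bsub>G\<^esub> r) f (y, x)"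
proof -
  let ?y = "\<phi> (inv\<^bsub>G\<^esub> s) y" and ?x = "\<phi> (inv\<^bsub>G\<^esub> s) x"
  let ?y' = "\<phi> (inv\<^bsub>G\<^esub> r) ?y" and ?x' = "\<phi> (inv\<^bsub>G\<^esub> r) ?x"
  have yx: "?y \<in> v" "?x \<in> u" "?y' \<in> v" "?x' \<in> u" using orbs_act v u x y s r by auto
  have o: "?y \<in> Obj C" "?x \<in> Obj C" "?y' \<in> Obj C" "?x' \<in> Obj C" "y \<in> Obj C" "x \<in> Obj C"
    using yx x y v u orbs_obj by auto
  have e: "\<phi> r ?y' = ?y" "\<phi> r ?x' = ?x" using o r by (simp_all add: act_obj_inv)
  have e': "\<phi> (inv\<^bsub>G\<^esub> (s \<otimes>\<^bsub>G\<^esub> r)) y = ?y'" "\<phi> (inv\<^bsub>G\<^esub> (s \<otimes>\<^bsub>G\<^esub> r)) x = ?x'"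
    using s r o by (simp_all add: G.inv_mult_group act_obj_mult)
  have "\<psi> s ?y ?x (\<psi> r ?y' ?x' (f (?y', ?x'))) = \<psi> (s \<otimes>\<^bsub>G\<^esub> r) ?y' ?x' (f (?y', ?x'))"
    using act_mult[OF r s o(4) o(3) orbit_sumD[OF v u f yx(3,4)]] by (simp add: e)
  then show ?thesis using y x yx by (simp add: orbit_act_apply e')
qed

lemma relators_submodule:
  "v \<in> orbs \<Longrightarrow> u \<in> orbs \<Longrightarrow> LinearCombinations.submodule K (relators v u) (orbit_sum C v u)"
  by (rule augmentation_span_submodule[OF orbit_sum_module orbit_act_closed])

lemma quot_hom_module: "v \<in> orbs \<Longrightarrow> u \<in> orbs \<Longrightarrow> module K (qhom v u)"
  unfolding quot_hom_def coinvariants_def by (rule quot_space_module[OF relators_submodule])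

lemma quot_class_hom':
  "v \<in> orbs \<Longrightarrow> u \<in> orbs \<Longrightarrow>
    qclass v u \<in> module_hom K (orbit_sum C v u) (qhom v u)"
  unfolding quot_class_def[abs_def] quot_hom_def coinvariants_def by (rule quot_class_hom[OF relators_submodule])

lemma orbit_inj_hom:
  "v \<in> orbs \<Longrightarrow> u \<in> orbs \<Longrightarrow> y \<in> v \<Longrightarrow> x \<in> u \<Longrightarrow>
    orbit_inj C v u (y, x) \<in> module_hom K (Hom C y x) (orbit_sum C v u)"
  using dsum_inj_hom[where A = homp and I = "v \<times> u" and i = "(y, x)", OF homp_mod]
  by (simp add: orbit_inj_def orbit_sum_def)

lemma cov_eq:
  "v \<in> orbs \<Longrightarrow> u \<in> orbs \<Longrightarrow> y \<in> v \<Longrightarrow> x \<in> u \<Longrightarrow>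
    cov y x c = qclass v u (orbit_inj C v u (y, x) c)"
  by (simp add: covering_def orb_eq)

lemma cov_hom':
  "v \<in> orbs \<Longrightarrow> u \<in> orbs \<Longrightarrow> y \<in> v \<Longrightarrow> x \<in> u \<Longrightarrow>
    cov y x \<in> module_hom K (Hom C y x) (qhom v u)"
proof -
  assume a: "v \<in> orbs" "u \<in> orbs" "y \<in> v" "x \<in> u"
  have "cov y x = (\<lambda>c. qclass v u (orbit_inj C v u (y, x) c))"
    using cov_eq[OF a] by (rule ext)
  then show ?thesis using hom_comp[OF orbit_inj_hom[OF a] quot_class_hom'[OF a(1,2)]] by simp
qed

lemma cov_hom:
  "x \<in> Obj C \<Longrightarrow> y \<in> Obj C \<Longrightarrow> cov y x \<in> module_hom K (Hom C y x) (qhom (orb y) (orb x))"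
  by (rule cov_hom') (simp_all add: orb_in orb_self)

lemma orbit_act_inj:
  assumes v: "v \<in> orbs" and u: "u \<in> orbs" and y: "y \<in> v" and x: "x \<in> u" and s: "s \<in> carrier G"
    and c: "c \<in> carrier (Hom C y x)" and y': "y' \<in> v" and x': "x' \<in> u"
  shows "orbit_act G \<phi> \<psi> v u s (orbit_inj C v u (y, x) c) (y', x') =
    (if y' = \<phi> s y \<and> x' = \<phi> s x then \<psi> s y x c else \<zero>\<^bsub>Hom C y' x'\<^esub>)"
proof -
  have o: "y \<in> Obj C" "x \<in> Obj C" "y' \<in> Obj C" "x' \<in> Obj C" using orbs_obj assms by auto
  have i: "\<phi> (inv\<^bsub>G\<^esub> s) y' \<in> v" "\<phi> (inv\<^bsub>G\<^esub> s) x' \<in> u" using orbs_act assms by auto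
  have oi: "\<phi> (inv\<^bsub>G\<^esub> s) y' \<in> Obj C" "\<phi> (inv\<^bsub>G\<^esub> s) x' \<in> Obj C" using i orbs_obj v u by auto
  have z: "\<psi> s (\<phi> (inv\<^bsub>G\<^esub> s) y') (\<phi> (inv\<^bsub>G\<^esub> s) x') \<zero>\<^bsub>Hom C (\<phi> (inv\<^bsub>G\<^esub> s) y') (\<phi> (inv\<^bsub>G\<^esub> s) x')\<^esub> = \<zero>\<^bsub>Hom C y' x'\<^esub>"
    by (rule hom_zero[OF act_mor_back[OF s o(4,3)] hom_mod[OF oi(2,1)] hom_mod[OF o(4,3)]])
  show ?thesis
    using i z act_obj_inv_eq[OF s o(1,3)] act_obj_inv_eq[OF s o(2,4)]
    by (auto simp: orbit_act_apply y' x' orbit_inj_def dsum_inj_def)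
qed

text \<open>The covering functor identifies \<open>c\<close> and \<open>s c\<close>, as their difference lies in the augmentation span.\<close>

lemma cov_act:
  assumes s: "s \<in> carrier G" and x: "x \<in> Obj C" and y: "y \<in> Obj C" and c: "c \<in> carrier (Hom C y x)"
  shows "cov (\<phi> s y) (\<phi> s x) (\<psi> s y x c) = cov y x c"
proof -
  let ?v = "orb y" and ?u = "orb x"
  have v: "?v \<in> orbs" "y \<in> ?v" "\<phi> s y \<in> ?v" using orb_in orb_self orbs_act y s by auto
  have u: "?u \<in> orbs" "x \<in> ?u" "\<phi> s x \<in> ?u" using orb_in orb_self orbs_act x s by auto
  let ?f = "orbit_inj C ?v ?u (y, x) c" and ?g = "orbit_inj C ?v ?u (\<phi> s y, \<phi> s x) (\<psi> s y x c)"
  have f: "?f \<in> carrier (orbit_sum C ?v ?u)" by (rule hom_in[OF orbit_inj_hom c]) (use v u in auto)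
  have g: "?g \<in> carrier (orbit_sum C ?v ?u)"
    by (rule hom_in[OF orbit_inj_hom act_mor]) (use v u s x y c in auto)
  have e: "orbit_act G \<phi> \<psi> ?v ?u s ?f = ?g"
  proof (rule extensionalityI[where A = "?v \<times> ?u"])
    fix i assume "i \<in> ?v \<times> ?u"
    then obtain y' x' where i: "i = (y', x')" "y' \<in> ?v" "x' \<in> ?u" by auto
    show "orbit_act G \<phi> \<psi> ?v ?u s ?f i = ?g i"
      unfolding i(1) orbit_act_inj[OF v(1) u(1) v(2) u(2) s c i(2,3)]
      using i(2,3) by (simp add: orbit_inj_def dsum_inj_def)
  qed (simp_all add: orbit_act_def orbit_inj_def dsum_inj_def)
  have "orbit_act G \<phi> \<psi> ?v ?u s ?f \<ominus>\<^bsub>orbit_sum C ?v ?u\<^esub> ?f \<in> relators ?v ?u"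
    by (rule augmentation_span_diff[OF group_G finite_group orbit_sum_module[OF v(1) u(1)] _ _ s f])
      (auto intro: orbit_act_closed orbit_act_one v u f)
  then have "relators ?v ?u +>\<^bsub>orbit_sum C ?v ?u\<^esub> ?g = relators ?v ?u +>\<^bsub>orbit_sum C ?v ?u\<^esub> ?f"
    unfolding e by (subst coset_eq_iff[OF relators_submodule[OF v(1) u(1)] g f])
  then show ?thesis using v u by (simp add: cov_eq[of ?v ?u] quot_class_def)
qed

lemma quot_hom_ext:
  assumes v: "v \<in> orbs" and u: "u \<in> orbs" and V: "module K V"
    and f: "f \<in> module_hom K (qhom v u) V" and g: "g \<in> module_hom K (qhom v u) V"
    and eq: "\<And>y x c. y \<in> v \<Longrightarrow> x \<in> u \<Longrightarrow> c \<in> carrier (Hom C y x) \<Longrightarrow> f (cov y x c) = g (cov y x c)"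
    and \<gamma>: "\<gamma> \<in> carrier (qhom v u)"
  shows "f \<gamma> = g \<gamma>"
proof -
  obtain e where e: "e \<in> carrier (orbit_sum C v u)" "\<gamma> = qclass v u e"
    using \<gamma> by (auto simp: quot_hom_def coinvariants_def quot_space_carrier quot_class_def)
  note q = quot_class_hom'[OF v u, unfolded orbit_sum_def]
  show ?thesis unfolding e(2)
  proof (rule dsum_ext[OF homp_mod[OF v u] V hom_comp[OF q f] hom_comp[OF q g] _ e(1)[unfolded orbit_sum_def]])
    fix i a assume "i \<in> v \<times> u" "a \<in> carrier (homp i)"
    then obtain y x where "i = (y, x)" "y \<in> v" "x \<in> u" "a \<in> carrier (Hom C y x)" by auto
    then show "f (qclass v u (dsum_inj (v \<times> u) homp i a)) =
        g (qclass v u (dsum_inj (v \<times> u) homp i a))"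
      using eq[of y x a] by (simp add: cov_eq[OF v u] orbit_inj_def)
  qed
qed

text \<open>The component at \<open>(y, x)\<close> of the sum \<open>\<Sum>\<^sub>s s f\<close> over the group. As the norm of an element of the orbit sum it is
  invariant, so it depends only on the class of \<open>f\<close>; this gives the lifts of a morphism of the quotient.\<close>

definition orbit_norm :: "'o \<Rightarrow> 'o \<Rightarrow> ('o \<times> 'o \<Rightarrow> 'c) \<Rightarrow> 'c" where
  "orbit_norm y x f = (\<Oplus>\<^bsub>Hom C y x\<^esub>s\<in>carrier G.
    \<psi> s (\<phi> (inv\<^bsub>G\<^esub> s) y) (\<phi> (inv\<^bsub>G\<^esub> s) x) (f (\<phi> (inv\<^bsub>G\<^esub> s) y, \<phi> (inv\<^bsub>G\<^esub> s) x)))"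

definition lift_at :: "'o \<Rightarrow> 'o \<Rightarrow> ('o \<times> 'o \<Rightarrow> 'c) set \<Rightarrow> 'c" where
  "lift_at y x \<gamma> = the_elem (orbit_norm y x ` \<gamma>)"

lemma orbit_norm_eq:
  "y \<in> v \<Longrightarrow> x \<in> u \<Longrightarrow> orbit_norm y x f = (\<Oplus>\<^bsub>Hom C y x\<^esub>s\<in>carrier G. orbit_act G \<phi> \<psi> v u s f (y, x))"
  by (simp add: orbit_norm_def orbit_act_apply)

lemma orbit_norm_hom:
  assumes v: "v \<in> orbs" and u: "u \<in> orbs" and y: "y \<in> v" and x: "x \<in> u"
  shows "orbit_norm y x \<in> module_hom K (orbit_sum C v u) (Hom C y x)"
  unfolding orbit_norm_def[abs_def]
proof (rule hom_sum[OF orbit_sum_module[OF v u] hom_mod])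
  show o: "x \<in> Obj C" "y \<in> Obj C" using orbs_obj assms by auto
  fix s assume s: "s \<in> carrier G"
  have "(\<phi> (inv\<^bsub>G\<^esub> s) y, \<phi> (inv\<^bsub>G\<^esub> s) x) \<in> v \<times> u" using orbs_act assms s by auto
  from dsum_proj_hom[where A = homp, OF this]
  show "(\<lambda>f. \<psi> s (\<phi> (inv\<^bsub>G\<^esub> s) y) (\<phi> (inv\<^bsub>G\<^esub> s) x) (f (\<phi> (inv\<^bsub>G\<^esub> s) y, \<phi> (inv\<^bsub>G\<^esub> s) x)))
      \<in> module_hom K (orbit_sum C v u) (Hom C y x)"
    unfolding orbit_sum_def by (intro hom_comp[OF _ act_mor_back[OF s o]]) simp
qed

lemma orbit_norm_killed:
  assumes v: "v \<in> orbs" and u: "u \<in> orbs" and y: "y \<in> v" and x: "x \<in> u" and w: "w \<in> relators v u"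
  shows "orbit_norm y x w = \<zero>\<^bsub>Hom C y x\<^esub>"
proof (rule augmentation_span_killed[OF finite_group orbit_sum_module[OF v u] _ _ orbit_norm_hom[OF assms(1-4)] _ w])
  show H: "module K (Hom C y x)" using orbs_obj assms by (intro hom_mod) auto
  interpret H: module K "Hom C y x" by (rule H)
  fix s f assume s: "s \<in> carrier G" and f: "f \<in> carrier (orbit_sum C v u)"
  show "orbit_act G \<phi> \<psi> v u s f \<in> carrier (orbit_sum C v u)" by (rule orbit_act_closed[OF v u s f])
  have h: "(\<lambda>g. orbit_act G \<phi> \<psi> v u g f (y, x)) \<in> carrier G \<rightarrow> carrier (Hom C y x)"
    using orbit_sumD[OF v u orbit_act_closed[OF v u _ f] y x] by auto
  have "orbit_norm y x (orbit_act G \<phi> \<psi> v u s f) = (\<Oplus>\<^bsub>Hom C y x\<^esub>g\<in>carrier G. orbit_act G \<phi> \<psi> v u (g \<otimes>\<^bsub>G\<^esub> s) f (y, x))"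
    unfolding orbit_norm_eq[OF y x] using h s by (intro H.finsum_cong') (auto simp: orbit_act_mult[OF v u _ s f y x])
  also have "\<dots> = orbit_norm y x f"
    unfolding orbit_norm_eq[OF y x] by (rule finsum_translate[OF H.abelian_monoid_axioms group_G s h])
  finally show "orbit_norm y x (orbit_act G \<phi> \<psi> v u s f) = orbit_norm y x f" .
qed

lemma lift_at_hom:
  assumes v: "v \<in> orbs" and u: "u \<in> orbs" and y: "y \<in> v" and x: "x \<in> u"
  shows "lift_at y x \<in> module_hom K (qhom v u) (Hom C y x)"
  unfolding lift_at_def[abs_def] quot_hom_def coinvariants_def
  by (rule quot_lift_hom[OF relators_submodule[OF v u] hom_mod orbit_norm_hom[OF assms] orbit_norm_killed[OF assms]])
    (use orbs_obj assms in auto)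

text \<open>By freeness at most one translate of \<open>c\<close> is a morphism from \<open>x'\<close> to \<open>y'\<close>, so the norm of \<open>c\<close> has at most one
  summand there.\<close>

lemma lift_at_cov:
  assumes v: "v \<in> orbs" and u: "u \<in> orbs" and y: "y \<in> v" and x: "x \<in> u"
    and y': "y' \<in> v" and x': "x' \<in> u" and c: "c \<in> carrier (Hom C y x)"
  shows "s \<in> carrier G \<Longrightarrow> y' = \<phi> s y \<Longrightarrow> x' = \<phi> s x \<Longrightarrow> lift_at y' x' (cov y x c) = \<psi> s y x c"
    and "\<not> (\<exists>s\<in>carrier G. y' = \<phi> s y \<and> x' = \<phi> s x) \<Longrightarrow> lift_at y' x' (cov y x c) = \<zero>\<^bsub>Hom C y' x'\<^esub>"
proof -
  have o: "y \<in> Obj C" "x \<in> Obj C" "y' \<in> Obj C" "x' \<in> Obj C" using orbs_obj assms by auto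
  interpret H: module K "Hom C y' x'" by (rule hom_mod[OF o(4,3)])
  let ?f = "orbit_inj C v u (y, x) c"
  have f: "?f \<in> carrier (orbit_sum C v u)" by (rule hom_in[OF orbit_inj_hom[OF v u y x] c])
  have "orbit_norm y' x' ` (relators v u +>\<^bsub>orbit_sum C v u\<^esub> ?f) = {orbit_norm y' x' ?f}"
    by (rule coset_image[OF relators_submodule[OF v u] H.module_axioms orbit_norm_hom[OF v u y' x'] _ f])
      (rule orbit_norm_killed[OF v u y' x'])
  then have l: "lift_at y' x' (cov y x c) = orbit_norm y' x' ?f"
    by (simp add: lift_at_def cov_eq[OF v u y x] quot_class_def)
  also have "\<dots> = (\<Oplus>\<^bsub>Hom C y' x'\<^esub>s\<in>carrier G. if y' = \<phi> s y \<and> x' = \<phi> s x then \<psi> s y x c else \<zero>\<^bsub>Hom C y' x'\<^esub>)"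
    unfolding orbit_norm_eq[OF y' x'] using act_mor[OF _ o(2,1) c]
    by (intro H.finsum_cong') (auto simp: orbit_act_inj[OF v u y x _ c y' x'])
  finally have e: "lift_at y' x' (cov y x c) = \<dots>" .
  show "lift_at y' x' (cov y x c) = \<psi> s y x c" if s: "s \<in> carrier G" "y' = \<phi> s y" "x' = \<phi> s x"
  proof -
    have ps: "\<psi> s y x c \<in> carrier (Hom C y' x')" using act_mor[OF s(1) o(2,1) c] s by simp
    have "(if y' = \<phi> g y \<and> x' = \<phi> g x then \<psi> g y x c else \<zero>\<^bsub>Hom C y' x'\<^esub>) = (if s = g then \<psi> s y x c else \<zero>\<^bsub>Hom C y' x'\<^esub>)"
      if "g \<in> carrier G" for g
      using that s act_free[OF s(1) that o(1)] by auto
    then have "lift_at y' x' (cov y x c) = (\<Oplus>\<^bsub>Hom C y' x'\<^esub>g\<in>carrier G. if s = g then \<psi> s y x c else \<zero>\<^bsub>Hom C y' x'\<^esub>)"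
      unfolding e using ps by (intro H.finsum_cong') auto
    also have "\<dots> = \<psi> s y x c"
      using H.finsum_singleton[OF s(1) finite_group, of "\<lambda>_. \<psi> s y x c"] ps by simp
    finally show ?thesis .
  qed
  show "lift_at y' x' (cov y x c) = \<zero>\<^bsub>Hom C y' x'\<^esub>" if n: "\<not> (\<exists>s\<in>carrier G. y' = \<phi> s y \<and> x' = \<phi> s x)"
  proof -
    have "lift_at y' x' (cov y x c) = (\<Oplus>\<^bsub>Hom C y' x'\<^esub>g\<in>carrier G. \<zero>\<^bsub>Hom C y' x'\<^esub>)"
      unfolding e using n by (intro H.finsum_cong') auto
    then show ?thesis by simp
  qed
qed

text \<open>A morphism of the quotient is recovered from its lifts with a fixed source: the class of a morphism
  starting at another point of \<open>u\<close> has, by freeness, only one of its translates among the lifts starting at \<open>x\<close>, and its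
  other lifts vanish.\<close>

lemma quot_hom_expand:
  assumes v: "v \<in> orbs" and u: "u \<in> orbs" and x: "x \<in> u" and \<gamma>: "\<gamma> \<in> carrier (qhom v u)"
  shows "(\<Oplus>\<^bsub>qhom v u\<^esub>y\<in>v. cov y x (lift_at y x \<gamma>)) = \<gamma>"
proof -
  interpret Q: module K "qhom v u" by (rule quot_hom_module[OF v u])
  have h: "(\<lambda>\<gamma>. cov y x (lift_at y x \<gamma>)) \<in> module_hom K (qhom v u) (qhom v u)" if "y \<in> v" for y
    by (rule hom_comp[OF lift_at_hom[OF v u that x] cov_hom'[OF v u that x]])
  have s: "(\<lambda>\<gamma>. \<Oplus>\<^bsub>qhom v u\<^esub>y\<in>v. cov y x (lift_at y x \<gamma>)) \<in> module_hom K (qhom v u) (qhom v u)"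
    by (rule hom_sum[OF Q.module_axioms Q.module_axioms h])
  show ?thesis
  proof (rule quot_hom_ext[OF v u Q.module_axioms s hom_id _ \<gamma>])
    fix y0 x0 c assume y0: "y0 \<in> v" and x0: "x0 \<in> u" and c: "c \<in> carrier (Hom C y0 x0)"
    obtain s where s: "s \<in> carrier G" "x = \<phi> s x0" by (rule orbs_trans[OF u x0 x])
    have o: "y0 \<in> Obj C" "x0 \<in> Obj C" using orbs_obj v u y0 x0 by auto
    have sy: "\<phi> s y0 \<in> v" using orbs_act v y0 s by auto
    have cc: "cov y0 x0 c \<in> carrier (qhom v u)" by (rule hom_in[OF cov_hom'[OF v u y0 x0] c])
    have t: "cov y x (lift_at y x (cov y0 x0 c)) = (if \<phi> s y0 = y then cov y0 x0 c else \<zero>\<^bsub>qhom v u\<^esub>)"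
      if y: "y \<in> v" for y
    proof (cases "\<phi> s y0 = y")
      case True
      then show ?thesis
        using lift_at_cov(1)[OF v u y0 x0 y x c s(1)] s cov_act[OF s(1) o(2,1) c] by simp
    next
      case False
      have "\<not> (\<exists>g\<in>carrier G. y = \<phi> g y0 \<and> x = \<phi> g x0)"
        using False act_free[OF s(1) _ o(2)] s(2) by auto
      then have "lift_at y x (cov y0 x0 c) = \<zero>\<^bsub>Hom C y x\<^esub>" by (rule lift_at_cov(2)[OF v u y0 x0 y x c])
      then show ?thesis
        using False hom_zero[OF cov_hom'[OF v u y x] hom_mod Q.module_axioms] orbs_obj[OF v y] orbs_obj[OF u x] by simp
    qed
    have "(\<Oplus>\<^bsub>qhom v u\<^esub>y\<in>v. cov y x (lift_at y x (cov y0 x0 c))) =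
        (\<Oplus>\<^bsub>qhom v u\<^esub>y\<in>v. if \<phi> s y0 = y then cov y0 x0 c else \<zero>\<^bsub>qhom v u\<^esub>)"
      using cc t by (intro Q.finsum_cong') auto
    also have "\<dots> = cov y0 x0 c"
      using Q.finsum_singleton[OF sy orbs_finite[OF v], of "\<lambda>_. cov y0 x0 c"] cc by simp
    finally show "(\<Oplus>\<^bsub>qhom v u\<^esub>y\<in>v. cov y x (lift_at y x (cov y0 x0 c))) = cov y0 x0 c" .
  qed
qed

text \<open>Composition in the quotient, computed on lifts with the common source \<open>x\<close>. Unlike the definition of
  \<^const>\<open>quot_comp\<close> it does not mention representatives, so it is visibly well defined and bilinear.\<close>

definition lifted_comp where
  "lifted_comp w v u x \<gamma> \<delta> = (\<Oplus>\<^bsub>qhom w u\<^esub>y\<in>v. \<Oplus>\<^bsub>qhom w u\<^esub>z\<in>w.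
    cov z x (comp C z y x (lift_at z y \<gamma>) (lift_at y x \<delta>)))"

lemma lifted_comp_bilinear:
  assumes w: "w \<in> orbs" and v: "v \<in> orbs" and u: "u \<in> orbs" and x: "x \<in> u"
  shows "bilinear K (qhom w v) (qhom v u) (qhom w u) (lifted_comp w v u x)"
  unfolding bilinear_def
proof (intro conjI ballI)
  note Q = quot_hom_module
  fix \<gamma> assume \<gamma>: "\<gamma> \<in> carrier (qhom w v)"
  show "lifted_comp w v u x \<gamma> \<in> module_hom K (qhom v u) (qhom w u)"
    unfolding lifted_comp_def[abs_def]
  proof (intro hom_sum[OF Q[OF v u] Q[OF w u]])
    fix y z assume y: "y \<in> v" and z: "z \<in> w"
    have "comp C z y x (lift_at z y \<gamma>) \<in> module_hom K (Hom C y x) (Hom C z x)"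
      by (rule bilinearD(1)[OF comp_bilinear hom_in[OF lift_at_hom[OF w v z y] \<gamma>]]) (use orbs_obj x y z u v w in auto)
    then show "(\<lambda>\<delta>. cov z x (comp C z y x (lift_at z y \<gamma>) (lift_at y x \<delta>))) \<in> module_hom K (qhom v u) (qhom w u)"
      by (rule hom_comp[OF hom_comp[OF lift_at_hom[OF v u y x]] cov_hom'[OF w u z x]])
  qed
next
  note Q = quot_hom_module
  fix \<delta> assume \<delta>: "\<delta> \<in> carrier (qhom v u)"
  show "(\<lambda>\<gamma>. lifted_comp w v u x \<gamma> \<delta>) \<in> module_hom K (qhom w v) (qhom w u)"
    unfolding lifted_comp_def
  proof (intro hom_sum[OF Q[OF w v] Q[OF w u]])
    fix y z assume y: "y \<in> v" and z: "z \<in> w"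
    have "(\<lambda>c. comp C z y x c (lift_at y x \<delta>)) \<in> module_hom K (Hom C z y) (Hom C z x)"
      by (rule bilinearD(2)[OF comp_bilinear hom_in[OF lift_at_hom[OF v u y x] \<delta>]]) (use orbs_obj x y z u v w in auto)
    then show "(\<lambda>\<gamma>. cov z x (comp C z y x (lift_at z y \<gamma>) (lift_at y x \<delta>))) \<in> module_hom K (qhom w v) (qhom w u)"
      by (rule hom_comp[OF hom_comp[OF lift_at_hom[OF w v z y]] cov_hom'[OF w u z x]])
  qed
qed

text \<open>Translating by the \<open>t\<close> with \<open>t x = x\<^sub>0\<close> makes \<open>e\<close> start at \<open>x\<^sub>0\<close>. In the double sum only the lift \<open>t e\<close> and the
  lift of \<open>d\<close> that starts where \<open>t e\<close> ends remain, and their composite is the translate of \<open>(s d) e\<close>.\<close>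

lemma lifted_comp_cov:
  assumes w: "w \<in> orbs" and v: "v \<in> orbs" and u: "u \<in> orbs" and x0: "x0 \<in> u"
    and z: "z \<in> w" and y': "y' \<in> v" and y: "y \<in> v" and x: "x \<in> u"
    and d: "d \<in> carrier (Hom C z y')" and e: "e \<in> carrier (Hom C y x)"
    and s: "s \<in> carrier G" "\<phi> s y' = y"
  shows "lifted_comp w v u x0 (cov z y' d) (cov y x e) = cov (\<phi> s z) x (comp C (\<phi> s z) y x (\<psi> s z y' d) e)"
proof -
  let ?Q = "qhom w u"
  interpret Q: module K ?Q by (rule quot_hom_module[OF w u])
  obtain t where t: "t \<in> carrier G" "x0 = \<phi> t x" by (rule orbs_trans[OF u x x0])
  have o: "z \<in> Obj C" "y' \<in> Obj C" "y \<in> Obj C" "x \<in> Obj C" "x0 \<in> Obj C" using orbs_obj assms by auto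
  let ?g = "t \<otimes>\<^bsub>G\<^esub> s"
  have g: "?g \<in> carrier G" using t s by simp
  let ?y1 = "\<phi> t y" and ?z1 = "\<phi> ?g z"
  have y1: "?y1 \<in> v" and z1: "?z1 \<in> w" using orbs_act v w y z t g by auto
  have y1e: "?y1 = \<phi> ?g y'" using s t o by (simp add: act_obj_mult[symmetric])
  let ?k = "\<lambda>y z. cov z x0 (comp C z y x0 (lift_at z y (cov z y' d)) (lift_at y x0 (cov y x e)))"
  have sd: "\<psi> s z y' d \<in> carrier (Hom C (\<phi> s z) y)" using act_mor[OF s(1) o(2,1) d] s(2) by simp
  have de: "comp C (\<phi> s z) y x (\<psi> s z y' d) e \<in> carrier (Hom C (\<phi> s z) x)"
    by (rule bilinearD(3)[OF comp_bilinear sd e]) (use o act_obj s in auto)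
  let ?r = "cov (\<phi> s z) x (comp C (\<phi> s z) y x (\<psi> s z y' d) e)"
  have szw: "\<phi> s z \<in> w" using orbs_act w z s by auto
  have r: "?r \<in> carrier ?Q" by (rule hom_in[OF cov_hom'[OF w u szw x] de])
  let ?c = "\<lambda>a b. cov a x0 (comp C a b x0 (lift_at a b (cov z y' d)) (lift_at b x0 (cov y x e)))"
  have l0: "?c z' y2 = (if ?y1 = y2 then (if ?z1 = z' then ?r else \<zero>\<^bsub>?Q\<^esub>) else \<zero>\<^bsub>?Q\<^esub>)"
    if y2: "y2 \<in> v" and z': "z' \<in> w" for y2 z'
  proof -
    have oo: "y2 \<in> Obj C" "z' \<in> Obj C" using orbs_obj y2 z' v w by auto
    note bl = comp_bilinear[OF o(5) oo]
    note cz = hom_zero[OF cov_hom'[OF w u z' x0] hom_mod[OF o(5) oo(2)] Q.module_axioms]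
    have ld: "lift_at z' y2 (cov z y' d) \<in> carrier (Hom C z' y2)"
      by (rule hom_in[OF lift_at_hom[OF w v z' y2] hom_in[OF cov_hom'[OF w v z y'] d]])
    have le: "lift_at y2 x0 (cov y x e) \<in> carrier (Hom C y2 x0)"
      by (rule hom_in[OF lift_at_hom[OF v u y2 x0] hom_in[OF cov_hom'[OF v u y x] e]])
    show ?thesis
    proof (cases "?y1 = y2")
      case y2e: True
      have le': "lift_at y2 x0 (cov y x e) = \<psi> t y x e"
        by (rule lift_at_cov(1)[OF v u y x y2 x0 e t(1) _ t(2)]) (simp add: y2e)
      show ?thesis
      proof (cases "?z1 = z'")
        case True
        have ld': "lift_at z' y2 (cov z y' d) = \<psi> ?g z y' d"
          by (rule lift_at_cov(1)[OF w v z y' z' y2 d g]) (simp_all add: True[symmetric] y2e[symmetric] y1e)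
        have tsd: "\<psi> ?g z y' d = \<psi> t (\<phi> s z) y (\<psi> s z y' d)"
          using act_mult[OF s(1) t(1) o(2,1) d] s(2) by simp
        have z1e: "?z1 = \<phi> t (\<phi> s z)" using t s o by (simp add: act_obj_mult)
        have "?c z' y2 = cov (\<phi> t (\<phi> s z)) (\<phi> t x) (comp C (\<phi> t (\<phi> s z)) (\<phi> t y) (\<phi> t x) (\<psi> t (\<phi> s z) y (\<psi> s z y' d)) (\<psi> t y x e))"
          unfolding ld' le' tsd using True y2e z1e t(2) by simp
        also have "\<dots> = cov (\<phi> t (\<phi> s z)) (\<phi> t x) (\<psi> t (\<phi> s z) x (comp C (\<phi> s z) y x (\<psi> s z y' d) e))"
          using act_comp[OF t(1) o(4,3) act_obj[OF s(1) o(1)] e sd] by simp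
        also have "\<dots> = ?r" by (rule cov_act[OF t(1) o(4) act_obj[OF s(1) o(1)] de])
        finally show ?thesis using True y2e by simp
      next
        case False
        have "\<not> (\<exists>h\<in>carrier G. z' = \<phi> h z \<and> y2 = \<phi> h y')"
          using act_free[OF g _ o(2)] False y1e y2e by auto
        then have "lift_at z' y2 (cov z y' d) = \<zero>\<^bsub>Hom C z' y2\<^esub>" by (rule lift_at_cov(2)[OF w v z y' z' y2 d])
        then show ?thesis
          using False y2e cz hom_zero[OF bilinearD(2)[OF bl le] hom_mod[OF oo] hom_mod[OF o(5) oo(2)]] by simp
      qed
    next
      case False
      have "\<not> (\<exists>h\<in>carrier G. y2 = \<phi> h y \<and> x0 = \<phi> h x)"
        using act_free[OF t(1) _ o(4)] False t(2) by auto
      then have "lift_at y2 x0 (cov y x e) = \<zero>\<^bsub>Hom C y2 x0\<^esub>" by (rule lift_at_cov(2)[OF v u y x y2 x0 e])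
      then show ?thesis
        using False cz hom_zero[OF bilinearD(1)[OF bl ld] hom_mod[OF o(5) oo(1)] hom_mod[OF o(5) oo(2)]] by simp
    qed
  qed
  have "lifted_comp w v u x0 (cov z y' d) (cov y x e) = (\<Oplus>\<^bsub>?Q\<^esub>y2\<in>v. if ?y1 = y2 then ?r else \<zero>\<^bsub>?Q\<^esub>)"
    unfolding lifted_comp_def
  proof (intro Q.finsum_cong' refl)
    fix y2 assume y2: "y2 \<in> v"
    have "(\<Oplus>\<^bsub>?Q\<^esub>z'\<in>w. ?c z' y2) = (\<Oplus>\<^bsub>?Q\<^esub>z'\<in>w. if ?z1 = z' then (if ?y1 = y2 then ?r else \<zero>\<^bsub>?Q\<^esub>) else \<zero>\<^bsub>?Q\<^esub>)"
      using l0[OF y2] r by (intro Q.finsum_cong') auto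
    also have "\<dots> = (if ?y1 = y2 then ?r else \<zero>\<^bsub>?Q\<^esub>)"
      using Q.finsum_singleton[OF z1 orbs_finite[OF w], of "\<lambda>_. if ?y1 = y2 then ?r else \<zero>\<^bsub>?Q\<^esub>"] r by simp
    finally show "(\<Oplus>\<^bsub>?Q\<^esub>z'\<in>w. ?c z' y2) = (if ?y1 = y2 then ?r else \<zero>\<^bsub>?Q\<^esub>)" .
  qed (use r in auto)
  also have "\<dots> = ?r"
    using Q.finsum_singleton[OF y1 orbs_finite[OF v], of "\<lambda>_. ?r"] r by simp
  finally show ?thesis .
qed

lemma bilinear_finsum:
  assumes b: "bilinear K A B D f" and A: "module K A" and B: "module K B" and D: "module K D"
    and fin: "finite I" "finite J" and g: "g \<in> I \<rightarrow> carrier A" and h: "h \<in> J \<rightarrow> carrier B"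
  shows "(\<Oplus>\<^bsub>D\<^esub>k\<in>I \<times> J. f (g (fst k)) (h (snd k))) = f (finsum A g I) (finsum B h J)"
proof -
  interpret A: module K A by fact
  interpret B: module K B by fact
  interpret D: module K D by fact
  have gi: "g i \<in> carrier A" if "i \<in> I" for i using g that by auto
  have hj: "h j \<in> carrier B" if "j \<in> J" for j using h that by auto
  have hs: "finsum B h J \<in> carrier B" using h by (rule B.finsum_closed)
  have "(\<Oplus>\<^bsub>D\<^esub>k\<in>I \<times> J. f (g (fst k)) (h (snd k))) = (\<Oplus>\<^bsub>D\<^esub>i\<in>I. \<Oplus>\<^bsub>D\<^esub>j\<in>J. f (g i) (h j))"
    using bilinearD(3)[OF b gi hj] by (intro finsum_cartesian[OF D.abelian_monoid_axioms fin]) auto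
  also have "\<dots> = (\<Oplus>\<^bsub>D\<^esub>i\<in>I. f (g i) (finsum B h J))"
    using hom_finsum[OF bilinearD(1)[OF b gi] B D h] bilinearD(3)[OF b gi hs] by (intro D.finsum_cong') auto
  also have "\<dots> = f (finsum A g I) (finsum B h J)"
    by (rule hom_finsum[OF bilinearD(2)[OF b hs] A D g, symmetric])
  finally show ?thesis .
qed

lemma class_expand:
  assumes v: "v \<in> orbs" and u: "u \<in> orbs" and d: "d \<in> carrier (orbit_sum C v u)"
  shows "finite (orbit_supp C v u d)" "orbit_supp C v u d \<subseteq> v \<times> u"
    "(\<lambda>i. cov (fst i) (snd i) (d i)) \<in> orbit_supp C v u d \<rightarrow> carrier (qhom v u)"
    "qclass v u d = (\<Oplus>\<^bsub>qhom v u\<^esub>i\<in>orbit_supp C v u d. cov (fst i) (snd i) (d i))"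
proof -
  let ?I = "orbit_supp C v u d"
  show I: "?I \<subseteq> v \<times> u" by (auto simp: orbit_supp_def dsum_supp_def)
  then show fin: "finite ?I" by (rule finite_subset) (use orbs_finite v u in auto)
  interpret Q: module K "qhom v u" by (rule quot_hom_module[OF v u])
  have e: "qclass v u (orbit_inj C v u i (d i)) = cov (fst i) (snd i) (d i)"
    and j: "orbit_inj C v u i (d i) \<in> carrier (orbit_sum C v u)" if iI: "i \<in> ?I" for i
  proof -
    obtain y x where i: "i = (y, x)" "y \<in> v" "x \<in> u" using I iI by auto
    show "qclass v u (orbit_inj C v u i (d i)) = cov (fst i) (snd i) (d i)"
      by (simp add: i cov_eq[OF v u])
    show "orbit_inj C v u i (d i) \<in> carrier (orbit_sum C v u)"
      unfolding i(1) by (rule hom_in[OF orbit_inj_hom[OF v u i(2,3)] orbit_sumD[OF v u d i(2,3)]])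
  qed
  show c: "(\<lambda>i. cov (fst i) (snd i) (d i)) \<in> ?I \<rightarrow> carrier (qhom v u)"
    using e hom_in[OF quot_class_hom'[OF v u] j] by auto
  have "d = (\<Oplus>\<^bsub>orbit_sum C v u\<^esub>i\<in>?I. orbit_inj C v u i (d i))"
    unfolding orbit_sum_def orbit_inj_def
    by (rule dsum_expand[OF homp_mod[OF v u] d[unfolded orbit_sum_def] fin _ I]) (auto simp: orbit_supp_def)
  then have "qclass v u d = qclass v u (\<Oplus>\<^bsub>orbit_sum C v u\<^esub>i\<in>?I. orbit_inj C v u i (d i))"
    by simp
  also have "\<dots> = (\<Oplus>\<^bsub>qhom v u\<^esub>i\<in>?I. qclass v u (orbit_inj C v u i (d i)))"
    using j by (intro hom_finsum[OF quot_class_hom'[OF v u] orbit_sum_module[OF v u] Q.module_axioms]) auto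
  also have "\<dots> = (\<Oplus>\<^bsub>qhom v u\<^esub>i\<in>?I. cov (fst i) (snd i) (d i))"
    using c e by (intro Q.finsum_cong') auto
  finally show "qclass v u d = (\<Oplus>\<^bsub>qhom v u\<^esub>i\<in>?I. cov (fst i) (snd i) (d i))" .
qed

text \<open>Both sides are sums over the pairs of components of representatives, on the left by definition and
  on the right by bilinearity, and they agree for each pair. In particular the union in the definition of
  \<^const>\<open>quot_comp\<close> is a union of equal cosets.\<close>

lemma quot_comp_eq:
  assumes w: "w \<in> orbs" and v: "v \<in> orbs" and u: "u \<in> orbs" and x0: "x0 \<in> u"
    and \<gamma>: "\<gamma> \<in> carrier (qhom w v)" and \<delta>: "\<delta> \<in> carrier (qhom v u)"
  shows "quot_comp K C G \<phi> \<psi> w v u \<gamma> \<delta> = lifted_comp w v u x0 \<gamma> \<delta>"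
proof -
  let ?Q = "qhom w u"
  let ?k = "\<lambda>d e. \<lambda>((z, y'), (y, x)). let s = (THE s. s \<in> carrier G \<and> \<phi> s y' = y) in
          orbit_inj C w u (\<phi> s z, x) (comp C (\<phi> s z) y x (\<psi> s z y' (d (z, y'))) (e (y, x)))"
  interpret Q: module K ?Q by (rule quot_hom_module[OF w u])
  note b = lifted_comp_bilinear[OF w v u x0]
  have *: "qclass w u (finsum (orbit_sum C w u) (?k d e) (orbit_supp C w v d \<times> orbit_supp C v u e)) =
      lifted_comp w v u x0 (qclass w v d) (qclass v u e)"
    if d: "d \<in> carrier (orbit_sum C w v)" and e: "e \<in> carrier (orbit_sum C v u)" for d e
  proof -
    let ?I = "orbit_supp C w v d" and ?J = "orbit_supp C v u e"
    note cd = class_expand[OF w v d] and ce = class_expand[OF v u e]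
    have k: "?k d e p \<in> carrier (orbit_sum C w u)"
        "qclass w u (?k d e p) =
          lifted_comp w v u x0 (cov (fst (fst p)) (snd (fst p)) (d (fst p))) (cov (fst (snd p)) (snd (snd p)) (e (snd p)))"
      if "p \<in> ?I \<times> ?J" for p
    proof -
      obtain z y' y x where p: "p = ((z, y'), (y, x))" by (metis prod.collapse)
      have zyx: "z \<in> w" "y' \<in> v" "y \<in> v" "x \<in> u" using that p cd(2) ce(2) by auto
      have o: "z \<in> Obj C" "y' \<in> Obj C" "y \<in> Obj C" "x \<in> Obj C" using orbs_obj zyx w v u by auto
      obtain s where s: "s \<in> carrier G" "\<phi> s y' = y" by (rule orbs_trans[OF v zyx(2,3)]) auto
      have the: "(THE s. s \<in> carrier G \<and> \<phi> s y' = y) = s"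
      proof (rule the_equality)
        show "s \<in> carrier G \<and> \<phi> s y' = y" using s by simp
        fix g assume g: "g \<in> carrier G \<and> \<phi> g y' = y"
        then have "\<phi> g y' = \<phi> s y'" using s(2) by simp
        then show "g = s" by (rule act_free[OF conjunct1[OF g] s(1) o(2)])
      qed
      have kp: "?k d e p = orbit_inj C w u (\<phi> s z, x) (comp C (\<phi> s z) y x (\<psi> s z y' (d (z, y'))) (e (y, x)))"
        by (simp add: p the)
      have dd: "d (z, y') \<in> carrier (Hom C z y')" and ee: "e (y, x) \<in> carrier (Hom C y x)"
        using orbit_sumD[OF w v d zyx(1,2)] orbit_sumD[OF v u e zyx(3,4)] by auto
      have sd: "\<psi> s z y' (d (z, y')) \<in> carrier (Hom C (\<phi> s z) y)" using act_mor[OF s(1) o(2,1) dd] s(2) by simp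
      have de: "comp C (\<phi> s z) y x (\<psi> s z y' (d (z, y'))) (e (y, x)) \<in> carrier (Hom C (\<phi> s z) x)"
        by (rule bilinearD(3)[OF comp_bilinear sd ee]) (use o act_obj s in auto)
      have sz: "\<phi> s z \<in> w" using orbs_act w zyx s by auto
      show "?k d e p \<in> carrier (orbit_sum C w u)"
        unfolding kp by (rule hom_in[OF orbit_inj_hom[OF w u sz zyx(4)] de])
      show "qclass w u (?k d e p) =
          lifted_comp w v u x0 (cov (fst (fst p)) (snd (fst p)) (d (fst p))) (cov (fst (snd p)) (snd (snd p)) (e (snd p)))"
        unfolding kp using lifted_comp_cov[OF w v u x0 zyx dd ee s] by (simp add: p cov_eq[OF w u sz zyx(4)])
    qed
    have "qclass w u (finsum (orbit_sum C w u) (?k d e) (?I \<times> ?J)) =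
        (\<Oplus>\<^bsub>?Q\<^esub>p\<in>?I \<times> ?J. qclass w u (?k d e p))"
      using k(1) by (intro hom_finsum[OF quot_class_hom'[OF w u] orbit_sum_module[OF w u] Q.module_axioms]) (rule Pi_I)
    also have "\<dots> = (\<Oplus>\<^bsub>?Q\<^esub>p\<in>?I \<times> ?J. lifted_comp w v u x0 (cov (fst (fst p)) (snd (fst p)) (d (fst p))) (cov (fst (snd p)) (snd (snd p)) (e (snd p))))"
      using k(2) hom_in[OF quot_class_hom'[OF w u] k(1)] by (intro Q.finsum_cong' refl) (auto simp del: split_paired_All)
    also have "\<dots> = lifted_comp w v u x0 (qclass w v d) (qclass v u e)"
      unfolding cd(4) ce(4)
      by (rule bilinear_finsum[OF b quot_hom_module[OF w v] quot_hom_module[OF v u] Q.module_axioms cd(1) ce(1) cd(3) ce(3)])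
    finally show ?thesis .
  qed
  obtain d0 where d0: "d0 \<in> carrier (orbit_sum C w v)" "\<gamma> = qclass w v d0"
    using \<gamma> by (auto simp: quot_hom_def coinvariants_def quot_space_carrier quot_class_def)
  obtain e0 where e0: "e0 \<in> carrier (orbit_sum C v u)" "\<delta> = qclass v u e0"
    using \<delta> by (auto simp: quot_hom_def coinvariants_def quot_space_carrier quot_class_def)
  have d: "d \<in> carrier (orbit_sum C w v)" "qclass w v d = \<gamma>" if "d \<in> \<gamma>" for d
    using coset_memD[OF relators_submodule[OF w v] d0(1), of d] that d0(2) by (auto simp: quot_class_def)
  have e: "e \<in> carrier (orbit_sum C v u)" "qclass v u e = \<delta>" if "e \<in> \<delta>" for e
    using coset_memD[OF relators_submodule[OF v u] e0(1), of e] that e0(2) by (auto simp: quot_class_def)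
  have ne: "d0 \<in> \<gamma>" "e0 \<in> \<delta>"
    using coset_self[OF relators_submodule[OF w v] d0(1)] coset_self[OF relators_submodule[OF v u] e0(1)] d0(2) e0(2)
    by (auto simp: quot_class_def)
  have "quot_comp K C G \<phi> \<psi> w v u \<gamma> \<delta> = (\<Union>d\<in>\<gamma>. \<Union>e\<in>\<delta>. lifted_comp w v u x0 \<gamma> \<delta>)"
    unfolding quot_comp_def
  proof (intro SUP_cong refl)
    fix d' e' assume "d' \<in> \<gamma>" "e' \<in> \<delta>"
    then show "qclass w u (finsum (orbit_sum C w u) (?k d' e') (orbit_supp C w v d' \<times> orbit_supp C v u e')) =
        lifted_comp w v u x0 \<gamma> \<delta>"
      using *[OF d(1) e(1), of d' e'] d(2)[of d'] e(2)[of e'] by simp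
  qed
  also have "\<dots> = lifted_comp w v u x0 \<gamma> \<delta>"
  proof -
    have "\<gamma> \<noteq> {}" "\<delta> \<noteq> {}" using ne by auto
    then show ?thesis by simp
  qed
  finally show ?thesis .
qed

lemma orbs_nonempty: "v \<in> orbs \<Longrightarrow> \<exists>x. x \<in> v"
  using orb_self by (auto simp: orbits_def)

lemma quot_comp_bilinear:
  assumes w: "w \<in> orbs" and v: "v \<in> orbs" and u: "u \<in> orbs"
  shows "bilinear K (qhom w v) (qhom v u) (qhom w u)
    (quot_comp K C G \<phi> \<psi> w v u)"
proof -
  obtain x where x: "x \<in> u" using orbs_nonempty[OF u] by blast
  note b = lifted_comp_bilinear[OF assms x] and e = quot_comp_eq[OF assms x]
  show ?thesis unfolding bilinear_def
  proof (intro conjI ballI)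
    show "quot_comp K C G \<phi> \<psi> w v u \<gamma> \<in> module_hom K (qhom v u) (qhom w u)"
      if "\<gamma> \<in> carrier (qhom w v)" for \<gamma>
      by (rule hom_cong[OF bilinearD(1)[OF b that] quot_hom_module[OF v u] e[OF that]])
    show "(\<lambda>\<gamma>. quot_comp K C G \<phi> \<psi> w v u \<gamma> \<delta>) \<in> module_hom K (qhom w v) (qhom w u)"
      if "\<delta> \<in> carrier (qhom v u)" for \<delta>
      by (rule hom_cong[OF bilinearD(2)[OF b that] quot_hom_module[OF w v] e[OF _ that]])
  qed
qed

lemma cov_comp:
  assumes x: "x \<in> Obj C" and y: "y \<in> Obj C" and z: "z \<in> Obj C"
    and c: "c \<in> carrier (Hom C y x)" and d: "d \<in> carrier (Hom C z y)"
  shows "cov z x (comp C z y x d c) = quot_comp K C G \<phi> \<psi> (orb z) (orb y) (orb x) (cov z y d) (cov y x c)"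
proof -
  note o = orb_in[OF z] orb_in[OF y] orb_in[OF x]
  show ?thesis
    unfolding quot_comp_eq[OF o orb_self[OF x] hom_in[OF cov_hom[OF y z] d] hom_in[OF cov_hom[OF x y] c]]
    using lifted_comp_cov[OF o orb_self[OF x] orb_self[OF z] orb_self[OF y] orb_self[OF y] orb_self[OF x] d c
        G.one_closed act_obj_one[OF y]] y z d
    by (simp add: act_obj_one act_one)
qed

end

section \<open>Transfer along the covering\<close>

context cring
begin

text \<open>Here \<open>X\<close> and \<open>Y\<close> are complexes and \<open>p\<close> is a chain map, and it follows that \<open>t\<close> is one: on elements \<open>y = p x\<close> one has
  \<open>t d y = t p d x = \<Sum>\<^sub>s s d x = d \<Sum>\<^sub>s s x = d t p x = d t y\<close>, and \<open>p\<close> is onto because \<open>p t\<close> is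
  invertible. So the faces of a tuple of lifts never have to be computed.\<close>

lemma transfer_commutes:
  assumes X1: "module R X1" and X0: "module R X0" and Y1: "module R Y1"
    and dX: "dX \<in> module_hom R X1 X0" and dY: "dY \<in> module_hom R Y1 Y0"
    and p1: "p1 \<in> module_hom R X1 Y1" and t1: "t1 \<in> module_hom R Y1 X1"
    and pt: "\<And>y. y \<in> carrier Y1 \<Longrightarrow> p1 (t1 y) = e \<odot>\<^bsub>Y1\<^esub> y"
    and tp1: "\<And>x. x \<in> carrier X1 \<Longrightarrow> t1 (p1 x) = (\<Oplus>\<^bsub>X1\<^esub>s\<in>S. act1 s x)"
    and tp0: "\<And>x. x \<in> carrier X0 \<Longrightarrow> t0 (p0 x) = (\<Oplus>\<^bsub>X0\<^esub>s\<in>S. act0 s x)"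
    and act1: "\<And>s. s \<in> S \<Longrightarrow> act1 s \<in> module_hom R X1 X1"
    and actd: "\<And>s x. s \<in> S \<Longrightarrow> x \<in> carrier X1 \<Longrightarrow> dX (act1 s x) = act0 s (dX x)"
    and pd: "\<And>x. x \<in> carrier X1 \<Longrightarrow> p0 (dX x) = dY (p1 x)"
    and c: "c \<in> carrier R" "e \<in> carrier R" "c \<otimes> e = \<one>" and y: "y \<in> carrier Y1"
  shows "t0 (dY y) = dX (t1 y)"
proof -
  interpret X1: module R X1 by fact
  interpret X0: module R X0 by fact
  interpret Y1: module R Y1 by fact
  let ?x = "c \<odot>\<^bsub>X1\<^esub> t1 y"
  have x: "?x \<in> carrier X1" using c hom_in[OF t1 y] by simp
  have ax: "(\<lambda>s. act1 s ?x) \<in> S \<rightarrow> carrier X1" using hom_in[OF act1 x] by auto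
  have px: "p1 ?x = y"
    using c y by (simp add: module_hom_smult[OF p1 c(1) hom_in[OF t1 y]] pt Y1.smult_assoc1[symmetric])
  have "t0 (dY y) = t0 (p0 (dX ?x))" by (simp add: pd x px)
  also have "\<dots> = (\<Oplus>\<^bsub>X0\<^esub>s\<in>S. act0 s (dX ?x))" by (rule tp0[OF hom_in[OF dX x]])
  also have "\<dots> = (\<Oplus>\<^bsub>X0\<^esub>s\<in>S. dX (act1 s ?x))"
    using actd[OF _ x] hom_in[OF dX] ax by (intro X0.finsum_cong') auto
  also have "\<dots> = dX (\<Oplus>\<^bsub>X1\<^esub>s\<in>S. act1 s ?x)" by (rule hom_finsum[OF dX X1 X0 ax, symmetric])
  also have "\<dots> = dX (t1 y)" by (simp add: tp1[OF x, symmetric] px)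
  finally show ?thesis .
qed

text \<open>The dual case: \<open>t\<close> commutes with the differentials and is injective, so it suffices to compare
  \<open>p d x\<close> and \<open>d p x\<close> after \<open>t\<close>, where \<open>t p\<close> is the norm of the action.\<close>

lemma transfer_commutes':
  assumes X0: "module R X0" and X1: "module R X1" and Y1: "module R Y1"
    and dX: "dX \<in> module_hom R X0 X1" and dY: "dY \<in> module_hom R Y0 Y1"
    and p0: "p0 \<in> module_hom R X0 Y0" and p1: "p1 \<in> module_hom R X1 Y1"
    and pt: "\<And>y. y \<in> carrier Y1 \<Longrightarrow> p1 (t1 y) = e \<odot>\<^bsub>Y1\<^esub> y"
    and tp0: "\<And>x. x \<in> carrier X0 \<Longrightarrow> t0 (p0 x) = (\<Oplus>\<^bsub>X0\<^esub>s\<in>S. act0 s x)"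
    and tp1: "\<And>x. x \<in> carrier X1 \<Longrightarrow> t1 (p1 x) = (\<Oplus>\<^bsub>X1\<^esub>s\<in>S. act1 s x)"
    and act0: "\<And>s. s \<in> S \<Longrightarrow> act0 s \<in> module_hom R X0 X0"
    and actd: "\<And>s x. s \<in> S \<Longrightarrow> x \<in> carrier X0 \<Longrightarrow> dX (act0 s x) = act1 s (dX x)"
    and td: "\<And>y. y \<in> carrier Y0 \<Longrightarrow> t1 (dY y) = dX (t0 y)"
    and c: "c \<in> carrier R" "e \<in> carrier R" "c \<otimes> e = \<one>" and x: "x \<in> carrier X0"
  shows "p1 (dX x) = dY (p0 x)"
proof -
  interpret X1: module R X1 by fact
  interpret Y1: module R Y1 by fact
  have ax: "(\<lambda>s. act0 s x) \<in> S \<rightarrow> carrier X0" using hom_in[OF act0 x] by auto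
  have "t1 (p1 (dX x)) = (\<Oplus>\<^bsub>X1\<^esub>s\<in>S. act1 s (dX x))" by (rule tp1[OF hom_in[OF dX x]])
  also have "\<dots> = (\<Oplus>\<^bsub>X1\<^esub>s\<in>S. dX (act0 s x))"
    using actd[OF _ x] hom_in[OF dX] ax by (intro X1.finsum_cong') auto
  also have "\<dots> = dX (\<Oplus>\<^bsub>X0\<^esub>s\<in>S. act0 s x)" by (rule hom_finsum[OF dX X0 X1 ax, symmetric])
  also have "\<dots> = t1 (dY (p0 x))" by (simp add: tp0[OF x, symmetric] td hom_in[OF p0 x])
  finally have "p1 (t1 (p1 (dX x))) = p1 (t1 (dY (p0 x)))" by simp
  then have "c \<odot>\<^bsub>Y1\<^esub> (e \<odot>\<^bsub>Y1\<^esub> p1 (dX x)) = c \<odot>\<^bsub>Y1\<^esub> (e \<odot>\<^bsub>Y1\<^esub> dY (p0 x))"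
    by (simp add: pt hom_in[OF p1 hom_in[OF dX x]] hom_in[OF dY hom_in[OF p0 x]])
  then show ?thesis
    using hom_in[OF p1 hom_in[OF dX x]] hom_in[OF dY hom_in[OF p0 x]] c
    by (simp add: Y1.smult_assoc1[symmetric])
qed

end

text \<open>For a tuple \<open>us\<close> of orbits, \<^term>\<open>listset us\<close> is the set of the tuples of objects above it.\<close>

lemma listset_iff: "xs \<in> listset us \<longleftrightarrow> length xs = length us \<and> (\<forall>i<length us. xs ! i \<in> us ! i)"
proof (induction us arbitrary: xs)
  case (Cons u us)
  show ?case
    by (cases xs) (auto simp: set_Cons_def Cons.IH All_less_Suc2)
qed simp

lemma listset_Cons_image: "listset (u # us) = (\<lambda>k. snd k # fst k) ` (listset us \<times> u)"
  by (force simp: set_Cons_def)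

lemma finite_listset: "(\<And>u. u \<in> set us \<Longrightarrow> finite u) \<Longrightarrow> finite (listset us)"
  by (induction us) (simp_all add: listset_Cons_image del: listset.simps(2))

lemma map_tuple_Cons: "xs \<noteq> [] \<Longrightarrow> map_tuple f (x # xs) (c # cs) = f x (hd xs) c # map_tuple f xs cs"
  by (simp add: map_tuple_def map_upt_Suc hd_conv_nth del: upt_Suc)

locale covering_bimodule = finite_covering K C G \<phi> \<psi>
  for K :: "('k, 'r) ring_scheme" (structure) and C :: "('o, 'c, 'k) kcat"
    and G :: "('g, 'h) monoid_scheme" and \<phi> :: "'g \<Rightarrow> 'o \<Rightarrow> 'o"
    and \<psi> :: "'g \<Rightarrow> 'o \<Rightarrow> 'o \<Rightarrow> 'c \<Rightarrow> 'c" +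
  fixes M :: "('o set, ('o \<times> 'o \<Rightarrow> 'c) set, 'm, 'k) bimod"
  assumes bimodule_M: "bimodule K (quot_cat K C G \<phi> \<psi>) M"
    and order_unit: "[order G] \<cdot> \<one> \<noteq> \<zero>"
begin

abbreviation "L \<equiv> lift_bimod K C G \<phi> \<psi> M"

lemma \<B>_simps [simp]:
  "Obj \<B> = orbs" "Hom \<B> = qhom" "comp \<B> = quot_comp K C G \<phi> \<psi>"
  by (simp_all add: quot_cat_def)

lemma L_simps [simp]:
  "Bim L y x = Bim M (orb y) (orb x)"
  "lact L z y x c m = lact M (orb z) (orb y) (orb x) (cov z y c) m"
  "ract L y x u m d = ract M (orb y) (orb x) (orb u) m (cov x u d)"
  by (simp_all add: lift_bimod_def)

sublocale B: lin_data K "\<B>" M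
proof (intro lin_data.intro lin_data_axioms.intro)
  show "cring K" by (rule is_cring)
  interpret bimodule K "\<B>" M by (rule bimodule_M)
  show "module K (Hom \<B> y x)" if "x \<in> Obj \<B>" "y \<in> Obj \<B>" for x y
    using that by (simp add: quot_hom_module)
  show "module K (Bim M y x)" if "x \<in> Obj \<B>" "y \<in> Obj \<B>" for x y
    using bim_vectorspace[OF that] by (simp add: vectorspace_def)
  show "bilinear K (Hom \<B> z y) (Hom \<B> y x) (Hom \<B> z x) (comp \<B> z y x)"
    if "x \<in> Obj \<B>" "y \<in> Obj \<B>" "z \<in> Obj \<B>" for x y z
    using that by (simp add: quot_comp_bilinear)
  show "bilinear K (Hom \<B> z y) (Bim M y x) (Bim M z x) (lact M z y x)"
    if "x \<in> Obj \<B>" "y \<in> Obj \<B>" "z \<in> Obj \<B>" for x y z by (rule lact_bilinear[OF that])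
  show "bilinear K (Bim M y x) (Hom \<B> x u) (Bim M y u) (ract M y x u)"
    if "u \<in> Obj \<B>" "x \<in> Obj \<B>" "y \<in> Obj \<B>" for u x y by (rule ract_bilinear[OF that])
qed

sublocale CL: lin_data K C L
proof (intro lin_data.intro lin_data_axioms.intro)
  show "cring K" by (rule is_cring)
  show "module K (Hom C y x)" if "x \<in> Obj C" "y \<in> Obj C" for x y by (rule hom_mod[OF that])
  show "module K (Bim L y x)" if "x \<in> Obj C" "y \<in> Obj C" for x y
    using B.bim_module[of "orb x" "orb y"] that by (simp add: orb_in)
  show "bilinear K (Hom C z y) (Hom C y x) (Hom C z x) (comp C z y x)"
    if "x \<in> Obj C" "y \<in> Obj C" "z \<in> Obj C" for x y z by (rule comp_bilinear[OF that])
  show "bilinear K (Hom C z y) (Bim L y x) (Bim L z x) (lact L z y x)"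
    if o: "x \<in> Obj C" "y \<in> Obj C" "z \<in> Obj C" for x y z
  proof -
    have b: "bilinear K (qhom (orb z) (orb y)) (Bim M (orb y) (orb x)) (Bim M (orb z) (orb x))
        (lact M (orb z) (orb y) (orb x))"
      using B.lact_bil[of "orb x" "orb y" "orb z"] o by (simp add: orb_in)
    show ?thesis unfolding bilinear_def L_simps
      by (intro conjI ballI)
        (auto intro: bilinearD(1)[OF b hom_in[OF cov_hom[OF o(2,3)]]] hom_comp[OF cov_hom[OF o(2,3)] bilinearD(2)[OF b]]
          simp: L_simps(2)[abs_def])
  qed
  show "bilinear K (Bim L y x) (Hom C x u) (Bim L y u) (ract L y x u)"
    if o: "u \<in> Obj C" "x \<in> Obj C" "y \<in> Obj C" for u x y
  proof -
    have b: "bilinear K (Bim M (orb y) (orb x)) (qhom (orb x) (orb u)) (Bim M (orb y) (orb u))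
        (ract M (orb y) (orb x) (orb u))"
      using B.ract_bil[of "orb u" "orb x" "orb y"] o by (simp add: orb_in)
    show ?thesis unfolding bilinear_def L_simps
      by (intro conjI ballI)
        (auto intro: bilinearD(2)[OF b hom_in[OF cov_hom[OF o(1,2)]]] hom_comp[OF cov_hom[OF o(1,2)] bilinearD(1)[OF b]]
          simp: L_simps(3)[abs_def])
  qed
qed

sublocale P: lin_functor K C L "\<B>" M orb cov
  by unfold_locales (simp_all add: orb_in cov_hom cov_comp)

lemma act_functor:
  assumes s: "s \<in> carrier G"
  shows "lin_functor K C L C L (\<phi> s) (\<psi> s)"
  by unfold_locales (simp_all add: s act_obj act_linear act_comp orb_act cov_act)

lemma push_act: "s \<in> carrier G \<Longrightarrow> lin_functor.push K C L C L (\<phi> s) (\<psi> s) n = chain_act K C \<phi> \<psi> L n s"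
  by (simp add: lin_functor.push_def[OF act_functor] chain_act_def act_tuple_eq)

lemma pull_act:
  "s \<in> carrier G \<Longrightarrow>
    lin_functor.pull K C L C (\<phi> (inv\<^bsub>G\<^esub> s)) (\<psi> (inv\<^bsub>G\<^esub> s)) n f = cochain_act K C G \<phi> \<psi> L n s f"
  by (simp add: lin_functor.pull_def[OF act_functor] cochain_act_def cochain_of_def act_tuple_eq Let_def)

lemma chain_act_hom: "s \<in> carrier G \<Longrightarrow> chain_act K C \<phi> \<psi> L n s \<in> module_hom K (chains K C L n) (chains K C L n)"
  using lin_functor.push_hom[OF act_functor, of s n] by (simp add: push_act)

lemma chain_act_gen:
  assumes "s \<in> carrier G" "xs \<in> obj_tuples C n" "m \<in> carrier (Bim L (last xs) (hd xs))" "cs \<in> tuples (homs C xs)"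
  shows "chain_act K C \<phi> \<psi> L n s (chain_gen K C L n xs (m, cs)) =
    chain_gen K C L n (map (\<phi> s) xs) (m, map_tuple (\<psi> s) xs cs)"
  using lin_functor.push_gen[OF act_functor[OF assms(1)] assms(2-)] by (simp only: push_act[OF assms(1)])

lemma chain_act_bd:
  assumes "s \<in> carrier G" "c \<in> carrier (chains K C L (Suc n))"
  shows "chain_bd K C L n (chain_act K C \<phi> \<psi> L (Suc n) s c) = chain_act K C \<phi> \<psi> L n s (chain_bd K C L n c)"
  using lin_functor.push_bd[OF act_functor[OF assms(1)] assms(2)] by (simp only: push_act[OF assms(1)])

lemma map_act:
  assumes s: "s \<in> carrier G" and xs: "xs \<in> obj_tuples C n" and cs: "cs \<in> tuples (homs C xs)"
  shows "map (\<phi> s) xs \<in> obj_tuples C n" "map_tuple (\<psi> s) xs cs \<in> tuples (homs C (map (\<phi> s) xs))"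
    "Bim L (last (map (\<phi> s) xs)) (hd (map (\<phi> s) xs)) = Bim L (last xs) (hd xs)"
    "Bim L (hd (map (\<phi> s) xs)) (last (map (\<phi> s) xs)) = Bim L (hd xs) (last xs)"
    "u \<in> carrier G \<Longrightarrow> map (\<phi> u) (map (\<phi> s) xs) = map (\<phi> (u \<otimes>\<^bsub>G\<^esub> s)) xs"
    "u \<in> carrier G \<Longrightarrow> map_tuple (\<psi> u) (map (\<phi> s) xs) (map_tuple (\<psi> s) xs cs) = map_tuple (\<psi> (u \<otimes>\<^bsub>G\<^esub> s)) xs cs"
    "map (\<phi> \<one>\<^bsub>G\<^esub>) xs = xs" "map_tuple (\<psi> \<one>\<^bsub>G\<^esub>) xs cs = cs"
proof -
  note f = act_functor[OF s] and d = obj_tuplesD[OF xs]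
  show "map (\<phi> s) xs \<in> obj_tuples C n" by (rule lin_functor.map_obj_tuples[OF f xs])
  show "map_tuple (\<psi> s) xs cs \<in> tuples (homs C (map (\<phi> s) xs))" by (rule lin_functor.map_tuple_closed[OF f xs cs])
  show "Bim L (last (map (\<phi> s) xs)) (hd (map (\<phi> s) xs)) = Bim L (last xs) (hd xs)"
    "Bim L (hd (map (\<phi> s) xs)) (last (map (\<phi> s) xs)) = Bim L (hd xs) (last xs)"
    by (rule lin_functor.map_ends[OF f xs])+
  have o: "xs ! i \<in> Obj C" if "i < length xs" for i using that d(1) by (intro d(5)) simp
  have c: "length cs = n" "cs ! i \<in> carrier (Hom C (xs ! i) (xs ! Suc i))" if "i < n" for i
    using cs that by (auto simp: tuples_iff d)
  have len: "length cs = n" using cs by (simp add: tuples_iff d)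
  show "map (\<phi> u) (map (\<phi> s) xs) = map (\<phi> (u \<otimes>\<^bsub>G\<^esub> s)) xs" if "u \<in> carrier G"
    using that s o by (intro nth_equalityI) (simp_all add: act_obj_mult)
  show "map_tuple (\<psi> u) (map (\<phi> s) xs) (map_tuple (\<psi> s) xs cs) = map_tuple (\<psi> (u \<otimes>\<^bsub>G\<^esub> s)) xs cs" if "u \<in> carrier G"
    using that s d(1) len o c(2) by (intro nth_equalityI) (simp_all add: act_mult)
  show "map (\<phi> \<one>\<^bsub>G\<^esub>) xs = xs" using o by (intro nth_equalityI) (simp_all add: act_obj_one)
  show "map_tuple (\<psi> \<one>\<^bsub>G\<^esub>) xs cs = cs" using len d(1) o c(2) by (intro nth_equalityI) (simp_all add: act_one)
qed

lemma chain_act_mult: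
  assumes s: "s \<in> carrier G" and u: "u \<in> carrier G" and c: "c \<in> carrier (chains K C L n)"
  shows "chain_act K C \<phi> \<psi> L n s (chain_act K C \<phi> \<psi> L n u c) = chain_act K C \<phi> \<psi> L n (s \<otimes>\<^bsub>G\<^esub> u) c"
proof (rule CL.chains_ext[OF CL.chains_module hom_comp[OF chain_act_hom[OF u] chain_act_hom[OF s]]
      chain_act_hom[OF G.m_closed[OF s u]] _ c])
  fix xs m cs assume xs: "xs \<in> obj_tuples C n" and m: "m \<in> carrier (Bim L (last xs) (hd xs))"
    and cs: "cs \<in> tuples (homs C xs)"
  note a = map_act[OF u xs cs]
  show "chain_act K C \<phi> \<psi> L n s (chain_act K C \<phi> \<psi> L n u (chain_gen K C L n xs (m, cs))) =
      chain_act K C \<phi> \<psi> L n (s \<otimes>\<^bsub>G\<^esub> u) (chain_gen K C L n xs (m, cs))"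
    unfolding chain_act_gen[OF u xs m cs] chain_act_gen[OF s a(1) m[folded a(3)] a(2)]
      chain_act_gen[OF G.m_closed[OF s u] xs m cs] a(5,6)[OF s] ..
qed

lemma chain_act_one:
  assumes c: "c \<in> carrier (chains K C L n)"
  shows "chain_act K C \<phi> \<psi> L n \<one>\<^bsub>G\<^esub> c = c"
proof (rule CL.chains_ext[OF CL.chains_module chain_act_hom[OF G.one_closed] hom_id _ c])
  fix xs m cs assume xs: "xs \<in> obj_tuples C n" and m: "m \<in> carrier (Bim L (last xs) (hd xs))"
    and cs: "cs \<in> tuples (homs C xs)"
  show "chain_act K C \<phi> \<psi> L n \<one>\<^bsub>G\<^esub> (chain_gen K C L n xs (m, cs)) = chain_gen K C L n xs (m, cs)"
    unfolding chain_act_gen[OF G.one_closed xs m cs] map_act(7,8)[OF G.one_closed xs cs] ..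
qed

lemma cochain_act_hom:
  assumes s: "s \<in> carrier G"
  shows "cochain_act K C G \<phi> \<psi> L n s \<in> module_hom K (cochains K C L n) (cochains K C L n)"
proof -
  have "lin_functor.pull K C L C (\<phi> (inv\<^bsub>G\<^esub> s)) (\<psi> (inv\<^bsub>G\<^esub> s)) n = cochain_act K C G \<phi> \<psi> L n s"
    by (rule ext) (rule pull_act[OF s])
  then show ?thesis using lin_functor.pull_hom[OF act_functor[OF G.inv_closed[OF s]], of n] by simp
qed

lemma cochain_act_pure:
  assumes s: "s \<in> carrier G" and f: "f \<in> carrier (cochains K C L n)" and "xs \<in> obj_tuples C n" "cs \<in> tuples (homs C xs)"
  shows "cochain_act K C G \<phi> \<psi> L n s f xs (pure_tensor K (homs C xs) cs) =
    f (map (\<phi> (inv\<^bsub>G\<^esub> s)) xs) (pure_tensor K (homs C (map (\<phi> (inv\<^bsub>G\<^esub> s)) xs)) (map_tuple (\<psi> (inv\<^bsub>G\<^esub> s)) xs cs))"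
  using lin_functor.pull_pure[OF act_functor[OF G.inv_closed[OF s]] assms(2-)] by (simp only: pull_act[OF s])

lemma cochain_act_bd:
  assumes s: "s \<in> carrier G" and f: "f \<in> carrier (cochains K C L n)"
  shows "cochain_bd K C L n (cochain_act K C G \<phi> \<psi> L n s f) = cochain_act K C G \<phi> \<psi> L (Suc n) s (cochain_bd K C L n f)"
  using lin_functor.pull_bd[OF act_functor[OF G.inv_closed[OF s]] f] by (simp only: pull_act[OF s])

lemma cochain_act_mult:
  assumes s: "s \<in> carrier G" and u: "u \<in> carrier G" and f: "f \<in> carrier (cochains K C L n)"
  shows "cochain_act K C G \<phi> \<psi> L n s (cochain_act K C G \<phi> \<psi> L n u f) = cochain_act K C G \<phi> \<psi> L n (s \<otimes>\<^bsub>G\<^esub> u) f"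
proof (rule CL.cochain_ext)
  note uf = hom_in[OF cochain_act_hom[OF u] f]
  show "cochain_act K C G \<phi> \<psi> L n s (cochain_act K C G \<phi> \<psi> L n u f) \<in> carrier (cochains K C L n)"
    by (rule hom_in[OF cochain_act_hom[OF s] uf])
  show "cochain_act K C G \<phi> \<psi> L n (s \<otimes>\<^bsub>G\<^esub> u) f \<in> carrier (cochains K C L n)"
    by (rule hom_in[OF cochain_act_hom[OF G.m_closed[OF s u]] f])
  fix xs cs assume xs: "xs \<in> obj_tuples C n" and cs: "cs \<in> tuples (homs C xs)"
  note a = map_act[OF G.inv_closed[OF s] xs cs]
  show "cochain_act K C G \<phi> \<psi> L n s (cochain_act K C G \<phi> \<psi> L n u f) xs (pure_tensor K (homs C xs) cs) =
      cochain_act K C G \<phi> \<psi> L n (s \<otimes>\<^bsub>G\<^esub> u) f xs (pure_tensor K (homs C xs) cs)"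
    unfolding cochain_act_pure[OF s uf xs cs] cochain_act_pure[OF u f a(1,2)]
      cochain_act_pure[OF G.m_closed[OF s u] f xs cs] a(5,6)[OF G.inv_closed[OF u]] G.inv_mult_group[OF s u] ..
qed

lemma cochain_act_one:
  assumes f: "f \<in> carrier (cochains K C L n)"
  shows "cochain_act K C G \<phi> \<psi> L n \<one>\<^bsub>G\<^esub> f = f"
proof (rule CL.cochain_ext[OF hom_in[OF cochain_act_hom[OF G.one_closed] f] f])
  fix xs cs assume xs: "xs \<in> obj_tuples C n" and cs: "cs \<in> tuples (homs C xs)"
  show "cochain_act K C G \<phi> \<psi> L n \<one>\<^bsub>G\<^esub> f xs (pure_tensor K (homs C xs) cs) = f xs (pure_tensor K (homs C xs) cs)"
    unfolding cochain_act_pure[OF G.one_closed f xs cs] G.inv_one map_act(7,8)[OF G.one_closed xs cs] ..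
qed

lemma listset_lifts:
  assumes us: "us \<in> obj_tuples \<B> n" and xs: "xs \<in> listset us"
  shows "xs \<in> obj_tuples C n" "map orb xs = us"
    "Bim L (last xs) (hd xs) = Bim M (last us) (hd us)" "Bim L (hd xs) (last xs) = Bim M (hd us) (last us)"
proof -
  have l: "length us = Suc n" "\<And>i. i < length us \<Longrightarrow> us ! i \<in> orbs" using us by (auto simp: obj_tuples_def)
  have x: "length xs = Suc n" "\<And>i. i < length us \<Longrightarrow> xs ! i \<in> us ! i" using xs l by (simp_all add: listset_iff)
  show xo: "xs \<in> obj_tuples C n" using x l orbs_obj[OF l(2) x(2)] by (auto simp: obj_tuples_def in_set_conv_nth)
  show m: "map orb xs = us" using x l orb_eq by (intro nth_equalityI) auto
  show "Bim L (last xs) (hd xs) = Bim M (last us) (hd us)" "Bim L (hd xs) (last xs) = Bim M (hd us) (last us)"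
    using P.map_ends[OF xo] by (simp_all add: m)
qed

lemma listset_self: "xs \<in> obj_tuples C n \<Longrightarrow> xs \<in> listset (map orb xs)"
  using obj_tuplesD(1,5)[of xs C n] by (auto simp: listset_iff intro!: orb_self)

lemma finite_lifts: "us \<in> obj_tuples \<B> n \<Longrightarrow> finite (listset us)"
  by (rule finite_listset) (auto simp: obj_tuples_def orbs_finite)

lemma slotwise_lift_at:
  assumes us: "us \<in> obj_tuples \<B> n" and xs: "xs \<in> listset us"
  shows "slotwise K (homs \<B> us) (homs C xs) (map_tuple lift_at xs)"
proof (rule slotwise_map_tuple)
  note d = obj_tuplesD[OF us] and e = obj_tuplesD[OF listset_lifts(1)[OF us xs]]
  show "length (homs C xs) = length (homs \<B> us)" by (simp add: d e)
  fix i assume "i < length (homs \<B> us)"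
  then have i: "i < n" by (simp add: d)
  have "us ! i \<in> orbs" "us ! Suc i \<in> orbs" using d(5)[of i] d(5)[of "Suc i"] i by simp_all
  moreover have "xs ! i \<in> us ! i" "xs ! Suc i \<in> us ! Suc i" using xs i d(1) by (auto simp: listset_iff)
  ultimately show "lift_at (xs ! i) (xs ! Suc i) \<in> module_hom K (homs \<B> us ! i) (homs C xs ! i)"
    using lift_at_hom[of "us ! i" "us ! Suc i" "xs ! i" "xs ! Suc i"] i by (simp add: d e)
qed

lemma lifts_closed:
  "us \<in> obj_tuples \<B> n \<Longrightarrow> xs \<in> listset us \<Longrightarrow> \<gamma>s \<in> tuples (homs \<B> us) \<Longrightarrow> map_tuple lift_at xs \<gamma>s \<in> tuples (homs C xs)"
  using slotwise_lift_at by (simp add: slotwise_def)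

text \<open>Induction on the length. For fixed lifts of the other objects, the sum over the lifts of the first
  object, which is the target of the first morphism and not involved in the others, replaces the class of the component by the
  morphism itself (\<open>quot_hom_expand\<close>). At the end one orbit is left, with as many elements as \<open>G\<close>.\<close>

lemma sum_lifts:
  assumes V: "module K V"
  shows "set us \<subseteq> orbs \<Longrightarrow> us \<noteq> [] \<Longrightarrow> mlin K (homs \<B> us) V F \<Longrightarrow> \<gamma>s \<in> tuples (homs \<B> us) \<Longrightarrow>
    (\<Oplus>\<^bsub>V\<^esub>xs\<in>listset us. F (map_tuple (\<lambda>y x \<gamma>. cov y x (lift_at y x \<gamma>)) xs \<gamma>s)) = ([order G] \<cdot> \<one>) \<odot>\<^bsub>V\<^esub> F \<gamma>s"
proof (induction us arbitrary: F \<gamma>s)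
  case (Cons u us)
  interpret V: module K V by (rule V)
  let ?h = "\<lambda>y x \<gamma>. cov y x (lift_at y x \<gamma>)"
  have u: "u \<in> orbs" using Cons.prems by simp
  show ?case
  proof (cases us)
    case Nil
    have h: "homs \<B> [u] = []" by (simp add: homs_def)
    have g: "\<gamma>s = []" using Cons.prems(4) by (simp add: Nil h tuples_def)
    have F: "F [] \<in> carrier V" using mlinD(1)[OF Cons.prems(3,4)] g by simp
    have "listset [u] = (\<lambda>x. [x]) ` u" by (auto simp: set_Cons_def)
    then have "(\<Oplus>\<^bsub>V\<^esub>xs\<in>listset [u]. F (map_tuple ?h xs [])) = (\<Oplus>\<^bsub>V\<^esub>xs\<in>(\<lambda>x. [x]) ` u. F [])"
      by (simp add: map_tuple_def)
    also have "\<dots> = [card u] \<cdot>\<^bsub>V\<^esub> F []"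
      using F by (subst V.add.finprod_const) (simp_all add: card_image inj_on_def)
    finally show ?thesis using F by (simp add: Nil g orbs_card[OF u] smult_nat[OF V])
  next
    case us: (Cons u' us')
    have u': "u' \<in> orbs" using Cons.prems us by simp
    have fl: "finite (listset us)"
      by (rule finite_listset) (use Cons.prems in \<open>auto intro: orbs_finite\<close>)
    have h: "homs \<B> (u # us) = qhom u u' # homs \<B> us" by (simp add: homs_def us)
    obtain \<gamma> \<gamma>s' where g: "\<gamma>s = \<gamma> # \<gamma>s'" "\<gamma> \<in> carrier (qhom u u')" "\<gamma>s' \<in> tuples (homs \<B> us)"
      using Cons.prems(4) by (auto simp: h tuples_def list_all2_Cons2)
    have tc: "\<delta> # ds \<in> tuples (homs \<B> (u # us)) \<longleftrightarrow>
        \<delta> \<in> carrier (qhom u u') \<and> ds \<in> tuples (homs \<B> us)" for \<delta> ds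
      by (simp add: h tuples_def)
    have Fh: "(\<lambda>x. F (x # ds)) \<in> module_hom K (qhom u u') V" if "ds \<in> tuples (homs \<B> us)" for ds
      using mlinD(2)[OF Cons.prems(3), of "\<gamma> # ds" 0] that g(2) by (simp add: tc) (simp add: h)
    have Fm: "mlin K (homs \<B> us) V (\<lambda>ds. F (\<gamma> # ds))"
      unfolding mlin_def
    proof (intro ballI conjI allI impI)
      fix ds assume ds: "ds \<in> tuples (homs \<B> us)"
      have t: "\<gamma> # ds \<in> tuples (homs \<B> (u # us))" using ds g(2) by (simp add: tc)
      show "F (\<gamma> # ds) \<in> carrier V" by (rule mlinD(1)[OF Cons.prems(3) t])
      fix i assume "i < length (homs \<B> us)"
      then show "(\<lambda>x. F (\<gamma> # ds[i := x])) \<in> module_hom K (homs \<B> us ! i) V"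
        using mlinD(2)[OF Cons.prems(3) t, of "Suc i"] by (simp add: h)
    qed
    have len: "us \<in> obj_tuples \<B> (length us')" using Cons.prems us by (simp add: obj_tuples_def)
    have lt: "map_tuple ?h xs \<gamma>s' \<in> tuples (homs \<B> us)" and hx: "xs \<noteq> []" "hd xs \<in> u'"
      if xs: "xs \<in> listset us" for xs
    proof -
      note c = lifts_closed[OF len xs g(3)] and l = listset_lifts[OF len xs]
      have "map_tuple cov xs (map_tuple lift_at xs \<gamma>s') \<in> tuples (homs \<B> us)"
        using P.map_tuple_closed[OF l(1) c] by (simp add: l(2))
      moreover have "map_tuple cov xs (map_tuple lift_at xs \<gamma>s') = map_tuple ?h xs \<gamma>s'"
        by (intro nth_equalityI) simp_all
      ultimately show "map_tuple ?h xs \<gamma>s' \<in> tuples (homs \<B> us)" by simp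
      show "xs \<noteq> []" using obj_tuplesD(2)[OF l(1)] .
      then show "hd xs \<in> u'" using iffD1[OF listset_iff xs] us by (auto simp: hd_conv_nth)
    qed
    have hc: "?h x x' \<gamma> \<in> carrier (qhom u u')" if "x \<in> u" "x' \<in> u'" for x x'
      by (rule hom_in[OF cov_hom'[OF u u' that] hom_in[OF lift_at_hom[OF u u' that] g(2)]])
    have Fc: "F (?h x (hd xs) \<gamma> # map_tuple ?h xs \<gamma>s') \<in> carrier V" if "xs \<in> listset us" "x \<in> u" for xs x
      by (rule mlinD(1)[OF Cons.prems(3)]) (simp add: tc lt[OF that(1)] hc[OF that(2) hx(2)[OF that(1)]])
    have "(\<Oplus>\<^bsub>V\<^esub>xs\<in>listset (u # us). F (map_tuple ?h xs \<gamma>s)) =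
        (\<Oplus>\<^bsub>V\<^esub>k\<in>listset us \<times> u. F (map_tuple ?h (snd k # fst k) \<gamma>s))"
      unfolding listset_Cons_image using Fc hx
      by (intro V.finsum_reindex) (auto simp: g(1) map_tuple_Cons inj_on_def)
    also have "\<dots> = (\<Oplus>\<^bsub>V\<^esub>k\<in>listset us \<times> u. F (?h (snd k) (hd (fst k)) \<gamma> # map_tuple ?h (fst k) \<gamma>s'))"
      using Fc hx by (intro V.finsum_cong') (auto simp: g(1) map_tuple_Cons)
    also have "\<dots> = (\<Oplus>\<^bsub>V\<^esub>xs\<in>listset us. \<Oplus>\<^bsub>V\<^esub>x\<in>u. F (?h x (hd xs) \<gamma> # map_tuple ?h xs \<gamma>s'))"
      by (rule finsum_cartesian[OF V.abelian_monoid_axioms fl orbs_finite[OF u] Fc])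
    also have "\<dots> = (\<Oplus>\<^bsub>V\<^esub>xs\<in>listset us. F (\<gamma> # map_tuple ?h xs \<gamma>s'))"
    proof (intro V.finsum_cong' refl)
      show "(\<lambda>xs. F (\<gamma> # map_tuple ?h xs \<gamma>s')) \<in> listset us \<rightarrow> carrier V"
        using mlinD(1)[OF Fm lt] by auto
      fix xs assume xs: "xs \<in> listset us"
      have "(\<Oplus>\<^bsub>V\<^esub>x\<in>u. F (?h x (hd xs) \<gamma> # map_tuple ?h xs \<gamma>s')) =
          F ((\<Oplus>\<^bsub>qhom u u'\<^esub>x\<in>u. ?h x (hd xs) \<gamma>) # map_tuple ?h xs \<gamma>s')"
        using hc hx(2)[OF xs]
        by (intro hom_finsum[OF Fh[OF lt[OF xs]] quot_hom_module[OF u u'] V, symmetric]) auto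
      then show "(\<Oplus>\<^bsub>V\<^esub>x\<in>u. F (?h x (hd xs) \<gamma> # map_tuple ?h xs \<gamma>s')) = F (\<gamma> # map_tuple ?h xs \<gamma>s')"
        using quot_hom_expand[OF u u' hx(2)[OF xs] g(2)] by simp
    qed
    also have "\<dots> = ([order G] \<cdot> \<one>) \<odot>\<^bsub>V\<^esub> F (\<gamma> # \<gamma>s')"
      using Cons.prems us by (intro Cons.IH[OF _ _ Fm g(3)]) auto
    finally show ?thesis by (simp add: g(1))
  qed
qed simp

text \<open>The component of the class of \<open>c\<^sub>i\<close> between two consecutive objects of \<open>ys\<close> vanishes unless some \<open>s \<in> G\<close> moves the
  end points of \<open>c\<^sub>i\<close> to these objects. Consecutive morphisms share an object, so by freeness this is the
  same \<open>s\<close> for all of them, and \<open>ys\<close> is the translate of \<open>xs\<close> by \<open>s\<close>.\<close>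

lemma sum_lifts_of_cover:
  assumes V: "module K V" and xs: "xs \<in> obj_tuples C n" and cs: "cs \<in> tuples (homs C xs)"
    and F: "\<And>ys. ys \<in> listset (map orb xs) \<Longrightarrow> mlin K (homs C ys) V (F ys)"
  shows "(\<Oplus>\<^bsub>V\<^esub>ys\<in>listset (map orb xs). F ys (map_tuple lift_at ys (map_tuple cov xs cs))) =
    (\<Oplus>\<^bsub>V\<^esub>s\<in>carrier G. F (map (\<phi> s) xs) (map_tuple (\<psi> s) xs cs))"
proof -
  interpret V: module K V by (rule V)
  let ?S = "(\<lambda>s. map (\<phi> s) xs) ` carrier G" and ?us = "map orb xs"
  note d = obj_tuplesD[OF xs] and us = P.map_obj_tuples[OF xs] and cc = P.map_tuple_closed[OF xs cs]
  have len: "length cs = n" using cs by (simp add: tuples_iff d)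
  have ci: "cs ! i \<in> carrier (Hom C (xs ! i) (xs ! Suc i))" if "i < n" for i
    using cs that by (simp add: tuples_iff d)
  have oi: "orb (xs ! i) \<in> orbs" "xs ! i \<in> orb (xs ! i)" if "i \<le> n" for i
    using d(5)[OF that] orb_in orb_self by auto
  have yi: "ys ! i \<in> orb (xs ! i)" if "ys \<in> listset ?us" "i \<le> n" for ys i
    using that d(1) by (auto simp: listset_iff)
  have Fc: "F ys (map_tuple lift_at ys (map_tuple cov xs cs)) \<in> carrier V" if "ys \<in> listset ?us" for ys
    by (rule mlinD(1)[OF F[OF that] lifts_closed[OF us that cc]])
  have S: "?S \<subseteq> listset ?us"
  proof
    fix ys assume "ys \<in> ?S"
    then obtain s where s: "s \<in> carrier G" "ys = map (\<phi> s) xs" by auto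
    have "map orb ys = ?us" using s orb_act d(5) by (auto simp: in_set_conv_nth d(1))
    then show "ys \<in> listset ?us" using listset_self[OF map_act(1)[OF s(1) xs cs]] s(2) by (simp only:)
  qed
  have zero: "F ys (map_tuple lift_at ys (map_tuple cov xs cs)) = \<zero>\<^bsub>V\<^esub>" if ys: "ys \<in> listset ?us - ?S" for ys
  proof -
    have y: "ys \<in> listset ?us" using ys by simp
    note yo = listset_lifts(1)[OF us y] and yd = obj_tuplesD[OF listset_lifts(1)[OF us y]]
    have "\<exists>i<n. \<not> (\<exists>s\<in>carrier G. ys ! i = \<phi> s (xs ! i) \<and> ys ! Suc i = \<phi> s (xs ! Suc i))"
    proof (rule ccontr)
      assume "\<not> (\<exists>i<n. \<not> (\<exists>s\<in>carrier G. ys ! i = \<phi> s (xs ! i) \<and> ys ! Suc i = \<phi> s (xs ! Suc i)))"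
      then have ex: "\<exists>s\<in>carrier G. ys ! i = \<phi> s (xs ! i) \<and> ys ! Suc i = \<phi> s (xs ! Suc i)" if "i < n" for i
        using that by blast
      \<comment> \<open>For tuples with a single object there is no morphism to compare, but the object lies in the orbit.\<close>
      obtain s where s: "s \<in> carrier G" "ys ! 0 = \<phi> s (xs ! 0)"
        using yi[OF y, of 0] by (auto simp: orbit_def)
      have "ys ! i = \<phi> s (xs ! i)" if "i \<le> n" for i
        using that
      proof (induction i)
        case (Suc i)
        then obtain r where r: "r \<in> carrier G" "ys ! i = \<phi> r (xs ! i)" "ys ! Suc i = \<phi> r (xs ! Suc i)"
          using ex[of i] by auto
        have "r = s" using r(2) Suc d(5)[of i] by (intro act_free[OF r(1) s(1)]) auto
        then show ?case using r(3) by simp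
      qed (rule s(2))
      then have "ys = map (\<phi> s) xs" using d(1) yd(1) by (intro nth_equalityI) simp_all
      then show False using ys s(1) by auto
    qed
    then obtain i where i: "i < n" "\<not> (\<exists>s\<in>carrier G. ys ! i = \<phi> s (xs ! i) \<and> ys ! Suc i = \<phi> s (xs ! Suc i))" by auto
    have "lift_at (ys ! i) (ys ! Suc i) (cov (xs ! i) (xs ! Suc i) (cs ! i)) = \<zero>\<^bsub>Hom C (ys ! i) (ys ! Suc i)\<^esub>"
      using i(1) by (intro lift_at_cov(2)[OF oi(1) oi(1) oi(2) oi(2) yi[OF y] yi[OF y] ci i(2)]) auto
    then have e: "map_tuple lift_at ys (map_tuple cov xs cs) ! i = \<zero>\<^bsub>homs C ys ! i\<^esub>" using i(1) len by (simp add: yd)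
    have m: "module K (homs C ys ! i)" using i(1) by (simp add: yd(9)) (intro hom_mod yd(5); simp)
    have il: "i < length (homs C ys)" using i(1) by (simp add: yd(8))
    show ?thesis by (rule mlin_zero[OF F[OF y] V m lifts_closed[OF us y cc] il e])
  qed
  have "(\<Oplus>\<^bsub>V\<^esub>ys\<in>listset ?us. F ys (map_tuple lift_at ys (map_tuple cov xs cs))) =
      (\<Oplus>\<^bsub>V\<^esub>ys\<in>?S. F ys (map_tuple lift_at ys (map_tuple cov xs cs)))"
    using Fc by (intro finsum_mono_neutral[symmetric] V.abelian_monoid_axioms finite_lifts[OF us] S zero) auto
  also have "\<dots> = (\<Oplus>\<^bsub>V\<^esub>s\<in>carrier G. F (map (\<phi> s) xs) (map_tuple lift_at (map (\<phi> s) xs) (map_tuple cov xs cs)))"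
  proof (rule V.finsum_reindex)
    show "(\<lambda>ys. F ys (map_tuple lift_at ys (map_tuple cov xs cs))) \<in> ?S \<rightarrow> carrier V" using Fc S by blast
    show "inj_on (\<lambda>s. map (\<phi> s) xs) (carrier G)"
    proof (rule inj_onI)
      fix s r assume sr: "s \<in> carrier G" "r \<in> carrier G" and eq: "map (\<phi> s) xs = map (\<phi> r) xs"
      have "map (\<phi> s) xs ! 0 = map (\<phi> r) xs ! 0" by (simp only: eq)
      then have "\<phi> s (xs ! 0) = \<phi> r (xs ! 0)" using d(1) by simp
      then show "s = r" by (rule act_free[OF sr d(5)[of 0], rotated]) simp
    qed
  qed
  also have "\<dots> = (\<Oplus>\<^bsub>V\<^esub>s\<in>carrier G. F (map (\<phi> s) xs) (map_tuple (\<psi> s) xs cs))"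
  proof (intro V.finsum_cong' refl)
    fix s assume s: "s \<in> carrier G"
    have sl: "map (\<phi> s) xs \<in> listset ?us" using S s by auto
    have "lift_at (\<phi> s (xs ! i)) (\<phi> s (xs ! Suc i)) (cov (xs ! i) (xs ! Suc i) (cs ! i)) = \<psi> s (xs ! i) (xs ! Suc i) (cs ! i)"
      if i: "i < n" for i
      using i yi[OF sl, of i] yi[OF sl, of "Suc i"] d(1)
      by (intro lift_at_cov(1)[OF oi(1) oi(1) oi(2) oi(2) _ _ ci s]) auto
    then have e: "map_tuple lift_at (map (\<phi> s) xs) (map_tuple cov xs cs) = map_tuple (\<psi> s) xs cs"
      using len d(1) by (intro nth_equalityI) simp_all
    then show "F (map (\<phi> s) xs) (map_tuple lift_at (map (\<phi> s) xs) (map_tuple cov xs cs)) = F (map (\<phi> s) xs) (map_tuple (\<psi> s) xs cs)"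
      by simp
  next
    show "(\<lambda>s. F (map (\<phi> s) xs) (map_tuple (\<psi> s) xs cs)) \<in> carrier G \<rightarrow> carrier V"
    proof
      fix s assume s: "s \<in> carrier G"
      have sl: "map (\<phi> s) xs \<in> listset ?us" using S s by auto
      show "F (map (\<phi> s) xs) (map_tuple (\<psi> s) xs cs) \<in> carrier V"
        by (rule mlinD(1)[OF F[OF sl] map_act(2)[OF s xs cs]])
    qed
  qed
  finally show ?thesis .
qed

abbreviation "ord1 \<equiv> [order G] \<cdot> \<one>"

lemma order_inverse: "\<exists>c\<in>carrier K. c \<otimes> ord1 = \<one>"
proof -
  have "ord1 \<in> Units K" using order_unit field_Units by simp
  then show ?thesis by (intro bexI[of _ "inv\<^bsub>K\<^esub> ord1"] Units_l_inv Units_inv_closed)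
qed

text \<open>A sum over all tuples of lifts, like the dual \<open>cotransfer\<close> below, so the two identities for each of them are instances of
  \<open>sum_lifts\<close> and \<open>sum_lifts_of_cover\<close>.\<close>

definition transfer where
  "transfer n = chain_lift K \<B> M n (chains K C L n) (\<lambda>us (m, \<gamma>s).
    \<Oplus>\<^bsub>chains K C L n\<^esub>xs\<in>listset us. chain_gen K C L n xs (m, map_tuple lift_at xs \<gamma>s))"

lemma mlin1_transfer:
  assumes us: "us \<in> obj_tuples \<B> n"
  shows "mlin1 K (Bim M (last us) (hd us)) (homs \<B> us) (chains K C L n)
    (\<lambda>(m, \<gamma>s). \<Oplus>\<^bsub>chains K C L n\<^esub>xs\<in>listset us. chain_gen K C L n xs (m, map_tuple lift_at xs \<gamma>s))"
proof -
  note A = B.coeffs_module[OF us] and N = B.homs_module[OF us]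
  have g: "mlin1 K (Bim M (last us) (hd us)) (homs \<B> us) (chains K C L n)
      (\<lambda>t. chain_gen K C L n xs ((\<lambda>(m, \<gamma>s). (m, map_tuple lift_at xs \<gamma>s)) t))" if xs: "xs \<in> listset us" for xs
    by (rule mlin1_slotwise1[OF CL.mlin1_chain_gen[OF listset_lifts(1)[OF us xs], unfolded listset_lifts(3)[OF us xs]]
          slotwise1_right[OF slotwise_lift_at[OF us xs]] A N])
  have "mlin1 K (Bim M (last us) (hd us)) (homs \<B> us) (chains K C L n)
      (\<lambda>t. \<Oplus>\<^bsub>chains K C L n\<^esub>xs\<in>listset us. chain_gen K C L n xs ((\<lambda>(m, \<gamma>s). (m, map_tuple lift_at xs \<gamma>s)) t))"
    by (rule mlin1_sum[OF g CL.chains_module A N])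
  then show ?thesis by (simp add: case_prod_unfold)
qed

lemma transfer_hom: "transfer n \<in> module_hom K (chains K \<B> M n) (chains K C L n)"
  unfolding transfer_def by (rule B.chain_lift_hom[OF CL.chains_module mlin1_transfer])

lemma transfer_gen:
  assumes "us \<in> obj_tuples \<B> n" "m \<in> carrier (Bim M (last us) (hd us))" "\<gamma>s \<in> tuples (homs \<B> us)"
  shows "transfer n (chain_gen K \<B> M n us (m, \<gamma>s)) =
    (\<Oplus>\<^bsub>chains K C L n\<^esub>xs\<in>listset us. chain_gen K C L n xs (m, map_tuple lift_at xs \<gamma>s))"
  unfolding transfer_def
  by (subst B.chain_lift_gen[OF CL.chains_module mlin1_transfer assms(1)]) (use assms in \<open>auto simp: tuples1_def\<close>)

lemma push_transfer:
  assumes c: "c \<in> carrier (chains K \<B> M n)"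
  shows "P.push n (transfer n c) = ord1 \<odot>\<^bsub>chains K \<B> M n\<^esub> c"
proof (rule B.chains_ext[OF B.chains_module hom_comp[OF transfer_hom P.push_hom]
      hom_smult[OF B.chains_module B.chains_module hom_id] _ c])
  show "ord1 \<in> carrier K" by simp
  fix us m \<gamma>s assume us: "us \<in> obj_tuples \<B> n" and m: "m \<in> carrier (Bim M (last us) (hd us))"
    and g: "\<gamma>s \<in> tuples (homs \<B> us)"
  interpret D: module K "chains K \<B> M n" by (rule B.chains_module)
  let ?h = "\<lambda>y x \<gamma>. cov y x (lift_at y x \<gamma>)"
  note l = listset_lifts[OF us]
  have x: "chain_gen K C L n xs (m, map_tuple lift_at xs \<gamma>s) \<in> carrier (chains K C L n)" if "xs \<in> listset us" for xs
    by (rule mlin1D(3)[OF CL.mlin1_chain_gen[OF l(1)[OF that]] _ lifts_closed[OF us that g]]) (simp only: l(3)[OF that] m)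
  have p: "P.push n (chain_gen K C L n xs (m, map_tuple lift_at xs \<gamma>s)) = chain_gen K \<B> M n us (m, map_tuple ?h xs \<gamma>s)"
    if xs: "xs \<in> listset us" for xs
  proof -
    have "map_tuple cov xs (map_tuple lift_at xs \<gamma>s) = map_tuple ?h xs \<gamma>s" by (intro nth_equalityI) simp_all
    then show ?thesis
      using P.push_gen[OF l(1)[OF xs] _ lifts_closed[OF us xs g]] m by (simp only: l(2,3)[OF xs])
  qed
  have "P.push n (transfer n (chain_gen K \<B> M n us (m, \<gamma>s))) =
      (\<Oplus>\<^bsub>chains K \<B> M n\<^esub>xs\<in>listset us. P.push n (chain_gen K C L n xs (m, map_tuple lift_at xs \<gamma>s)))"
    unfolding transfer_gen[OF us m g] using x
    by (intro hom_finsum[OF P.push_hom CL.chains_module D.module_axioms]) auto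
  also have "\<dots> = (\<Oplus>\<^bsub>chains K \<B> M n\<^esub>xs\<in>listset us. chain_gen K \<B> M n us (m, map_tuple ?h xs \<gamma>s))"
  proof (intro D.finsum_cong' refl p)
    show "(\<lambda>xs. chain_gen K \<B> M n us (m, map_tuple ?h xs \<gamma>s)) \<in> listset us \<rightarrow> carrier (chains K \<B> M n)"
      using hom_in[OF P.push_hom x] by (auto simp: p)
  qed
  also have "\<dots> = ord1 \<odot>\<^bsub>chains K \<B> M n\<^esub> chain_gen K \<B> M n us (m, \<gamma>s)"
    using us obj_tuplesD(2)[OF us] by (intro sum_lifts[OF D.module_axioms _ _ mlin1D(2)[OF B.mlin1_chain_gen[OF us] m] g])
      (auto simp: obj_tuples_def)
  finally show "P.push n (transfer n (chain_gen K \<B> M n us (m, \<gamma>s))) = ord1 \<odot>\<^bsub>chains K \<B> M n\<^esub> chain_gen K \<B> M n us (m, \<gamma>s)" .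
qed

lemma transfer_push:
  assumes c: "c \<in> carrier (chains K C L n)"
  shows "transfer n (P.push n c) = (\<Oplus>\<^bsub>chains K C L n\<^esub>s\<in>carrier G. chain_act K C \<phi> \<psi> L n s c)"
proof (rule CL.chains_ext[OF CL.chains_module hom_comp[OF P.push_hom transfer_hom]
      hom_sum[OF CL.chains_module CL.chains_module chain_act_hom] _ c])
  fix xs m cs assume xs: "xs \<in> obj_tuples C n" and m: "m \<in> carrier (Bim L (last xs) (hd xs))"
    and cs: "cs \<in> tuples (homs C xs)"
  interpret D: module K "chains K C L n" by (rule CL.chains_module)
  note us = P.map_obj_tuples[OF xs] and g = P.map_tuple_closed[OF xs cs]
  have m': "m \<in> carrier (Bim M (last (map orb xs)) (hd (map orb xs)))" using m by (simp only: P.map_ends(1)[OF xs])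
  have "transfer n (P.push n (chain_gen K C L n xs (m, cs))) =
      (\<Oplus>\<^bsub>chains K C L n\<^esub>ys\<in>listset (map orb xs). chain_gen K C L n ys (m, map_tuple lift_at ys (map_tuple cov xs cs)))"
    unfolding P.push_gen[OF xs m cs] by (rule transfer_gen[OF us m' g])
  also have "\<dots> = (\<Oplus>\<^bsub>chains K C L n\<^esub>s\<in>carrier G. chain_gen K C L n (map (\<phi> s) xs) (m, map_tuple (\<psi> s) xs cs))"
  proof (rule sum_lifts_of_cover[where F = "\<lambda>ys cs. chain_gen K C L n ys (m, cs)", OF D.module_axioms xs cs])
    fix ys assume ys: "ys \<in> listset (map orb xs)"
    show "mlin K (homs C ys) (chains K C L n) (\<lambda>cs. chain_gen K C L n ys (m, cs))"
      using m' by (intro mlin1D(2)[OF CL.mlin1_chain_gen[OF listset_lifts(1)[OF us ys]]]) (simp only: listset_lifts(3)[OF us ys])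
  qed
  also have "\<dots> = (\<Oplus>\<^bsub>chains K C L n\<^esub>s\<in>carrier G. chain_act K C \<phi> \<psi> L n s (chain_gen K C L n xs (m, cs)))"
  proof (intro D.finsum_cong' refl)
    show "chain_gen K C L n (map (\<phi> s) xs) (m, map_tuple (\<psi> s) xs cs) = chain_act K C \<phi> \<psi> L n s (chain_gen K C L n xs (m, cs))"
      if "s \<in> carrier G" for s by (rule chain_act_gen[OF that xs m cs, symmetric])
    show "(\<lambda>s. chain_act K C \<phi> \<psi> L n s (chain_gen K C L n xs (m, cs))) \<in> carrier G \<rightarrow> carrier (chains K C L n)"
      using hom_in[OF chain_act_hom mlin1D(3)[OF CL.mlin1_chain_gen[OF xs] m cs]] by auto
  qed
  finally show "transfer n (P.push n (chain_gen K C L n xs (m, cs))) =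
      (\<Oplus>\<^bsub>chains K C L n\<^esub>s\<in>carrier G. chain_act K C \<phi> \<psi> L n s (chain_gen K C L n xs (m, cs)))" .
qed

lemma transfer_bd:
  assumes c: "c \<in> carrier (chains K \<B> M (Suc n))"
  shows "transfer n (chain_bd K \<B> M n c) = chain_bd K C L n (transfer (Suc n) c)"
proof -
  obtain r where r: "r \<in> carrier K" "r \<otimes> ord1 = \<one>" using order_inverse by blast
  show ?thesis
    by (rule transfer_commutes[where S = "carrier G" and ?act1.0 = "chain_act K C \<phi> \<psi> L (Suc n)"
          and ?act0.0 = "chain_act K C \<phi> \<psi> L n" and ?p0.0 = "P.push n" and ?p1.0 = "P.push (Suc n)",
          OF CL.chains_module CL.chains_module B.chains_module CL.chain_bd_hom B.chain_bd_hom P.push_hom transfer_hom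
            push_transfer transfer_push transfer_push chain_act_hom chain_act_bd P.push_bd r(1) _ r(2) c]) simp_all
qed

definition cotransfer where
  "cotransfer n f = cochain_of K \<B> M n (\<lambda>us \<gamma>s.
    \<Oplus>\<^bsub>Bim M (hd us) (last us)\<^esub>xs\<in>listset us. f xs (pure_tensor K (homs C xs) (map_tuple lift_at xs \<gamma>s)))"

lemma mlin_cotransfer:
  assumes f: "f \<in> carrier (cochains K C L n)" and us: "us \<in> obj_tuples \<B> n"
  shows "mlin K (homs \<B> us) (Bim M (hd us) (last us))
    (\<lambda>\<gamma>s. \<Oplus>\<^bsub>Bim M (hd us) (last us)\<^esub>xs\<in>listset us. f xs (pure_tensor K (homs C xs) (map_tuple lift_at xs \<gamma>s)))"
proof (rule mlin_sum[OF _ B.values_module[OF us] B.homs_module[OF us]])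
  fix xs assume xs: "xs \<in> listset us"
  show "mlin K (homs \<B> us) (Bim M (hd us) (last us)) (\<lambda>\<gamma>s. f xs (pure_tensor K (homs C xs) (map_tuple lift_at xs \<gamma>s)))"
    by (rule mlin_slotwise[OF CL.cochain_mlin[OF f listset_lifts(1)[OF us xs], unfolded listset_lifts(4)[OF us xs]]
          slotwise_lift_at[OF us xs] B.homs_module[OF us]])
qed

lemma cotransfer_hom: "cotransfer n \<in> module_hom K (cochains K C L n) (cochains K \<B> M n)"
  unfolding cotransfer_def[abs_def]
proof (rule B.cochain_of_hom[OF CL.cochains_module mlin_cotransfer])
  fix us \<gamma>s assume us: "us \<in> obj_tuples \<B> n" and g: "\<gamma>s \<in> tuples (homs \<B> us)"
  show "(\<lambda>f. \<Oplus>\<^bsub>Bim M (hd us) (last us)\<^esub>xs\<in>listset us. f xs (pure_tensor K (homs C xs) (map_tuple lift_at xs \<gamma>s)))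
      \<in> module_hom K (cochains K C L n) (Bim M (hd us) (last us))"
  proof (rule hom_sum[OF CL.cochains_module B.values_module[OF us]])
    fix xs assume xs: "xs \<in> listset us"
    show "(\<lambda>f. f xs (pure_tensor K (homs C xs) (map_tuple lift_at xs \<gamma>s)))
        \<in> module_hom K (cochains K C L n) (Bim M (hd us) (last us))"
      using CL.eval_hom[OF listset_lifts(1)[OF us xs] lifts_closed[OF us xs g]] by (simp only: listset_lifts(4)[OF us xs])
  qed
qed

lemma cotransfer_pure:
  "f \<in> carrier (cochains K C L n) \<Longrightarrow> us \<in> obj_tuples \<B> n \<Longrightarrow> \<gamma>s \<in> tuples (homs \<B> us) \<Longrightarrow>
    cotransfer n f us (pure_tensor K (homs \<B> us) \<gamma>s) =
      (\<Oplus>\<^bsub>Bim M (hd us) (last us)\<^esub>xs\<in>listset us. f xs (pure_tensor K (homs C xs) (map_tuple lift_at xs \<gamma>s)))"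
  unfolding cotransfer_def by (rule B.cochain_of_pure[OF mlin_cotransfer])

lemma cotransfer_pull:
  assumes f: "f \<in> carrier (cochains K \<B> M n)"
  shows "cotransfer n (P.pull n f) = ord1 \<odot>\<^bsub>cochains K \<B> M n\<^esub> f"
proof (rule B.cochain_ext)
  interpret D: module K "cochains K \<B> M n" by (rule B.cochains_module)
  note pf = hom_in[OF P.pull_hom f]
  show "cotransfer n (P.pull n f) \<in> carrier (cochains K \<B> M n)" by (rule hom_in[OF cotransfer_hom pf])
  show "ord1 \<odot>\<^bsub>cochains K \<B> M n\<^esub> f \<in> carrier (cochains K \<B> M n)" using f by simp
  fix us \<gamma>s assume us: "us \<in> obj_tuples \<B> n" and g: "\<gamma>s \<in> tuples (homs \<B> us)"
  let ?V = "Bim M (hd us) (last us)" and ?h = "\<lambda>y x \<gamma>. cov y x (lift_at y x \<gamma>)"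
  interpret V: module K ?V by (rule B.values_module[OF us])
  note l = listset_lifts[OF us]
  have p: "P.pull n f xs (pure_tensor K (homs C xs) (map_tuple lift_at xs \<gamma>s)) =
      f us (pure_tensor K (homs \<B> us) (map_tuple ?h xs \<gamma>s))" if xs: "xs \<in> listset us" for xs
  proof -
    have "map_tuple cov xs (map_tuple lift_at xs \<gamma>s) = map_tuple ?h xs \<gamma>s" by (intro nth_equalityI) simp_all
    then show ?thesis
      using P.pull_pure[OF f l(1)[OF xs] lifts_closed[OF us xs g]] by (simp only: l(2)[OF xs])
  qed
  have c: "P.pull n f xs (pure_tensor K (homs C xs) (map_tuple lift_at xs \<gamma>s)) \<in> carrier ?V" if xs: "xs \<in> listset us" for xs
    using mlinD(1)[OF CL.cochain_mlin[OF pf l(1)[OF xs]] lifts_closed[OF us xs g]] by (simp only: l(4)[OF xs])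
  have "cotransfer n (P.pull n f) us (pure_tensor K (homs \<B> us) \<gamma>s) =
      (\<Oplus>\<^bsub>?V\<^esub>xs\<in>listset us. f us (pure_tensor K (homs \<B> us) (map_tuple ?h xs \<gamma>s)))"
    unfolding cotransfer_pure[OF pf us g] using c by (intro V.finsum_cong') (auto simp: p)
  also have "\<dots> = ord1 \<odot>\<^bsub>?V\<^esub> f us (pure_tensor K (homs \<B> us) \<gamma>s)"
    using us obj_tuplesD(2)[OF us] by (intro sum_lifts[OF V.module_axioms _ _ B.cochain_mlin[OF f us] g])
      (auto simp: obj_tuples_def)
  also have "\<dots> = (ord1 \<odot>\<^bsub>cochains K \<B> M n\<^esub> f) us (pure_tensor K (homs \<B> us) \<gamma>s)"
    by (rule module_hom_smult[OF B.eval_hom[OF us g] _ f, symmetric]) simp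
  finally show "cotransfer n (P.pull n f) us (pure_tensor K (homs \<B> us) \<gamma>s) =
      (ord1 \<odot>\<^bsub>cochains K \<B> M n\<^esub> f) us (pure_tensor K (homs \<B> us) \<gamma>s)" .
qed

lemma pull_cotransfer:
  assumes f: "f \<in> carrier (cochains K C L n)"
  shows "P.pull n (cotransfer n f) = (\<Oplus>\<^bsub>cochains K C L n\<^esub>s\<in>carrier G. cochain_act K C G \<phi> \<psi> L n s f)"
proof (rule CL.cochain_ext)
  interpret D: module K "cochains K C L n" by (rule CL.cochains_module)
  note tf = hom_in[OF cotransfer_hom f]
  have af: "(\<lambda>s. cochain_act K C G \<phi> \<psi> L n s f) \<in> carrier G \<rightarrow> carrier (cochains K C L n)"
    using hom_in[OF cochain_act_hom f] by auto
  show "P.pull n (cotransfer n f) \<in> carrier (cochains K C L n)" by (rule hom_in[OF P.pull_hom tf])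
  show "(\<Oplus>\<^bsub>cochains K C L n\<^esub>s\<in>carrier G. cochain_act K C G \<phi> \<psi> L n s f) \<in> carrier (cochains K C L n)"
    by (rule D.finsum_closed[OF af])
  fix xs cs assume xs: "xs \<in> obj_tuples C n" and cs: "cs \<in> tuples (homs C xs)"
  let ?V = "Bim L (hd xs) (last xs)"
  interpret V: module K ?V by (rule CL.values_module[OF xs])
  note us = P.map_obj_tuples[OF xs] and g = P.map_tuple_closed[OF xs cs]
  let ?F = "\<lambda>s. f (map (\<phi> s) xs) (pure_tensor K (homs C (map (\<phi> s) xs)) (map_tuple (\<psi> s) xs cs))"
  have Fc: "?F s \<in> carrier ?V" if "s \<in> carrier G" for s
    using mlinD(1)[OF CL.cochain_mlin[OF f map_act(1)[OF that xs cs]] map_act(2)[OF that xs cs]]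
    by (simp only: map_act(4)[OF that xs cs])
  have "P.pull n (cotransfer n f) xs (pure_tensor K (homs C xs) cs) =
      (\<Oplus>\<^bsub>?V\<^esub>ys\<in>listset (map orb xs). f ys (pure_tensor K (homs C ys) (map_tuple lift_at ys (map_tuple cov xs cs))))"
    unfolding P.pull_pure[OF tf xs cs] cotransfer_pure[OF f us g] P.map_ends(2)[OF xs] ..
  also have "\<dots> = (\<Oplus>\<^bsub>?V\<^esub>s\<in>carrier G. ?F s)"
  proof (rule sum_lifts_of_cover[where F = "\<lambda>ys cs. f ys (pure_tensor K (homs C ys) cs)", OF V.module_axioms xs cs])
    fix ys assume ys: "ys \<in> listset (map orb xs)"
    show "mlin K (homs C ys) ?V (\<lambda>cs. f ys (pure_tensor K (homs C ys) cs))"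
      using CL.cochain_mlin[OF f listset_lifts(1)[OF us ys]]
      by (simp only: listset_lifts(4)[OF us ys] P.map_ends(2)[OF xs])
  qed
  \<comment> \<open>An element acts on cochains by translating the arguments by its inverse.\<close>
  also have "\<dots> = (\<Oplus>\<^bsub>?V\<^esub>s\<in>(\<lambda>s. inv\<^bsub>G\<^esub> s) ` carrier G. ?F s)"
  proof -
    have "(\<lambda>s. inv\<^bsub>G\<^esub> s) ` carrier G = carrier G"
    proof (intro equalityI subsetI)
      fix s assume "s \<in> carrier G"
      then show "s \<in> (\<lambda>s. inv\<^bsub>G\<^esub> s) ` carrier G" by (intro image_eqI[where x = "inv\<^bsub>G\<^esub> s"]) simp_all
    qed auto
    then show ?thesis by simp
  qed
  also have "\<dots> = (\<Oplus>\<^bsub>?V\<^esub>s\<in>carrier G. ?F (inv\<^bsub>G\<^esub> s))"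
  proof (rule V.finsum_reindex)
    show "?F \<in> (\<lambda>s. inv\<^bsub>G\<^esub> s) ` carrier G \<rightarrow> carrier ?V"
      by (rule Pi_I, erule imageE, hypsubst, rule Fc, rule G.inv_closed)
    show "inj_on (\<lambda>s. inv\<^bsub>G\<^esub> s) (carrier G)" by (rule inj_onI) (metis G.inv_inv)
  qed
  also have "\<dots> = (\<Oplus>\<^bsub>?V\<^esub>s\<in>carrier G. cochain_act K C G \<phi> \<psi> L n s f xs (pure_tensor K (homs C xs) cs))"
  proof (intro V.finsum_cong' refl)
    show "?F (inv\<^bsub>G\<^esub> s) = cochain_act K C G \<phi> \<psi> L n s f xs (pure_tensor K (homs C xs) cs)" if "s \<in> carrier G" for s
      by (rule cochain_act_pure[OF that f xs cs, symmetric])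
    show "(\<lambda>s. cochain_act K C G \<phi> \<psi> L n s f xs (pure_tensor K (homs C xs) cs)) \<in> carrier G \<rightarrow> carrier ?V"
      using hom_in[OF CL.eval_hom[OF xs cs] hom_in[OF cochain_act_hom f]] by (rule Pi_I)
  qed
  also have "\<dots> = (\<Oplus>\<^bsub>cochains K C L n\<^esub>s\<in>carrier G. cochain_act K C G \<phi> \<psi> L n s f) xs (pure_tensor K (homs C xs) cs)"
    by (rule hom_finsum[OF CL.eval_hom[OF xs cs] D.module_axioms V.module_axioms af, symmetric])
  finally show "P.pull n (cotransfer n f) xs (pure_tensor K (homs C xs) cs) =
      (\<Oplus>\<^bsub>cochains K C L n\<^esub>s\<in>carrier G. cochain_act K C G \<phi> \<psi> L n s f) xs (pure_tensor K (homs C xs) cs)" .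
qed

lemma cotransfer_bd:
  assumes f: "f \<in> carrier (cochains K C L n)"
  shows "cotransfer (Suc n) (cochain_bd K C L n f) = cochain_bd K \<B> M n (cotransfer n f)"
proof -
  obtain r where r: "r \<in> carrier K" "r \<otimes> ord1 = \<one>" using order_inverse by blast
  show ?thesis
    by (rule transfer_commutes'[where S = "carrier G" and ?act0.0 = "cochain_act K C G \<phi> \<psi> L n"
          and ?act1.0 = "cochain_act K C G \<phi> \<psi> L (Suc n)" and ?t0.0 = "P.pull n" and ?t1.0 = "P.pull (Suc n)",
          OF CL.cochains_module CL.cochains_module B.cochains_module CL.cochain_bd_hom B.cochain_bd_hom
            cotransfer_hom cotransfer_hom cotransfer_pull pull_cotransfer pull_cotransfer cochain_act_hom cochain_act_bd P.pull_bd
            r(1) _ r(2) f]) simp_all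
qed

end

section \<open>Homology and cohomology of the quotient\<close>

context lin_data
begin

lemma cycles_submodule: "LinearCombinations.submodule K (cycles K C M n) (chains K C M n)"
  using carrier_submodule[OF chains_module] hom_ker_submodule[OF chain_bd_hom chains_module chains_module]
  by (cases n) (simp_all add: cycles_def)

lemma boundaries_submodule: "LinearCombinations.submodule K (boundaries K C M n) (chains K C M n)"
  unfolding boundaries_def by (rule hom_im_submodule[OF chain_bd_hom chains_module chains_module])

lemma cocycles_submodule: "LinearCombinations.submodule K (cocycles K C M n) (cochains K C M n)"
  unfolding cocycles_def by (rule hom_ker_submodule[OF cochain_bd_hom cochains_module cochains_module])

lemma coboundaries_submodule: "LinearCombinations.submodule K (coboundaries K C M n) (cochains K C M n)"
proof (cases n)
  case 0
  interpret D: module K "cochains K C M 0" by (rule cochains_module)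
  show ?thesis unfolding 0 coboundaries_def
    by (simp, rule submoduleI) (simp_all add: D.module_axioms)
next
  case (Suc k)
  then show ?thesis
    using hom_im_submodule[OF cochain_bd_hom cochains_module cochains_module, of k] by (simp add: coboundaries_def)
qed

end

lemma cycles_preserved:
  assumes S: "lin_data K C M" and T: "lin_data K C' M'"
    and F: "\<And>n. F n \<in> module_hom K (chains K C M n) (chains K C' M' n)"
    and d: "\<And>n c. c \<in> carrier (chains K C M (Suc n)) \<Longrightarrow> F n (chain_bd K C M n c) = chain_bd K C' M' n (F (Suc n) c)"
  shows "c \<in> cycles K C M n \<Longrightarrow> F n c \<in> cycles K C' M' n"
    and "c \<in> boundaries K C M n \<Longrightarrow> F n c \<in> boundaries K C' M' n"
proof -
  interpret S: lin_data K C M by (rule S)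
  interpret T: lin_data K C' M' by (rule T)
  show "F n c \<in> cycles K C' M' n" if "c \<in> cycles K C M n"
    using that hom_in[OF F] S.hom_zero[OF F S.chains_module T.chains_module] d
    by (cases n) (auto simp: cycles_def d[symmetric])
  show "F n c \<in> boundaries K C' M' n" if "c \<in> boundaries K C M n"
  proof -
    obtain b where b: "b \<in> carrier (chains K C M (Suc n))" "c = chain_bd K C M n b"
      using \<open>c \<in> boundaries K C M n\<close> by (auto simp: boundaries_def)
    show ?thesis unfolding b(2) d[OF b(1)] boundaries_def by (rule imageI, rule hom_in[OF F b(1)])
  qed
qed

lemma cocycles_preserved:
  assumes S: "lin_data K C M" and T: "lin_data K C' M'"
    and F: "\<And>n. F n \<in> module_hom K (cochains K C M n) (cochains K C' M' n)"
    and d: "\<And>n f. f \<in> carrier (cochains K C M n) \<Longrightarrow> F (Suc n) (cochain_bd K C M n f) = cochain_bd K C' M' n (F n f)"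
  shows "f \<in> cocycles K C M n \<Longrightarrow> F n f \<in> cocycles K C' M' n"
    and "f \<in> coboundaries K C M n \<Longrightarrow> F n f \<in> coboundaries K C' M' n"
proof -
  interpret S: lin_data K C M by (rule S)
  interpret T: lin_data K C' M' by (rule T)
  note z = S.hom_zero[OF F S.cochains_module T.cochains_module]
  show "F n f \<in> cocycles K C' M' n" if "f \<in> cocycles K C M n"
    using that hom_in[OF F] z by (auto simp: cocycles_def d[symmetric])
  show "F n f \<in> coboundaries K C' M' n" if f: "f \<in> coboundaries K C M n"
  proof (cases n)
    case 0
    then show ?thesis using f z[of 0] by (simp add: coboundaries_def)
  next
    case (Suc k)
    then obtain g where g: "g \<in> carrier (cochains K C M k)" "f = cochain_bd K C M k g"
      using f by (auto simp: coboundaries_def)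
    have "F (Suc k) f \<in> cochain_bd K C' M' k ` carrier (cochains K C' M' k)"
      unfolding g(2) d[OF g(1)] by (rule imageI, rule hom_in[OF F g(1)])
    then show ?thesis by (simp add: Suc coboundaries_def)
  qed
qed

context covering_bimodule
begin

theorem homology_iso:
  "vs_iso K (HM_homology K \<B> M n) (coinvariants K G (HM_homology K C L n) (homology_act K C \<phi> \<psi> L n))"
proof -
  obtain r where r: "r \<in> carrier K" "r \<otimes> ord1 = \<one>" using order_inverse by blast
  have LB: "lin_data K \<B> M" and LC: "lin_data K C L" by unfold_locales
  have p: "c \<in> cycles K C L n \<Longrightarrow> P.push n c \<in> cycles K \<B> M n"
    "c \<in> boundaries K C L n \<Longrightarrow> P.push n c \<in> boundaries K \<B> M n" for c
    by (rule cycles_preserved[where F = P.push, OF LC LB P.push_hom P.push_bd]; assumption)+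
  have t: "c \<in> cycles K \<B> M n \<Longrightarrow> transfer n c \<in> cycles K C L n"
    "c \<in> boundaries K \<B> M n \<Longrightarrow> transfer n c \<in> boundaries K C L n" for c
    by (rule cycles_preserved[where F = transfer, OF LB LC transfer_hom transfer_bd]; assumption)+
  have a: "c \<in> cycles K C L n \<Longrightarrow> chain_act K C \<phi> \<psi> L n s c \<in> cycles K C L n"
    "c \<in> boundaries K C L n \<Longrightarrow> chain_act K C \<phi> \<psi> L n s c \<in> boundaries K C L n" if s: "s \<in> carrier G" for s c
    by (rule cycles_preserved[where F = "\<lambda>n. chain_act K C \<phi> \<psi> L n s", OF LC LC chain_act_hom[OF s] chain_act_bd[OF s, symmetric]];
        assumption)+
  have "homology_act K C \<phi> \<psi> L n = (\<lambda>s T. chain_act K C \<phi> \<psi> L n s ` T)"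
    by (intro ext) (simp add: homology_act_def)
  moreover have "vs_iso K (quot_space ((chains K \<B> M n)\<lparr>carrier := cycles K \<B> M n\<rparr>) (boundaries K \<B> M n))
      (coinvariants K G (quot_space ((chains K C L n)\<lparr>carrier := cycles K C L n\<rparr>) (boundaries K C L n))
        (\<lambda>s T. chain_act K C \<phi> \<psi> L n s ` T))"
    by (rule transfer_iso_subquotient(1)[OF group_G finite_group CL.boundaries_submodule CL.cycles_submodule
          B.boundaries_submodule B.cycles_submodule])
      (fact group_G finite_group chain_act_hom chain_act_mult chain_act_one a P.push_hom p transfer_hom t
        push_transfer transfer_push r)+
  ultimately show ?thesis unfolding HM_homology_def by simp
qed

theorem cohomology_iso:
  "vs_iso K (HM_cohomology K \<B> M n) (invariants_space G (HM_cohomology K C L n) (cohomology_act K C G \<phi> \<psi> L n))"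
proof -
  obtain r where r: "r \<in> carrier K" "r \<otimes> ord1 = \<one>" using order_inverse by blast
  have LB: "lin_data K \<B> M" and LC: "lin_data K C L" by unfold_locales
  have p: "f \<in> cocycles K C L n \<Longrightarrow> cotransfer n f \<in> cocycles K \<B> M n"
    "f \<in> coboundaries K C L n \<Longrightarrow> cotransfer n f \<in> coboundaries K \<B> M n" for f
    by (rule cocycles_preserved[where F = cotransfer, OF LC LB cotransfer_hom cotransfer_bd]; assumption)+
  have t: "f \<in> cocycles K \<B> M n \<Longrightarrow> P.pull n f \<in> cocycles K C L n"
    "f \<in> coboundaries K \<B> M n \<Longrightarrow> P.pull n f \<in> coboundaries K C L n" for f
    by (rule cocycles_preserved[where F = P.pull, OF LB LC P.pull_hom P.pull_bd]; assumption)+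
  have a: "f \<in> cocycles K C L n \<Longrightarrow> cochain_act K C G \<phi> \<psi> L n s f \<in> cocycles K C L n"
    "f \<in> coboundaries K C L n \<Longrightarrow> cochain_act K C G \<phi> \<psi> L n s f \<in> coboundaries K C L n" if s: "s \<in> carrier G" for s f
    by (rule cocycles_preserved[where F = "\<lambda>n. cochain_act K C G \<phi> \<psi> L n s", OF LC LC cochain_act_hom[OF s] cochain_act_bd[OF s, symmetric]];
        assumption)+
  have "cohomology_act K C G \<phi> \<psi> L n = (\<lambda>s T. cochain_act K C G \<phi> \<psi> L n s ` T)"
    by (intro ext) (simp add: cohomology_act_def)
  moreover have "vs_iso K (quot_space ((cochains K \<B> M n)\<lparr>carrier := cocycles K \<B> M n\<rparr>) (coboundaries K \<B> M n))
      (invariants_space G (quot_space ((cochains K C L n)\<lparr>carrier := cocycles K C L n\<rparr>) (coboundaries K C L n))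
        (\<lambda>s T. cochain_act K C G \<phi> \<psi> L n s ` T))"
    by (rule transfer_iso_subquotient(2)[OF group_G finite_group CL.coboundaries_submodule CL.cocycles_submodule
          B.coboundaries_submodule B.cocycles_submodule])
      (fact group_G finite_group cochain_act_hom cochain_act_mult cochain_act_one a cotransfer_hom p P.pull_hom t
        cotransfer_pull pull_cotransfer r)+
  ultimately show ?thesis unfolding HM_cohomology_def by simp
qed

end

text \<open>If \<open>n\<close> annihilates \<open>1\<close>, then so does its remainder modulo the characteristic, the least positive
  number with this property; hence the characteristic is positive and divides \<open>n\<close>.\<close>

lemma (in field) order_unit_of_char:
  assumes n: "n > 0" and char: "field_char R = 0 \<or> \<not> field_char R dvd n"
  shows "[n] \<cdot> \<one> \<noteq> \<zero>"
proof
  assume z: "[n] \<cdot> \<one> = \<zero>"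
  let ?P = "\<lambda>n::nat. n > 0 \<and> [n] \<cdot> \<one> = \<zero>"
  have ex: "\<exists>n. ?P n" using n z by blast
  let ?p = "field_char R"
  have p: "?p = (LEAST n. ?P n)" using ex by (simp add: field_char_def)
  have P: "?P ?p" unfolding p using LeastI_ex[OF ex] .
  have "[n] \<cdot> \<one> = [(n div ?p * ?p + n mod ?p)] \<cdot> \<one>" by simp
  also have "\<dots> = [(n div ?p * ?p)] \<cdot> \<one> \<oplus> [(n mod ?p)] \<cdot> \<one>" by (rule add.nat_pow_mult[symmetric]) simp
  also have "[(n div ?p * ?p)] \<cdot> \<one> = [(n div ?p)] \<cdot> ([?p] \<cdot> \<one>)" by (simp add: add.nat_pow_pow mult.commute)
  also have "\<dots> = \<zero>" using P by simp
  finally have "[(n mod ?p)] \<cdot> \<one> = \<zero>" using z by simp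
  moreover have "n mod ?p < ?p" using P by simp
  ultimately have "n mod ?p = 0" using not_less_Least[of "n mod ?p" ?P] unfolding p[symmetric] by auto
  then have "?p dvd n" by (rule dvd_eq_mod_eq_0[THEN iffD2])
  then show False using char P by auto
qed

theorem proposition3p14:
  fixes K :: "('k, 'r) ring_scheme"
    and C :: "('o, 'c, 'k) kcat"
    and G :: "('g, 'h) monoid_scheme"
    and \<phi> :: "'g \<Rightarrow> 'o \<Rightarrow> 'o"
    and \<psi> :: "'g \<Rightarrow> 'o \<Rightarrow> 'o \<Rightarrow> 'c \<Rightarrow> 'c"
    and M :: "('o set, ('o \<times> 'o \<Rightarrow> 'c) set, 'm, 'k) bimod"
  defines "B \<equiv> quot_cat K C G \<phi> \<psi>"
    and "L \<equiv> lift_bimod K C G \<phi> \<psi> M"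
  assumes "field K"
    and "free_kcat_action K C G \<phi> \<psi>"
    and "finite (carrier G)"
    and "field_char K = 0 \<or> \<not> field_char K dvd order G"
    and "bimodule K B M"
  shows "(\<forall>n. vs_iso K (HM_homology K B M n)
                (coinvariants K G (HM_homology K C L n) (homology_act K C \<phi> \<psi> L n)))
       \<and> (locally_finite K B M \<longrightarrow>
           (\<forall>n. vs_iso K (HM_cohomology K B M n)
                  (invariants_space G (HM_cohomology K C L n) (cohomology_act K C G \<phi> \<psi> L n))))"
proof -
  interpret finite_covering K C G \<phi> \<psi>
    using assms(4,5) by (simp add: finite_covering_def finite_covering_axioms_def)
  have "order G > 0" using finite_group G.one_closed by (auto simp: order_def card_gt_0_iff)
  then have unit: "[order G] \<cdot>\<^bsub>K\<^esub> \<one>\<^bsub>K\<^esub> \<noteq> \<zero>\<^bsub>K\<^esub>" by (rule order_unit_of_char[OF _ assms(6)])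
  interpret covering_bimodule K C G \<phi> \<psi> M
    by (intro covering_bimodule.intro covering_bimodule_axioms.intro finite_covering_axioms
        assms(7)[unfolded B_def] unit)
  show ?thesis
    unfolding B_def L_def by (intro conjI allI impI homology_iso cohomology_iso)
qed

end
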